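(* Let $\ell\ge 2$ and $n\ge 1$, put $N=\lfloor n/\ell\rfloor$, and let $\mu_0^{(n)},\dots,\mu_N^{(n)}$ be the partitions of $n$ defined below. In the level-one Fock space of $U_q(\widehat{\mathfrak{sl}}_\ell)$, the dual basis vector $\langle (n)|$ expands in the upper global basis as $$\langle (n)|=\sum_{i=0}^{N}q^{i}\,G^{up}(\mu_i^{(n)}).$$ Equivalently, the $q$-decomposition numbers satisfy $d_{(n),\mu}(q)=q^{i}$ if $\mu=\mu_i^{(n)}$ for some $0\le i\le N$, and $d_{(n),\mu}(q)=0$ for every other partition $\mu$.
   Context: Partitions $\mu_i^{(n)}$: $\mu_0^{(n)}=(n)$. For $1\le i\le N$, let $a=(\ell-1)+(N-i)\ell$ and $m=n-a\ (\ge1)$; write $m=b(\ell-1)+c$ with $0\le c<\ell-1$; then $\mu_i^{(n)}=(a,\underbrace{\ell-1,\dots,\ell-1}_{b},c)$ (the part $c$ omitted if $c=0$). E.g. for $\ell=3,n=10$: $\mu_3=(2^5),\mu_2=(5,2,2,1),\mu_1=(8,2),\mu_0=(10)$. Fock space: $\mathcal{F}=\bigoplus_{\lambda}\mathbb{C}(q)|\lambda\rangle$ over all partitions $\lambda$, realized as the Kashiwara–Miwa–Stern $q$-wedge space via $|\lambda\rangle\leftrightarrow\cdots\wedge u_{\lambda_2-2}\wedge u_{\lambda_1-1}\wedge u_{\lambda_0}$ for $\lambda=(\lambda_0\ge\lambda_1\ge\cdots)$, with $U_q(\widehat{\mathfrak{sl}}_\ell)$ acting (Hayashi action) by $F_i|\lambda\rangle=\sum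 q^{N^b_i(\lambda,\mu)}|\mu\rangle$, the sum over $\mu$ obtained by adding a box of $\ell$-residue $i$ (box in row $a$, column $b$ has residue $b-a \bmod \ell$), $N_i^b$ being (number of $i$-addable) minus (number of $i$-removable) boxes below the added box. $\mathcal{F}$ carries the bar involution: the unique $\mathbb{C}$-linear involution with $\overline{qv}=q^{-1}\overline v$, commuting with all $F_i$ and with the Heisenberg operators $B_k$ ($k>0$), $B_k(\cdots\wedge u_{i_1}\wedge u_{i_0})=\sum_{s\ge0}\cdots\wedge u_{i_s-\ell k}\wedge\cdots\wedge u_{i_0}$, and fixing $|\emptyset\rangle$. The lower global basis $\{G^{low}(\mu)\}$ is the unique basis with $\overline{G^{low}(\mu)}=G^{low}(\mu)$ and $G^{low}(\mu)=|\mu\rangle+\sum_{\lambda\rhd\mu,\,|\lambda|=|\mu|}d_{\lambda\mu}(q)|\lambda\rangle$ with $d_{\lambda\mu}(q)\in q\mathbb{Z}[q]$ ($\rhd$ = dominance order); the $d_{\lambda\mu}(q)$ are the $q$-decomposition numbers. $\{\langle\lambda|\}$ is the dual basis of $\{|\lambda\rangle\}$ and $\{G^{up}(\mu)\}$ is the basis dual to $\{G^{low}(\mu)\}$, so that $\langle\lambda|=\sum_\mu d_{\lambda\mu}(q)G^{up}(\mu)$. *)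

theory Defs
  imports Complex_Main "HOL-Computational_Algebra.Polynomial" "HOL-Computational_Algebra.Fraction_Field"
begin

type_synonym qf = "complex poly fract"

definition qv :: qf where "qv = Fract [:0, 1:] 1"
definition cst :: "complex \<Rightarrow> qf" where "cst c = Fract [:c:] 1"

definition in_qZq :: "qf \<Rightarrow> bool" where
  "in_qZq x \<longleftrightarrow> (\<exists>p. x = Fract p 1 \<and> coeff p 0 = 0 \<and> (\<forall>k. coeff p k \<in> \<int>))"

definition is_partition :: "nat list \<Rightarrow> bool" where
  "is_partition lam \<longleftrightarrow> sorted_wrt (\<ge>) lam \<and> 0 \<notin> set lam"

definition pg :: "nat list \<Rightarrow> nat \<Rightarrow> nat" where
  "pg lam a = (if a < length lam then lam ! a else 0)"

definition dominates :: "nat list \<Rightarrow> nat list \<Rightarrow> bool" where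
  "dominates lam mu \<longleftrightarrow> (\<forall>k. (\<Sum>j<k. pg mu j) \<le> (\<Sum>j<k. pg lam j))"

text \<open>Residue of the box in row a, column b (0-based).\<close>
definition res :: "nat \<Rightarrow> nat \<Rightarrow> nat \<Rightarrow> int" where
  "res l a b = (int b - int a) mod int l"

text \<open>The box (a, pg lam a) is addable; the box (a, lam!a - 1) is removable.\<close>
definition addable :: "nat list \<Rightarrow> nat \<Rightarrow> bool" where
  "addable lam a \<longleftrightarrow> a \<le> length lam \<and> (a = 0 \<or> pg lam a < pg lam (a - 1))"

definition removable :: "nat list \<Rightarrow> nat \<Rightarrow> bool" where
  "removable lam a \<longleftrightarrow> a < length lam \<and> pg lam (Suc a) < lam ! a"

definition add_box :: "nat list \<Rightarrow> nat \<Rightarrow> nat list" where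
  "add_box lam a = (if a < length lam then lam[a := Suc (lam ! a)] else lam @ [1])"

definition Nb :: "nat \<Rightarrow> nat \<Rightarrow> nat list \<Rightarrow> nat \<Rightarrow> int" where
  "Nb l i lam a =
     int (card {b. a < b \<and> addable lam b \<and> res l b (pg lam b) = int i})
   - int (card {b. a < b \<and> removable lam b \<and> res l b (lam ! b - 1) = int i})"

type_synonym fvec = "nat list \<Rightarrow> qf"

definition supp :: "fvec \<Rightarrow> nat list set" where
  "supp v = {lam. v lam \<noteq> 0}"

definition fock :: "fvec \<Rightarrow> bool" where
  "fock v \<longleftrightarrow> finite (supp v) \<and> (\<forall>lam \<in> supp v. is_partition lam)"

definition ket :: "nat list \<Rightarrow> fvec" where
  "ket lam = (\<lambda>mu. if mu = lam then 1 else 0)"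

definition add_v :: "fvec \<Rightarrow> fvec \<Rightarrow> fvec" where
  "add_v v w = (\<lambda>lam. v lam + w lam)"

definition smult_v :: "qf \<Rightarrow> fvec \<Rightarrow> fvec" where
  "smult_v c v = (\<lambda>lam. c * v lam)"

definition lin_op :: "(nat list \<Rightarrow> nat list \<Rightarrow> qf) \<Rightarrow> fvec \<Rightarrow> fvec" where
  "lin_op A v = (\<lambda>mu. \<Sum>lam \<in> supp v. v lam * A lam mu)"

text \<open>Hayashi action of F_i.\<close>
definition fcoef :: "nat \<Rightarrow> nat \<Rightarrow> nat list \<Rightarrow> nat list \<Rightarrow> qf" where
  "fcoef l i lam mu =
     (\<Sum>a \<in> {a. addable lam a \<and> res l a (pg lam a) = int i \<and> add_box lam a = mu}.
        qv powi Nb l i lam a)"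

definition Fop :: "nat \<Rightarrow> nat \<Rightarrow> fvec \<Rightarrow> fvec" where
  "Fop l i = lin_op (fcoef l i)"

section \<open>The q-wedge straightening (Kashiwara--Miwa--Stern), finite rank\<close>

text \<open>Finite q-wedges u_{w_0} ^ ... ^ u_{w_{r-1}} are indexed by int lists; normally ordered
  means strictly increasing from left to right.  A straightening map S sends each list w to
  its coordinates S w w' on the basis of normally ordered wedges w'.  The relations (for a
  non-normal adjacent pair u_m ^ u_l, m >= l, i = (m - l) mod l) are
  u_m ^ u_l = - u_l ^ u_m  if i = 0,  and otherwise
  u_m ^ u_l = -q u_l ^ u_m + (q^2 - 1) sum_{j>=1} (-q)^(j-1) u_{l+d_j} ^ u_{m-d_j},
  d_j = (j div 2) l + (i if j odd), the sum running over normally ordered terms.\<close>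

definition dshift :: "nat \<Rightarrow> int \<Rightarrow> nat \<Rightarrow> int" where
  "dshift l i j = int (j div 2) * int l + (if odd j then i else 0)"

definition straight_ok :: "nat \<Rightarrow> (int list \<Rightarrow> int list \<Rightarrow> qf) \<Rightarrow> bool" where
  "straight_ok l S \<longleftrightarrow>
     (\<forall>w. sorted_wrt (<) w \<longrightarrow> S w = (\<lambda>w'. if w' = w then 1 else 0)) \<and>
     (\<forall>w p. Suc p < length w \<longrightarrow> w ! Suc p \<le> w ! p \<longrightarrow>
        (let m = w ! p; k = w ! Suc p; i = (m - k) mod int l;
             sw = w[p := k, Suc p := m] in
         S w = (if i = 0 then (\<lambda>w'. - S sw w')
                else (\<lambda>w'. - qv * S sw w' + (qv ^ 2 - 1) *
                    (\<Sum>j \<in> {j \<in> {1..nat (m - k)}. k + dshift l i j < m - dshift l i j}.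
                        (- qv) ^ (j - 1) * S (w[p := k + dshift l i j, Suc p := m - dshift l i j]) w')))))"

definition qstraight :: "nat \<Rightarrow> int list \<Rightarrow> int list \<Rightarrow> qf" where
  "qstraight l = (THE S. straight_ok l S)"

text \<open>Truncation to r factors of |lam> = ... ^ u_{lam_1 - 1} ^ u_{lam_0}.\<close>
definition wedge_of :: "nat \<Rightarrow> nat list \<Rightarrow> int list" where
  "wedge_of r lam = map (\<lambda>j. int (pg lam j) - int j) (rev [0..<r])"

text \<open>Coefficient of |mu> in B_k|lam> computed in the rank-r truncation (all factors shifted
  in turn by -l k, then straightened); the semi-infinite value is the eventual value in r.\<close>
definition bcoef_trunc :: "nat \<Rightarrow> nat \<Rightarrow> nat \<Rightarrow> nat list \<Rightarrow> nat list \<Rightarrow> qf" where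
  "bcoef_trunc l k r lam mu =
     (\<Sum>p<r. qstraight l ((wedge_of r lam)[p := wedge_of r lam ! p - int l * int k]) (wedge_of r mu))"

definition bcoef :: "nat \<Rightarrow> nat \<Rightarrow> nat list \<Rightarrow> nat list \<Rightarrow> qf" where
  "bcoef l k lam mu = (THE c. \<forall>\<^sub>F r in sequentially. bcoef_trunc l k r lam mu = c)"

definition Bop :: "nat \<Rightarrow> nat \<Rightarrow> fvec \<Rightarrow> fvec" where
  "Bop l k = lin_op (bcoef l k)"

definition is_bar :: "nat \<Rightarrow> (fvec \<Rightarrow> fvec) \<Rightarrow> bool" where
  "is_bar l bar \<longleftrightarrow>
     (\<forall>v. fock v \<longrightarrow> fock (bar v)) \<and>
     (\<forall>v w. fock v \<longrightarrow> fock w \<longrightarrow> bar (add_v v w) = add_v (bar v) (bar w)) \<and>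
     (\<forall>c v. fock v \<longrightarrow> bar (smult_v (cst c) v) = smult_v (cst c) (bar v)) \<and>
     (\<forall>v. fock v \<longrightarrow> bar (smult_v qv v) = smult_v (inverse qv) (bar v)) \<and>
     (\<forall>v. fock v \<longrightarrow> bar (bar v) = v) \<and>
     (\<forall>i v. i < l \<longrightarrow> fock v \<longrightarrow> bar (Fop l i v) = Fop l i (bar v)) \<and>
     (\<forall>k v. 0 < k \<longrightarrow> fock v \<longrightarrow> bar (Bop l k v) = Bop l k (bar v)) \<and>
     bar (ket []) = ket []"

text \<open>G mu is G^low(mu); its coefficient G mu lam is the q-decomposition number d_{lam,mu}(q).\<close>
definition is_lower_global_basis :: "nat \<Rightarrow> (fvec \<Rightarrow> fvec) \<Rightarrow> (nat list \<Rightarrow> fvec) \<Rightarrow> bool" where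
  "is_lower_global_basis l bar G \<longleftrightarrow>
     (\<forall>mu. is_partition mu \<longrightarrow>
        fock (G mu) \<and> bar (G mu) = G mu \<and> G mu mu = 1 \<and>
        (\<forall>lam. lam \<noteq> mu \<and> G mu lam \<noteq> 0 \<longrightarrow>
            dominates lam mu \<and> sum_list lam = sum_list mu \<and> in_qZq (G mu lam)))"

definition mu_part :: "nat \<Rightarrow> nat \<Rightarrow> nat \<Rightarrow> nat list" where
  "mu_part l n i =
     (if i = 0 then [n]
      else (let N = n div l; a = (l - 1) + (N - i) * l; m = n - a;
                b = m div (l - 1); c = m mod (l - 1) in
            a # replicate b (l - 1) @ (if c = 0 then [] else [c])))"

end

theory Submission
  imports Defs
begin

text \<open>The straightening rules are read as relations of a representation of an affine Hecke algebra, which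
  makes them confluent; functionals on wedges are then functions on words satisfying them, and the transposes
  of \<open>F\<^sub>i\<close> and \<open>B\<^sub>k\<close> act on these letter by letter. Lowering letters by multiples of \<open>l\<close> splits the functional
  \<open>\<langle>(m)|\<close>, for all \<open>m\<close> at once, into a sum of \<open>q\<close>-powers times functionals \<open>\<psi>\<^sub>j\<close> with
  \<open>j \<psi>\<^sub>j = \<Sum>\<^sub>k B\<^sub>k\<^sup>t \<psi>\<^sub>j\<^sub>-\<^sub>k\<close>, where \<open>\<psi>\<^sub>0\<close> vanishes on partitions with first row at least \<open>l\<close> and is an
  eigenfunctional of all \<open>F\<^sub>i\<^sup>t\<close>. These two properties determine \<open>\<psi>\<^sub>0\<close>, so it is invariant under the dual bar
  involution, and hence so are all \<open>\<psi>\<^sub>j\<close>. A bar invariant functional that is polynomial in \<open>q\<close> takes on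
  \<open>G(\<mu>)\<close> the constant equal to its value on \<open>\<mu>\<close> at \<open>q = 0\<close>, which is read off from an explicit formula for \<open>\<psi>\<^sub>0\<close>
  and from the fact that straightening at \<open>q = 0\<close> preserves the residue of every letter.

  Since the operator \<open>B\<^sub>k\<close> also produces coefficients on lists that are not partitions, its compatibility with the
  bar involution is only usable as: equal values of \<open>B\<^sub>k\<close> and \<open>B\<^sub>k\<^sub>'\<close> give equal values after applying bar. So the
  dual bar involution is related by \<open>B\<^sub>k\<^sup>t\<close> to a possibly different operator with the same properties, and this
  in turn to a further one.\<close>

section \<open>Confluence of the straightening rules\<close>

text \<open>Let S_p lower the p-th letter by \<open>l\<close>. The splitting is the identity 1 =
  \<Sum>j h_j(S) times \<Prod>p (1 - S_p), and the recursion for the \<psi>_j is Newton's identity,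
  because the transpose of B_k is the k-th power sum of the S_p. All row lengths are summed because
  the value then no longer depends on a nonnegative last letter, so the factor 1 - S_p of the last
  letter kills every partition with first row at least \<open>l\<close>. On this product the
  transposes of the F_i have eigenvalue q in a step reaching a size divisible by \<open>l\<close>,
  and 1 or 0 otherwise; dividing by q to the power size div \<open>l\<close> makes all eigenvalues
  bar invariant, and restoring the power yields q^i. Two obstacles shape the rest.
  \<open>qstraight\<close> and \<open>bcoef\<close> are definite descriptions, so nothing is known
  about them before confluence and stability in the rank are proved. And \<open>bar\<close> is given
  only by properties, so invariance must come from uniqueness of an eigenfunctional; the bound on
  the first row survives \<open>bar\<close> because the lower global basis makes \<open>bar\<close>
  triangular for dominance.\<close>

instance fract :: ("{idom,ring_char_0}") ring_char_0
proof
  show "inj (of_nat :: nat \<Rightarrow> 'a fract)"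
    by (rule injI) (simp add: of_nat_fract eq_fract)
qed

instance fract :: ("{idom,ring_char_0}") field_char_0 ..

text \<open>A generator T of the affine Hecke algebra acting on functions of two letters, each
  letter being a residue plus \<open>l\<close> times a level. The conditional terms are the finite
  Hecke action on the residues combined with an exchange of the levels; the two sums form a divided
  difference in the levels, and at most one of them is nonempty. Straightening will be the equation
  T f = -f.\<close>

definition hecke :: "'a::field_char_0 \<Rightarrow> nat \<Rightarrow> (int \<Rightarrow> int \<Rightarrow> 'a) \<Rightarrow> int \<Rightarrow> int \<Rightarrow> 'a" where
  "hecke q l f m k =
    (let L = int l; a = m mod L; s = m div L; b = k mod L; t = k div L; u = inverse (q ^ 2) - 1 in
      (if a = b then inverse (q ^ 2) * f k m
       else if a < b then inverse q * f k m
       else inverse q * f k m + u * f (a + L * t) (b + L * s))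
      + u * ((\<Sum>j<nat (s - t). f (a + L * (s - int j)) (b + L * (t + int j)))
           - (\<Sum>j<nat (t - s). f (a + L * (t - int j)) (b + L * (s + int j)))))"

definition hecke12 :: "'a::field_char_0 \<Rightarrow> nat \<Rightarrow> (int \<Rightarrow> int \<Rightarrow> int \<Rightarrow> 'a) \<Rightarrow> int \<Rightarrow> int \<Rightarrow> int \<Rightarrow> 'a" where
  "hecke12 q l f = (\<lambda>x y z. hecke q l (\<lambda>x' y'. f x' y' z) x y)"

definition hecke23 :: "'a::field_char_0 \<Rightarrow> nat \<Rightarrow> (int \<Rightarrow> int \<Rightarrow> int \<Rightarrow> 'a) \<Rightarrow> int \<Rightarrow> int \<Rightarrow> int \<Rightarrow> 'a" where
  "hecke23 q l f = (\<lambda>x y z. hecke q l (\<lambda>y' z'. f x y' z') y z)"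

text \<open>Test functions, arbitrary in the residues and exponential in the levels. On them the
  sums in \<open>hecke\<close> become geometric, and the operator turns into a matrix with entries
  rational in X, Y, Z.\<close>

definition lvl_exp :: "nat \<Rightarrow> (int \<Rightarrow> int \<Rightarrow> int \<Rightarrow> 'a) \<Rightarrow> 'a \<Rightarrow> 'a \<Rightarrow> 'a::field_char_0 \<Rightarrow> int \<Rightarrow> int \<Rightarrow> int \<Rightarrow> 'a" where
  "lvl_exp l g X Y Z = (\<lambda>x y z. g (x mod int l) (y mod int l) (z mod int l) *
      (X powi (x div int l) * Y powi (y div int l) * Z powi (z div int l)))"

section \<open>The braid relation on functions exponential in the levels\<close>

lemma geometric_powi_diff:
  fixes X Y :: "'a::field_char_0"
  assumes "X \<noteq> 0" "Y \<noteq> 0" "X \<noteq> Y"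
  shows "(\<Sum>j<n. X powi (s - int j) * Y powi (t + int j)) =
    X * (X powi s * Y powi t - X powi (s - int n) * Y powi (t + int n)) / (X - Y)"
proof (induction n)
  case (Suc n)
  have e: "X powi (s - int n) = X * X powi (s - int (Suc n))" 
    using power_int_add_1[of X "s - int (Suc n)"] assms by (simp add: algebra_simps)
  have f: "Y powi (t + int (Suc n)) = Y * Y powi (t + int n)"
    using power_int_add_1[of Y "t + int n"] assms by (simp add: algebra_simps)
  show ?case unfolding sum.lessThan_Suc Suc e f using assms by (simp add: divide_simps) (simp add: algebra_simps)
qed auto

lemma geometric_powi:
  fixes X Y :: "'a::field_char_0"
  assumes "X \<noteq> 0" "Y \<noteq> 0" "X \<noteq> Y"
  shows "(\<Sum>j<nat (s - t). X powi (s - int j) * Y powi (t + int j))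
       - (\<Sum>j<nat (t - s). X powi (t - int j) * Y powi (s + int j)) =
    X * (X powi s * Y powi t - X powi t * Y powi s) / (X - Y)"
proof (cases "s \<ge> t")
  case True
  then show ?thesis unfolding geometric_powi_diff[OF assms] by simp
next
  case False
  then show ?thesis unfolding geometric_powi_diff[OF assms] using assms by (simp add: divide_simps algebra_simps)
qed

text \<open>The generator of the finite Hecke algebra on the first two residues, with eigenvalues
  q^(-2) and -1.\<close>

definition res12 where
  "res12 q g = (\<lambda>a b c. if a = b then inverse (q^2) * g a b c else if a < b then inverse q * g b a c
     else inverse q * g b a c + (inverse (q ^ 2) - 1) * g a b c)"

definition res23 where
  "res23 q g = (\<lambda>a b c. if b = c then inverse (q^2) * g a b c else if b < c then inverse q * g a c b
     else inverse q * g a c b + (inverse (q ^ 2) - 1) * g a b c)"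

lemma hecke12_exp:
  fixes X Y Z :: "'a::field_char_0"
  assumes "l > 0" "X \<noteq> 0" "Y \<noteq> 0" "X \<noteq> Y"
  shows "hecke12 q l (lvl_exp l g X Y Z) =
    (\<lambda>x y z. lvl_exp l (\<lambda>a b c. res12 q g a b c - (inverse (q ^ 2) - 1) * (X / (X - Y)) * g a b c) Y X Z x y z
       + lvl_exp l (\<lambda>a b c. (inverse (q ^ 2) - 1) * (X / (X - Y)) * g a b c) X Y Z x y z)"
proof (intro ext)
  fix x y z
  define L where "L = int l"
  have L: "L > 0" using assms L_def by simp
  define a b c s t where "a = x mod L" and "b = y mod L" and "c = z mod L" and "s = x div L" and "t = y div L"
  have m: "(a + L * r) mod L = a" "(b + L * r) mod L = b" "(a + L * r) div L = r" "(b + L * r) div L = r" for r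
    using L by (auto simp: a_def b_def)
  define u where "u = inverse (q ^ 2) - 1"
  define Zc where "Zc = Z powi (z div L)"
  have N: "(\<Sum>j<nat (s - t). lvl_exp l g X Y Z (a + L * (s - int j)) (b + L * (t + int j)) z)
     - (\<Sum>j<nat (t - s). lvl_exp l g X Y Z (a + L * (t - int j)) (b + L * (s + int j)) z)
     = g a b c * Zc * (X * (X powi s * Y powi t - X powi t * Y powi s) / (X - Y))"
    unfolding geometric_powi[OF assms(2-4), symmetric] lvl_exp_def L_def[symmetric] m
    by (simp add: sum_distrib_left right_diff_distrib c_def Zc_def mult_ac)
  have "X - Y \<noteq> 0" using assms by simp
  then show "hecke12 q l (lvl_exp l g X Y Z) x y z = lvl_exp l (\<lambda>a b c. res12 q g a b c - (inverse (q ^ 2) - 1) * (X / (X - Y)) * g a b c) Y X Z x y z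
       + lvl_exp l (\<lambda>a b c. (inverse (q ^ 2) - 1) * (X / (X - Y)) * g a b c) X Y Z x y z"
    unfolding hecke12_def hecke_def Let_def L_def[symmetric] a_def[symmetric] b_def[symmetric] s_def[symmetric] t_def[symmetric] u_def[symmetric] N
    unfolding lvl_exp_def res12_def L_def[symmetric] a_def[symmetric] b_def[symmetric] c_def[symmetric] s_def[symmetric] t_def[symmetric] u_def[symmetric] m Zc_def[symmetric]
    by (simp add: divide_simps) (simp add: algebra_simps)
qed

lemma hecke23_exp:
  fixes X Y Z :: "'a::field_char_0"
  assumes "l > 0" "Z \<noteq> 0" "Y \<noteq> 0" "Y \<noteq> Z"
  shows "hecke23 q l (lvl_exp l g X Y Z) =
    (\<lambda>x y z. lvl_exp l (\<lambda>a b c. res23 q g a b c - (inverse (q ^ 2) - 1) * (Y / (Y - Z)) * g a b c) X Z Y x y z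
       + lvl_exp l (\<lambda>a b c. (inverse (q ^ 2) - 1) * (Y / (Y - Z)) * g a b c) X Y Z x y z)"
proof (intro ext)
  fix x y z
  have "hecke23 q l (lvl_exp l g X Y Z) x y z = hecke12 q l (lvl_exp l (\<lambda>b c a. g a b c) Y Z X) y z x"
    unfolding hecke12_def hecke23_def lvl_exp_def by (simp add: mult_ac)
  also have "\<dots> = lvl_exp l (\<lambda>a b c. res23 q g a b c - (inverse (q ^ 2) - 1) * (Y / (Y - Z)) * g a b c) X Z Y x y z
       + lvl_exp l (\<lambda>a b c. (inverse (q ^ 2) - 1) * (Y / (Y - Z)) * g a b c) X Y Z x y z"
    unfolding hecke12_exp[OF assms(1) assms(3,2,4)] unfolding lvl_exp_def res12_def res23_def by (simp add: mult_ac)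
  finally show "hecke23 q l (lvl_exp l g X Y Z) x y z = \<dots>" .
qed

lemma hecke_add: "hecke q l (\<lambda>x y. f x y + g x y) m k = hecke q l f m k + hecke q l g m k"
  unfolding hecke_def Let_def by (simp add: sum.distrib algebra_simps)

lemma hecke12_add: "hecke12 q l (\<lambda>x y z. f x y z + g x y z) = (\<lambda>x y z. hecke12 q l f x y z + hecke12 q l g x y z)"
  unfolding hecke12_def by (simp add: hecke_add fun_eq_iff)

lemma hecke23_add: "hecke23 q l (\<lambda>x y z. f x y z + g x y z) = (\<lambda>x y z. hecke23 q l f x y z + hecke23 q l g x y z)"
  unfolding hecke23_def by (simp add: hecke_add fun_eq_iff)

text \<open>The two coefficients of T on an exponential with weight w = X / (X - Y):
  \<open>resD\<close> belongs to the term in which the bases X and Y are exchanged,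
  \<open>resM\<close> to the term in which they stay.\<close>

definition resD where "resD q t w f = (\<lambda>a b c. t q f a b c - (inverse (q ^ 2) - 1) * w * (f a b c :: 'a::field_char_0))"
definition resM where "resM q w f = (\<lambda>a b c. (inverse (q ^ 2) - 1) * w * (f a b c :: 'a::field_char_0))"

text \<open>The coefficients of the two sides of the braid relation are compared separately for each
  of the six permutations of X, Y, Z. The weights enter only through \<open>rel\<close>, a partial
  fraction identity for X / (X - Y), Y / (Y - Z) and X / (X - Z); beyond that, each comparison is a
  finite check over the relative order of the three residues.\<close>

lemma braid_res:
  fixes A1 A2 B :: "'a::field_char_0" and g :: "int \<Rightarrow> int \<Rightarrow> int \<Rightarrow> 'a"
  assumes rel: "A1 * A2 = B * A1 + B * A2 - B"
  shows "resD q res12 A2 (resD q res23 B (resD q res12 A1 g)) a b c = resD q res23 A1 (resD q res12 B (resD q res23 A2 g)) a b c"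
    and "resD q res12 B (resD q res23 A2 (resM q A1 g)) a b c = resM q A1 (resD q res12 B (resD q res23 A2 g)) a b c"
    and "resM q A2 (resD q res23 B (resD q res12 A1 g)) a b c = resD q res23 B (resD q res12 A1 (resM q A2 g)) a b c"
    and "resD q res12 (1 - A1) (resM q B (resD q res12 A1 g)) a b c + resM q A1 (resM q A2 (resM q A1 g)) a b c
       = resD q res23 (1 - A2) (resM q B (resD q res23 A2 g)) a b c + resM q A2 (resM q A1 (resM q A2 g)) a b c"
    and "resM q (1 - A1) (resM q B (resD q res12 A1 g)) a b c + resD q res12 A1 (resM q A2 (resM q A1 g)) a b c
       = resM q B (resD q res12 A1 (resM q A2 g)) a b c"
    and "resM q B (resD q res23 A2 (resM q A1 g)) a b c
       = resM q (1 - A2) (resM q B (resD q res23 A2 g)) a b c + resD q res23 A2 (resM q A1 (resM q A2 g)) a b c"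
proof -
  define r where "r = inverse q"
  have rel': "A1 * (A2 * x) = B * (A1 * x) + B * (A2 * x) - B * x" for x
    using arg_cong[OF rel, of "\<lambda>y. y * x"] by (simp add: algebra_simps)
  have q2: "inverse (q ^ 2) = r ^ 2" by (simp add: r_def power_inverse)
  note defs = resD_def resM_def res12_def res23_def q2 r_def[symmetric]
  show "resD q res12 A2 (resD q res23 B (resD q res12 A1 g)) a b c = resD q res23 A1 (resD q res12 B (resD q res23 A2 g)) a b c"
    unfolding defs by (rule linorder_cases[of a b]; rule linorder_cases[of a c]; rule linorder_cases[of b c])
      (simp_all add: order.strict_implies_not_eq algebra_simps power2_eq_square rel rel')
  show "resD q res12 B (resD q res23 A2 (resM q A1 g)) a b c = resM q A1 (resD q res12 B (resD q res23 A2 g)) a b c"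
    unfolding defs by (rule linorder_cases[of a b]; rule linorder_cases[of a c]; rule linorder_cases[of b c])
      (simp_all add: order.strict_implies_not_eq algebra_simps power2_eq_square)
  show "resM q A2 (resD q res23 B (resD q res12 A1 g)) a b c = resD q res23 B (resD q res12 A1 (resM q A2 g)) a b c"
    unfolding defs by (rule linorder_cases[of a b]; rule linorder_cases[of a c]; rule linorder_cases[of b c])
      (simp_all add: order.strict_implies_not_eq algebra_simps power2_eq_square)
  show "resD q res12 (1 - A1) (resM q B (resD q res12 A1 g)) a b c + resM q A1 (resM q A2 (resM q A1 g)) a b c
       = resD q res23 (1 - A2) (resM q B (resD q res23 A2 g)) a b c + resM q A2 (resM q A1 (resM q A2 g)) a b c"
    unfolding defs by (rule linorder_cases[of a b]; rule linorder_cases[of a c]; rule linorder_cases[of b c])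
      (simp_all add: order.strict_implies_not_eq algebra_simps power2_eq_square rel rel')
  show "resM q (1 - A1) (resM q B (resD q res12 A1 g)) a b c + resD q res12 A1 (resM q A2 (resM q A1 g)) a b c
       = resM q B (resD q res12 A1 (resM q A2 g)) a b c"
    unfolding defs by (rule linorder_cases[of a b]; rule linorder_cases[of a c]; rule linorder_cases[of b c])
      (simp_all add: order.strict_implies_not_eq algebra_simps power2_eq_square rel rel')
  show "resM q B (resD q res23 A2 (resM q A1 g)) a b c
       = resM q (1 - A2) (resM q B (resD q res23 A2 g)) a b c + resD q res23 A2 (resM q A1 (resM q A2 g)) a b c"
    unfolding defs by (rule linorder_cases[of a b]; rule linorder_cases[of a c]; rule linorder_cases[of b c])
      (simp_all add: order.strict_implies_not_eq algebra_simps power2_eq_square rel rel')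
qed

lemma braid_exp:
  fixes X Y Z :: "'a::field_char_0"
  assumes "l > 0" "q \<noteq> 0" "X \<noteq> 0" "Y \<noteq> 0" "Z \<noteq> 0" "X \<noteq> Y" "X \<noteq> Z" "Y \<noteq> Z"
  shows "hecke12 q l (hecke23 q l (hecke12 q l (lvl_exp l g X Y Z))) =
         hecke23 q l (hecke12 q l (hecke23 q l (lvl_exp l g X Y Z)))"
proof (intro ext)
  fix x y z
  note ne = assms(3-8) assms(6-8)[symmetric]
  define A1 B A2 where "A1 = X / (X - Y)" and "B = X / (X - Z)" and "A2 = Y / (Y - Z)"
  have dd: "X / (X - Y) = A1" "X / (X - Z) = B" "Y / (Y - Z) = A2"
     "Y / (Y - X) = 1 - A1" "Z / (Z - X) = 1 - B" "Z / (Z - Y) = 1 - A2"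
    using ne by (simp_all add: A1_def B_def A2_def divide_simps) (simp_all add: algebra_simps)
  have rel: "A1 * A2 = B * A1 + B * A2 - B"
    using ne by (simp add: A1_def B_def A2_def divide_simps) (simp add: algebra_simps)
  note br = braid_res(1-3)[OF rel, of q g "x mod int l" "y mod int l" "z mod int l"]
  note br4 = braid_res(4)[OF rel, of q g "x mod int l" "y mod int l" "z mod int l", folded eq_diff_eq]
  note br5 = braid_res(5)[OF rel, of q g "x mod int l" "y mod int l" "z mod int l", folded eq_diff_eq]
  note br6 = braid_res(6)[OF rel, of q g "x mod int l" "y mod int l" "z mod int l"]
  show "hecke12 q l (hecke23 q l (hecke12 q l (lvl_exp l g X Y Z))) x y z =
         hecke23 q l (hecke12 q l (hecke23 q l (lvl_exp l g X Y Z))) x y z"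
    apply (simp only: hecke12_exp[OF assms(1)] hecke23_exp[OF assms(1)] resD_def[symmetric] resM_def[symmetric]
       hecke12_add hecke23_add ne not_False_eq_True dd)
    apply (simp only: lvl_exp_def)
    apply (simp only: br br4 br5 br6)
    apply (simp only: algebra_simps)
    done
qed

section \<open>Extension of the relations from exponentials to all functions\<close>

definition fin_lin :: "((int \<Rightarrow> int \<Rightarrow> int \<Rightarrow> 'a::field_char_0) \<Rightarrow> 'a) \<Rightarrow> bool" where
  "fin_lin F \<longleftrightarrow> (\<exists>A c. finite A \<and> (\<forall>f. F f = (\<Sum>v\<in>A. c v * f (fst v) (fst (snd v)) (snd (snd v)))))"

lemma fin_lin_eval: "fin_lin (\<lambda>f. f x y z)"
  unfolding fin_lin_def by (rule exI[of _ "{(x, y, z)}"], rule exI[of _ "\<lambda>_. 1"]) auto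

lemma fin_lin_0: "fin_lin (\<lambda>f. 0)"
  unfolding fin_lin_def by (rule exI[of _ "{}"]) auto

lemma fin_lin_scale: "fin_lin F \<Longrightarrow> fin_lin (\<lambda>f. a * F f)"
proof -
  assume "fin_lin F"
  then obtain A c where "finite A" "\<And>f. F f = (\<Sum>v\<in>A. c v * f (fst v) (fst (snd v)) (snd (snd v)))"
    unfolding fin_lin_def by blast
  then show ?thesis unfolding fin_lin_def
    by (intro exI[of _ A] exI[of _ "\<lambda>v. a * c v"]) (simp add: sum_distrib_left mult.assoc)
qed

lemma fin_lin_add: 
  assumes "fin_lin F" "fin_lin G" shows "fin_lin (\<lambda>f. F f + G f)"
proof -
  obtain A c where A: "finite A" "\<And>f. F f = (\<Sum>v\<in>A. c v * f (fst v) (fst (snd v)) (snd (snd v)))"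
    using assms unfolding fin_lin_def by blast
  obtain B d where B: "finite B" "\<And>f. G f = (\<Sum>v\<in>B. d v * f (fst v) (fst (snd v)) (snd (snd v)))"
    using assms unfolding fin_lin_def by blast
  have "F f + G f = (\<Sum>v\<in>A\<union>B. ((if v \<in> A then c v else 0) + (if v \<in> B then d v else 0)) * f (fst v) (fst (snd v)) (snd (snd v)))" for f
  proof -
    have "F f = (\<Sum>v\<in>A\<union>B. (if v \<in> A then c v else 0) * f (fst v) (fst (snd v)) (snd (snd v)))"
      unfolding A(2) using A(1) B(1) by (intro sum.mono_neutral_cong_left) auto
    moreover have "G f = (\<Sum>v\<in>A\<union>B. (if v \<in> B then d v else 0) * f (fst v) (fst (snd v)) (snd (snd v)))"
      unfolding B(2) using A(1) B(1) by (intro sum.mono_neutral_cong_left) auto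
    ultimately show ?thesis by (simp only: sum.distrib ring_distribs)
  qed
  then show ?thesis unfolding fin_lin_def using A(1) B(1) by (intro exI[of _ "A \<union> B"] exI) auto
qed

lemma fin_lin_diff: 
  assumes "fin_lin F" "fin_lin G" shows "fin_lin (\<lambda>f. F f - G f)"
  using fin_lin_add[OF assms(1) fin_lin_scale[OF assms(2), of "-1"]] by simp

lemma fin_lin_sum:
  assumes "\<And>i. i \<in> I \<Longrightarrow> fin_lin (F i)" shows "fin_lin (\<lambda>f. \<Sum>i\<in>I. F i f)"
  using assms by (induction I rule: infinite_finite_induct) (auto intro: fin_lin_add fin_lin_0)

lemma fin_lin_comp:
  assumes "fin_lin F" "\<And>x y z. fin_lin (\<lambda>f. G f x y z)" shows "fin_lin (\<lambda>f. F (G f))"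
proof -
  obtain A c where A: "finite A" "\<And>f. F f = (\<Sum>v\<in>A. c v * f (fst v) (fst (snd v)) (snd (snd v)))"
    using assms unfolding fin_lin_def by blast
  show ?thesis unfolding A(2) by (intro fin_lin_sum fin_lin_scale assms(2))
qed

lemma fin_lin_if: "fin_lin F \<Longrightarrow> fin_lin G \<Longrightarrow> fin_lin (\<lambda>f. if P then F f else G f)"
  by (cases P) auto

lemma fin_lin_hecke12: "fin_lin (\<lambda>f. hecke12 q l f x y z)"
  unfolding hecke12_def hecke_def Let_def
  by (intro fin_lin_add fin_lin_diff fin_lin_scale fin_lin_sum fin_lin_if fin_lin_eval)

lemma fin_lin_hecke23: "fin_lin (\<lambda>f. hecke23 q l f x y z)"
  unfolding hecke23_def hecke_def Let_def
  by (intro fin_lin_add fin_lin_diff fin_lin_scale fin_lin_sum fin_lin_if fin_lin_eval)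

lemma fin_lin_comp12: "(\<And>x y z. fin_lin (\<lambda>f. G f x y z)) \<Longrightarrow> fin_lin (\<lambda>f. hecke12 q l (G f) x y z)"
  by (rule fin_lin_comp[OF fin_lin_hecke12, of G])

lemma fin_lin_comp23: "(\<And>x y z. fin_lin (\<lambda>f. G f x y z)) \<Longrightarrow> fin_lin (\<lambda>f. hecke23 q l (G f) x y z)"
  by (rule fin_lin_comp[OF fin_lin_hecke23, of G])

text \<open>After multiplication with n^E all exponents are nonnegative, so the sum becomes a
  polynomial that vanishes at every n \<ge> 2; in characteristic zero these are infinitely many
  roots.\<close>

lemma powi_independent:
  fixes c :: "'v \<Rightarrow> 'a::field_char_0"
  assumes "finite A" "inj_on e A" "\<And>n::nat. n \<ge> 2 \<Longrightarrow> (\<Sum>v\<in>A. c v * of_nat n powi (e v)) = 0" "w \<in> A"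
  shows "c w = 0"
proof -
  define E where "E = Max ((\<lambda>v. \<bar>e v\<bar>) ` A)"
  have E: "\<bar>e v\<bar> \<le> E" if "v \<in> A" for v unfolding E_def using assms(1) that by auto
  define p where "p = (\<Sum>v\<in>A. monom (c v) (nat (e v + E)))"
  have "poly p (of_nat n) = 0" if "n \<ge> 2" for n
  proof -
    have "of_nat n ^ nat (e v + E) = of_nat n powi (e v) * (of_nat n powi E :: 'a)" if "v \<in> A" for v
    proof -
      have "of_nat n powi (e v + E) = (of_nat n powi (e v) * of_nat n powi E :: 'a)"
        using \<open>n \<ge> 2\<close> by (intro power_int_add) auto
      moreover have "e v + E \<ge> 0" using E[OF that] by linarith
      ultimately show ?thesis by (simp add: power_int_def split: if_splits)
    qed
    then have "poly p (of_nat n) = (\<Sum>v\<in>A. c v * of_nat n powi (e v)) * of_nat n powi E"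
      unfolding p_def poly_sum poly_monom sum_distrib_right by (intro sum.cong) auto
    then show ?thesis using assms(3)[OF that] by simp
  qed
  then have "(of_nat :: nat \<Rightarrow> 'a) ` {2..} \<subseteq> {x. poly p x = 0}" by auto
  moreover have "infinite ((of_nat :: nat \<Rightarrow> 'a) ` {2..})"
    using finite_imageD[of "of_nat :: nat \<Rightarrow> 'a" "{2..}"] infinite_Ici[of "2::nat"] by (auto simp: inj_on_def)
  ultimately have "p = 0" using poly_roots_finite[of p] finite_subset by blast
  then have "0 = coeff p (nat (e w + E))" by simp
  also have "\<dots> = (\<Sum>v\<in>A. if v = w then c v else 0)"
    unfolding p_def coeff_sum coeff_monom
  proof (intro sum.cong refl)
    fix v assume "v \<in> A"
    have "e v = e w \<longleftrightarrow> v = w" using inj_onD[OF assms(2)] \<open>v \<in> A\<close> assms(4) by auto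
    moreover have "nat (e v + E) = nat (e w + E) \<longleftrightarrow> e v = e w" using E[OF \<open>v \<in> A\<close>] E[OF assms(4)] by auto
    ultimately show "(if nat (e v + E) = nat (e w + E) then c v else 0) = (if v = w then c v else 0)" by simp
  qed
  also have "\<dots> = c w" using assms(1,4) by simp
  finally show ?thesis by simp
qed

lemma base_expansion_inj:
  fixes B :: int
  assumes "\<bar>s\<bar> \<le> M" "\<bar>t\<bar> \<le> M" "\<bar>s'\<bar> \<le> M" "\<bar>t'\<bar> \<le> M"
    and "B = 2 * M + 2" and "s + B * (t + B * r) = s' + B * (t' + B * r')"
  shows "s = s' \<and> t = t' \<and> r = r'"
proof -
  have *: "x = y \<and> a = b" if "x + B * a = y + B * b" "\<bar>x\<bar> \<le> M" "\<bar>y\<bar> \<le> M" for x y a b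
  proof -
    have B: "B > 0" using that assms(5) by linarith
    have "x - y = B * (b - a)" using that by (simp add: algebra_simps)
    moreover have "\<bar>x - y\<bar> < B" using that assms(5) by linarith
    ultimately have "\<bar>B * (b - a)\<bar> < B" by simp
    then have "b = a" using B by (simp add: abs_mult)
    then show ?thesis using \<open>x - y = B * (b - a)\<close> by simp
  qed
  from *[OF assms(6,1,3)] have "s = s'" "t + B * r = t' + B * r'" by auto
  then show ?thesis using *[OF _ assms(2,4)] by blast
qed

text \<open>Exponentials separate functionals that depend on finitely many values: g selects one
  residue triple, and the substitution X = n, Y = n^B, Z = n^(B^2) packs the three levels into one
  exponent written in base B, so that \<open>powi_independent\<close> applies.\<close>

lemma fin_lin_eq_0:
  fixes F :: "(int \<Rightarrow> int \<Rightarrow> int \<Rightarrow> 'a::field_char_0) \<Rightarrow> 'a"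
  assumes "fin_lin F" "l > 0"
    and "\<And>g X Y Z. X \<noteq> 0 \<Longrightarrow> Y \<noteq> 0 \<Longrightarrow> Z \<noteq> 0 \<Longrightarrow> X \<noteq> Y \<Longrightarrow> X \<noteq> Z \<Longrightarrow> Y \<noteq> Z \<Longrightarrow> F (lvl_exp l g X Y Z) = 0"
  shows "F f = 0"
proof -
  obtain A c where A: "finite A" "\<And>f. F f = (\<Sum>v\<in>A. c v * f (fst v) (fst (snd v)) (snd (snd v)))"
    using assms(1) unfolding fin_lin_def by blast
  define rs where "rs = (\<lambda>v::int\<times>int\<times>int. (fst v mod int l, fst (snd v) mod int l, snd (snd v) mod int l))"
  have "c w = 0" if "w \<in> A" for w
  proof -
    define A' where "A' = {v \<in> A. rs v = rs w}"
    define g where "g = (\<lambda>a b c'. if (a, b, c') = rs w then 1 else 0 :: 'a)"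
    \<comment> \<open>Only the first two levels have to be bounded: the third is the leading digit
      of the expansion in base 2 * M + 2.\<close>
    define M where "M = Max ((\<lambda>v. \<bar>fst v div int l\<bar>) ` A' \<union> (\<lambda>v. \<bar>fst (snd v) div int l\<bar>) ` A')"
    have fA': "finite A'" "w \<in> A'" using A(1) that unfolding A'_def by auto
    have M: "\<bar>fst v div int l\<bar> \<le> M" "\<bar>fst (snd v) div int l\<bar> \<le> M" if "v \<in> A'" for v
      unfolding M_def using fA' that by auto
    then have M0: "M \<ge> 0" using fA'(2) by (meson abs_ge_zero order_trans)
    define B where "B = nat (2 * M + 2)"
    have B: "int B = 2 * M + 2" "B \<ge> 2" using M0 unfolding B_def by auto
    define e where "e = (\<lambda>v. fst v div int l + int B * (fst (snd v) div int l + int B * (snd (snd v) div int l)))"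
    have inj: "inj_on e A'"
    proof (rule inj_onI)
      fix v v' assume v: "v \<in> A'" "v' \<in> A'" "e v = e v'"
      have "fst v div int l = fst v' div int l \<and> fst (snd v) div int l = fst (snd v') div int l \<and> snd (snd v) div int l = snd (snd v') div int l"
        by (rule base_expansion_inj[OF M(1)[OF v(1)] M(2)[OF v(1)] M(1)[OF v(2)] M(2)[OF v(2)] B(1)]) (use v(3) e_def in auto)
      moreover have "rs v = rs v'" using v A'_def by auto
      ultimately show "v = v'" unfolding rs_def by (metis prod.collapse prod.inject div_mod_decomp_int)
    qed
    have "(\<Sum>v\<in>A'. c v * of_nat n powi (e v)) = 0" if n: "n \<ge> 2" for n
    proof -
      define X Y Z where "X = (of_nat n :: 'a)" and "Y = (of_nat (n ^ B) :: 'a)" and "Z = (of_nat (n ^ (B * B)) :: 'a)"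
      have nB: "n < n ^ B" "n ^ B < n ^ (B * B)" using n B(2) power_strict_increasing[of 1 B n] power_strict_increasing[of B "B * B" n] by auto
      have "n \<noteq> n ^ B" "n \<noteq> n ^ (B * B)" "n ^ B \<noteq> n ^ (B * B)" "n \<noteq> 0" "n ^ B \<noteq> 0" "n ^ (B * B) \<noteq> 0" using nB n by linarith+
      then have "X \<noteq> Y" "X \<noteq> Z" "Y \<noteq> Z" "X \<noteq> 0" "Y \<noteq> 0" "Z \<noteq> 0"
        unfolding X_def Y_def Z_def of_nat_eq_iff of_nat_eq_0_iff by blast+
      then have "0 = F (lvl_exp l g X Y Z)" using assms(3) by auto
      also have "\<dots> = (\<Sum>v\<in>A. if rs v = rs w then c v * of_nat n powi (e v) else 0)"
        unfolding A(2)
      proof (intro sum.cong refl)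
        fix v
        have "of_nat n powi (e v) = X powi (fst v div int l) * Y powi (fst (snd v) div int l) * Z powi (snd (snd v) div int l)"
        proof -
          have z: "(of_nat n :: 'a) \<noteq> 0" using n by simp
          have p: "(of_nat (n ^ k) :: 'a) powi i = of_nat n powi (int k * i)" for k i
            by (simp add: power_int_mult)
          show ?thesis unfolding e_def X_def Y_def Z_def p distrib_left by (simp only: power_int_add[OF disjI1[OF z]] of_nat_mult mult.assoc)
        qed
        then show "c v * lvl_exp l g X Y Z (fst v) (fst (snd v)) (snd (snd v)) = (if rs v = rs w then c v * of_nat n powi (e v) else 0)"
          unfolding lvl_exp_def g_def by (simp add: rs_def)
      qed
      also have "\<dots> = (\<Sum>v\<in>A'. c v * of_nat n powi (e v))" unfolding A'_def using A(1) by (simp add: sum.inter_filter)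
      finally show ?thesis by simp
    qed
    from powi_independent[OF fA'(1) inj this fA'(2)] show ?thesis .
  qed
  then show ?thesis unfolding A(2) by simp
qed

text \<open>At a fixed point both sides depend linearly on finitely many values of f, so agreement
  on exponentials with nonzero and distinct bases suffices.\<close>

lemma hecke_braid:
  fixes q :: "'a::field_char_0"
  assumes "l > 0" "q \<noteq> 0"
  shows "hecke12 q l (hecke23 q l (hecke12 q l f)) = hecke23 q l (hecke12 q l (hecke23 q l f))"
proof (intro ext)
  fix x y z
  have "fin_lin (\<lambda>f. hecke12 q l (hecke23 q l (hecke12 q l f)) x y z - hecke23 q l (hecke12 q l (hecke23 q l f)) x y z)"
    by (intro fin_lin_diff fin_lin_comp12 fin_lin_comp23 fin_lin_eval)
  from fin_lin_eq_0[OF this assms(1)] show "hecke12 q l (hecke23 q l (hecke12 q l f)) x y z = hecke23 q l (hecke12 q l (hecke23 q l f)) x y z"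
    using braid_exp[OF assms] by simp
qed

lemma hecke12_quadratic_exp:
  fixes X Y Z :: "'a::field_char_0"
  assumes "l > 0" "q \<noteq> 0" "X \<noteq> 0" "Y \<noteq> 0" "X \<noteq> Y"
  shows "hecke12 q l (hecke12 q l (lvl_exp l g X Y Z)) x y z =
    (inverse (q^2) - 1) * hecke12 q l (lvl_exp l g X Y Z) x y z + inverse (q^2) * lvl_exp l g X Y Z x y z"
proof -
  define r A where "r = inverse q" and "A = X / (X - Y)"
  have dd: "X / (X - Y) = A" "Y / (Y - X) = 1 - A"
    using assms by (simp_all add: A_def divide_simps) (simp_all add: algebra_simps)
  have q2: "inverse (q ^ 2) = r ^ 2" by (simp add: r_def power_inverse)
  note ne = assms(3-5) assms(5)[symmetric]
  show ?thesis
    apply (simp only: hecke12_exp[OF assms(1)] hecke12_add ne not_False_eq_True dd)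
    apply (simp only: lvl_exp_def res12_def q2 r_def[symmetric])
    apply (rule linorder_cases[of "x mod int l" "y mod int l"])
      apply (simp_all add: order.strict_implies_not_eq algebra_simps power2_eq_square)
    done
qed

lemma hecke_quadratic:
  fixes q :: "'a::field_char_0"
  assumes "l > 0" "q \<noteq> 0"
  shows "hecke q l (hecke q l f) m k = (inverse (q^2) - 1) * hecke q l f m k + inverse (q^2) * f m k"
proof -
  have "fin_lin (\<lambda>f. hecke12 q l (hecke12 q l f) m k (0::int) - ((inverse (q^2) - 1) * hecke12 q l f m k 0 + inverse (q^2) * f m k 0))"
    by (intro fin_lin_diff fin_lin_add fin_lin_scale fin_lin_comp12 fin_lin_eval)
  note fin_lin_eq_0[OF this assms(1), where f = "\<lambda>x y z. f x y"]
  then have "hecke12 q l (hecke12 q l (\<lambda>x y z. f x y)) m k 0 =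
      (inverse (q^2) - 1) * hecke12 q l (\<lambda>x y z. f x y) m k 0 + inverse (q^2) * f m k"
    using hecke12_quadratic_exp[OF assms] by simp
  then show ?thesis unfolding hecke12_def .
qed

text \<open>The coefficient of the reversed pair in T f at (k, m) with k \<le> m. It is nonzero for
  q \<noteq> 0, so T f = -f at an ascending pair can be solved for the value at the descending
  one.\<close>

definition hecke_lead :: "'a::field_char_0 \<Rightarrow> nat \<Rightarrow> int \<Rightarrow> int \<Rightarrow> 'a" where
  "hecke_lead q l k m = (if k = m then inverse (q ^ 2) else if k mod int l = m mod int l then 1 else inverse q)"

section \<open>Leading terms of the operators with respect to the energy of a word\<close>

lemma hecke_diag: "l > 0 \<Longrightarrow> hecke q l f k k = inverse (q ^ 2) * f k k"
  by (simp add: hecke_def Let_def)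

text \<open>Apart from the reversed pair, only pairs strictly between k and m occur. The summand j =
  0 is the delicate one: for equal residues it is the reversed pair itself and lowers its
  coefficient from q^(-2) to 1, and for a > b it cancels the additional term of
  \<open>hecke\<close>, whose letters would lie outside.\<close>

lemma hecke_ascent:
  fixes q :: "'a::field_char_0"
  assumes "l > 0" "k < m"
  shows "\<exists>(n::nat) c x. (\<forall>j<n. k < x j \<and> x j < m) \<and>
     (\<forall>f. hecke q l f k m = hecke_lead q l k m * f m k + (\<Sum>j<n. c j * f (x j) (k + m - x j)))"
proof -
  define L where "L = int l"
  have L: "L > 0" using assms L_def by simp
  define a b s t where "a = k mod L" and "b = m mod L" and "s = k div L" and "t = m div L"
  have km: "k = a + L * s" "m = b + L * t" by (simp_all add: a_def b_def s_def t_def)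
  have ab: "0 \<le> a" "a < L" "0 \<le> b" "b < L" using L by (simp_all add: a_def b_def)
  have st: "s \<le> t" unfolding s_def t_def using assms L by (intro zdiv_mono1) auto
  define u where "u = inverse (q ^ 2) - 1"
  define x where "x = (\<lambda>j. a + L * (t - int j))"
  have y: "k + m - x j = b + L * (s + int j)" for j unfolding x_def km by (simp add: algebra_simps)
  have H: "hecke q l f k m = (if a = b then inverse (q ^ 2) * f m k
       else if a < b then inverse q * f m k
       else inverse q * f m k + u * f (x 0) (k + m - x 0))
      - u * (\<Sum>j<nat (t - s). f (x j) (k + m - x j))" for f
    unfolding y using st by (simp add: hecke_def Let_def L_def[symmetric] a_def[symmetric] b_def[symmetric] s_def[symmetric] t_def[symmetric] u_def[symmetric] x_def)
  have lo: "k < x j" if "j < nat (t - s)" for j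
    unfolding x_def km using that L by auto
  show ?thesis
  proof (cases "a < b")
    case True
    have "x j < m" for j
    proof -
      have "L * (t - int j) \<le> L * t" using L by simp
      then show ?thesis unfolding x_def km using True by linarith
    qed
    moreover have "hecke_lead q l k m = inverse q" unfolding hecke_lead_def L_def[symmetric] a_def[symmetric] b_def[symmetric] using True assms by auto
    ultimately show ?thesis using lo H True
      by (intro exI[of _ "nat (t - s)"] exI[of _ "\<lambda>_. - u"] exI[of _ x]) (auto simp: sum_distrib_left sum_negf)
  next
    case False
    have st': "s < t"
    proof (rule ccontr)
      assume "\<not> s < t" then have "s = t" using st by simp
      then show False using assms False km by simp
    qed
    define n where "n = nat (t - s) - 1"
    have n: "nat (t - s) = Suc n" using st' unfolding n_def by simp
    have "x (Suc j) < m" for j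
    proof -
      have "L * (t - int (Suc j)) \<le> L * (t - 1)" using L by simp
      moreover have "L * int j \<ge> 0" using L by simp
      moreover have "x (Suc j) = a + L * t - L - L * int j" by (simp add: x_def algebra_simps)
      ultimately show ?thesis unfolding km using ab by linarith
    qed
    moreover have "hecke q l f k m = hecke_lead q l k m * f m k + (\<Sum>j<n. - u * f (x (Suc j)) (k + m - x (Suc j)))" for f
    proof (cases "a = b")
      case True
      then have "x 0 = m" "k + m - x 0 = k" unfolding x_def km by auto
      moreover have "hecke_lead q l k m = 1" unfolding hecke_lead_def L_def[symmetric] a_def[symmetric] b_def[symmetric] using True assms by auto
      moreover have "inverse (q ^ 2) = u + 1" by (simp add: u_def)
      ultimately show ?thesis unfolding H n sum.lessThan_Suc_shift using True
        by (simp add: sum_distrib_left sum_negf algebra_simps)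
    next
      case ne: False
      have "hecke_lead q l k m = inverse q" unfolding hecke_lead_def L_def[symmetric] a_def[symmetric] b_def[symmetric] using ne assms by auto
      then show ?thesis unfolding H n sum.lessThan_Suc_shift using ne False
        by (simp add: sum_distrib_left sum_negf algebra_simps)
    qed
    ultimately show ?thesis using lo unfolding n
      by (intro exI[of _ n] exI[of _ "\<lambda>_. - u"] exI[of _ "\<lambda>j. x (Suc j)"]) auto
  qed
qed

lemma hecke_support:
  fixes q :: "'a::field_char_0"
  assumes "l > 0" "\<And>x y. x + y = m + k \<Longrightarrow> \<bar>x - y\<bar> \<le> \<bar>m - k\<bar> \<Longrightarrow> f x y = 0"
  shows "hecke q l f m k = 0"
proof (cases "m < k")
  case True
  obtain n c x where "\<forall>j<n. m < x j \<and> x j < k"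
     "\<forall>f. hecke q l f m k = hecke_lead q l m k * f k m + (\<Sum>j<(n::nat). c j * f (x j) (m + k - x j))"
    using hecke_ascent[OF assms(1) True] by blast
  moreover from this have "f (x j) (m + k - x j) = 0" if "j < n" for j using that by (intro assms(2)) auto
  moreover have "f k m = 0" by (intro assms(2)) auto
  ultimately show ?thesis by simp
next
  case False
  define L where "L = int l"
  have L: "L > 0" using assms L_def by simp
  define a b s t where "a = m mod L" and "b = k mod L" and "s = m div L" and "t = k div L"
  have km: "m = a + L * s" "k = b + L * t" by (simp_all add: a_def b_def s_def t_def)
  have ab: "0 \<le> a" "a < L" "0 \<le> b" "b < L" using L by (simp_all add: a_def b_def)
  have st: "t \<le> s" unfolding s_def t_def using False L by (intro zdiv_mono1) auto
  have mk: "m - k = a - b + L * (s - t)" "m - k \<ge> 0" using False by (simp_all add: km algebra_simps)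
  have "f k m = 0" by (intro assms(2)) auto
  moreover have "f (a + L * (s - int j)) (b + L * (t + int j)) = 0" if "j < nat (s - t)" for j
  proof (intro assms(2))
    have "L * int j \<le> L * (s - t - 1)" "L * int j \<ge> 0" using that L by auto
    moreover have "a + L * (s - int j) - (b + L * (t + int j)) = (m - k) - 2 * (L * int j)" "L * (s - t - 1) = L * (s - t) - L"
      unfolding mk(1) by (simp_all add: algebra_simps)
    moreover have "\<bar>D - 2 * P\<bar> \<le> \<bar>D\<bar>" if "0 \<le> P" "P \<le> R - L" "D = a - b + R" "D \<ge> 0" for D P R
      using that ab by arith
    ultimately show "\<bar>a + L * (s - int j) - (b + L * (t + int j))\<bar> \<le> \<bar>m - k\<bar>"
      using mk by metis
  qed (simp add: km algebra_simps)
  moreover have "f (a + L * t) (b + L * s) = 0" if "a \<ge> b"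
  proof (intro assms(2))
    have "L * t \<le> L * s" using st L by simp
    then show "\<bar>a + L * t - (b + L * s)\<bar> \<le> \<bar>m - k\<bar>" using mk that by (simp add: algebra_simps abs_if)
  qed (simp add: km algebra_simps)
  ultimately show ?thesis using st
    by (simp add: hecke_def Let_def L_def[symmetric] a_def[symmetric] b_def[symmetric] s_def[symmetric] t_def[symmetric])
qed

text \<open>For fixed sum, the sum of squares measures the distance of two letters. This makes the
  quadratic energy of a whole word a termination measure that is insensitive to the position at
  which a rule is applied.\<close>

lemma same_sum_squares:
  fixes x y m k :: int
  assumes "x + y = m + k"
  shows "x\<^sup>2 + y\<^sup>2 < m\<^sup>2 + k\<^sup>2 \<longleftrightarrow> \<bar>x - y\<bar> < \<bar>m - k\<bar>" "x\<^sup>2 + y\<^sup>2 \<le> m\<^sup>2 + k\<^sup>2 \<longleftrightarrow> \<bar>x - y\<bar> \<le> \<bar>m - k\<bar>"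
proof -
  have "2 * (x\<^sup>2 + y\<^sup>2) = (x + y)\<^sup>2 + (x - y)\<^sup>2" "2 * (m\<^sup>2 + k\<^sup>2) = (m + k)\<^sup>2 + (m - k)\<^sup>2"
    by (simp_all add: power2_eq_square algebra_simps)
  then have "x\<^sup>2 + y\<^sup>2 < m\<^sup>2 + k\<^sup>2 \<longleftrightarrow> (x - y)\<^sup>2 < (m - k)\<^sup>2" "x\<^sup>2 + y\<^sup>2 \<le> m\<^sup>2 + k\<^sup>2 \<longleftrightarrow> (x - y)\<^sup>2 \<le> (m - k)\<^sup>2" using assms by auto
  then show "x\<^sup>2 + y\<^sup>2 < m\<^sup>2 + k\<^sup>2 \<longleftrightarrow> \<bar>x - y\<bar> < \<bar>m - k\<bar>" "x\<^sup>2 + y\<^sup>2 \<le> m\<^sup>2 + k\<^sup>2 \<longleftrightarrow> \<bar>x - y\<bar> \<le> \<bar>m - k\<bar>"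
    by (simp_all add: abs_le_square_iff flip: not_le)
qed

lemma hecke_ascent_low:
  fixes q :: "'a::field_char_0"
  assumes "l > 0" "k \<le> m" "\<And>x y. x + y = k + m \<Longrightarrow> \<bar>x - y\<bar> < \<bar>m - k\<bar> \<Longrightarrow> f x y = 0"
  shows "hecke q l f k m = hecke_lead q l k m * f m k"
proof (cases "k = m")
  case False
  then have km: "k < m" using assms(2) by simp
  obtain n c x where "\<forall>j<n. k < x j \<and> x j < m"
     "\<forall>f. hecke q l f k m = hecke_lead q l k m * f m k + (\<Sum>j<(n::nat). c j * f (x j) (k + m - x j))"
    using hecke_ascent[OF assms(1) km] by blast
  moreover from this have "f (x j) (k + m - x j) = 0" if "j < n" for j using that by (intro assms(3)) auto
  ultimately show ?thesis by simp
qed (use assms(1) in \<open>simp add: hecke_diag hecke_lead_def\<close>)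

text \<open>For functions vanishing below energy e, the inner pairs of \<open>hecke_ascent\<close>
  drop out at energy e, and on ascending pairs the operators act there as exchanges of letters up to
  a nonzero factor.\<close>

lemma hecke12_low:
  fixes q :: "'a::field_char_0"
  assumes "l > 0" "\<And>x y z. x\<^sup>2 + y\<^sup>2 + z\<^sup>2 < e \<Longrightarrow> F x y z = 0"
  shows "x\<^sup>2 + y\<^sup>2 + z\<^sup>2 < e \<Longrightarrow> hecke12 q l F x y z = 0"
    and "x\<^sup>2 + y\<^sup>2 + z\<^sup>2 < e \<Longrightarrow> hecke23 q l F x y z = 0"
    and "x\<^sup>2 + y\<^sup>2 + z\<^sup>2 = e \<Longrightarrow> x \<le> y \<Longrightarrow> hecke12 q l F x y z = hecke_lead q l x y * F y x z"
    and "x\<^sup>2 + y\<^sup>2 + z\<^sup>2 = e \<Longrightarrow> y \<le> z \<Longrightarrow> hecke23 q l F x y z = hecke_lead q l y z * F x z y"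
proof -
  show "hecke12 q l F x y z = 0" if "x\<^sup>2 + y\<^sup>2 + z\<^sup>2 < e"
    unfolding hecke12_def
  proof (rule hecke_support[OF assms(1)])
    fix x' y' assume "x' + y' = x + y" "\<bar>x' - y'\<bar> \<le> \<bar>x - y\<bar>"
    then have "x'\<^sup>2 + y'\<^sup>2 \<le> x\<^sup>2 + y\<^sup>2" using same_sum_squares by blast
    then show "F x' y' z = 0" using assms(2) that by force
  qed
  show "hecke23 q l F x y z = 0" if "x\<^sup>2 + y\<^sup>2 + z\<^sup>2 < e"
    unfolding hecke23_def
  proof (rule hecke_support[OF assms(1)])
    fix y' z' assume "y' + z' = y + z" "\<bar>y' - z'\<bar> \<le> \<bar>y - z\<bar>"
    then have "y'\<^sup>2 + z'\<^sup>2 \<le> y\<^sup>2 + z\<^sup>2" using same_sum_squares by blast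
    then show "F x y' z' = 0" using assms(2) that by force
  qed
  show "hecke12 q l F x y z = hecke_lead q l x y * F y x z" if "x\<^sup>2 + y\<^sup>2 + z\<^sup>2 = e" "x \<le> y"
    unfolding hecke12_def
  proof (rule hecke_ascent_low[OF assms(1) that(2)])
    fix x' y' assume *: "x' + y' = x + y" "\<bar>x' - y'\<bar> < \<bar>y - x\<bar>"
    then have "x'\<^sup>2 + y'\<^sup>2 < x\<^sup>2 + y\<^sup>2" using same_sum_squares(1)[OF *(1)] by auto
    then show "F x' y' z = 0" using assms(2) that by force
  qed
  show "hecke23 q l F x y z = hecke_lead q l y z * F x z y" if "x\<^sup>2 + y\<^sup>2 + z\<^sup>2 = e" "y \<le> z"
    unfolding hecke23_def
  proof (rule hecke_ascent_low[OF assms(1) that(2)])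
    fix x' y' assume *: "x' + y' = y + z" "\<bar>x' - y'\<bar> < \<bar>z - y\<bar>"
    then have "x'\<^sup>2 + y'\<^sup>2 < y\<^sup>2 + z\<^sup>2" using same_sum_squares(1)[OF *(1)] by auto
    then show "F x x' y' = 0" using assms(2) that by force
  qed
qed

text \<open>The braid relation turns the relation at the first descent of the decreasing triple
  into the relation at its second descent.\<close>

lemma triple_confluence:
  fixes q :: "'a::field_char_0" and H :: "int \<Rightarrow> int \<Rightarrow> int \<Rightarrow> 'a"
  assumes l: "l > 0" and q: "q \<noteq> 0" "inverse (q ^ 2) + 1 \<noteq> 0"
  defines "D1 \<equiv> \<lambda>x y z. hecke12 q l H x y z + H x y z" and "D2 \<equiv> \<lambda>x y z. hecke23 q l H x y z + H x y z"
  assumes abc: "a \<ge> b" "b \<ge> c"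
    and low: "\<And>x y z. x\<^sup>2 + y\<^sup>2 + z\<^sup>2 < a\<^sup>2 + b\<^sup>2 + c\<^sup>2 \<Longrightarrow> D1 x y z = 0"
      "\<And>x y z. x\<^sup>2 + y\<^sup>2 + z\<^sup>2 < a\<^sup>2 + b\<^sup>2 + c\<^sup>2 \<Longrightarrow> D2 x y z = 0"
    and hyp: "D1 b a c = 0" "a > b \<Longrightarrow> D2 b c a = 0" "b > c \<Longrightarrow> D1 c a b = 0" "a > c \<Longrightarrow> D1 c b a = 0" "a > c \<Longrightarrow> D2 c b a = 0"
  shows "D2 a c b = 0"
proof (cases "a = c")
  case True
  then have "a = b" "b = c" using abc by auto
  then show ?thesis using hyp(1) hecke_diag[OF l, of q] unfolding D1_def D2_def hecke12_def hecke23_def by simp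
next
  case False
  define e where "e = a\<^sup>2 + b\<^sup>2 + c\<^sup>2"
  note low1 = hecke12_low[OF l, where F = D1 and e = e and q = q] and low2 = hecke12_low[OF l, where F = D2 and e = e and q = q]
  have l1: "x\<^sup>2 + y\<^sup>2 + z\<^sup>2 < e \<Longrightarrow> D1 x y z = 0" "x\<^sup>2 + y\<^sup>2 + z\<^sup>2 < e \<Longrightarrow> D2 x y z = 0" for x y z using low e_def by auto
  have z: "D1 c b a = 0" "D2 c b a = 0" "D1 c a b = 0" using hyp abc False by (auto simp: less_le)
  have nz: "hecke_lead q l x y \<noteq> 0" for x y unfolding hecke_lead_def using q by auto
  have add12: "hecke12 q l (\<lambda>x y z. f x y z + g x y z) x' y' z' = hecke12 q l f x' y' z' + hecke12 q l g x' y' z'" for f g x' y' z'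
    by (simp add: hecke12_add)
  have add23: "hecke23 q l (\<lambda>x y z. f x y z + g x y z) x' y' z' = hecke23 q l f x' y' z' + hecke23 q l g x' y' z'" for f g x' y' z'
    by (simp add: hecke23_add)
  have T: "hecke12 q l D2 c b a = hecke_lead q l c b * D2 b c a" "hecke23 q l D1 c b a = hecke_lead q l b a * D1 c a b"
    using low1(4)[OF l1(1), of c b a] low2(3)[OF l1(2), of c b a] abc by (auto simp: e_def)
  have T21: "hecke23 q l (hecke12 q l D2) c b a = hecke_lead q l b a * (hecke_lead q l c a * D2 a c b)"
    using hecke12_low(4)[OF l, where F = "hecke12 q l D2" and e = e and q = q, of c b a] low2(1)[OF l1(2)] low2(3)[OF l1(2), of c a b] abc by (auto simp: e_def)
  have T12: "hecke12 q l (hecke23 q l D1) c b a = hecke_lead q l c b * (hecke_lead q l c a * D1 b a c)"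
    using hecke12_low(3)[OF l, where F = "hecke23 q l D1" and e = e and q = q, of c b a] low1(2)[OF l1(1)] low1(4)[OF l1(1), of b c a] abc by (auto simp: e_def)
  have "hecke23 q l (hecke12 q l D2) c b a = hecke23 q l (hecke12 q l (hecke23 q l H)) c b a + hecke23 q l (hecke12 q l H) c b a"
    unfolding D2_def hecke12_add hecke23_add by simp
  also have "\<dots> = hecke12 q l (hecke23 q l (hecke12 q l H)) c b a + hecke23 q l (hecke12 q l H) c b a"
    using hecke_braid[OF l q(1)] by metis
  also have "\<dots> = hecke12 q l (hecke23 q l D1) c b a - hecke12 q l (hecke23 q l H) c b a + hecke23 q l (hecke12 q l H) c b a"
    unfolding D1_def hecke12_add hecke23_add by simp
  also have "\<dots> = hecke12 q l (hecke23 q l D1) c b a - hecke12 q l D2 c b a + hecke23 q l D1 c b a + D1 c b a - D2 c b a"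
    unfolding D1_def D2_def hecke12_add hecke23_add by simp
  \<comment> \<open>In T2 T1 D2 = T1 T2 D1 + (lower terms) all other defects vanish by hypothesis or
    by energy, and what remains relates the two second-position defects at (a, c, b) and (b, c,
    a).\<close>
  finally have main: "hecke_lead q l b a * (hecke_lead q l c a * D2 a c b) = - hecke_lead q l c b * D2 b c a"
    using T T21 T12 hyp(1) z by simp
  then show ?thesis
  proof (cases "a = b")
    \<comment> \<open>Now (b, c, a) and (a, c, b) are the same triple, so \<open>main\<close> is a
      multiple of q^(-2) + 1 times the defect in question.\<close>
    case ab: True
    have "hecke_lead q l b a = inverse (q ^ 2)" using ab by (simp add: hecke_lead_def)
    then have "inverse (q ^ 2) * (hecke_lead q l c a * D2 a c b) = - hecke_lead q l c a * D2 a c b"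
      using main ab by simp
    then have "hecke_lead q l c a * ((inverse (q ^ 2) + 1) * D2 a c b) = 0" by algebra
    then show ?thesis using nz q by simp
  next
    case False
    then show ?thesis using hyp(2) abc nz main by simp
  qed
qed

section \<open>Relations at a position of a word, and coordinate functionals of normal words\<close>

definition upd2 :: "int list \<Rightarrow> nat \<Rightarrow> int \<Rightarrow> int \<Rightarrow> int list" where
  "upd2 w p x y = w[p := x, Suc p := y]"

abbreviation swap_at :: "nat \<Rightarrow> int list \<Rightarrow> int list" where
  "swap_at p w \<equiv> upd2 w p (w ! Suc p) (w ! p)"

lemma length_upd2 [simp]: "length (upd2 w p x y) = length w" by (simp add: upd2_def)

lemma nth_upd2:
  "Suc p < length w \<Longrightarrow> upd2 w p x y ! i = (if i = p then x else if i = Suc p then y else w ! i)"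
  by (auto simp: upd2_def nth_list_update)

lemma upd2_upd2 [simp]: "upd2 (upd2 w p x y) p x' y' = upd2 w p x' y'"
  by (simp add: upd2_def list_update_swap[of "Suc p" p])

lemma upd2_triv [simp]: "upd2 w p (w ! p) (w ! Suc p) = w" by (simp add: upd2_def)

lemma upd2_commute: "Suc p < p' \<Longrightarrow> upd2 (upd2 w p x y) p' x' y' = upd2 (upd2 w p' x' y') p x y"
  by (simp add: upd2_def list_update_swap[of "Suc p" p'] list_update_swap[of p p'] list_update_swap[of "Suc p" "Suc p'"] list_update_swap[of p "Suc p'"])

definition hecke_at :: "'a::field_char_0 \<Rightarrow> nat \<Rightarrow> nat \<Rightarrow> (int list \<Rightarrow> 'a) \<Rightarrow> int list \<Rightarrow> 'a" where
  "hecke_at q l p f w = hecke q l (\<lambda>x y. f (upd2 w p x y)) (w ! p) (w ! Suc p)"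

definition qsum :: "(nat \<Rightarrow> int \<Rightarrow> int) \<Rightarrow> int list \<Rightarrow> int" where
  "qsum g w = (\<Sum>i<length w. g i (w ! i))"

lemma qsum_upd2:
  assumes "Suc p < length w"
  shows "qsum g (upd2 w p x y) = qsum g w - g p (w ! p) - g (Suc p) (w ! Suc p) + g p x + g (Suc p) y"
proof -
  have S: "{..<length w} = insert p (insert (Suc p) ({..<length w} - {p, Suc p}))" using assms by auto
  have "(\<Sum>i\<in>{..<length w} - {p, Suc p}. g i (upd2 w p x y ! i)) = (\<Sum>i\<in>{..<length w} - {p, Suc p}. g i (w ! i))"
    by (intro sum.cong) (auto simp: nth_upd2[OF assms])
  then show ?thesis unfolding qsum_def length_upd2
    by (subst (1 2) S) (simp add: nth_upd2[OF assms])
qed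

definition energy :: "int list \<Rightarrow> int" where "energy = qsum (\<lambda>_ x. x\<^sup>2)"
definition moment :: "int list \<Rightarrow> int" where "moment = qsum (\<lambda>i x. int i * x)"

lemma energy_nonneg: "energy w \<ge> 0" unfolding energy_def qsum_def by (intro sum_nonneg) auto

lemma moment_le: "moment w \<le> int (length w) * energy w"
  unfolding energy_def moment_def qsum_def sum_distrib_left
proof (intro sum_mono)
  fix i assume "i \<in> {..<length w}"
  have "w ! i \<le> (w ! i)\<^sup>2" by (cases "w ! i > 0") (auto simp: power2_eq_square mult_le_cancel_left1 intro: order_trans)
  then have "int i * (w ! i) \<le> int i * (w ! i)\<^sup>2" by (intro mult_left_mono) auto
  also have "\<dots> \<le> int (length w) * (w ! i)\<^sup>2" using \<open>i \<in> _\<close> by (intro mult_right_mono) auto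
  finally show "int i * w ! i \<le> int (length w) * (w ! i)\<^sup>2" .
qed

lemmas energy_upd2 = qsum_upd2[where g = "\<lambda>_ x. x\<^sup>2", folded energy_def]
lemmas moment_upd2 = qsum_upd2[where g = "\<lambda>i x. int i * x", folded moment_def]

text \<open>Moving the letters of a descent strictly towards each other lowers the energy;
  exchanging them keeps the energy and raises the moment, which \<open>moment_le\<close> bounds by
  length times energy.\<close>

definition straight_rel :: "(int list \<times> int list) set" where
  "straight_rel = measures [\<lambda>w. nat (energy w), \<lambda>w. nat (int (length w) * energy w - moment w)]"

lemma wf_straight_rel: "wf straight_rel" by (simp add: straight_rel_def)

lemma straight_rel_upd2:
  assumes "Suc p < length w" "w ! Suc p \<le> x" "x < w ! p"
  shows "(upd2 w p x (w ! p + w ! Suc p - x), w) \<in> straight_rel"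
proof (cases "x = w ! Suc p")
  case True
  have e: "energy (swap_at p w) = energy w" using energy_upd2[OF assms(1)] by simp
  have "moment (swap_at p w) = moment w + (w ! p - w ! Suc p)" unfolding moment_upd2[OF assms(1)] by (simp add: algebra_simps)
  then show ?thesis using True assms(3) e moment_le[of "swap_at p w"] by (simp add: straight_rel_def)
next
  case False
  have "x\<^sup>2 + (w ! p + w ! Suc p - x)\<^sup>2 < (w ! p)\<^sup>2 + (w ! Suc p)\<^sup>2"
    using same_sum_squares(1)[of x "w ! p + w ! Suc p - x" "w ! p" "w ! Suc p"] False assms by auto
  then have "energy (upd2 w p x (w ! p + w ! Suc p - x)) < energy w" unfolding energy_upd2[OF assms(1)] by simp
  then show ?thesis using energy_nonneg[of "upd2 w p x (w ! p + w ! Suc p - x)"] by (simp add: straight_rel_def)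
qed

lemma straight_induct [case_names step]:
  assumes "\<And>w. (\<And>p x. Suc p < length w \<Longrightarrow> w ! Suc p \<le> x \<Longrightarrow> x < w ! p \<Longrightarrow> P (upd2 w p x (w ! p + w ! Suc p - x))) \<Longrightarrow> P w"
  shows "P w"
  using wf_straight_rel by (induction w rule: wf_induct_rule) (blast intro: assms straight_rel_upd2)

lemma hecke_at_ascent:
  fixes q :: "'a::field_char_0"
  assumes "l > 0" "Suc p < length w" "\<And>v. energy v < e \<Longrightarrow> f v = 0" "energy w \<le> e" "w ! p \<le> w ! Suc p"
  shows "hecke_at q l p f w = hecke_lead q l (w ! p) (w ! Suc p) * f (swap_at p w)"
  unfolding hecke_at_def
proof (rule hecke_ascent_low[OF assms(1,5)])
  fix x y assume *: "x + y = w ! p + w ! Suc p" "\<bar>x - y\<bar> < \<bar>w ! Suc p - w ! p\<bar>"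
  then have "energy (upd2 w p x y) < energy w" unfolding energy_upd2[OF assms(2)] using same_sum_squares(1)[OF *(1)] by (simp add: abs_minus_commute)
  then show "f (upd2 w p x y) = 0" using assms(3,4) by simp
qed

lemma hecke_at_add: "hecke_at q l p (\<lambda>w. f w + g w) w = hecke_at q l p f w + hecke_at q l p g w"
  unfolding hecke_at_def by (rule hecke_add)

lemma hecke_at_quadratic:
  fixes q :: "'a::field_char_0"
  assumes "l > 0" "q \<noteq> 0" "Suc p < length w"
  shows "hecke_at q l p (hecke_at q l p f) w = (inverse (q^2) - 1) * hecke_at q l p f w + inverse (q^2) * f w"
proof -
  have "hecke_at q l p (hecke_at q l p f) w = hecke q l (hecke q l (\<lambda>x y. f (upd2 w p x y))) (w ! p) (w ! Suc p)"
    unfolding hecke_at_def by (simp add: nth_upd2 assms(3))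
  then show ?thesis unfolding hecke_quadratic[OF assms(1,2)] hecke_at_def by simp
qed

lemma hecke_repr:
  "\<exists>A c. finite A \<and> (\<forall>f. hecke q l f m k = (\<Sum>v\<in>A. c v * f (fst v) (snd v)))"
proof -
  obtain A c where "finite A" "\<And>f. hecke12 q l f m k 0 = (\<Sum>v\<in>A. c v * f (fst v) (fst (snd v)) (snd (snd v)))"
    using fin_lin_hecke12[of q l m k 0] unfolding fin_lin_def by blast
  then have A: "finite A" "hecke q l f m k = (\<Sum>v\<in>A. c v * f (fst v) (fst (snd v)))" for f
    unfolding hecke12_def by (auto dest: meta_spec[of _ "\<lambda>x y z. f x y"])
  define h where "h = (\<lambda>v::int\<times>int\<times>int. (fst v, fst (snd v)))"
  have "hecke q l f m k = (\<Sum>u\<in>h ` A. (\<Sum>v\<in>{v\<in>A. h v = u}. c v) * f (fst u) (snd u))" for f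
    unfolding A(2) sum.image_gen[OF A(1), of _ h] sum_distrib_right by (intro sum.cong) (auto simp: h_def)
  then show ?thesis using A(1) by (intro exI[of _ "h ` A"] exI[of _ "\<lambda>u. (\<Sum>v\<in>{v\<in>A. h v = u}. c v)"]) auto
qed

lemma hecke_at_commute:
  fixes q :: "'a::field_char_0"
  assumes "Suc p < p'" "Suc p' < length w"
  shows "hecke_at q l p (hecke_at q l p' f) w = hecke_at q l p' (hecke_at q l p f) w"
proof -
  obtain A c where A: "\<And>f. hecke q l f (w ! p) (w ! Suc p) = (\<Sum>v\<in>A. c v * f (fst v) (snd v))" using hecke_repr by metis
  obtain B d where B: "\<And>f. hecke q l f (w ! p') (w ! Suc p') = (\<Sum>v\<in>B. d v * f (fst v) (snd v))" using hecke_repr by metis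
  have n: "upd2 w p x y ! p' = w ! p'" "upd2 w p x y ! Suc p' = w ! Suc p'" 
     "upd2 w p' x y ! p = w ! p" "upd2 w p' x y ! Suc p = w ! Suc p" for x y using assms by (simp_all add: nth_upd2)
  show ?thesis unfolding hecke_at_def n A B upd2_commute[OF assms(1)] sum_distrib_left
    by (subst sum.swap) (simp add: mult.left_commute)
qed

definition upd3 :: "int list \<Rightarrow> nat \<Rightarrow> int \<Rightarrow> int \<Rightarrow> int \<Rightarrow> int list" where
  "upd3 w p x y z = w[p := x, Suc p := y, Suc (Suc p) := z]"

lemma upd3_simps:
  assumes "Suc (Suc p) < length w"
  shows "length (upd3 w p x y z) = length w" "upd3 w p x y z ! p = x" "upd3 w p x y z ! Suc p = y" "upd3 w p x y z ! Suc (Suc p) = z"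
    "upd2 (upd3 w p x y z) p x' y' = upd3 w p x' y' z" "upd2 (upd3 w p x y z) (Suc p) y' z' = upd3 w p x y' z'"
    "upd3 w p (w ! p) (w ! Suc p) (w ! Suc (Suc p)) = w"
    "upd2 w p x y = upd3 w p x y (w ! Suc (Suc p))" "upd2 w (Suc p) y z = upd3 w p (w ! p) y z"
  using assms by (auto simp: upd3_def upd2_def list_eq_iff_nth_eq nth_list_update)

lemma hecke_at_upd3:
  assumes "Suc (Suc p) < length w"
  shows "hecke_at q l p f (upd3 w p x y z) = hecke12 q l (\<lambda>x y z. f (upd3 w p x y z)) x y z"
    "hecke_at q l (Suc p) f (upd3 w p x y z) = hecke23 q l (\<lambda>x y z. f (upd3 w p x y z)) x y z"
  unfolding hecke_at_def hecke12_def hecke23_def upd3_simps[OF assms] by auto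

lemma qsum_upd3:
  assumes "Suc (Suc p) < length w"
  shows "qsum g (upd3 w p x y z) = qsum g w - g p (w ! p) - g (Suc p) (w ! Suc p) - g (Suc (Suc p)) (w ! Suc (Suc p)) + g p x + g (Suc p) y + g (Suc (Suc p)) z"
proof -
  have "upd3 w p x y z = upd2 (upd2 w p x y) (Suc p) y z"
    by (simp add: upd3_def upd2_def list_update_swap)
  then show ?thesis using assms by (simp add: qsum_upd2 nth_upd2)
qed

lemmas energy_upd3 = qsum_upd3[where g = "\<lambda>_ x. x\<^sup>2", folded energy_def]
lemmas moment_upd3 = qsum_upd3[where g = "\<lambda>i x. int i * x", folded moment_def]

text \<open>The coordinate functional of the normal word t. At a word with a descent, the relation T
  f = -f at the exchanged word is solved for the value at w; the update \<open>h(w := 0)\<close>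
  removes w itself from the sum, as its coefficient has become the denominator. Only the first
  descent is used, so the recursion is unambiguous, and the relation at every other position remains
  to be proved.\<close>

definition straight_fun :: "'a::field_char_0 \<Rightarrow> nat \<Rightarrow> int list \<Rightarrow> int list \<Rightarrow> 'a" where
  "straight_fun q l t = wfrec straight_rel (\<lambda>h w.
     if \<exists>p. Suc p < length w \<and> w ! Suc p \<le> w ! p then
       (let p = (LEAST p. Suc p < length w \<and> w ! Suc p \<le> w ! p) in
         if w ! p = w ! Suc p then 0
         else - (h (swap_at p w) + hecke_at q l p (h(w := 0)) (swap_at p w)) / hecke_lead q l (w ! Suc p) (w ! p))
     else if w = t then 1 else 0)"

lemma straight_fun_rec:
  fixes q :: "'a::field_char_0" and l :: nat and t :: "int list"
  defines "D \<equiv> \<lambda>w p. Suc p < length w \<and> w ! Suc p \<le> w ! p"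
  defines "h \<equiv> straight_fun q l t"
  assumes l: "l > 0" and q: "q \<noteq> 0"
  shows "\<nexists>p. D w p \<Longrightarrow> h w = (if w = t then 1 else 0)"
    and "D w p \<Longrightarrow> p = (LEAST p. D w p) \<Longrightarrow> w ! p = w ! Suc p \<Longrightarrow> h w = 0"
    and "D w p \<Longrightarrow> p = (LEAST p. D w p) \<Longrightarrow> w ! p \<noteq> w ! Suc p \<Longrightarrow> hecke_at q l p h (swap_at p w) + h (swap_at p w) = 0"
proof -
  let ?c = "cut h straight_rel w"
  have rec: "h w = (if \<exists>p. D w p then
       (let p = (LEAST p. D w p) in
         if w ! p = w ! Suc p then 0
         else - (?c (swap_at p w) + hecke_at q l p (?c(w := 0)) (swap_at p w)) / hecke_lead q l (w ! Suc p) (w ! p))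
     else if w = t then 1 else 0)"
    unfolding h_def D_def straight_fun_def by (subst wfrec[OF wf_straight_rel]) simp
  show "\<nexists>p. D w p \<Longrightarrow> h w = (if w = t then 1 else 0)" using rec by auto
  show "D w p \<Longrightarrow> p = (LEAST p. D w p) \<Longrightarrow> w ! p = w ! Suc p \<Longrightarrow> h w = 0"
    using rec by (auto simp: Let_def)
  assume p: "D w p" "p = (LEAST p. D w p)" "w ! p \<noteq> w ! Suc p"
  then have lt: "w ! Suc p < w ! p" "Suc p < length w" unfolding D_def by auto
  have hw: "h w = - (?c (swap_at p w) + hecke_at q l p (?c(w := 0)) (swap_at p w)) / hecke_lead q l (w ! Suc p) (w ! p)"
    using rec p by (auto simp: Let_def)
  have nz: "hecke_lead q l (w ! Suc p) (w ! p) \<noteq> 0" unfolding hecke_lead_def using q by auto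
  have cs: "?c (swap_at p w) = h (swap_at p w)"
    using straight_rel_upd2[OF lt(2), of "w ! Suc p"] lt by (simp add: cut_apply)
  obtain n c x where x: "\<forall>j<n. w ! Suc p < x j \<and> x j < w ! p"
    and rep: "\<And>f. hecke q l f (w ! Suc p) (w ! p) = hecke_lead q l (w ! Suc p) (w ! p) * f (w ! p) (w ! Suc p) + (\<Sum>j<(n::nat). c j * f (x j) (w ! Suc p + w ! p - x j))"
    using hecke_ascent[OF l lt(1), of q] by blast
  have at: "hecke_at q l p f (swap_at p w) = hecke_lead q l (w ! Suc p) (w ! p) * f w +
      (\<Sum>j<n. c j * f (upd2 w p (x j) (w ! Suc p + w ! p - x j)))" for f
    unfolding hecke_at_def using lt by (simp add: nth_upd2 rep)
  have "(?c(w := 0)) (upd2 w p (x j) (w ! Suc p + w ! p - x j)) = h (upd2 w p (x j) (w ! Suc p + w ! p - x j))" if "j < n" for j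
  proof -
    have r: "(upd2 w p (x j) (w ! Suc p + w ! p - x j), w) \<in> straight_rel"
      using straight_rel_upd2[OF lt(2), of "x j"] x that by (simp add: add.commute less_imp_le)
    then have "upd2 w p (x j) (w ! Suc p + w ! p - x j) \<noteq> w" using wf_straight_rel wf_not_refl by metis
    then show ?thesis using r by (simp add: cut_apply)
  qed
  then have "hecke_at q l p (?c(w := 0)) (swap_at p w) = (\<Sum>j<n. c j * h (upd2 w p (x j) (w ! Suc p + w ! p - x j)))"
    unfolding at by simp
  then show "hecke_at q l p h (swap_at p w) + h (swap_at p w) = 0"
    unfolding at[of h] using hw nz cs by (simp add: field_simps)
qed

text \<open>Newman-style argument: by induction on the energy all relations of smaller energy hold,
  so that modulo these the operators of the Hecke algebra act by permutation of the letters.\<close>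

lemma straight_fun_hecke:
  fixes q :: "'a::field_char_0" and l :: nat and t :: "int list"
  defines "h \<equiv> straight_fun q l t"
  assumes l: "l > 0" and q: "q \<noteq> 0" "inverse (q ^ 2) + 1 \<noteq> 0"
  assumes "Suc p < length w"
  shows "hecke_at q l p h w + h w = 0"
proof -
  define Rel where "Rel = (\<lambda>p w. hecke_at q l p h w + h w)"
  define D where "D = (\<lambda>(w::int list) p. Suc p < length w \<and> w ! Suc p \<le> w ! p)"
  have nz: "hecke_lead q l x y \<noteq> 0" for x y unfolding hecke_lead_def using q by auto
  have "\<forall>w p. nat (energy w) = e \<longrightarrow> Suc p < length w \<longrightarrow> Rel p w = 0" for e
  proof (induction e rule: less_induct)
    case (less e)
    have low: "Rel p v = 0" if "Suc p < length v" "energy v < int e" for p v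
      using less[of "nat (energy v)"] that energy_nonneg[of v] by auto
    \<comment> \<open>\<open>hecke_at_ascent\<close> expects vanishing on all words of small energy,
      while \<open>Rel p\<close> is meaningful only on words longer than p + 1; hence the extension
      by zero.\<close>
    have low': "(\<lambda>v. if Suc p < length v then Rel p v else 0) v = 0" if "energy v < int e" for p v using low that by auto
    have cong_at: "hecke_at q l p' (\<lambda>v. if Suc p < length v then Rel p v else 0) w = hecke_at q l p' (Rel p) w" if "Suc p < length w" for p p' w
      unfolding hecke_at_def using that by simp
    have asc: "hecke_at q l p' (Rel p) w = hecke_lead q l (w ! p') (w ! Suc p') * Rel p (swap_at p' w)"
      if "Suc p < length w" "Suc p' < length w" "energy w \<le> int e" "w ! p' \<le> w ! Suc p'" for p p' w
      using hecke_at_ascent[OF l that(2) _ that(3,4), where q = q and f = "\<lambda>v. if Suc p < length v then Rel p v else 0"] low' cong_at[OF that(1)] that(1) by simp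
    \<comment> \<open>At fixed energy the words y are treated by decreasing moment. The defect is
      evaluated at the exchanged word, which is the ascending side of the rule that rewrites
      y.\<close>
    have desc: "Rel p (swap_at p y) = 0" if "energy y = int e" "D y p" for y p
      using that
    proof (induction "nat (int (length y) * energy y - moment y)" arbitrary: y p rule: less_induct)
      case (less y p)
      have IH: "Rel p' (swap_at p' v) = 0" if "energy v = int e" "D v p'" "length v = length y" "moment v > moment y" for v p'
        using less(1)[OF _ that(1,2)] that less(2) moment_le[of v] by auto
      define s where "s = (LEAST p. D y p)"
      have sD: "D y s" unfolding s_def using less(3) by (rule LeastI)
      have sp: "s \<le> p" unfolding s_def using less(3) by (rule Least_le)
      have D': "Suc p < length y" "y ! Suc p \<le> y ! p" "Suc s < length y" "y ! Suc s \<le> y ! s" using less(3) sD D_def by auto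
      have base: "Rel s (swap_at s y) = 0"
      proof (cases "y ! s = y ! Suc s")
        case True
        then have "h y = 0" using straight_fun_rec(2)[OF l q(1), where w = y and p = s and t = t] sD s_def unfolding D_def h_def by simp
        then show ?thesis unfolding Rel_def hecke_at_def using True upd2_triv[of y s] by (simp add: hecke_diag[OF l])
      next
        case False
        then show ?thesis using straight_fun_rec(3)[OF l q(1), where w = y and p = s and t = t] sD s_def unfolding D_def h_def Rel_def by simp
      qed
      consider "p = s" | "p = Suc s" | "Suc s < p" using sp by linarith
      then show "Rel p (swap_at p y) = 0"
      proof cases
        case 1
        then show ?thesis using base by simp
      next
        case 2
        then have len: "Suc (Suc s) < length y" using D' by simp
        define H where "H = (\<lambda>x y' z. h (upd3 y s x y' z))"
        define a b c where "a = y ! s" and "b = y ! Suc s" and "c = y ! Suc (Suc s)"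
        have abc: "a \<ge> b" "b \<ge> c" using D' 2 unfolding a_def b_def c_def by auto
        have R1: "hecke12 q l H x y' z + H x y' z = Rel s (upd3 y s x y' z)"
         and R2: "hecke23 q l H x y' z + H x y' z = Rel p (upd3 y s x y' z)" for x y' z
          unfolding Rel_def H_def 2 hecke_at_upd3[OF len] by auto
        have en: "energy (upd3 y s x y' z) = int e - a\<^sup>2 - b\<^sup>2 - c\<^sup>2 + x\<^sup>2 + y'\<^sup>2 + z\<^sup>2" for x y' z
          unfolding energy_upd3[OF len] less(2) a_def b_def c_def ..
        have mo: "moment (upd3 y s x y' z) = moment y - int s * a - int (Suc s) * b - int (Suc (Suc s)) * c + int s * x + int (Suc s) * y' + int (Suc (Suc s)) * z" for x y' z
          unfolding moment_upd3[OF len] a_def b_def c_def ..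
        note u3 = upd3_simps[OF len]
        have sw: "swap_at s (upd3 y s x y' z) = upd3 y s y' x z" "swap_at p (upd3 y s x y' z) = upd3 y s x z y'" for x y' z
          unfolding 2 u3 by auto
        have y3: "y = upd3 y s a b c" using u3 a_def b_def c_def by simp
        have s1: "swap_at s y = upd3 y s b a c" and s2: "swap_at p y = upd3 y s a c b"
          using sw[of a b c] y3 by metis+
        have "hecke23 q l H a c b + H a c b = 0"
        proof (rule triple_confluence[OF l q abc])
          show "hecke12 q l H x y' z + H x y' z = 0" "hecke23 q l H x y' z + H x y' z = 0"
            if "x\<^sup>2 + y'\<^sup>2 + z\<^sup>2 < a\<^sup>2 + b\<^sup>2 + c\<^sup>2" for x y' z
            unfolding R1 R2 using low[of _ "upd3 y s x y' z"] that len 2 by (simp_all add: u3 en)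
          show "hecke12 q l H b a c + H b a c = 0" unfolding R1 using base s1 by simp
          show "hecke23 q l H b c a + H b c a = 0" if "a > b"
          proof -
            have "Rel p (swap_at p (upd3 y s b a c)) = 0"
              by (rule IH) (use that abc len in \<open>auto simp: en mo D_def u3 2 algebra_simps\<close>)
            then show ?thesis unfolding R2 sw .
          qed
          show "hecke12 q l H c a b + H c a b = 0" if "b > c"
          proof -
            have "Rel s (swap_at s (upd3 y s a c b)) = 0"
              by (rule IH) (use that abc len in \<open>auto simp: en mo D_def u3 2 algebra_simps\<close>)
            then show ?thesis unfolding R1 sw .
          qed
          show "hecke12 q l H c b a + H c b a = 0" if "a > c"
          proof -
            have "Rel s (swap_at s (upd3 y s b c a)) = 0"
              by (rule IH) (use that abc len in \<open>auto simp: en mo D_def u3 2 algebra_simps\<close>)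
            then show ?thesis unfolding R1 sw .
          qed
          show "hecke23 q l H c b a + H c b a = 0" if "a > c"
          proof -
            have "Rel p (swap_at p (upd3 y s c a b)) = 0"
              by (rule IH) (use that abc len in \<open>auto simp: en mo D_def u3 2 algebra_simps\<close>)
            then show ?thesis unfolding R2 sw .
          qed
        qed
        then show ?thesis unfolding R2 s2 .
      next
        case 3
        \<comment> \<open>The descents s and p are disjoint. With both pairs exchanged, commuting
          the two operators at x expresses the defect at p through the known one at s and two
          defects attached to words of larger moment.\<close>
        define x where "x = swap_at s (swap_at p y)"
        have x': "x = swap_at p (swap_at s y)"
          unfolding x_def using 3 D' by (simp add: nth_upd2 upd2_commute)
        have len: "length x = length y" by (simp add: x_def)
        have nth: "x ! s = y ! Suc s" "x ! Suc s = y ! s" "x ! p = y ! Suc p" "x ! Suc p = y ! p"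
          unfolding x_def using 3 D' by (simp_all add: nth_upd2)
        have sx: "swap_at s x = swap_at p y" "swap_at p x = swap_at s y"
          unfolding nth unfolding x_def upd2_upd2 using 3 D' unfolding x_def[symmetric] x' by (simp_all add: nth_upd2)
           (simp_all add: upd2_def nth_list_update list_eq_iff_nth_eq)
        have en: "energy x = int e" unfolding x_def using 3 D' less(2) by (simp add: energy_upd2 nth_upd2)
        have "hecke_at q l s (Rel p) x = hecke_at q l s (hecke_at q l p h) x + hecke_at q l s h x"
          unfolding Rel_def by (rule hecke_at_add)
        also have "\<dots> = hecke_at q l p (hecke_at q l s h) x + hecke_at q l s h x"
          using hecke_at_commute[of s p x q l h] 3 D' len by simp
        also have "\<dots> = hecke_at q l p (Rel s) x - Rel p x + Rel s x"
          unfolding Rel_def hecke_at_add by simp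
        finally have eq: "hecke_lead q l (y ! Suc s) (y ! s) * Rel p (swap_at p y) =
            hecke_lead q l (y ! Suc p) (y ! p) * Rel s (swap_at s y) - Rel p x + Rel s x"
          using asc[of p x s] asc[of s x p] 3 D' len en nth sx by simp
        have R1: "Rel s x = 0"
        proof (cases "y ! p = y ! Suc p")
          case True
          then have "swap_at p y = y" by (metis upd2_triv)
          then show ?thesis unfolding x_def using base by simp
        next
          case False
          show ?thesis unfolding x_def
            by (rule IH) (use False less(2) D' 3 in \<open>auto simp: energy_upd2 moment_upd2 nth_upd2 D_def algebra_simps\<close>)
        qed
        show ?thesis
        proof (cases "y ! s = y ! Suc s")
          case True
          then have "swap_at s y = y" by (metis upd2_triv)
          then have "x = swap_at p y" using x' by simp
          then have "(inverse (q ^ 2) + 1) * Rel p (swap_at p y) = 0"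
            using eq R1 base True by (simp add: hecke_lead_def algebra_simps)
          then show ?thesis using q by simp
        next
          case False
          have "Rel p x = 0" unfolding x'
            by (rule IH) (use False less(2) D' 3 in \<open>auto simp: energy_upd2 moment_upd2 nth_upd2 D_def algebra_simps\<close>)
          then show ?thesis using eq R1 base nz by simp
        qed
      qed
    qed
    show ?case
    proof (intro allI impI)
      fix w p assume w: "nat (energy w) = e" "Suc p < length w"
      then have en: "energy w = int e" using energy_nonneg[of w] by auto
      have sw: "swap_at p (swap_at p w) = w" using w by (simp add: nth_upd2)
      have ens: "energy (swap_at p w) = int e" unfolding energy_upd2[OF w(2)] en by simp
      show "Rel p w = 0"
      proof (cases "w ! p \<le> w ! Suc p")
        case True
        then show ?thesis using desc[OF ens, of p] w sw by (simp add: D_def nth_upd2)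
      next
        case False
        then have d: "Rel p (swap_at p w) = 0" using desc[OF en, of p] w by (simp add: D_def)
        \<comment> \<open>By the quadratic relation, T h + h is an eigenvector of T with eigenvalue
          q^(-2); this carries the relation from the ascending word to the descending one.\<close>
        have "hecke_lead q l (w ! Suc p) (w ! p) * Rel p w = hecke_at q l p (Rel p) (swap_at p w)"
          using asc[of p "swap_at p w" p] w False ens sw by (simp add: nth_upd2)
        also have "\<dots> = inverse (q ^ 2) * Rel p (swap_at p w)"
          unfolding Rel_def hecke_at_add using hecke_at_quadratic[OF l q(1), of p "swap_at p w" h] w by (simp add: algebra_simps)
        finally show ?thesis using d nz by simp
      qed
    qed
  qed
  then show ?thesis using assms(5) unfolding Rel_def by blast
qed

section \<open>From the Hecke relations to the straightening rules\<close>

lemma qv_nonzero [simp]: "qv \<noteq> 0"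
  by (simp add: qv_def Zero_fract_def eq_fract)

lemma qv_power: "qv ^ n = Fract (monom 1 n) 1"
  by (induction n) (simp_all add: qv_def One_fract_def monom_Suc)

lemma qv_hecke_nonzero: "inverse (qv ^ 2) + 1 \<noteq> 0"
proof
  assume "inverse (qv ^ 2) + 1 = 0"
  then have "qv ^ 2 * (inverse (qv ^ 2) + 1) = 0" by simp
  then have "1 + qv ^ 2 = 0" by (simp add: distrib_left)
  then have "Fract (1 + monom 1 2) 1 = (0 :: qf)" by (simp add: qv_power One_fract_def)
  then have "1 + monom 1 2 = (0 :: complex poly)" by (simp add: Zero_fract_def eq_fract)
  then have "coeff (1 + monom 1 2) 2 = (0 :: complex)" by simp
  then show False by simp
qed

text \<open>The four-term form of the straightening relation; unlike the original one it is imposed on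
  all pairs \<open>(m, k)\<close> and contains no sum.\<close>

definition pair_rel :: "nat \<Rightarrow> (int \<Rightarrow> int \<Rightarrow> qf) \<Rightarrow> int \<Rightarrow> int \<Rightarrow> qf" where
  "pair_rel l g m k = (let i = (m - k) mod int l in
     if i = 0 then g m k + g k m
     else g m k + qv * g (m - i) (k + i) + g (k + i) (m - i) + qv * g k m)"

definition wedge_alt :: "nat \<Rightarrow> nat \<Rightarrow> (int list \<Rightarrow> qf) \<Rightarrow> bool" where
  "wedge_alt l r f \<longleftrightarrow> (\<forall>w p m k. length w = r \<longrightarrow> Suc p < r \<longrightarrow> pair_rel l (\<lambda>x y. f (upd2 w p x y)) m k = 0)"

lemma int_primitive:
  fixes f :: "int \<Rightarrow> 'a::ab_group_add"
  obtains F where "\<And>x. F x - F (x - 1) = f x"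
proof
  define F where "F = (\<lambda>x. (\<Sum>j<nat x. f (int j + 1)) - (\<Sum>j<nat (- x). f (- int j)))"
  show "F x - F (x - 1) = f x" for x
  proof (cases "x > 0")
    case True
    then have "nat x = Suc (nat (x - 1))" "int (nat (x - 1)) = x - 1" by auto
    then show ?thesis using True by (simp add: F_def)
  next
    case False
    then have "nat (- (x - 1)) = Suc (nat (- x))" "int (nat (- x)) = - x" by auto
    then show ?thesis using False unfolding F_def by simp
  qed
qed

text \<open>Two instances of T g = -g with exchanged levels have opposite sums, so adding them
  removes the sums. For a < b the second instance has its levels shifted by one in opposite
  directions; there the sums are differences of a discrete primitive F, and the boundary terms are
  what the extra terms of \<open>hecke\<close> compensate.\<close>

lemma hecke_imp_pair_rel:
  assumes l: "l > 0" and H: "\<And>m k. hecke qv l g m k + g m k = 0"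
  shows "pair_rel l g m k = 0"
proof -
  define L where "L = int l"
  have L: "L > 0" using l L_def by simp
  define a b s t where "a = m mod L" and "b = k mod L" and "s = m div L" and "t = k div L"
  have mk: "m = a + L * s" "k = b + L * t" by (simp_all add: a_def b_def s_def t_def)
  have ab: "0 \<le> a" "a < L" "0 \<le> b" "b < L" using L by (simp_all add: a_def b_def)
  define u where "u = inverse (qv ^ 2) - 1"
  have T: "(if a = b then inverse (qv ^ 2) * g (b + L * t) (a + L * s)
       else if a < b then inverse qv * g (b + L * t) (a + L * s)
       else inverse qv * g (b + L * t) (a + L * s) + u * g (a + L * t) (b + L * s))
      + u * ((\<Sum>j<nat (s - t). g (a + L * (s - int j)) (b + L * (t + int j)))
           - (\<Sum>j<nat (t - s). g (a + L * (t - int j)) (b + L * (s + int j)))) + g (a + L * s) (b + L * t) = 0"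
    if "0 \<le> a" "a < L" "0 \<le> b" "b < L" for a b s t
  proof -
    have m: "(a + L * s) mod L = a" "(b + L * t) mod L = b" "(a + L * s) div L = s" "(b + L * t) div L = t"
      using that L by (simp_all add: mod_pos_pos_trivial div_pos_pos_trivial)
    show ?thesis using H[of "a + L * s" "b + L * t"] unfolding hecke_def Let_def L_def[symmetric] m u_def[symmetric] .
  qed
  have i: "(m - k) mod L = (if a \<ge> b then a - b else a - b + L)"
  proof -
    have "(m - k) mod L = (a - b) mod L" unfolding a_def b_def by (simp add: mod_diff_eq)
    also have "\<dots> = (if a \<ge> b then a - b else a - b + L)"
    proof (cases "a \<ge> b")
      case False
      have "(a - b) mod L = (a - b + L) mod L" by simp
      also have "\<dots> = a - b + L" using False ab by (intro mod_pos_pos_trivial) auto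
      finally show ?thesis using False by simp
    qed (use ab in \<open>simp add: mod_pos_pos_trivial\<close>)
    finally show ?thesis .
  qed
  consider "a = b" | "a > b" | "a < b" by linarith
  then show ?thesis
  proof cases
    case 1
    define P Q where "P = (\<Sum>j<nat (s - t). g (a + L * (s - int j)) (a + L * (t + int j)))"
      and "Q = (\<Sum>j<nat (t - s). g (a + L * (t - int j)) (a + L * (s + int j)))"
    have "inverse (qv ^ 2) * g k m + u * (P - Q) + g m k = 0" "inverse (qv ^ 2) * g m k + u * (Q - P) + g k m = 0"
      using T[of a a s t] T[of a a t s] ab 1 unfolding mk P_def Q_def by simp_all
    then have "(inverse (qv ^ 2) + 1) * (g m k + g k m) = 0" by algebra
    then have "g m k + g k m = 0" using qv_hecke_nonzero by simp
    then show ?thesis using i 1 unfolding pair_rel_def L_def[symmetric] by (simp add: Let_def)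
  next
    case 2
    have e: "m - (a - b) = b + L * s" "k + (a - b) = a + L * t" unfolding mk by auto
    define P Q where "P = (\<Sum>j<nat (s - t). g (b + L * (s - int j)) (a + L * (t + int j)))"
      and "Q = (\<Sum>j<nat (t - s). g (b + L * (t - int j)) (a + L * (s + int j)))"
    have "inverse qv * g (a + L * t) (b + L * s) + u * (P - Q) + g (b + L * s) (a + L * t) = 0"
        "inverse qv * g m k + u * (Q - P) + g k m = 0"
      using T[of b a s t] T[of b a t s] ab 2 unfolding mk P_def Q_def by simp_all
    then have "inverse qv * (g (a + L * t) (b + L * s) + g m k) + g (b + L * s) (a + L * t) + g k m = 0" by algebra
    then have "qv * (inverse qv * (g (a + L * t) (b + L * s) + g m k) + g (b + L * s) (a + L * t) + g k m) = 0" by simp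
    then show ?thesis using i 2 unfolding pair_rel_def L_def[symmetric] by (simp add: Let_def e distrib_left flip: mult.assoc) (simp add: algebra_simps)
  next
    case 3
    have e: "m - (a - b + L) = b + L * (s - 1)" "k + (a - b + L) = a + L * (t + 1)" unfolding mk by (simp_all add: algebra_simps)
    define f where "f = (\<lambda>x. g (b + L * x) (a + L * (s + t - x)))"
    obtain F where F: "\<And>x. F x - F (x - 1) = f x" using int_primitive[of f] by blast
    have sum: "(\<Sum>j<n. f (x - int j)) = F x - F (x - int n)" for n x
      by (induction n) (use F[of "x - int n" for n] in \<open>auto simp: algebra_simps\<close>)
    have N: "(\<Sum>j<nat (x - y). g (b + L * (x - int j)) (a + L * (y + int j))) = F x - F (x - int (nat (x - y)))" if "x + y = s + t" for x y
      proof -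
      have e: "s + t - (x - int j) = y + int j" for j using that by simp
      show ?thesis unfolding sum[symmetric] f_def e by (rule refl)
    qed
    have N': "(\<Sum>j<nat (x - y). g (b + L * (x - int j)) (a + L * (y + int j)))
       - (\<Sum>j<nat (y - x). g (b + L * (y - int j)) (a + L * (x + int j))) = F x - F y" if "x + y = s + t" for x y
      using that N[of x y] N[of y x] by (cases "x \<ge> y") auto
    have 1: "inverse qv * g m k + u * g (b + L * s) (a + L * t) + u * (F t - F s) + g k m = 0"
      using T[of b a s t] ab 3 N'[of t s] unfolding mk by (simp add: add.commute)
    have 2: "inverse qv * g (a + L * (t + 1)) (b + L * (s - 1)) + u * g (b + L * (t + 1)) (a + L * (s - 1)) + u * (F (s - 1) - F (t + 1)) + g (b + L * (s - 1)) (a + L * (t + 1)) = 0"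
      using T[of b a "t + 1" "s - 1"] ab 3 N'[of "s - 1" "t + 1"] by simp
    have "g (b + L * s) (a + L * t) = F s - F (s - 1)" "g (b + L * (t + 1)) (a + L * (s - 1)) = F (t + 1) - F t"
      using F[of s] F[of "t + 1"] by (simp_all add: f_def)
    then have "inverse qv * (g m k + g (a + L * (t + 1)) (b + L * (s - 1))) + g k m + g (b + L * (s - 1)) (a + L * (t + 1)) = 0"
      using 1 2 by algebra
    then have "qv * (inverse qv * (g m k + g (a + L * (t + 1)) (b + L * (s - 1))) + g k m + g (b + L * (s - 1)) (a + L * (t + 1))) = 0" by simp
    then show ?thesis using i 3 ab unfolding pair_rel_def L_def[symmetric] by (simp add: Let_def e distrib_left flip: mult.assoc) (simp add: algebra_simps)
  qed
qed

lemma dshift_ge: "0 < i \<Longrightarrow> 2 \<le> l \<Longrightarrow> int j \<le> dshift l i j"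
proof -
  assume a: "0 < i" "2 \<le> l"
  have "int (j div 2) * 2 \<le> int (j div 2) * int l" using a by (intro mult_left_mono) auto
  moreover have "int j = int (j div 2) * 2 + (if odd j then 1 else 0)" by (cases "odd j") (auto elim!: oddE evenE)
  ultimately show ?thesis using a unfolding dshift_def by (cases "odd j") simp_all
qed

text \<open>The four-term relation is iterated. Its second term is again a descending pair, now with
  residue difference l - i, so the accumulated shifts are i, l, l + i, 2 l and so on, which is
  \<open>dshift\<close>; each round contributes a factor -q.\<close>

lemma pair_rel_imp_straight:
  assumes l: "2 \<le> l" and R: "\<And>m k. pair_rel l g m k = 0" and "k \<le> m"
  defines "i \<equiv> (m - k) mod int l"
  shows "g m k = (if i = 0 then - g k m else - qv * g k m + (qv ^ 2 - 1) *
     (\<Sum>j \<in> {j \<in> {1..nat (m - k)}. k + dshift l i j < m - dshift l i j}.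
         (- qv) ^ (j - 1) * g (k + dshift l i j) (m - dshift l i j)))"
  using assms(3) unfolding i_def
proof (induction "nat (m - k)" arbitrary: m k rule: less_induct)
  case (less m k)
  define L where "L = int l"
  have L: "L \<ge> 2" using l L_def by simp
  define i where "i = (m - k) mod L"
  show ?case
  proof (cases "i = 0")
    case True
    then show ?thesis using R[of m k] unfolding pair_rel_def L_def[symmetric] i_def by (simp add: Let_def eq_neg_iff_add_eq_0)
  next
    case False
    have "0 \<le> i" "i < L" using L unfolding i_def by auto
    then have i: "0 < i" "i < L" using False by auto
    have rel: "g m k + qv * g (m - i) (k + i) + g (k + i) (m - i) + qv * g k m = 0"
      using R[of m k] False unfolding pair_rel_def L_def[symmetric] i_def by (simp add: Let_def)
    define J where "J = {j \<in> {1..nat (m - k)}. k + dshift l i j < m - dshift l i j}"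
    have J: "J = {j. 1 \<le> j \<and> k + dshift l i j < m - dshift l i j}"
      using dshift_ge[OF i(1) l] unfolding J_def by (auto simp: nat_le_iff) (smt (verit) dshift_ge i(1) l le_nat_iff of_nat_0_le_iff)
    have d1: "dshift l i 1 = i" by (simp add: dshift_def)
    obtain c where c: "m - k = i + L * c" unfolding i_def by (metis mod_mult_div_eq)
    have "k + i \<noteq> m - i"
    proof
      assume "k + i = m - i"
      then have "i = L * c" using c by simp
      then show False using i by (cases "c \<ge> 1") (auto simp: zero_less_mult_iff mult_le_cancel_left1)
    qed
    then consider "k + i < m - i" | "k + i > m - i" by linarith
    then have "g m k = - qv * g k m + (qv ^ 2 - 1) * (\<Sum>j\<in>J. (- qv) ^ (j - 1) * g (k + dshift l i j) (m - dshift l i j))"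
    proof cases
      case 1
      define i' where "i' = (m - i - (k + i)) mod L"
      have i': "i' = L - i"
      proof -
        have "m - i - (k + i) = (L - i) + L * (c - 1)" using c by (simp add: algebra_simps)
        then have "i' = (L - i) mod L" unfolding i'_def by (simp only: mod_mult_self2)
        also have "\<dots> = L - i" using i by (intro mod_pos_pos_trivial) auto
          finally show ?thesis .
      qed
      define J' where "J' = {j \<in> {1..nat (m - i - (k + i))}. k + i + dshift l i' j < m - i - dshift l i' j}"
      have i'0: "0 < i'" using i i' by simp
      have J': "J' = {j. 1 \<le> j \<and> k + i + dshift l i' j < m - i - dshift l i' j}"
        using dshift_ge[OF i'0 l] unfolding J'_def by (auto simp: nat_le_iff) (smt (verit) dshift_ge i'0 l le_nat_iff of_nat_0_le_iff)
      have IH: "g (m - i) (k + i) = - qv * g (k + i) (m - i) + (qv ^ 2 - 1) * (\<Sum>j\<in>J'. (- qv) ^ (j - 1) * g (k + i + dshift l i' j) (m - i - dshift l i' j))"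
        using less(1)[of "m - i" "k + i"] 1 i i' i'0 unfolding L_def[symmetric] i'_def[symmetric] J'_def by simp
      have ds: "dshift l i (Suc j) = i + dshift l i' j" for j
        unfolding dshift_def i' L_def[symmetric] by (cases "odd j") (auto elim!: oddE evenE simp: algebra_simps)
      have JJ: "J = insert 1 (Suc ` J')"
      proof (intro set_eqI iffI)
        fix j assume j: "j \<in> J"
        show "j \<in> insert 1 (Suc ` J')"
        proof (cases "j = 1")
          case False
          then obtain j' where "j = Suc j'" "j' \<ge> 1" using j unfolding J by (cases j) auto
          then show ?thesis using j unfolding J J' by (auto simp: ds)
        qed auto
      qed (use 1 d1 in \<open>auto simp: J J' ds\<close>)
      have fin: "finite J'" unfolding J'_def by simp
      have "(\<Sum>j\<in>J. (- qv) ^ (j - 1) * g (k + dshift l i j) (m - dshift l i j)) = g (k + i) (m - i) +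
         (\<Sum>j\<in>J'. (- qv) ^ j * g (k + dshift l i (Suc j)) (m - dshift l i (Suc j)))"
        unfolding JJ using fin by (subst sum.insert) (auto simp: J' d1[unfolded One_nat_def] sum.reindex)
      also have "(\<Sum>j\<in>J'. (- qv) ^ j * g (k + dshift l i (Suc j)) (m - dshift l i (Suc j))) =
          - qv * (\<Sum>j\<in>J'. (- qv) ^ (j - 1) * g (k + i + dshift l i' j) (m - i - dshift l i' j))"
        unfolding sum_distrib_left
      proof (intro sum.cong refl)
        fix j assume "j \<in> J'"
        then obtain j' where "j = Suc j'" unfolding J' by (cases j) auto
        then show "(- qv) ^ j * g (k + dshift l i (Suc j)) (m - dshift l i (Suc j)) = - qv * ((- qv) ^ (j - 1) * g (k + i + dshift l i' j) (m - i - dshift l i' j))"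
          by (simp add: ds add.assoc diff_diff_eq)
      qed
      finally show ?thesis using rel IH by algebra
    next
      \<comment> \<open>The letters cross only if m - k = i. Then the four terms coincide in pairs
        and the relation is twice u_m u_k = -q u_k u_m, with an empty sum.\<close>
      case 2
      then have ic: "i > L * c" using c by linarith
      have "c \<le> 0"
      proof (rule ccontr)
        assume "\<not> c \<le> 0" then have "L * 1 \<le> L * c" using L by (intro mult_left_mono) auto
        then show False using ic i by linarith
      qed
      moreover have "c \<ge> 0" 
      proof (rule ccontr)
        assume "\<not> c \<ge> 0" then have "L * c \<le> L * (-1)" using L by (intro mult_left_mono) auto
        then show False using c less(2) i by linarith
      qed
      ultimately have c0: "m - i = k" "k + i = m" using c by auto
      have "J = {}"
      proof -
        have "dshift l i j \<ge> i" if "j \<ge> 1" for j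
        proof (cases "odd j")
          case True then show ?thesis unfolding dshift_def by simp
        next
          case False
          then have "int (j div 2) \<ge> 1" using that by (auto elim: evenE)
          then have "int (j div 2) * L \<ge> 1 * L" using L by (intro mult_right_mono) auto
          moreover have "dshift l i j = int (j div 2) * L" using False by (simp add: dshift_def L_def)
          ultimately show ?thesis using i by linarith
        qed
        then have "\<not> (1 \<le> j \<and> k + dshift l i j < m - dshift l i j)" for j using c0 i(1) by (smt (verit))
        then show ?thesis unfolding J by blast
      qed
      moreover have "g m k + qv * g k m = 0"
      proof -
        have "2 * (g m k + qv * g k m) = 0" using rel unfolding c0 by (simp add: algebra_simps)
        then show ?thesis unfolding mult_eq_0_iff by simp
      qed
      ultimately show ?thesis by (simp add: eq_neg_iff_add_eq_0)
    qed
    then show ?thesis using False unfolding J_def i_def L_def by simp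
  qed
qed

lemma sorted_iff_no_descent:
  "sorted_wrt (<) (w :: int list) \<longleftrightarrow> (\<nexists>p. Suc p < length w \<and> w ! Suc p \<le> w ! p)"
  by (auto simp: sorted_wrt_iff_nth_Suc_transp not_le)

lemma straight_fun_alt: "l > 0 \<Longrightarrow> wedge_alt l r (straight_fun qv l t)"
  unfolding wedge_alt_def
proof (intro allI impI)
  fix w :: "int list" and p m k assume l: "l > 0" and w: "length w = r" "Suc p < r"
  show "pair_rel l (\<lambda>x y. straight_fun qv l t (upd2 w p x y)) m k = 0"
  proof (rule hecke_imp_pair_rel[OF l])
    fix m k
    show "hecke qv l (\<lambda>x y. straight_fun qv l t (upd2 w p x y)) m k + straight_fun qv l t (upd2 w p m k) = 0"
      using straight_fun_hecke[OF l qv_nonzero qv_hecke_nonzero, of p "upd2 w p m k" t] w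
      unfolding hecke_at_def by (simp add: nth_upd2)
  qed
qed

lemma wedge_alt_straight:
  fixes w :: "int list" and f :: "int list \<Rightarrow> qf"
  assumes "2 \<le> l" "wedge_alt l r f" "length w = r" "Suc p < r" "w ! Suc p \<le> w ! p"
  defines "m \<equiv> w ! p" and "k \<equiv> w ! Suc p" and "i \<equiv> (w ! p - w ! Suc p) mod int l"
  shows "f w = (if i = 0 then - f (upd2 w p k m) else - qv * f (upd2 w p k m) + (qv ^ 2 - 1) *
     (\<Sum>j \<in> {j \<in> {1..nat (m - k)}. k + dshift l i j < m - dshift l i j}.
         (- qv) ^ (j - 1) * f (upd2 w p (k + dshift l i j) (m - dshift l i j))))"
proof -
  have "pair_rel l (\<lambda>x y. f (upd2 w p x y)) m k = 0" for m k
    using assms(2-4) unfolding wedge_alt_def by blast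
  from pair_rel_imp_straight[OF assms(1) this assms(5)] show ?thesis unfolding m_def k_def i_def by simp
qed

lemma straight_ok_alt:
  assumes "2 \<le> l"
  shows "straight_ok l S \<longleftrightarrow> (\<forall>w. sorted_wrt (<) w \<longrightarrow> S w = (\<lambda>w'. if w' = w then 1 else 0)) \<and>
    (\<forall>w p t. Suc p < length w \<longrightarrow> w ! Suc p \<le> w ! p \<longrightarrow> (let m = w ! p; k = w ! Suc p; i = (m - k) mod int l in
       S w t = (if i = 0 then - S (upd2 w p k m) t else - qv * S (upd2 w p k m) t + (qv ^ 2 - 1) *
     (\<Sum>j \<in> {j \<in> {1..nat (m - k)}. k + dshift l i j < m - dshift l i j}.
         (- qv) ^ (j - 1) * S (upd2 w p (k + dshift l i j) (m - dshift l i j)) t))))"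
  unfolding straight_ok_def upd2_def Let_def fun_eq_iff if_distribR by metis

lemma dshift_pos: "2 \<le> l \<Longrightarrow> 0 < i \<Longrightarrow> 1 \<le> j \<Longrightarrow> 0 < dshift l i j"
  using dshift_ge[of i l j] by linarith

lemma straight_ok_exists: "2 \<le> l \<Longrightarrow> straight_ok l (\<lambda>w t. straight_fun qv l t w)"
  unfolding straight_ok_alt Let_def
  using straight_fun_rec(1)[of l qv] wedge_alt_straight[OF _ straight_fun_alt[of l]]
  by (auto simp: sorted_iff_no_descent fun_eq_iff)

lemma straight_ok_unique:
  assumes l: "2 \<le> l" and S: "straight_ok l S" "straight_ok l S'"
  shows "S w = S' w"
proof (induction w rule: straight_induct)
  case (step w)
  show ?case
  proof (cases "sorted_wrt (<) w")
    case True
    then show ?thesis using S unfolding straight_ok_def by auto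
  next
    case False
    then obtain p where p: "Suc p < length w" "w ! Suc p \<le> w ! p" unfolding sorted_iff_no_descent by blast
    define m k i where "m = w ! p" and "k = w ! Suc p" and "i = (m - k) mod int l"
    define J where "J = {j \<in> {1..nat (m - k)}. k + dshift l i j < m - dshift l i j}"
    have S': "S w t = (if i = 0 then - S (upd2 w p k m) t else - qv * S (upd2 w p k m) t + (qv ^ 2 - 1) *
     (\<Sum>j \<in> J.
         (- qv) ^ (j - 1) * S (upd2 w p (k + dshift l i j) (m - dshift l i j)) t))"
      if "straight_ok l S" for S t
      using that p unfolding straight_ok_alt[OF l] m_def k_def i_def J_def Let_def by blast
    show ?thesis
    proof (cases "k = m")
      case True
      then have "upd2 w p k m = w" unfolding m_def k_def by (metis upd2_triv)
      then have "S w t = 0" "S' w t = 0" for t using S'[OF S(1), of t] S'[OF S(2), of t] True by (simp_all add: i_def eq_neg_iff_add_eq_0)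
      then show ?thesis by auto
    next
      case False
      then have km: "k < m" using p by (simp add: m_def k_def)
      have IH: "S (upd2 w p x (m + k - x)) = S' (upd2 w p x (m + k - x))" if "k \<le> x" "x < m" for x
        using step[OF p(1)] that unfolding m_def k_def .
      have "S (upd2 w p (k + dshift l i j) (m - dshift l i j)) = S' (upd2 w p (k + dshift l i j) (m - dshift l i j))"
        if "j \<in> J" "i \<noteq> 0" for j
      proof -
        have "i \<ge> 0" unfolding i_def using l by simp
        then have "dshift l i j > 0" using that l by (intro dshift_pos) (auto simp: J_def)
        then show ?thesis using IH[of "k + dshift l i j"] that(1) unfolding J_def by (auto simp: algebra_simps)
      qed
      moreover have "S (upd2 w p k m) = S' (upd2 w p k m)" using IH[of k] km by simp
      ultimately show ?thesis by (intro ext) (simp add: S'[OF S(1)] S'[OF S(2)])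
    qed
  qed
qed

lemma qstraight_eq: "2 \<le> l \<Longrightarrow> qstraight l w t = straight_fun qv l t w"
proof -
  assume l: "2 \<le> l"
  have "(THE S. straight_ok l S) = (\<lambda>w t. straight_fun qv l t w)"
    by (rule the_equality[of "straight_ok l", OF straight_ok_exists[OF l]], rule ext, rule straight_ok_unique[OF l _ straight_ok_exists[OF l]])
  then show ?thesis unfolding qstraight_def by simp
qed

lemma qstraight_normal:
  "2 \<le> l \<Longrightarrow> sorted_wrt (<) w \<Longrightarrow> qstraight l w t = (if w = t then 1 else 0)"
  unfolding qstraight_eq using straight_fun_rec(1)[of l qv w t] by (simp add: sorted_iff_no_descent)

lemma qstraight_alt: "2 \<le> l \<Longrightarrow> wedge_alt l r (\<lambda>w. qstraight l w t)"
  unfolding qstraight_eq by (rule straight_fun_alt) simp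

lemma wedge_alt_descent:
  assumes l: "2 \<le> l" and f: "wedge_alt l (length w) f" and p: "Suc p < length w" "w ! Suc p \<le> w ! p"
    and van: "\<And>x. w ! Suc p \<le> x \<Longrightarrow> x < w ! p \<Longrightarrow> f (upd2 w p x (w ! p + w ! Suc p - x)) = 0"
  shows "f w = 0"
proof -
  define m k i where "m = w ! p" and "k = w ! Suc p" and "i = (m - k) mod int l"
  define J where "J = {j \<in> {1..nat (m - k)}. k + dshift l i j < m - dshift l i j}"
  note eq = wedge_alt_straight[OF l f refl p, folded m_def k_def, folded i_def, folded J_def]
  show ?thesis
  proof (cases "k = m")
    case True
    then have "upd2 w p k m = w" unfolding m_def k_def by (metis upd2_triv)
    then show ?thesis using eq True by (simp add: i_def eq_neg_iff_add_eq_0)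
  next
    case False
    then have km: "k < m" using p by (simp add: m_def k_def)
    have "f (upd2 w p (k + dshift l i j) (m - dshift l i j)) = 0"
      if "j \<in> J" "i \<noteq> 0" for j
    proof -
      have "i \<ge> 0" unfolding i_def using l by simp
      then have "dshift l i j > 0" using that l by (intro dshift_pos) (auto simp: J_def)
      then show ?thesis using van[of "k + dshift l i j"] that(1) unfolding J_def by (auto simp: m_def k_def algebra_simps)
    qed
    moreover have "f (upd2 w p k m) = 0" using van[of k] km by (simp add: m_def k_def)
    ultimately show ?thesis using eq by simp
  qed
qed

text \<open>A straightening step replaces the letters of a descent by two letters with the same sum,
  the left one in the half-open interval from the lower to the upper letter. A property P stable
  under such steps holds for all normal words that can occur. This yields the bounds on letters used
  throughout.\<close>

lemma wedge_alt_zeroI: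
  assumes l: "2 \<le> l" and f: "wedge_alt l (length w) f"
    and P: "P w" "\<And>v p x. P v \<Longrightarrow> length v = length w \<Longrightarrow> Suc p < length v \<Longrightarrow> v ! Suc p \<le> x \<Longrightarrow> x < v ! p \<Longrightarrow> P (upd2 v p x (v ! p + v ! Suc p - x))"
    and z: "\<And>v. P v \<Longrightarrow> length v = length w \<Longrightarrow> sorted_wrt (<) v \<Longrightarrow> f v = 0"
  shows "f w = 0"
proof -
  have "length v = length w \<longrightarrow> P v \<longrightarrow> f v = 0" for v
  proof (induction v rule: straight_induct)
    case (step v)
    show ?case
    proof (intro impI)
      assume v: "length v = length w" "P v"
      show "f v = 0"
      proof (cases "sorted_wrt (<) v")
        case False
        then obtain p where p: "Suc p < length v" "v ! Suc p \<le> v ! p" unfolding sorted_iff_no_descent by blast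
        show ?thesis
          by (rule wedge_alt_descent[OF l _ p]) (use f v step[OF p(1)] P(2)[OF v(2,1) p(1)] in auto)
      qed (use z v in auto)
    qed
  qed
  then show ?thesis using P by blast
qed

lemma pair_rel_diff: "pair_rel l (\<lambda>x y. g x y - h x y) m k = pair_rel l g m k - pair_rel l h m k"
  by (simp add: pair_rel_def Let_def algebra_simps)

lemma wedge_alt_diff: "wedge_alt l r f \<Longrightarrow> wedge_alt l r g \<Longrightarrow> wedge_alt l r (\<lambda>w. f w - g w)"
  unfolding wedge_alt_def pair_rel_diff by simp

lemma wedge_alt_eqI:
  assumes l: "2 \<le> l" and f: "wedge_alt l r f" "wedge_alt l r g"
    and "\<And>v. length v = r \<Longrightarrow> sorted_wrt (<) v \<Longrightarrow> f v = g v" "length w = r"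
  shows "f w = g w"
  using wedge_alt_zeroI[OF l, of w "\<lambda>w. f w - g w" "\<lambda>_. True"] wedge_alt_diff[OF f] assms by auto

lemma qstraight_support:
  assumes l: "2 \<le> l" and "qstraight l w t \<noteq> 0"
    and P: "P w" "\<And>v p x. P v \<Longrightarrow> length v = length w \<Longrightarrow> Suc p < length v \<Longrightarrow> v ! Suc p \<le> x \<Longrightarrow> x < v ! p \<Longrightarrow> P (upd2 v p x (v ! p + v ! Suc p - x))"
  shows "P t \<and> length t = length w \<and> sorted_wrt (<) t"
proof (rule ccontr)
  assume n: "\<not> (P t \<and> length t = length w \<and> sorted_wrt (<) t)"
  have "qstraight l w t = 0"
    by (rule wedge_alt_zeroI[OF l qstraight_alt[OF l], of P]) (use P n qstraight_normal[OF l] in auto)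
  then show False using assms(2) by simp
qed

section \<open>Operators on alternating functionals\<close>

lemma upd2_Cons_0: "upd2 (a # b # v) 0 x y = x # y # v"
  and upd2_Cons_Suc: "upd2 (a # w) (Suc p) x y = a # upd2 w p x y"
  by (simp_all add: upd2_def)

lemma wedge_alt_Cons:
  "wedge_alt l (Suc r) f \<longleftrightarrow> (\<forall>a. wedge_alt l r (\<lambda>v. f (a # v))) \<and>
     (\<forall>v m k. Suc (length v) = r \<longrightarrow> pair_rel l (\<lambda>x y. f (x # y # v)) m k = 0)" (is "?L \<longleftrightarrow> ?R")
proof
  assume L: ?L
  have "pair_rel l (\<lambda>x y. f (a # upd2 w p x y)) m k = 0" if "length w = r" "Suc p < r" for a p m k and w :: "int list"
    using L[unfolded wedge_alt_def, rule_format, of "a # w" "Suc p" m k] that by (simp add: upd2_Cons_Suc)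
  moreover have "pair_rel l (\<lambda>x y. f (x # y # v)) m k = 0" if "Suc (length v) = r" for v m k
    using L[unfolded wedge_alt_def, rule_format, of "0 # 0 # v" 0 m k] that by (simp add: upd2_Cons_0)
  ultimately show ?R unfolding wedge_alt_def by blast
next
  assume R: ?R
  show ?L unfolding wedge_alt_def
  proof (intro allI impI)
    fix w :: "int list" and p m k assume w: "length w = Suc r" "Suc p < Suc r"
    then obtain a b v where w': "w = a # b # v" by (cases w; cases "tl w") auto
    show "pair_rel l (\<lambda>x y. f (upd2 w p x y)) m k = 0"
    proof (cases p)
      case 0
      then show ?thesis using R w w' by (simp add: upd2_Cons_0)
    next
      case (Suc p')
      then show ?thesis using R w w' unfolding wedge_alt_def by (simp add: upd2_Cons_Suc)
    qed
  qed
qed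

lemma pair_rel_add: "pair_rel l (\<lambda>x y. g x y + h x y) m k = pair_rel l g m k + pair_rel l h m k"
  by (simp add: pair_rel_def Let_def algebra_simps)

lemma pair_rel_scale: "pair_rel l (\<lambda>x y. c * g x y) m k = c * pair_rel l g m k"
  by (simp add: pair_rel_def Let_def algebra_simps)

lemma pair_rel_sum: "pair_rel l (\<lambda>x y. \<Sum>i\<in>I. g i x y) m k = (\<Sum>i\<in>I. pair_rel l (g i) m k)"
  by (induction I rule: infinite_finite_induct) (auto simp: pair_rel_add, simp_all add: pair_rel_def)

lemma pair_rel_cong:
  "(\<And>x y. x + y = m + k \<Longrightarrow> g x y = h x y) \<Longrightarrow> pair_rel l g m k = pair_rel l h m k"
  by (simp add: pair_rel_def Let_def)

text \<open>Shifts by multiples of \<open>l\<close> keep the residue of m - k, but a term with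
  exchanged letters carries the shifts in the other order; only the sum over both orders respects
  the relation. This is why symmetric functions of the letter shifts act on alternating
  functionals.\<close>

lemma pair_rel_shift:
  "pair_rel l (\<lambda>x y. g (x - int l * c) (y - int l * d) + g (x - int l * d) (y - int l * c)) m k =
   pair_rel l g (m - int l * c) (k - int l * d) + pair_rel l g (m - int l * d) (k - int l * c)"
proof -
  have "(m - int l * c - (k - int l * d)) mod int l = (m - k + int l * (d - c)) mod int l"
    "(m - int l * d - (k - int l * c)) mod int l = (m - k + int l * (c - d)) mod int l"
    by (simp_all add: algebra_simps)
  then have "(m - int l * c - (k - int l * d)) mod int l = (m - k) mod int l"
    "(m - int l * d - (k - int l * c)) mod int l = (m - k) mod int l" by simp_all
  then show ?thesis unfolding pair_rel_def Let_def by (simp add: algebra_simps)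
qed

fun shift_sum :: "int \<Rightarrow> (int list \<Rightarrow> 'a::comm_monoid_add) \<Rightarrow> int list \<Rightarrow> 'a" where
  "shift_sum K f [] = 0"
| "shift_sum K f (a # w) = f ((a - K) # w) + shift_sum K (\<lambda>v. f (a # v)) w"

lemma shift_sum_eq: "shift_sum K f w = (\<Sum>p<length w. f (w[p := w ! p - K]))"
  by (induction w arbitrary: f) (simp_all del: sum.lessThan_Suc add: sum.lessThan_Suc_shift)

lemma wedge_alt_shift_sum:
  "wedge_alt l r f \<Longrightarrow> wedge_alt l r (shift_sum (int l * k) f)"
proof (induction r arbitrary: f)
  case 0
  then show ?case by (simp add: wedge_alt_def)
next
  case (Suc r)
  have "pair_rel l (\<lambda>x y. shift_sum (int l * k) f (x # y # v)) m n = 0" if v: "Suc (length v) = r" for v m n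
  proof -
    have "wedge_alt l (Suc (Suc (length v))) f" using Suc.prems v by simp
    then have z: "pair_rel l (\<lambda>x y. f (x # y # v')) m n = 0" if "length v' = length v" for v' m n 
      using that unfolding wedge_alt_Cons by simp
    have "pair_rel l (\<lambda>x y. shift_sum (int l * k) f (x # y # v)) m n =
      pair_rel l (\<lambda>x y. f ((x - int l * k) # (y - int l * 0) # v) + f ((x - int l * 0) # (y - int l * k) # v)) m n + pair_rel l (\<lambda>x y. shift_sum (int l * k) (\<lambda>v. f (x # y # v)) v) m n"
      by (simp add: pair_rel_add add.assoc)
    also have "pair_rel l (\<lambda>x y. shift_sum (int l * k) (\<lambda>v. f (x # y # v)) v) m n = 0"
      unfolding shift_sum_eq pair_rel_sum using z by simp
    finally show ?thesis unfolding pair_rel_shift[where g = "\<lambda>x y. f (x # y # v)"] using z by simp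
  qed
  moreover have "wedge_alt l r (\<lambda>v. shift_sum (int l * k) f (a # v))" for a
  proof -
    have "wedge_alt l r (\<lambda>v. f (b # v))" for b using Suc.prems unfolding wedge_alt_Cons by blast
    then show ?thesis using Suc.IH[of "\<lambda>v. f (a # v)"] unfolding wedge_alt_def by (simp add: pair_rel_add)
  qed
  ultimately show ?case unfolding wedge_alt_Cons by blast
qed

text \<open>The exponent of q with which K_i acts on the letter u_e. In \<open>fword\<close> it is
  collected over the letters to the left of the raised one, that is, over the lower rows.\<close>

definition wt :: "nat \<Rightarrow> int \<Rightarrow> int \<Rightarrow> int" where
  "wt l i e = (if e mod int l = i then 1 else 0) - (if e mod int l = (i + 1) mod int l then 1 else 0)"

fun fword :: "nat \<Rightarrow> int \<Rightarrow> (int list \<Rightarrow> qf) \<Rightarrow> int list \<Rightarrow> qf" where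
  "fword l i f [] = 0"
| "fword l i f (a # w) = (if a mod int l = i then f ((a + 1) # w) else 0) + qv powi wt l i a * fword l i (\<lambda>v. f (a # v)) w"

lemma fword_eq: "fword l i f w = (\<Sum>p<length w. if w ! p mod int l = i then qv powi (\<Sum>j<p. wt l i (w ! j)) * f (w[p := w ! p + 1]) else 0)"
  by (induction w arbitrary: f)
    (auto simp del: sum.lessThan_Suc simp: sum.lessThan_Suc_shift sum_distrib_left power_int_add intro!: sum.cong)

lemma fword_add: "fword l i (\<lambda>w. f w + g w) w = fword l i f w + fword l i g w"
  and fword_scale: "fword l i (\<lambda>w. c * f w) w = c * fword l i f w"
  by (induction w arbitrary: f g) (simp_all add: algebra_simps)

lemma fword_pair_rel:
  assumes "\<And>v'. length v' = length v \<Longrightarrow> pair_rel l (\<lambda>x y. f x y v') m k = 0"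
  shows "pair_rel l (\<lambda>x y. fword l i (\<lambda>v. f x y v) v) m k = 0"
proof -
  have "pair_rel l (\<lambda>x y. fword l i (\<lambda>v. f x y v) v) m k = 
     (\<Sum>p<length v. if v ! p mod int l = i then qv powi (\<Sum>j<p. wt l i (v ! j)) * pair_rel l (\<lambda>x y. f x y (v[p := v ! p + 1])) m k else 0)"
    unfolding fword_eq pair_rel_sum by (intro sum.cong refl) (simp add: pair_rel_scale, simp add: pair_rel_def)
  also have "\<dots> = 0" by (rule sum.neutral) (simp add: assms)
  finally show ?thesis .
qed

lemma wt_cong: "x mod int l = y mod int l \<Longrightarrow> wt l i x = wt l i y" by (simp add: wt_def)

text \<open>Compatibility of the coproduct of F_i with one relation. Only letters of residue i are
  raised, which changes the residue difference c to c + 1 or c - 1; the borderline values c = l - 1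
  and c = 1 lead to difference 0, where the relation degenerates to antisymmetry and the weight of
  the other letter supplies the missing power of q.\<close>

lemma fpair_rel:
  assumes l: "2 \<le> l" and i: "0 \<le> i" "i < int l" and R: "\<And>m k. pair_rel l g m k = 0"
  shows "pair_rel l (\<lambda>x y. (if x mod int l = i then g (x + 1) y else 0) + qv powi wt l i x * (if y mod int l = i then g x (y + 1) else 0)) m k = 0"
proof -
  define L where "L = int l"
  have L: "L \<ge> 2" using l L_def by simp
  define c where "c = (m - k) mod L"
  have c: "0 \<le> c" "c < L" using L unfolding c_def by auto
  have mk: "(m - c) mod L = k mod L" "(k + c) mod L = m mod L"
    unfolding c_def by (simp_all add: mod_diff_right_eq mod_add_right_eq)
  have cz: "c = 0 \<longleftrightarrow> m mod L = k mod L" unfolding c_def using mod_eq_dvd_iff by (metis dvd_eq_mod_eq_0)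
  have P0: "g x y + g y x = 0" if "(x - y) mod L = 0" for x y
    using R[of x y] that unfolding pair_rel_def L_def by simp
  have P: "g x y + qv * g (x - d) (y + d) + g (y + d) (x - d) + qv * g y x = 0" if "(x - y) mod L = d" "d \<noteq> 0" for x y d
    using R[of x y] that unfolding pair_rel_def L_def[symmetric] by (simp add: Let_def)
  have wm: "wt l i (m - c) = wt l i k" "wt l i (k + c) = wt l i m" using mk unfolding L_def by (auto intro: wt_cong)
  have i1: "(i + 1) mod L \<noteq> i"
  proof
    assume "(i + 1) mod L = i"
    then have "(i + 1) mod L = i mod L" using i unfolding L_def by simp
    then have "L dvd 1" by (simp add: mod_eq_dvd_iff)
    then show False using L by simp
  qed
  have c1: "(x + 1 - y) mod L = (if (x - y) mod L = L - 1 then 0 else (x - y) mod L + 1)" for x y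
  proof -
    have r: "0 \<le> (x - y) mod L" "(x - y) mod L < L" using L by auto
    have "(x + 1 - y) mod L = ((x - y) mod L + 1) mod L" proof -
      have "x + 1 - y = (x - y) + 1" by simp
      then show ?thesis by (simp only: mod_add_left_eq)
    qed
    then show ?thesis using r by (auto intro: mod_pos_pos_trivial)
  qed
  have c2: "(x - (y + 1)) mod L = (if (x - y) mod L = 0 then L - 1 else (x - y) mod L - 1)" for x y
  proof -
    have "0 \<le> (x - (y + 1)) mod L" using L by simp
    moreover have "(x - y) mod L = (if (x - (y + 1)) mod L = L - 1 then 0 else (x - (y + 1)) mod L + 1)"
      using c1[of x "y + 1"] by simp
    ultimately show ?thesis by (smt (verit))
  qed
  let ?W = "\<lambda>x. qv powi wt l i x"
  consider "m mod L = i" "k mod L = i" | "m mod L = i" "k mod L \<noteq> i" | "m mod L \<noteq> i" "k mod L = i" | "m mod L \<noteq> i" "k mod L \<noteq> i" by blast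
  then show ?thesis
  proof cases
    case 1
    then have c0: "(m - k) mod L = 0" using cz c_def by simp
    have w: "?W m = qv" "?W k = qv" using 1 i1 i unfolding wt_def L_def by auto
    have "g (m + 1) k + qv * g m (k + 1) + g (k + 1) m + qv * g k (m + 1) = 0"
      using P[of "m + 1" k 1] c1[of m k] c0 L by simp
    then show ?thesis using 1 c0 w unfolding pair_rel_def L_def[symmetric] by (simp add: Let_def algebra_simps)
  next
    case 2
    then have c0: "c \<noteq> 0" using cz by auto
    show ?thesis
    proof (cases "c = L - 1")
      case True
      have "k mod L = (i + 1) mod L"
      proof -
        have "(k + c) mod L = i" using 2 mk by simp
        then have "(i + 1) mod L = (k + c + 1) mod L" by (metis mod_add_left_eq)
        then show ?thesis using True by (simp add: algebra_simps)
      qed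
      then have w: "?W k = inverse qv" using 2 i1 i unfolding wt_def L_def by (auto simp: power_int_minus)
      have "g (m + 1) k + g k (m + 1) = 0" "g (m - c) (k + c + 1) + g (k + c + 1) (m - c) = 0"
      proof -
        show "g (m + 1) k + g k (m + 1) = 0" using P0[of "m + 1" k] c1[of m k] True c_def by simp
        have "m - c - (k + c + 1) = (m + 1 - k) - 2 * L" using True by simp
        then have "(m - c - (k + c + 1)) mod L = ((m + 1 - k) - 2 * L) mod L" by (simp only:)
        also have "\<dots> = 0" using c1[of m k] True c_def by (metis dvd_eq_mod_eq_0 dvd_diff dvd_triv_right)
        finally show "g (m - c) (k + c + 1) + g (k + c + 1) (m - c) = 0" by (rule P0)
      qed
      then show ?thesis using 2 c0 w wm mk unfolding pair_rel_def L_def[symmetric] c_def[symmetric]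
        by (simp add: Let_def algebra_simps flip: mult.assoc)
    next
      case False
      have "k mod L \<noteq> (i + 1) mod L"
      proof
        assume "k mod L = (i + 1) mod L"
        then have "(m + 1 - k) mod L = 0" using 2 by (metis mod_add_left_eq mod_eq_dvd_iff dvd_eq_mod_eq_0)
        then show False using c1[of m k] False c c_def by (auto split: if_splits)
      qed
      then have w: "?W k = 1" using 2 unfolding wt_def L_def by auto
      have "g (m + 1) k + qv * g (m + 1 - (c + 1)) (k + (c + 1)) + g (k + (c + 1)) (m + 1 - (c + 1)) + qv * g k (m + 1) = 0"
        using P[of "m + 1" k "c + 1"] c1[of m k] False c c_def by auto
      then show ?thesis using 2 c0 w wm mk unfolding pair_rel_def L_def[symmetric] c_def[symmetric]
        by (simp add: Let_def algebra_simps)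
    qed
  next
    case 3
    then have c0: "c \<noteq> 0" using cz by auto
    show ?thesis
    proof (cases "c = 1")
      case True
      have "m mod L = (i + 1) mod L" using 3 mk(2) True by (metis mod_add_left_eq)
      then have w: "?W m = inverse qv" using 3 i1 i unfolding wt_def L_def by (auto simp: power_int_minus)
      have "g m (k + 1) + g (k + 1) m = 0"
        using P0[of m "k + 1"] c2[of m k] True c_def by simp
      then have "g (k + 1) m = - g m (k + 1)" by (simp add: eq_neg_iff_add_eq_0 add.commute)
      then show ?thesis using 3 c0 w wm mk True unfolding pair_rel_def L_def[symmetric] c_def[symmetric]
        by (simp add: Let_def)
    next
      case False
      have "m mod L \<noteq> (i + 1) mod L"
      proof
        assume "m mod L = (i + 1) mod L"
        then have "(m - (k + 1)) mod L = 0" using 3 by (metis mod_add_left_eq mod_eq_dvd_iff dvd_eq_mod_eq_0)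
        then show False using c2[of m k] False c0 c c_def by (auto split: if_splits)
      qed
      then have w: "?W m = 1" using 3 unfolding wt_def L_def by auto
      have "g m (k + 1) + qv * g (m - (c - 1)) (k + 1 + (c - 1)) + g (k + 1 + (c - 1)) (m - (c - 1)) + qv * g (k + 1) m = 0"
        using P[of m "k + 1" "c - 1"] c2[of m k] False c0 c c_def by auto
      then show ?thesis using 3 c0 w wm mk unfolding pair_rel_def L_def[symmetric] c_def[symmetric]
        by (simp add: Let_def algebra_simps)
    qed
  next
    case 4
    then show ?thesis using mk unfolding pair_rel_def L_def[symmetric] c_def[symmetric] by (simp add: Let_def)
  qed
qed

lemma wedge_alt_fword:
  assumes l: "2 \<le> l" and i: "0 \<le> i" "i < int l"
  shows "wedge_alt l r f \<Longrightarrow> wedge_alt l r (fword l i f)"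
proof (induction r arbitrary: f)
  case 0
  then show ?case by (simp add: wedge_alt_def)
next
  case (Suc r)
  have "pair_rel l (\<lambda>x y. fword l i f (x # y # v)) m n = 0" if v: "Suc (length v) = r" for v m n
  proof -
    have "wedge_alt l (Suc (Suc (length v))) f" using Suc.prems v by simp
    then have z: "pair_rel l (\<lambda>x y. f (x # y # v')) m n = 0" if "length v' = length v" for v' m n 
      using that unfolding wedge_alt_Cons by simp
    have "pair_rel l (\<lambda>x y. fword l i f (x # y # v)) m n =
      pair_rel l (\<lambda>x y. ((if x mod int l = i then f ((x + 1) # y # v) else 0) + qv powi wt l i x * (if y mod int l = i then f (x # (y + 1) # v) else 0))
         + qv powi (wt l i x + wt l i y) * fword l i (\<lambda>v. f (x # y # v)) v) m n"
      by (simp add: algebra_simps power_int_add)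
    also have "\<dots> = pair_rel l (\<lambda>x y. qv powi (wt l i x + wt l i y) * fword l i (\<lambda>v. f (x # y # v)) v) m n"
      by (subst pair_rel_add) (use fpair_rel[OF l i z, of v] in simp)
    also have "\<dots> = qv powi (wt l i m + wt l i n) * pair_rel l (\<lambda>x y. fword l i (\<lambda>v. f (x # y # v)) v) m n"
    proof -
      define c where "c = (m - n) mod int l"
      have "(m - c) mod int l = n mod int l" "(n + c) mod int l = m mod int l"
        unfolding c_def by (simp_all add: mod_diff_right_eq mod_add_right_eq)
      then have w: "wt l i (m - c) = wt l i n" "wt l i (n + c) = wt l i m" by (auto intro: wt_cong)
      show ?thesis unfolding pair_rel_def Let_def c_def[symmetric] w by (simp add: algebra_simps)
    qed
    also have "pair_rel l (\<lambda>x y. fword l i (\<lambda>v. f (x # y # v)) v) m n = 0"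
      by (rule fword_pair_rel) (rule z)
    finally show ?thesis by simp
  qed
  moreover have "wedge_alt l r (\<lambda>v. fword l i f (a # v))" for a
  proof -
    have "wedge_alt l r (\<lambda>v. f (b # v))" for b using Suc.prems unfolding wedge_alt_Cons by blast
    then show ?thesis using Suc.IH[of "\<lambda>v. f (a # v)"] unfolding wedge_alt_def
      by (cases "a mod int l = i") (simp_all add: pair_rel_add pair_rel_scale)
  qed
  ultimately show ?case unfolding wedge_alt_Cons by blast
qed

text \<open>Functionals on semi-infinite wedges seen in rank r: to the left of the word one imagines
  the vacuum letters -r, -r - 1 and so on, so a word starting with one of them or below represents
  zero.\<close>

definition wfun :: "nat \<Rightarrow> nat \<Rightarrow> (int list \<Rightarrow> qf) \<Rightarrow> bool" where
  "wfun l r f \<longleftrightarrow> wedge_alt l r f \<and> (\<forall>w. length w = r \<longrightarrow> 0 < r \<longrightarrow> w ! 0 < 1 - int r \<longrightarrow> f w = 0)"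

definition parts :: "nat \<Rightarrow> nat list set" where
  "parts r = {lam. is_partition lam \<and> length lam \<le> r}"

section \<open>Partitions as normal words, and functionals of finite rank\<close>

lemma wedge_of_0 [simp]: "wedge_of 0 lam = []" by (simp add: wedge_of_def)

lemma wedge_of_Suc: "wedge_of (Suc r) lam = (int (pg lam r) - int r) # wedge_of r lam"
  by (simp add: wedge_of_def)

lemma length_wedge_of [simp]: "length (wedge_of r lam) = r" by (simp add: wedge_of_def)

lemma nth_wedge_of: "p < r \<Longrightarrow> wedge_of r lam ! p = int (pg lam (r - 1 - p)) - int (r - 1 - p)"
  by (simp add: wedge_of_def rev_nth)

lemma wedge_of_last: "0 < r \<Longrightarrow> wedge_of r lam ! (r - 1) = int (pg lam 0)"
  by (simp add: nth_wedge_of)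

lemma pg_pos_iff: "is_partition lam \<Longrightarrow> 0 < pg lam j \<longleftrightarrow> j < length lam"
proof (cases "j < length lam")
  case True
  assume "is_partition lam"
  then have "lam ! j \<noteq> 0" using nth_mem[OF True] unfolding is_partition_def by metis
  then show ?thesis using True by (simp add: pg_def)
qed (simp add: pg_def)

lemma pg_beyond: "length lam \<le> j \<Longrightarrow> pg lam j = 0" by (simp add: pg_def)

lemma pg_antimono: "is_partition lam \<Longrightarrow> i \<le> j \<Longrightarrow> pg lam j \<le> pg lam i"
  by (cases "i = j") (auto simp: is_partition_def pg_def sorted_wrt_iff_nth_less)

lemma partitionI: "(\<And>i. Suc i < length lam \<Longrightarrow> lam ! Suc i \<le> lam ! i) \<Longrightarrow> 0 \<notin> set lam \<Longrightarrow> is_partition lam"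
  unfolding is_partition_def by (simp add: sorted_wrt_iff_nth_Suc_transp transp_on_def)

lemma partition_eqI: "is_partition lam \<Longrightarrow> is_partition mu \<Longrightarrow> (\<And>j. pg lam j = pg mu j) \<Longrightarrow> lam = mu"
proof (rule nth_equalityI)
  assume a: "is_partition lam" "is_partition mu" "\<And>j. pg lam j = pg mu j"
  then have "j < length lam \<longleftrightarrow> j < length mu" for j using pg_pos_iff by metis
  then show len: "length lam = length mu" by (meson linorder_neqE_nat less_irrefl)
  show "lam ! i = mu ! i" if "i < length lam" for i using a(3)[of i] that len by (simp add: pg_def)
qed

lemma wedge_of_cong: "(\<And>j. j < r \<Longrightarrow> pg lam j = pg mu j) \<Longrightarrow> wedge_of r lam = wedge_of r mu"
  by (rule nth_equalityI) (auto simp: nth_wedge_of)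

lemma wedge_of_eqD: "wedge_of r lam = wedge_of r mu \<Longrightarrow> j < r \<Longrightarrow> pg lam j = pg mu j"
  using nth_wedge_of[of "r - 1 - j" r lam] nth_wedge_of[of "r - 1 - j" r mu] by auto

lemma wedge_of_inj: "lam \<in> parts r \<Longrightarrow> mu \<in> parts r \<Longrightarrow> wedge_of r lam = wedge_of r mu \<Longrightarrow> lam = mu"
proof (rule partition_eqI)
  fix j assume a: "lam \<in> parts r" "mu \<in> parts r" "wedge_of r lam = wedge_of r mu"
  show "pg lam j = pg mu j"
  proof (cases "j < r")
    case True then show ?thesis using wedge_of_eqD a(3) by blast
  next
    case False then show ?thesis using a(1,2) by (simp add: parts_def pg_def)
  qed
qed (auto simp: parts_def)

lemma wedge_of_sorted: "is_partition lam \<Longrightarrow> sorted_wrt (<) (wedge_of r lam)"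
proof (induction r)
  case (Suc r)
  have "int (pg lam r) - int r < wedge_of r lam ! p" if "p < r" for p
    using pg_antimono[OF Suc.prems, of "r - 1 - p" r] that by (simp add: nth_wedge_of)
  then show ?case using Suc by (auto simp: wedge_of_Suc in_set_conv_nth)
qed auto

lemma normal_wedge:
  "length w = r \<Longrightarrow> sorted_wrt (<) w \<Longrightarrow> (0 < r \<Longrightarrow> 1 - int r \<le> w ! 0) \<Longrightarrow> \<exists>lam\<in>parts r. wedge_of r lam = w"
proof (induction r arbitrary: w)
  case 0
  then show ?case by (intro bexI[of _ "[]"]) (auto simp: parts_def is_partition_def)
next
  case (Suc r)
  then obtain a w' where w: "w = a # w'" "length w' = r" by (cases w) auto
  have a: "a \<ge> - int r" using Suc.prems(3) w by simp
  have gt: "a < w' ! 0" if "0 < r" using Suc.prems(2) w that by auto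
  obtain lam where lam: "lam \<in> parts r" "wedge_of r lam = w'" 
  proof -
    have "sorted_wrt (<) w'" using Suc.prems(2) w by simp
    moreover have "1 - int r \<le> w' ! 0" if "0 < r" using gt[OF that] a by simp
    ultimately show thesis using Suc.IH[of w'] w(2) that by blast
  qed
  define x where "x = nat (a + int r)"
  have ax: "a = int x - int r" unfolding x_def using a by simp
  show ?case
  proof (cases "x = 0")
    case True
    then show ?thesis using lam w ax by (intro bexI[of _ lam]) (auto simp: wedge_of_Suc parts_def pg_beyond)
  next
    case False
    have le: "x \<le> pg lam (r - 1)" if "0 < r" using gt[OF that] that lam(2)[symmetric] ax by (simp add: nth_wedge_of)
    then have len: "length lam = r"
    proof (cases "r = 0")
      case r: False
      then have "0 < pg lam (r - 1)" using le False by simp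
      then show ?thesis using lam(1) r by (auto simp: parts_def pg_def split: if_splits)
    qed (use lam in \<open>auto simp: parts_def\<close>)
    have "is_partition (lam @ [x])"
    proof (rule partitionI)
      fix i assume i: "Suc i < length (lam @ [x])"
      show "(lam @ [x]) ! Suc i \<le> (lam @ [x]) ! i"
      proof (cases "Suc i < length lam")
        case True
        then show ?thesis using pg_antimono[of lam i "Suc i"] lam(1) by (simp add: nth_append pg_def parts_def)
      next
        case f: False
        then have "Suc i = r" using i len by simp
        then show ?thesis using le len by (simp add: nth_append pg_def flip: \<open>Suc i = r\<close>)
      qed
    qed (use False lam in \<open>auto simp: parts_def is_partition_def\<close>)
    moreover have "wedge_of r (lam @ [x]) = w'" unfolding lam(2)[symmetric]
      by (rule wedge_of_cong) (simp add: pg_def nth_append len)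
    ultimately show ?thesis using len w ax
      by (intro bexI[of _ "lam @ [x]"]) (auto simp: wedge_of_Suc parts_def pg_def nth_append)
  qed
qed

definition vac_sum :: "nat \<Rightarrow> int" where "vac_sum r = (\<Sum>j<r. - int j)"

lemma sum_pg: "length lam \<le> r \<Longrightarrow> (\<Sum>j<r. pg lam j) = sum_list lam"
proof -
  assume "length lam \<le> r"
  then have "(\<Sum>j<r. pg lam j) = (\<Sum>j<length lam. pg lam j)" by (intro sum.mono_neutral_right) (auto simp: pg_def)
  then show ?thesis by (simp add: sum_list_sum_nth pg_def atLeast0LessThan)
qed

lemma sum_wedge_of: "length lam \<le> r \<Longrightarrow> sum_list (wedge_of r lam) = int (sum_list lam) + vac_sum r"
proof -
  have "sum_list (wedge_of r lam) = (\<Sum>j<r. int (pg lam j)) + vac_sum r"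
    by (induction r) (simp_all add: wedge_of_Suc vac_sum_def)
  also assume "length lam \<le> r"
  then have "(\<Sum>j<r. int (pg lam j)) = int (sum_list lam)" by (simp flip: of_nat_sum add: sum_pg)
  finally show ?thesis .
qed

lemma length_le_sum: "is_partition lam \<Longrightarrow> length lam \<le> sum_list lam"
  unfolding is_partition_def by (induction lam) auto

lemma finite_parts: "finite {lam \<in> parts r. int (sum_list lam) + c = n}"
proof (rule finite_subset)
  show "{lam \<in> parts r. int (sum_list lam) + c = n} \<subseteq> {xs. set xs \<subseteq> {..nat (n - c)} \<and> length xs \<le> r}"
    using member_le_sum_list by (fastforce simp: parts_def)
qed (simp add: finite_lists_length_le)

lemma sum_list_upd2: "Suc p < length w \<Longrightarrow> sum_list (upd2 w p x y) = sum_list w - w ! p - w ! Suc p + x + y"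
proof -
  have "sum_list w = qsum (\<lambda>_ x. x) w" for w by (simp add: qsum_def sum_list_sum_nth atLeast0LessThan)
  then show "Suc p < length w \<Longrightarrow> ?thesis" using qsum_upd2[of p w "\<lambda>_ x. x" x y] by simp
qed

lemma qstraight_hd:
  assumes "2 \<le> l" "qstraight l w t \<noteq> 0" "0 < length w"
  shows "t ! 0 \<le> w ! 0"
proof -
  have "t ! 0 \<le> w ! 0 \<and> length t = length w \<and> sorted_wrt (<) t"
    by (rule qstraight_support[OF assms(1,2)]) (auto simp: nth_upd2)
  then show ?thesis by simp
qed

lemma qstraight_last:
  assumes "2 \<le> l" "qstraight l w t \<noteq> 0" "0 < length w"
  shows "w ! (length w - 1) \<le> t ! (length w - 1)"
proof -
  have "w ! (length w - 1) \<le> t ! (length w - 1) \<and> length t = length w \<and> sorted_wrt (<) t"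
    by (rule qstraight_support[OF assms(1,2)]) (auto simp: nth_upd2)
  then show ?thesis by simp
qed

lemma qstraight_sum:
  assumes "2 \<le> l" "qstraight l w t \<noteq> 0"
  shows "sum_list t = sum_list w"
proof -
  have "sum_list t = sum_list w \<and> length t = length w \<and> sorted_wrt (<) t"
    by (rule qstraight_support[OF assms(1,2)]) (auto simp: sum_list_upd2)
  then show ?thesis by simp
qed

lemma wedge_of_hd_ge: "0 < r \<Longrightarrow> wedge_of r lam ! 0 \<ge> 1 - int r"
  by (simp add: nth_wedge_of)

lemma wfun_qstraight: "2 \<le> l \<Longrightarrow> 0 < r \<longrightarrow> 1 - int r \<le> t ! 0 \<Longrightarrow> wfun l r (\<lambda>w. qstraight l w t)"
  unfolding wfun_def
proof (intro conjI allI impI)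
  assume l: "2 \<le> l" and t: "0 < r \<longrightarrow> 1 - int r \<le> t ! 0"
  show "wedge_alt l r (\<lambda>w. qstraight l w t)" by (rule qstraight_alt[OF l])
  fix w :: "int list" assume "length w = r" "0 < r" "w ! 0 < 1 - int r"
  then show "qstraight l w t = 0" using qstraight_hd[OF l, of w t] t by auto
qed

lemma wfun_eqI:
  assumes "2 \<le> l" "wfun l r f" "wfun l r g" "\<And>lam. lam \<in> parts r \<Longrightarrow> f (wedge_of r lam) = g (wedge_of r lam)" "length w = r"
  shows "f w = g w"
proof (rule wedge_alt_eqI[OF assms(1) _ _ _ assms(5)])
  fix v :: "int list" assume v: "length v = r" "sorted_wrt (<) v"
  show "f v = g v"
  proof (cases "0 < r \<and> v ! 0 < 1 - int r")
    case True
    then show ?thesis using assms(2,3) v unfolding wfun_def by simp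
  next
    case False
    then obtain lam where "lam \<in> parts r" "wedge_of r lam = v" using normal_wedge[OF v] by force
    then show ?thesis using assms(4) by blast
  qed
qed (use assms wfun_def in auto)

text \<open>If w starts below 1 - r, then the word with -r put in front has its first two letters at
  or below -r. Straightening preserves the stated disjunction, and a normal word satisfying it
  starts below -r, where f vanishes.\<close>

lemma wfun_Cons:
  assumes l: "2 \<le> l" and f: "wfun l (Suc r) f"
  shows "wfun l r (\<lambda>w. f (- int r # w))"
  unfolding wfun_def
proof (intro conjI allI impI)
  show "wedge_alt l r (\<lambda>w. f (- int r # w))" using f unfolding wfun_def wedge_alt_Cons by blast
  fix w :: "int list" assume w: "length w = r" "0 < r" "w ! 0 < 1 - int r"
  show "f (- int r # w) = 0"
  proof (rule wedge_alt_zeroI[OF l, where P = "\<lambda>v. v ! 0 < - int r \<or> v ! 0 = - int r \<and> v ! 1 \<le> - int r"])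
    show "wedge_alt l (length (- int r # w)) f" using f w unfolding wfun_def by simp
  next
    fix v assume v: "v ! 0 < - int r \<or> v ! 0 = - int r \<and> v ! 1 \<le> - int r" "length v = length (- int r # w)" "sorted_wrt (<) v"
    then have "v ! 0 < v ! 1" using w by (simp add: sorted_wrt_iff_nth_less)
    then show "f v = 0" using v f w unfolding wfun_def by auto
  next
    fix v p x assume *: "v ! 0 < - int r \<or> v ! 0 = - int r \<and> v ! 1 \<le> - int r" "length v = length (- int r # w)"
      "Suc p < length v" "v ! Suc p \<le> x" "x < v ! p"
    then show "upd2 v p x (v ! p + v ! Suc p - x) ! 0 < - int r \<or> upd2 v p x (v ! p + v ! Suc p - x) ! 0 = - int r \<and> upd2 v p x (v ! p + v ! Suc p - x) ! 1 \<le> - int r"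
      by (cases "p = 0"; cases "p = 1") (auto simp: nth_upd2)
  qed (use w in auto)
qed

text \<open>The functional on words of length r that straightens and then applies psi. Straightening
  preserves the sum of the letters, so the restriction on the size loses nothing and keeps the index
  set finite.\<close>

definition ext :: "nat \<Rightarrow> nat \<Rightarrow> (nat list \<Rightarrow> qf) \<Rightarrow> int list \<Rightarrow> qf" where
  "ext l r psi w = (\<Sum>lam\<in>{lam \<in> parts r. int (sum_list lam) + vac_sum r = sum_list w}. qstraight l w (wedge_of r lam) * psi lam)"

lemma wfun_ext:
  assumes l: "2 \<le> l"
  shows "wfun l r (ext l r psi)"
  unfolding wfun_def
proof (intro conjI allI impI)
  show "wedge_alt l r (ext l r psi)"
    unfolding wedge_alt_def
  proof (intro allI impI)
    fix w :: "int list" and p m k assume w: "length w = r" "Suc p < r"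
    define I where "I = {lam \<in> parts r. int (sum_list lam) + vac_sum r = sum_list (upd2 w p m k)}"
    have "pair_rel l (\<lambda>x y. ext l r psi (upd2 w p x y)) m k = pair_rel l (\<lambda>x y. \<Sum>lam\<in>I. psi lam * qstraight l (upd2 w p x y) (wedge_of r lam)) m k"
      unfolding ext_def I_def using w by (intro pair_rel_cong) (auto simp: sum_list_upd2 add.assoc mult.commute intro!: sum.cong)
    also have "\<dots> = 0" unfolding pair_rel_sum pair_rel_scale
      using qstraight_alt[OF l] w unfolding wedge_alt_def by (auto intro!: sum.neutral)
    finally show "pair_rel l (\<lambda>x y. ext l r psi (upd2 w p x y)) m k = 0" .
  qed
  fix w :: "int list" assume w: "length w = r" "0 < r" "w ! 0 < 1 - int r"
  have "qstraight l w (wedge_of r lam) = 0" for lam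
    using qstraight_hd[OF l, of w "wedge_of r lam"] wedge_of_hd_ge[OF w(2), of lam] w by auto
  then show "ext l r psi w = 0" unfolding ext_def by simp
qed

lemma ext_wedge_of:
  assumes "2 \<le> l" "lam \<in> parts r"
  shows "ext l r psi (wedge_of r lam) = psi lam"
proof -
  have lam: "is_partition lam" "length lam \<le> r" using assms parts_def by auto
  define I where "I = {mu \<in> parts r. int (sum_list mu) + vac_sum r = sum_list (wedge_of r lam)}"
  have I: "finite I" "lam \<in> I"
    unfolding I_def using finite_parts[of r "vac_sum r"] assms(2) sum_wedge_of[OF lam(2)] by (blast, simp)
  have "ext l r psi (wedge_of r lam) = (\<Sum>mu\<in>I. if mu = lam then psi mu else 0)"
    unfolding ext_def I_def[symmetric] qstraight_normal[OF assms(1) wedge_of_sorted[OF lam(1)]]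
    using wedge_of_inj[OF assms(2)] by (intro sum.cong) (auto simp: I_def)
  then show ?thesis using I by simp
qed

lemma ext_eqI:
  assumes "2 \<le> l" "wfun l r f" "\<And>lam. lam \<in> parts r \<Longrightarrow> f (wedge_of r lam) = psi lam" "length w = r"
  shows "ext l r psi w = f w"
  by (rule wfun_eqI[OF assms(1) wfun_ext[OF assms(1)] assms(2) _ assms(4)]) (simp add: ext_wedge_of assms)

lemma parts_Suc: "lam \<in> parts r \<Longrightarrow> lam \<in> parts (Suc r)" by (simp add: parts_def)

lemma wedge_of_Suc_parts: "lam \<in> parts r \<Longrightarrow> wedge_of (Suc r) lam = - int r # wedge_of r lam"
  by (simp add: wedge_of_Suc parts_def pg_beyond)

lemma ext_Cons: "2 \<le> l \<Longrightarrow> length w = r \<Longrightarrow> ext l (Suc r) psi (- int r # w) = ext l r psi w"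
proof -
  assume l: "2 \<le> l" "length w = r"
  show ?thesis
  proof (rule ext_eqI[OF l(1) wfun_Cons[OF l(1) wfun_ext[OF l(1)]] _ l(2), symmetric])
    fix lam assume lam: "lam \<in> parts r"
    show "ext l (Suc r) psi (- int r # wedge_of r lam) = psi lam"
      unfolding wedge_of_Suc_parts[OF lam, symmetric] by (rule ext_wedge_of[OF l(1) parts_Suc[OF lam]])
  qed
qed

lemma qstraight_Cons:
  assumes l: "2 \<le> l" and t: "length t = r" "0 < r \<longrightarrow> 1 - int r \<le> t ! 0" and w: "length w = r"
  shows "qstraight l (- int r # w) (- int r # t) = qstraight l w t"
proof (rule wfun_eqI[OF l _ wfun_qstraight[OF l t(2)] _ w])
  show "wfun l r (\<lambda>w. qstraight l (- int r # w) (- int r # t))"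
    by (rule wfun_Cons[OF l wfun_qstraight[OF l]]) simp
  fix lam assume lam: "lam \<in> parts r"
  then have p: "is_partition lam" by (simp add: parts_def)
  show "qstraight l (- int r # wedge_of r lam) (- int r # t) = qstraight l (wedge_of r lam) t"
    using qstraight_normal[OF l wedge_of_sorted[OF p, of r]]
      qstraight_normal[OF l wedge_of_sorted[OF p, of "Suc r", unfolded wedge_of_Suc_parts[OF lam]]] by simp
qed

lemma bcoef_trunc_eq: "bcoef_trunc l k r lam mu = shift_sum (int l * int k) (\<lambda>w. qstraight l w (wedge_of r mu)) (wedge_of r lam)"
  by (simp add: bcoef_trunc_def shift_sum_eq)

lemma shift_sum_cong: "(\<And>v. length v = length w \<Longrightarrow> f v = g v) \<Longrightarrow> shift_sum K f w = shift_sum K g w"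
  unfolding shift_sum_eq by (intro sum.cong) auto

lemma wedge_of_Suc_long: "length lam \<le> r \<Longrightarrow> wedge_of (Suc r) lam = - int r # wedge_of r lam"
  by (simp add: wedge_of_Suc pg_beyond)

text \<open>Lowering the additional vacuum letter contributes nothing, since straightening never
  raises the first letter; the remaining terms keep that letter and are computed in rank r. Hence
  the coefficients are stable once r reaches both lengths.\<close>

lemma bcoef_trunc_Suc:
  assumes l: "2 \<le> l" "0 < k" and len: "length lam \<le> r" "length mu \<le> r"
  shows "bcoef_trunc l k (Suc r) lam mu = bcoef_trunc l k r lam mu"
proof -
  have K: "0 < int l * int k" using l by simp
  have "qstraight l ((- int r - int l * int k) # wedge_of r lam) (- int r # wedge_of r mu) = 0"
  proof (rule ccontr)
    assume "qstraight l ((- int r - int l * int k) # wedge_of r lam) (- int r # wedge_of r mu) \<noteq> 0"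
    from qstraight_hd[OF l(1) this] have "- int r \<le> - int r - int l * int k" by simp
    then show False using K by linarith
  qed
  then have "bcoef_trunc l k (Suc r) lam mu = shift_sum (int l * int k) (\<lambda>v. qstraight l (- int r # v) (- int r # wedge_of r mu)) (wedge_of r lam)"
    unfolding bcoef_trunc_eq wedge_of_Suc_long[OF len(1)] wedge_of_Suc_long[OF len(2)] by simp
  also have "\<dots> = bcoef_trunc l k r lam mu" unfolding bcoef_trunc_eq
    by (intro shift_sum_cong qstraight_Cons[OF l(1)]) (auto simp: wedge_of_hd_ge)
  finally show ?thesis .
qed

lemma bcoef_eq:
  assumes l: "2 \<le> l" "0 < k" and len: "length lam \<le> r" "length mu \<le> r"
  shows "bcoef l k lam mu = bcoef_trunc l k r lam mu"
proof -
  have c: "bcoef_trunc l k r' lam mu = bcoef_trunc l k r lam mu" if "r \<le> r'" for r'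
    using that by (induction rule: dec_induct) (use bcoef_trunc_Suc[OF l] len in auto)
  show ?thesis unfolding bcoef_def
  proof (rule the_equality)
    show "\<forall>\<^sub>F r' in sequentially. bcoef_trunc l k r' lam mu = bcoef_trunc l k r lam mu"
      unfolding eventually_sequentially using c by blast
    fix c' assume "\<forall>\<^sub>F r' in sequentially. bcoef_trunc l k r' lam mu = c'"
    then obtain N where "\<And>r'. N \<le> r' \<Longrightarrow> bcoef_trunc l k r' lam mu = c'" unfolding eventually_sequentially by blast
    from this[of "max N r"] c[of "max N r"] show "c' = bcoef_trunc l k r lam mu" by simp
  qed
qed

lemma bcoef_longer:
  assumes l: "2 \<le> l" "0 < k" and mu: "is_partition mu" "length lam < length mu"
  shows "bcoef l k lam mu = 0"
proof -
  define R where "R = length mu - 1"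
  have R: "length mu = Suc R" "length lam \<le> R" using mu(2) unfolding R_def by auto
  define t where "t = wedge_of (Suc R) mu"
  have t: "t ! 0 \<ge> 1 - int R" using pg_pos_iff[OF mu(1), of R] R unfolding t_def by (simp add: wedge_of_Suc)
  have z: "qstraight l (a # v) t = 0" if "a \<le> - int R" for a v
    using qstraight_hd[OF l(1), of "a # v" t] t that by auto
  have "bcoef l k lam mu = bcoef_trunc l k (Suc R) lam mu" using R by (intro bcoef_eq l) auto
  also have "\<dots> = qstraight l ((- int R - int l * int k) # wedge_of R lam) t + shift_sum (int l * int k) (\<lambda>v. qstraight l (- int R # v) t) (wedge_of R lam)"
    unfolding bcoef_trunc_eq t_def[symmetric] wedge_of_Suc_long[OF R(2)] by simp
  also have "\<dots> = 0" unfolding shift_sum_eq using z by simp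
  finally show ?thesis .
qed

lemma wfun_shift_sum:
  assumes "2 \<le> l" "wfun l r f"
  shows "wfun l r (shift_sum (int l * int k) f)"
  unfolding wfun_def
proof (intro conjI allI impI)
  show "wedge_alt l r (shift_sum (int l * int k) f)" using assms wedge_alt_shift_sum unfolding wfun_def by blast
  fix w :: "int list" assume w: "length w = r" "0 < r" "w ! 0 < 1 - int r"
  have "w[p := w ! p - int l * int k] ! 0 < 1 - int r" for p
  proof -
    have "0 \<le> int l * int k" by simp
    moreover have "w[p := w ! p - int l * int k] ! 0 = (if p = 0 then w ! 0 - int l * int k else w ! 0)"
      using w by (cases "p = 0") simp_all
    ultimately show ?thesis using w(3) by (simp del: mult_nonneg_nonneg split: if_split)
  qed
  then show "shift_sum (int l * int k) f w = 0" unfolding shift_sum_eq using assms(2) w unfolding wfun_def by (intro sum.neutral) auto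
qed

lemma sum_list_shift: "p < length w \<Longrightarrow> sum_list (w[p := w ! p - K]) = sum_list w - (K :: int)"
  by (induction w arbitrary: p) (auto split: nat.split simp: nth_Cons')

lemma shift_sum_wfun:
  assumes l: "2 \<le> l" "0 < k" and g: "wfun l r g" and lam: "lam \<in> parts r"
  shows "shift_sum (int l * int k) g (wedge_of r lam) =
    (\<Sum>mu\<in>{mu \<in> parts r. int (sum_list mu) + int l * int k = int (sum_list lam)}. bcoef l k lam mu * g (wedge_of r mu))"
proof -
  define I where "I = {mu \<in> parts r. int (sum_list mu) + int l * int k = int (sum_list lam)}"
  have len: "length lam \<le> r" using lam parts_def by auto
  have "g ((wedge_of r lam)[p := wedge_of r lam ! p - int l * int k]) = (\<Sum>mu\<in>I. qstraight l ((wedge_of r lam)[p := wedge_of r lam ! p - int l * int k]) (wedge_of r mu) * g (wedge_of r mu))"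
    if "p < r" for p
  proof -
    have "g ((wedge_of r lam)[p := wedge_of r lam ! p - int l * int k]) = ext l r (\<lambda>mu. g (wedge_of r mu)) ((wedge_of r lam)[p := wedge_of r lam ! p - int l * int k])"
      by (rule ext_eqI[OF l(1) g, symmetric]) auto
    also have "{mu \<in> parts r. int (sum_list mu) + vac_sum r = sum_list ((wedge_of r lam)[p := wedge_of r lam ! p - int l * int k])} = I"
      using that sum_wedge_of[OF len] by (auto simp: sum_list_shift I_def)
    then have "ext l r (\<lambda>mu. g (wedge_of r mu)) ((wedge_of r lam)[p := wedge_of r lam ! p - int l * int k])
      = (\<Sum>mu\<in>I. qstraight l ((wedge_of r lam)[p := wedge_of r lam ! p - int l * int k]) (wedge_of r mu) * g (wedge_of r mu))"
      unfolding ext_def by simp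
    finally show ?thesis .
  qed
  then have "shift_sum (int l * int k) g (wedge_of r lam) = (\<Sum>p<r. \<Sum>mu\<in>I. qstraight l ((wedge_of r lam)[p := wedge_of r lam ! p - int l * int k]) (wedge_of r mu) * g (wedge_of r mu))"
    unfolding shift_sum_eq by simp
  also have "\<dots> = (\<Sum>mu\<in>I. bcoef_trunc l k r lam mu * g (wedge_of r mu))"
    by (subst sum.swap) (simp add: bcoef_trunc_def sum_distrib_right)
  also have "\<dots> = (\<Sum>mu\<in>I. bcoef l k lam mu * g (wedge_of r mu))"
    using len by (intro sum.cong refl) (simp add: bcoef_eq[OF l] I_def parts_def)
  finally show ?thesis unfolding I_def .
qed

text \<open>The transposed operators act on functionals, i.e. on arbitrary functions on partitions.\<close>

definition Bf :: "nat \<Rightarrow> nat \<Rightarrow> (nat list \<Rightarrow> qf) \<Rightarrow> nat list \<Rightarrow> qf" where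
  "Bf l k psi lam = (\<Sum>mu\<in>{mu \<in> parts (length lam). int (sum_list mu) + int l * int k = int (sum_list lam)}. bcoef l k lam mu * psi mu)"

lemma Bf_eq_sum:
  assumes l: "2 \<le> l" "0 < k" and lam: "lam \<in> parts r"
  shows "Bf l k psi lam = (\<Sum>mu\<in>{mu \<in> parts r. int (sum_list mu) + int l * int k = int (sum_list lam)}. bcoef l k lam mu * psi mu)"
  unfolding Bf_def
proof (rule sum.mono_neutral_left[OF finite_parts])
  show "\<forall>mu\<in>{mu \<in> parts r. int (sum_list mu) + int l * int k = int (sum_list lam)} -
       {mu \<in> parts (length lam). int (sum_list mu) + int l * int k = int (sum_list lam)}. bcoef l k lam mu * psi mu = 0"
    using bcoef_longer[OF l, of _ lam] by (auto simp: parts_def simp flip: not_less)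
qed (use lam in \<open>auto simp: parts_def\<close>)

lemma Bf_shift_sum:
  assumes l: "2 \<le> l" "0 < k" and lam: "lam \<in> parts r"
  shows "Bf l k psi lam = shift_sum (int l * int k) (ext l r psi) (wedge_of r lam)"
  unfolding Bf_eq_sum[OF assms] shift_sum_wfun[OF l wfun_ext[OF l(1)] lam]
  by (intro sum.cong refl) (simp add: ext_wedge_of[OF l(1)])

lemma ext_Bf:
  assumes l: "2 \<le> l" "0 < k" and w: "length w = r"
  shows "ext l r (Bf l k psi) w = shift_sum (int l * int k) (ext l r psi) w"
  by (rule ext_eqI[OF l(1) wfun_shift_sum[OF l(1) wfun_ext[OF l(1)]] _ w]) (simp add: Bf_shift_sum[OF l])

lemma shift_sum_add: "shift_sum K (\<lambda>w. f w + g w) w = shift_sum K f w + shift_sum K g w"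
  for f :: "int list \<Rightarrow> qf"
  unfolding shift_sum_eq by (simp add: sum.distrib)

lemma shift_sum_scale: "shift_sum K (\<lambda>w. c * f w) w = c * shift_sum K f w"
  for f :: "int list \<Rightarrow> qf"
  unfolding shift_sum_eq by (simp add: sum_distrib_left)

lemma shift_sum_commute: "shift_sum K (shift_sum K' f) w = shift_sum K' (shift_sum K f) w"
  for f :: "int list \<Rightarrow> qf"
  by (induction w arbitrary: f) (simp_all add: shift_sum_add algebra_simps)

lemma fword_cong: "(\<And>v. length v = length w \<Longrightarrow> f v = g v) \<Longrightarrow> fword l i f w = fword l i g w"
  unfolding fword_eq by (intro sum.cong) auto

lemma shift_sum_0 [simp]: "shift_sum K (\<lambda>v. 0) w = 0"
  by (simp add: shift_sum_eq)

lemma shift_sum_fword: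
  assumes "int l dvd K"
  shows "fword l i (shift_sum K f) w = shift_sum K (fword l i f) w"
proof (induction w arbitrary: f)
  case (Cons a w)
  have "(a - K) mod int l = a mod int l" using assms by (simp add: mod_eq_dvd_iff)
  then have m: "(a - K) mod int l = a mod int l" "wt l i (a - K) = wt l i a" by (auto intro: wt_cong)
  show ?case
    by (cases "a mod int l = i") (simp_all add: m fword_add shift_sum_add shift_sum_scale Cons algebra_simps)
qed simp

lemma Bf_commute:
  assumes l: "2 \<le> l" "0 < j" "0 < k" and lam: "is_partition lam"
  shows "Bf l k (Bf l j psi) lam = Bf l j (Bf l k psi) lam"
proof -
  define r where "r = length lam"
  have r: "lam \<in> parts r" using lam by (simp add: parts_def r_def)
  have "Bf l k (Bf l j psi) lam = shift_sum (int l * int k) (shift_sum (int l * int j) (ext l r psi)) (wedge_of r lam)"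
    unfolding Bf_shift_sum[OF l(1,3) r] by (rule shift_sum_cong) (simp add: ext_Bf[OF l(1,2)])
  also have "\<dots> = Bf l j (Bf l k psi) lam"
    unfolding Bf_shift_sum[OF l(1,2) r] shift_sum_commute[of "int l * int k"] by (rule shift_sum_cong) (simp add: ext_Bf[OF l(1,3)])
  finally show ?thesis .
qed

section \<open>The transposed F_i on partitions and on words\<close>

definition Ff :: "nat \<Rightarrow> nat \<Rightarrow> (nat list \<Rightarrow> qf) \<Rightarrow> nat list \<Rightarrow> qf" where
  "Ff l i psi lam = (\<Sum>a\<in>{a. addable lam a \<and> res l a (pg lam a) = int i}. qv powi Nb l i lam a * psi (add_box lam a))"

lemma pg_add_box: "addable lam a \<Longrightarrow> pg (add_box lam a) b = pg lam b + (if b = a then 1 else 0)"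
  by (auto simp: pg_def add_box_def addable_def nth_append nth_list_update)

lemma finite_addable: "finite {a. addable lam a \<and> Q a}"
  by (rule finite_subset[of _ "{..length lam}"]) (auto simp: addable_def)

lemma length_add_box: "addable lam a \<Longrightarrow> length (add_box lam a) \<le> Suc (length lam)"
  by (simp add: add_box_def)

lemma add_box_partition:
  assumes "is_partition lam" "addable lam a"
  shows "is_partition (add_box lam a)"
proof (rule partitionI)
  fix i assume i: "Suc i < length (add_box lam a)"
  have "pg (add_box lam a) (Suc i) \<le> pg (add_box lam a) i"
    unfolding pg_add_box[OF assms(2)] using pg_antimono[OF assms(1), of i "Suc i"] assms(2) by (auto simp: addable_def)
  then show "add_box lam a ! Suc i \<le> add_box lam a ! i" using i by (simp add: pg_def)
next
  show "0 \<notin> set (add_box lam a)" using assms(1) set_update_subset_insert[of lam a "Suc (lam ! a)"]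
    by (auto simp: add_box_def is_partition_def)
qed

lemma sum_add_box: "addable lam a \<Longrightarrow> sum_list (add_box lam a) = Suc (sum_list lam)"
proof -
  assume a: "addable lam a"
  have "sum_list (add_box lam a) = (\<Sum>j<Suc (length lam). pg lam j + (if j = a then 1 else 0))"
    using sum_pg[OF length_add_box[OF a]] pg_add_box[OF a] by simp
  also have "\<dots> = Suc (sum_list lam)" using a unfolding sum.distrib by (simp add: sum_pg addable_def del: sum.lessThan_Suc)
  finally show ?thesis .
qed

lemma mod_shift_iff: "0 \<le> i \<Longrightarrow> i < int l \<Longrightarrow> (x - 1) mod int l = i \<longleftrightarrow> x mod int l = (i + 1) mod int l"
proof -
  assume i: "0 \<le> i" "i < int l"
  have "(x - 1) mod int l = i \<longleftrightarrow> (x - 1) mod int l = i mod int l" using i by simp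
  also have "\<dots> \<longleftrightarrow> x mod int l = (i + 1) mod int l" by (simp add: mod_eq_dvd_iff algebra_simps)
  finally show ?thesis .
qed

text \<open>A letter contributes by its residue alone, also if its row has no addable or removable
  box. For neighbouring rows of equal length these surplus contributions cancel, because their
  letters differ by one; N records them and telescopes. The condition on r removes the boundary term
  at the vacuum letter -r.\<close>

lemma sum_wt_Nb:
  assumes l: "2 \<le> l" and i: "i < l" and lam: "is_partition lam" and a: "a < r" "length lam < r"
    and ea: "(int (pg lam a) - int a) mod int l = int i" and r: "(- int r) mod int l \<noteq> int i"
  shows "(\<Sum>j<r - Suc a. wt l (int i) (wedge_of r lam ! j)) = Nb l i lam a"
proof -
  define e where "e = (\<lambda>b. int (pg lam b) - int b)"
  define A where "A = (\<lambda>b. pg lam b < pg lam (b - 1) \<and> e b mod int l = int i)"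
  define R where "R = (\<lambda>b. pg lam (Suc b) < pg lam b \<and> e b mod int l = (int i + 1) mod int l)"
  define N where "N = (\<lambda>b. if pg lam b = pg lam (b - 1) \<and> e b mod int l = int i then 1 else 0 :: int)"
  have ne: "(x - 1) mod int l \<noteq> int i" if "x mod int l = int i" for x
  proof
    assume "(x - 1) mod int l = int i"
    then have "int l dvd x - (x - 1)" using that mod_eq_dvd_iff by metis
    then show False using l by simp
  qed
  have w: "wt l (int i) (e b) = (if A b then 1 else 0) - (if R b then 1 else 0) + (N b - N (Suc b))" if "a < b" for b
  proof -
    have 1: "(if e b mod int l = int i then 1 else 0) = (if A b then 1 else 0) + N b"
      using pg_antimono[OF lam, of "b - 1" b] unfolding A_def N_def by auto
    have "e (Suc b) = e b - 1" if "pg lam (Suc b) = pg lam b" using that unfolding e_def by simp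
    then have "N (Suc b) = (if pg lam (Suc b) = pg lam b \<and> e b mod int l = (int i + 1) mod int l then 1 else 0)"
      unfolding N_def using mod_shift_iff[of "int i" l "e b"] i by auto
    then have 2: "(if e b mod int l = (int i + 1) mod int l then 1 else 0) = (if R b then 1 else 0) + N (Suc b)"
      using pg_antimono[OF lam, of b "Suc b"] unfolding R_def by auto
    show ?thesis unfolding wt_def 1 2 by simp
  qed
  have "(\<Sum>j<r - Suc a. wt l (int i) (wedge_of r lam ! j)) = (\<Sum>j<r - Suc a. wt l (int i) (e (r - Suc j)))"
    by (intro sum.cong refl) (simp add: nth_wedge_of e_def)
  also have "\<dots> = (\<Sum>b\<in>{Suc a..<r}. wt l (int i) (e b))"
    by (rule sum.reindex_bij_witness[of _ "\<lambda>b. r - Suc b" "\<lambda>j. r - Suc j"]) (use a in auto)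
  also have "\<dots> = (\<Sum>b\<in>{Suc a..<r}. if A b then 1 else 0) - (\<Sum>b\<in>{Suc a..<r}. if R b then 1 else 0) + (\<Sum>b\<in>{Suc a..<r}. N b - N (Suc b))"
    unfolding sum_subtractf[symmetric] sum.distrib[symmetric] by (intro sum.cong refl) (simp add: w)
  also have "(\<Sum>b\<in>{Suc a..<r}. N b - N (Suc b)) = N (Suc a) - N r"
    using sum_Suc_diff'[of "Suc a" r "\<lambda>b. - N b"] a by simp
  also have "N (Suc a) = 0" using ne[OF ea] unfolding N_def e_def by (auto simp: diff_diff_eq add.commute)
  also have "N r = 0" using r a unfolding N_def e_def by (simp add: pg_beyond)
  also have "(\<Sum>b\<in>{Suc a..<r}. if A b then 1 else 0 :: int) = int (card {b. a < b \<and> addable lam b \<and> res l b (pg lam b) = int i})"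
  proof -
    have "{b. a < b \<and> addable lam b \<and> res l b (pg lam b) = int i} = {b \<in> {Suc a..<r}. A b}"
    proof -
      have "b \<le> length lam \<and> b < r" if "pg lam b < pg lam (b - 1)" for b
        using that a(2) pg_beyond[of lam "b - 1"] by (cases "b - 1 < length lam") auto
      then show ?thesis unfolding addable_def res_def A_def e_def using a by auto
    qed
    then show ?thesis by (simp flip: sum.inter_filter)
  qed
  also have "(\<Sum>b\<in>{Suc a..<r}. if R b then 1 else 0 :: int) = int (card {b. a < b \<and> removable lam b \<and> res l b (lam ! b - 1) = int i})"
  proof -
    have "removable lam b \<and> res l b (lam ! b - 1) = int i \<longleftrightarrow> R b" for b
    proof (cases "pg lam (Suc b) < pg lam b")
      case True
      then have b: "b < length lam" "lam ! b = pg lam b" using pg_pos_iff[OF lam, of b] by (auto simp: pg_def)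
      have "int (pg lam b - 1) - int b = e b - 1" using True by (simp add: e_def of_nat_diff)
      then have "res l b (lam ! b - 1) = (e b - 1) mod int l" unfolding res_def b(2) by (rule arg_cong)
      then show ?thesis using True b(1) mod_shift_iff[of "int i" l "e b"] i unfolding removable_def R_def b(2) by simp
    next
      case False
      then show ?thesis unfolding removable_def R_def by (auto simp: pg_def)
    qed
    moreover have "removable lam b \<Longrightarrow> b < r" for b using a by (simp add: removable_def)
    ultimately have "{b. a < b \<and> removable lam b \<and> res l b (lam ! b - 1) = int i} = {b \<in> {Suc a..<r}. R b}" by auto
    then show ?thesis by (simp flip: sum.inter_filter)
  qed
  finally show ?thesis by (simp add: Nb_def)
qed

lemma wedge_alt_equal:
  assumes "2 \<le> l" "wedge_alt l (length w) f" "Suc p < length w" "w ! p = w ! Suc p"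
  shows "f w = 0"
  by (rule wedge_alt_descent[OF assms(1-3)]) (use assms(4) in auto)

lemma fword_wedge_of:
  assumes l: "2 \<le> l" and i: "i < l" and lam: "is_partition lam" "length lam < r"
    and r: "(- int r) mod int l \<noteq> int i" and g: "wedge_alt l r g"
  shows "fword l (int i) g (wedge_of r lam) = Ff l i (\<lambda>mu. g (wedge_of r mu)) lam"
proof -
  define w where "w = wedge_of r lam"
  define F where "F = (\<lambda>p. if w ! p mod int l = int i then qv powi (\<Sum>j<p. wt l (int i) (w ! j)) * g (w[p := w ! p + 1]) else 0)"
  define Q where "Q = (\<lambda>a. addable lam a \<and> res l a (pg lam a) = int i)"
  have "fword l (int i) g w = (\<Sum>p<r. F p)" unfolding fword_eq F_def w_def by simp
  also have "\<dots> = (\<Sum>a<r. F (r - Suc a))" by (rule sum.nat_diff_reindex[symmetric])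
  also have "\<dots> = (\<Sum>a<r. if Q a then qv powi Nb l i lam a * g (wedge_of r (add_box lam a)) else 0)"
  proof (intro sum.cong refl)
    fix a assume "a \<in> {..<r}"
    then have a: "a < r" by simp
    have wp: "w ! (r - Suc a) = int (pg lam a) - int a" using a unfolding w_def by (simp add: nth_wedge_of)
    show "F (r - Suc a) = (if Q a then qv powi Nb l i lam a * g (wedge_of r (add_box lam a)) else 0)"
    proof (cases "(int (pg lam a) - int a) mod int l = int i")
      case True
      show ?thesis
      proof (cases "addable lam a")
        case ad: True
        have "w[r - Suc a := w ! (r - Suc a) + 1] = wedge_of r (add_box lam a)"
          by (rule nth_equalityI) (use a in \<open>auto simp: w_def nth_list_update nth_wedge_of pg_add_box[OF ad]\<close>)
        then show ?thesis using True ad sum_wt_Nb[OF l i lam(1) a lam(2) True r]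
          unfolding F_def Q_def wp res_def by (simp add: w_def)
      next
        case nad: False
        then have a0: "0 < a" "pg lam a = pg lam (a - 1)"
          using pg_antimono[OF lam(1), of "a - 1" a] pg_pos_iff[OF lam(1), of "a - 1"] pg_beyond[of lam a] pg_beyond[of lam "a - 1"]
          unfolding addable_def by force+
        have "g (w[r - Suc a := w ! (r - Suc a) + 1]) = 0"
        proof (rule wedge_alt_equal[OF l, where p = "r - Suc a"])
          show "w[r - Suc a := w ! (r - Suc a) + 1] ! (r - Suc a) = w[r - Suc a := w ! (r - Suc a) + 1] ! Suc (r - Suc a)"
            using a a0 unfolding w_def by (simp add: nth_wedge_of Suc_diff_Suc)
        qed (use g a a0 in \<open>auto simp: w_def\<close>)
        then show ?thesis unfolding F_def Q_def using nad by simp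
      qed
    next
      case False
      then show ?thesis unfolding F_def Q_def wp res_def by simp
    qed
  qed
  also have "\<dots> = (\<Sum>a\<in>{a. Q a}. qv powi Nb l i lam a * g (wedge_of r (add_box lam a)))"
  proof -
    have Qr: "{a. Q a} = {a \<in> {..<r}. Q a}" unfolding Q_def addable_def using lam(2) by auto
    show ?thesis unfolding Qr by (rule sum.inter_filter[symmetric]) simp
  qed
  finally show ?thesis unfolding Ff_def Q_def w_def .
qed

lemma Ff_fword:
  assumes l: "2 \<le> l" and i: "i < l" and lam: "is_partition lam" "length lam < r" and r: "(- int r) mod int l \<noteq> int i"
  shows "Ff l i psi lam = fword l (int i) (ext l r psi) (wedge_of r lam)"
proof -
  have "wedge_alt l r (ext l r psi)" using wfun_ext[OF l] unfolding wfun_def by blast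
  then have "fword l (int i) (ext l r psi) (wedge_of r lam) = Ff l i (\<lambda>mu. ext l r psi (wedge_of r mu)) lam"
    by (rule fword_wedge_of[OF l i lam r])
  also have "\<dots> = Ff l i psi lam"
    unfolding Ff_def using add_box_partition[OF lam(1)] length_add_box[of lam] lam(2)
    by (intro sum.cong refl) (auto simp: parts_def intro!: ext_wedge_of[OF l] order_trans[OF length_add_box])
  finally show ?thesis by simp
qed

text \<open>Raising a first letter equal to -r would bring it into the admissible range. The residue
  condition on r forbids exactly this, and one of any two consecutive ranks satisfies it
  (\<open>exists_rank\<close>).\<close>

lemma wfun_fword:
  assumes l: "2 \<le> l" and i: "i < l" and r: "(- int r) mod int l \<noteq> int i" and f: "wfun l r f"
  shows "wfun l r (fword l (int i) f)"
  unfolding wfun_def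
proof (intro conjI allI impI)
  show "wedge_alt l r (fword l (int i) f)" using f wedge_alt_fword[OF l, of "int i"] i unfolding wfun_def by auto
  fix w :: "int list" assume w: "length w = r" "0 < r" "w ! 0 < 1 - int r"
  show "fword l (int i) f w = 0" unfolding fword_eq
  proof (intro sum.neutral ballI)
    fix p assume "p \<in> {..<length w}"
    have "w[p := w ! p + 1] ! 0 < 1 - int r" if "w ! p mod int l = int i"
      using w r that by (cases "p = 0"; cases "w ! 0 = - int r") auto
    then show "(if w ! p mod int l = int i then qv powi (\<Sum>j<p. wt l (int i) (w ! j)) * f (w[p := w ! p + 1]) else 0) = 0"
      using f w unfolding wfun_def by auto
  qed
qed

lemma exists_rank:
  assumes "2 \<le> l" shows "\<exists>r>n. (- int r) mod int l \<noteq> int i"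
proof (cases "(- int (Suc n)) mod int l = int i")
  case True
  have "(- int (Suc (Suc n))) mod int l \<noteq> int i"
  proof
    assume "(- int (Suc (Suc n))) mod int l = int i"
    then have "int l dvd - int (Suc n) - (- int (Suc (Suc n)))" using True mod_eq_dvd_iff by metis
    then show False using assms by simp
  qed
  then show ?thesis by (meson lessI less_Suc_eq)
qed auto

lemma Bf_Ff_commute:
  assumes l: "2 \<le> l" "0 < k" and i: "i < l" and lam: "is_partition lam"
  shows "Bf l k (Ff l i psi) lam = Ff l i (Bf l k psi) lam"
proof -
  obtain r where r: "length lam < r" "(- int r) mod int l \<noteq> int i" using exists_rank[OF l(1)] by blast
  have lr: "lam \<in> parts r" using lam r by (simp add: parts_def)
  define g where "g = fword l (int i) (ext l r psi)"
  have g: "wfun l r g" unfolding g_def by (rule wfun_fword[OF l(1) i r(2) wfun_ext[OF l(1)]])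
  have "Ff l i (Bf l k psi) lam = fword l (int i) (shift_sum (int l * int k) (ext l r psi)) (wedge_of r lam)"
    unfolding Ff_fword[OF l(1) i lam r] by (rule fword_cong) (simp add: ext_Bf[OF l])
  also have "\<dots> = shift_sum (int l * int k) g (wedge_of r lam)" unfolding g_def by (rule shift_sum_fword) simp
  also have "\<dots> = Bf l k (Ff l i psi) lam"
    unfolding shift_sum_wfun[OF l g lr] Bf_def
  proof (intro sum.mono_neutral_cong_right[OF finite_parts])
    show "\<forall>mu\<in>{mu \<in> parts r. int (sum_list mu) + int l * int k = int (sum_list lam)} -
       {mu \<in> parts (length lam). int (sum_list mu) + int l * int k = int (sum_list lam)}. bcoef l k lam mu * g (wedge_of r mu) = 0"
      using bcoef_longer[OF l, of _ lam] by (auto simp: parts_def simp flip: not_less)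
    fix mu assume "mu \<in> {mu \<in> parts (length lam). int (sum_list mu) + int l * int k = int (sum_list lam)}"
    then show "bcoef l k lam mu * g (wedge_of r mu) = bcoef l k lam mu * Ff l i psi mu"
      unfolding g_def using Ff_fword[OF l(1) i _ _ r(2), of mu] r(1) by (simp add: parts_def)
  qed (use r(1) in \<open>auto simp: parts_def\<close>)
  finally show ?thesis by simp
qed

section \<open>The functionals summing to the one-row functional\<close>

text \<open>The complete symmetric function h_j in the operators that lower a single letter by
  K.\<close>

fun hsum :: "int \<Rightarrow> nat \<Rightarrow> (int list \<Rightarrow> qf) \<Rightarrow> int list \<Rightarrow> qf" where
  "hsum K j f [] = (if j = 0 then f [] else 0)"
| "hsum K j f (a # w) = (\<Sum>c\<le>j. hsum K (j - c) (\<lambda>v. f ((a - K * int c) # v)) w)"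

text \<open>The product of 1 - S_p over all letters, where S_p lowers the p-th letter by K; thus the
  alternating sum of all elementary symmetric functions.\<close>

fun esum :: "int \<Rightarrow> (int list \<Rightarrow> qf) \<Rightarrow> int list \<Rightarrow> qf" where
  "esum K f [] = f []"
| "esum K f (a # w) = esum K (\<lambda>v. f (a # v)) w - esum K (\<lambda>v. f ((a - K) # v)) w"

lemma esum_cong: "(\<And>v. length v = length w \<Longrightarrow> f v = g v) \<Longrightarrow> esum K f w = esum K g w"
proof (induction w arbitrary: f g)
  case (Cons a w)
  have "esum K (\<lambda>v. f (b # v)) w = esum K (\<lambda>v. g (b # v)) w" for b
    by (rule Cons.IH) (simp add: Cons.prems)
  then show ?case by simp
qed simp

lemma esum_diff: "esum K (\<lambda>v. f v - g v) w = esum K f w - esum K g w"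
  by (induction w arbitrary: f g) simp_all

lemma esum_add: "esum K (\<lambda>v. f v + g v) w = esum K f w + esum K g w"
  by (induction w arbitrary: f g) simp_all

lemma esum_scale: "esum K (\<lambda>v. c * f v) w = c * esum K f w"
  by (induction w arbitrary: f) (simp_all add: algebra_simps)

lemma esum_zero: "(\<And>v. length v = length w \<Longrightarrow> f v = 0) \<Longrightarrow> esum K f w = 0"
  using esum_cong[of w f "\<lambda>v. 0 * (0::qf)"] esum_scale[of K 0 "\<lambda>v. 0" w] by simp

lemma esum_snoc: "esum K f (w @ [b]) = esum K (\<lambda>v. f (v @ [b])) w - esum K (\<lambda>v. f (v @ [b - K])) w"
  by (induction w arbitrary: f) simp_all

lemma hsum_cong: "(\<And>v. length v = length w \<Longrightarrow> f v = g v) \<Longrightarrow> hsum K j f w = hsum K j g w"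
proof (induction w arbitrary: f g j)
  case (Cons a w)
  have "hsum K i (\<lambda>v. f (b # v)) w = hsum K i (\<lambda>v. g (b # v)) w" for b i
    by (rule Cons.IH) (simp add: Cons.prems)
  then show ?case by simp
qed simp

lemma hsum_0: "hsum K 0 f w = f w"
  by (induction w arbitrary: f) simp_all

text \<open>The generating function of the h_j is inverse to the product of the 1 - S_p. Cutting the
  series at N is exact because words of too small a sum are annihilated by f. In the induction each
  letter contributes a telescoping sum over its number c of shifts.\<close>

lemma hsum_esum:
  assumes K: "0 \<le> K" and "\<And>v. length v = length w \<Longrightarrow> sum_list v < s \<Longrightarrow> f v = 0" and "sum_list w - K * (int N + 1) < s"
  shows "(\<Sum>j\<le>N. hsum K j (esum K f) w) = f w"
  using assms(2,3)
proof (induction w arbitrary: f N s)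
  case Nil
  show ?case by (induction N) auto
next
  case (Cons a w)
  define g where "g = (\<lambda>c v. f ((a - K * int c) # v) - f ((a - K * int (Suc c)) # v))"
  have "(\<Sum>j\<le>N. hsum K j (esum K f) (a # w)) = (\<Sum>j\<le>N. \<Sum>c\<le>j. hsum K (j - c) (esum K (g c)) w)"
    unfolding g_def esum_diff hsum.simps esum.simps by (simp add: algebra_simps)
  also have "\<dots> = (\<Sum>c\<le>N. \<Sum>j\<le>N - c. hsum K j (esum K (g c)) w)"
    unfolding sum.Sigma[OF finite_atMost ballI[OF finite_atMost]]
    by (rule sum.reindex_bij_witness[of _ "\<lambda>(c, j). (c + j, c)" "\<lambda>(j, c). (c, j - c)"]) auto
  also have "\<dots> = (\<Sum>c\<le>N. g c w)"
  proof (rule sum.cong[OF refl])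
    fix c assume "c \<in> {..N}"
    then have c: "c \<le> N" by simp
    show "(\<Sum>j\<le>N - c. hsum K j (esum K (g c)) w) = g c w"
    proof (rule Cons.IH[where s = "min (s - a + K * int c) (s - a + K * int (Suc c))"])
      fix v :: "int list" assume v: "length v = length w" "sum_list v < min (s - a + K * int c) (s - a + K * int (Suc c))"
      have "f ((a - K * int c) # v) = 0" by (rule Cons.prems(1)) (use v in auto)
      moreover have "f ((a - K * int (Suc c)) # v) = 0" by (rule Cons.prems(1)) (use v in \<open>auto simp del: of_nat_Suc\<close>)
      ultimately show "g c v = 0" unfolding g_def by simp
    next
      have "sum_list w - K * (int (N - c) + 1) < s - a + K * int c" using Cons.prems(2) c by (simp add: algebra_simps of_nat_diff)
      moreover have "K * int c \<le> K * int (Suc c)" using K by (intro mult_left_mono) auto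
      ultimately show "sum_list w - K * (int (N - c) + 1) < min (s - a + K * int c) (s - a + K * int (Suc c))" by linarith
    qed
  qed
  also have "\<dots> = f (a # w) - f ((a - K * int (Suc N)) # w)"
    unfolding g_def by (induction N) simp_all
  also have "f ((a - K * int (Suc N)) # w) = 0" by (rule Cons.prems(1)) (use Cons.prems(2) in \<open>auto simp: algebra_simps\<close>)
  finally show ?case by simp
qed

lemma sum_triangle: "(\<Sum>c\<le>j. \<Sum>k\<in>{1..j - c}. h c k) = (\<Sum>k\<in>{1..j}. \<Sum>c\<le>j - k. h c k)" for h :: "nat \<Rightarrow> nat \<Rightarrow> qf"
proof -
  have "(\<Sum>c\<le>j. \<Sum>k\<in>{1..j - c}. h c k) = (\<Sum>(c,k)\<in>Sigma {..j} (\<lambda>c. {1..j - c}). h c k)"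
    by (rule sum.Sigma) auto
  also have "\<dots> = (\<Sum>(k,c)\<in>Sigma {1..j} (\<lambda>k. {..j - k}). h c k)"
    by (rule sum.reindex_bij_witness[of _ "\<lambda>(a,b). (b,a)" "\<lambda>(a,b). (b,a)"]) auto
  also have "\<dots> = (\<Sum>k\<in>{1..j}. \<Sum>c\<le>j - k. h c k)"
    by (rule sum.Sigma[symmetric]) auto
  finally show ?thesis .
qed

lemma shift_sum_sum: "finite I \<Longrightarrow> shift_sum K (\<lambda>w. \<Sum>i\<in>I. f i w) w = (\<Sum>i\<in>I. shift_sum K (f i) w)"
  for f :: "'i \<Rightarrow> int list \<Rightarrow> qf"
  by (induction I rule: finite_induct) (simp_all add: shift_sum_add)

text \<open>Newton's identity j h_j = \<Sum>k p_k h_(j-k), where lowering one letter by K * k,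
  summed over the letters, is the power sum p_k. It expresses the h_j by the operators B_k, the only
  shifts about which \<open>bar\<close> is known to say something.\<close>

lemma hsum_newton:
  "of_nat j * hsum K j f w = (\<Sum>k\<in>{1..j}. shift_sum (K * int k) (hsum K (j - k) f) w)"
proof (induction w arbitrary: f j)
  case (Cons a w)
  define F where "F = (\<lambda>c v. f ((a - K * int c) # v))"
  have "of_nat j * hsum K j f (a # w) = (\<Sum>c\<le>j. of_nat c * hsum K (j - c) (F c) w + of_nat (j - c) * hsum K (j - c) (F c) w)"
    unfolding hsum.simps F_def sum_distrib_left by (intro sum.cong refl) (simp add: algebra_simps of_nat_diff)
  also have "\<dots> = (\<Sum>c\<le>j. of_nat c * hsum K (j - c) (F c) w) + (\<Sum>c\<le>j. \<Sum>k\<in>{1..j - c}. shift_sum (K * int k) (hsum K (j - c - k) (F c)) w)"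
    unfolding Cons.IH sum.distrib ..
  also have "(\<Sum>c\<le>j. \<Sum>k\<in>{1..j - c}. shift_sum (K * int k) (hsum K (j - c - k) (F c)) w)
     = (\<Sum>k\<in>{1..j}. shift_sum (K * int k) (\<lambda>v. hsum K (j - k) f (a # v)) w)"
    unfolding sum_triangle hsum.simps shift_sum_sum[OF finite_atMost] F_def by (simp add: diff_diff_eq add.commute)
  also have "(\<Sum>c\<le>j. of_nat c * hsum K (j - c) (F c) w) = (\<Sum>k\<in>{1..j}. hsum K (j - k) f ((a - K * int k) # w))"
  proof -
    have "(\<Sum>k\<in>{1..j}. hsum K (j - k) f ((a - K * int k) # w)) = (\<Sum>k\<in>{1..j}. \<Sum>c\<le>j - k. hsum K (j - k - c) (F (k + c)) w)"
      unfolding hsum.simps F_def by (simp add: algebra_simps)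
    also have "\<dots> = (\<Sum>(k,c)\<in>Sigma {1..j} (\<lambda>k. {..j - k}). hsum K (j - k - c) (F (k + c)) w)" by (rule sum.Sigma) auto
    also have "\<dots> = (\<Sum>(c,k)\<in>Sigma {..j} (\<lambda>c. {1..c}). hsum K (j - c) (F c) w)"
      by (rule sum.reindex_bij_witness[of _ "\<lambda>(c,k). (k, c - k)" "\<lambda>(k,c). (k + c, k)"]) (auto simp: diff_diff_eq)
    also have "\<dots> = (\<Sum>c\<le>j. \<Sum>k\<in>{1..c}. hsum K (j - c) (F c) w)" by (rule sum.Sigma[symmetric]) auto
    finally show ?thesis by simp
  qed
  finally show ?case by (simp add: sum.distrib)
qed simp

text \<open>On the first two letters twice (1 - S)(1 - S') is G 0 0 + G 1 1 - 2 G 0 1, a combination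
  of the symmetrised shifts of \<open>pair_rel_shift\<close>.\<close>

lemma wedge_alt_esum: "wedge_alt l r f \<Longrightarrow> wedge_alt l r (esum (int l) f)"
proof (induction r arbitrary: f)
  case 0
  then show ?case by (simp add: wedge_alt_def)
next
  case (Suc r)
  have f: "wedge_alt l r (\<lambda>v. f (a # v))" for a using Suc.prems unfolding wedge_alt_Cons by blast
  show ?case unfolding wedge_alt_Cons
  proof (intro conjI allI impI)
    fix a show "wedge_alt l r (\<lambda>v. esum (int l) f (a # v))"
      unfolding esum.simps by (intro wedge_alt_diff Suc.IH f)
  next
    fix v :: "int list" and m k assume v: "Suc (length v) = r"
    define g where "g = (\<lambda>x y. esum (int l) (\<lambda>u. f (x # y # u)) v)"
    have g0: "pair_rel l g m k = 0" for m k
    proof -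
      have "pair_rel l (\<lambda>x y. esum (int l) (h x y) u) m k = esum (int l) (\<lambda>u. pair_rel l (\<lambda>x y. h x y u) m k) u" for h u
        unfolding pair_rel_def Let_def by (simp add: esum_add esum_scale)
      then have "pair_rel l g m k = esum (int l) (\<lambda>u. pair_rel l (\<lambda>x y. f (x # y # u)) m k) v" unfolding g_def .
      also have "\<dots> = 0" by (rule esum_zero) (use Suc.prems v in \<open>auto simp: wedge_alt_Cons\<close>)
      finally show ?thesis .
    qed
    define G where "G = (\<lambda>c d x y. g (x - int l * c) (y - int l * d) + g (x - int l * d) (y - int l * c))"
    have G0: "pair_rel l (G c d) m k = 0" for c d unfolding G_def pair_rel_shift by (simp add: g0)
    have "2 * pair_rel l (\<lambda>x y. esum (int l) f (x # y # v)) m k =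
        pair_rel l (\<lambda>x y. 2 * esum (int l) f (x # y # v)) m k" by (rule pair_rel_scale[symmetric])
    also have "\<dots> = pair_rel l (\<lambda>x y. (G 0 0 x y + G 1 1 x y) - 2 * G 0 1 x y) m k"
      by (rule pair_rel_cong) (simp add: G_def g_def)
    also have "\<dots> = 0" unfolding pair_rel_diff pair_rel_add pair_rel_scale by (simp add: G0)
    finally show "pair_rel l (\<lambda>x y. esum (int l) f (x # y # v)) m k = 0" by simp
  qed
qed

lemma wfun_esum:
  assumes "wfun l r f" shows "wfun l r (esum (int l) f)"
  unfolding wfun_def
proof (intro conjI allI impI)
  show "wedge_alt l r (esum (int l) f)" using assms wedge_alt_esum unfolding wfun_def by blast
  fix w :: "int list" assume w: "length w = r" "0 < r" "w ! 0 < 1 - int r"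
  then obtain a v where wa: "w = a # v" by (cases w) auto
  have "f (b # u) = 0" if "length u = length v" "b \<le> a" for b u
    using assms w that unfolding wfun_def wa by simp
  then show "esum (int l) f w = 0" unfolding wa by (simp add: esum_zero)
qed

lemma fword_diff: "fword l i (\<lambda>w. f w - g w) w = fword l i f w - fword l i g w"
  using fword_add[of l i "\<lambda>w. f w - g w" g w] by simp

lemma fword_esum: "fword l i (esum (int l) f) w = esum (int l) (fword l i f) w"
proof (induction w arbitrary: f)
  case (Cons a w)
  have m: "(a - int l) mod int l = a mod int l" by simp
  then have m: "(a - int l) mod int l = a mod int l" "wt l i (a - int l) = wt l i a" by (auto intro: wt_cong)
  show ?case
    by (cases "a mod int l = i") (simp_all add: m fword_diff Cons.IH esum_add esum_scale esum_diff algebra_simps)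
qed simp

section \<open>The formal sum of all one-row dual vectors, the empty row included, and its
  eigenvalues\<close>

definition row_fun :: "nat list \<Rightarrow> qf" where
  "row_fun lam = (if length lam \<le> 1 then 1 else 0)"

text \<open>Straightening keeps all letters at or above 2 - r, so only partitions with exactly r
  \<ge> 2 rows occur.\<close>

lemma ext_row_fun_high:
  assumes l: "2 \<le> l" and r: "2 \<le> r" "length w = r" and w: "\<And>p. p < r \<Longrightarrow> 2 - int r \<le> w ! p"
  shows "ext l r row_fun w = 0"
  unfolding ext_def
proof (rule sum.neutral, rule ballI)
  fix lam assume "lam \<in> {lam \<in> parts r. int (sum_list lam) + vac_sum r = sum_list w}"
  then have lam: "is_partition lam" "length lam \<le> r" by (auto simp: parts_def)
  have "qstraight l w (wedge_of r lam) = 0" if "length lam < r"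
  proof (rule ccontr)
    assume nz: "qstraight l w (wedge_of r lam) \<noteq> 0"
    have "(\<forall>p<r. 2 - int r \<le> wedge_of r lam ! p) \<and> length (wedge_of r lam) = length w \<and> sorted_wrt (<) (wedge_of r lam)"
    proof (rule qstraight_support[OF l nz])
      fix v p x assume v: "\<forall>p<r. 2 - int r \<le> v ! p" "length v = length w" "Suc p < length v" "v ! Suc p \<le> x" "x < v ! p"
      then have "2 - int r \<le> v ! Suc p" "2 - int r \<le> v ! p" using r by auto
      then show "\<forall>p'<r. 2 - int r \<le> upd2 v p x (v ! p + v ! Suc p - x) ! p'" using v r by (auto simp: nth_upd2)
    qed (use w in auto)
    then have "2 - int r \<le> wedge_of r lam ! 0" using r by simp
    then show False using that r by (simp add: nth_wedge_of pg_beyond)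
  qed
  then show "qstraight l w (wedge_of r lam) * row_fun lam = 0"
    using r lam by (cases "length lam < r") (auto simp: row_fun_def)
qed

lemma wedge_alt_snoc:
  assumes "wedge_alt l (Suc r) f" shows "wedge_alt l r (\<lambda>v. f (v @ [b]))"
  unfolding wedge_alt_def
proof (intro allI impI)
  fix w :: "int list" and p m k assume w: "length w = r" "Suc p < r"
  have "upd2 w p x y @ [b] = upd2 (w @ [b]) p x y" for x y
    unfolding upd2_def using w by (simp add: list_update_append)
  then show "pair_rel l (\<lambda>x y. f (upd2 w p x y @ [b])) m k = 0"
    using assms w unfolding wedge_alt_def by simp
qed

text \<open>In the non-normal case the last letter of a contributing one-row word would have to exceed all letters of the
  given word, but straightening does not increase the maximal letter.\<close>

lemma ext_row_fun_snoc_normal: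
  assumes l: "2 \<le> l" and u: "length u = r" "sorted_wrt (<) u" and b: "0 \<le> b"
  shows "ext l (Suc r) row_fun (u @ [b]) = (if u = map (\<lambda>x. x - 1) (wedge_of r []) then 1 else 0)"
proof (cases "0 < r \<and> u ! 0 < - int r")
  case True
  have "wedge_of r [] ! 0 = 1 - int r" using True by (simp add: nth_wedge_of pg_def)
  then have "u \<noteq> map (\<lambda>x. x - 1) (wedge_of r [])" using True by auto
  moreover have "ext l (Suc r) row_fun (u @ [b]) = 0"
    using wfun_ext[OF l, of "Suc r" row_fun] True u unfolding wfun_def by (simp add: nth_append)
  ultimately show ?thesis by simp
next
  case False
  have "\<exists>mu\<in>parts r. wedge_of r mu = map (\<lambda>x. x + 1) u"
    by (rule normal_wedge) (use u False in \<open>auto simp: sorted_wrt_iff_nth_less add1_zle_eq\<close>)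
  then obtain mu where mu: "mu \<in> parts r" "wedge_of r mu = map (\<lambda>x. x + 1) u" by blast
  have ueq: "u = map (\<lambda>x. x - 1) (wedge_of r mu)" unfolding mu(2) by (simp add: comp_def)
  have mup: "is_partition mu" "length mu \<le> r" using mu(1) by (auto simp: parts_def)
  have inj: "u = map (\<lambda>x. x - 1) (wedge_of r []) \<longleftrightarrow> mu = []"
  proof
    assume "u = map (\<lambda>x. x - 1) (wedge_of r [])"
    then have "wedge_of r mu = wedge_of r []" unfolding mu(2) by (simp add: comp_def)
    then show "mu = []" using wedge_of_inj[OF mu(1)] by (simp add: parts_def is_partition_def)
  qed (simp add: ueq)
  have norm: "ext l (Suc r) row_fun (u @ [b]) = row_fun lam"
    if lam: "is_partition lam" "length lam \<le> Suc r" "int (pg lam 0) = b" "\<And>j. pg lam (Suc j) = pg mu j" for lam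
  proof -
    have "u @ [b] = wedge_of (Suc r) lam"
    proof (rule nth_equalityI)
      fix p assume "p < length (u @ [b])"
      then have p: "p \<le> r" using u by simp
      show "(u @ [b]) ! p = wedge_of (Suc r) lam ! p"
      proof (cases "p = r")
        case True then show ?thesis using u lam(3) by (simp add: nth_append nth_wedge_of)
      next
        case f: False
        then have "r - p = Suc (r - 1 - p)" using p by simp
        then show ?thesis using u f p lam(4) by (simp add: nth_append nth_wedge_of ueq)
      qed
    qed (use u in simp)
    then show ?thesis using ext_wedge_of[OF l, of lam "Suc r"] lam by (simp add: parts_def)
  qed
  show ?thesis
  proof (cases "mu = []")
    case True
    have "ext l (Suc r) row_fun (u @ [b]) = row_fun (if b = 0 then [] else [nat b])"
      by (rule norm) (use b True in \<open>auto simp: is_partition_def pg_def\<close>)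
    then show ?thesis using inj True by (simp add: row_fun_def)
  next
    case ne: False
    show ?thesis
    proof (cases "int (pg mu 0) \<le> b")
      case True
      have "ext l (Suc r) row_fun (u @ [b]) = row_fun (nat b # mu)"
      proof (rule norm)
        show "is_partition (nat b # mu)"
        proof (rule partitionI)
          fix i assume "Suc i < length (nat b # mu)"
          then show "(nat b # mu) ! Suc i \<le> (nat b # mu) ! i"
            using True pg_antimono[OF mup(1), of "i - 1" i] by (cases i) (auto simp: pg_def)
        next
          show "0 \<notin> set (nat b # mu)" using mup(1) True ne pg_pos_iff[OF mup(1), of 0] by (auto simp: is_partition_def)
        qed
      qed (use mup b in \<open>auto simp: pg_def\<close>)
      then show ?thesis using inj ne by (simp add: row_fun_def)
    next
      case f: False
      define M where "M = int (pg mu 0) - 1"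
      have su: "sum_list u = int (sum_list mu) + vac_sum (Suc r)"
      proof -
        have "sum_list (map (\<lambda>x. x - 1) v) = sum_list v - int (length v)" for v :: "int list" by (induction v) auto
        then have "sum_list u = sum_list (wedge_of r mu) - int r" by (simp add: ueq)
        then show ?thesis using sum_wedge_of[OF mup(2)] by (simp add: vac_sum_def)
      qed
      have hdle: "pg mu 0 \<le> sum_list mu" using ne member_le_sum_list[of "mu ! 0" mu] by (auto simp: pg_def)
      have "ext l (Suc r) row_fun (u @ [b]) = 0"
        unfolding ext_def
      proof (rule sum.neutral, rule ballI)
        fix lam assume "lam \<in> {lam \<in> parts (Suc r). int (sum_list lam) + vac_sum (Suc r) = sum_list (u @ [b])}"
        then have lam: "int (sum_list lam) = int (sum_list mu) + b" using su by simp
        have "qstraight l (u @ [b]) (wedge_of (Suc r) lam) = 0" if "length lam \<le> 1"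
        proof (rule ccontr)
          assume nz: "qstraight l (u @ [b]) (wedge_of (Suc r) lam) \<noteq> 0"
          have "(\<forall>p<Suc r. wedge_of (Suc r) lam ! p \<le> M) \<and> length (wedge_of (Suc r) lam) = length (u @ [b]) \<and> sorted_wrt (<) (wedge_of (Suc r) lam)"
          proof (rule qstraight_support[OF l nz])
            show "\<forall>p<Suc r. (u @ [b]) ! p \<le> M"
            proof (intro allI impI)
              fix p assume "p < Suc r"
              show "(u @ [b]) ! p \<le> M"
                using f u \<open>p < Suc r\<close> pg_antimono[OF mup(1), of 0 "r - 1 - p"] by (auto simp: nth_append ueq nth_wedge_of M_def less_Suc_eq)
            qed
          next
            fix v p x assume v: "\<forall>p<Suc r. v ! p \<le> M" "length v = length (u @ [b])" "Suc p < length v" "v ! Suc p \<le> x" "x < v ! p"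
            then have "v ! Suc p \<le> M" "v ! p \<le> M" using u by auto
            then have "v ! p + v ! Suc p - x \<le> M" "x \<le> M" using v(4,5) by linarith+
            then show "\<forall>p'<Suc r. upd2 v p x (v ! p + v ! Suc p - x) ! p' \<le> M" using v u by (auto simp: nth_upd2)
          qed
          then have "wedge_of (Suc r) lam ! r \<le> M" using lessI[of r] by blast
          then have "int (pg lam 0) \<le> M" by (simp add: nth_wedge_of)
          moreover have "pg lam 0 = sum_list lam" using that by (cases lam) (auto simp: pg_def)
          ultimately show False using lam b hdle unfolding M_def by linarith
        qed
        then show "qstraight l (u @ [b]) (wedge_of (Suc r) lam) * row_fun lam = 0" by (auto simp: row_fun_def)
      qed
      then show ?thesis using inj ne by simp
    qed
  qed
qed

lemma ext_row_fun_snoc: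
  assumes l: "2 \<le> l" and b: "0 \<le> b" "0 \<le> c" and u: "length u = r"
  shows "ext l (Suc r) row_fun (u @ [b]) = ext l (Suc r) row_fun (u @ [c])"
proof (rule wedge_alt_eqI[OF l, where r = r and f = "\<lambda>v. ext l (Suc r) row_fun (v @ [b])"])
  have "wedge_alt l (Suc r) (ext l (Suc r) row_fun)" using wfun_ext[OF l] unfolding wfun_def by blast
  then show "wedge_alt l r (\<lambda>v. ext l (Suc r) row_fun (v @ [b]))" "wedge_alt l r (\<lambda>v. ext l (Suc r) row_fun (v @ [c]))"
    by (rule wedge_alt_snoc)+
qed (simp_all add: ext_row_fun_snoc_normal[OF l] b u)

definition P0 :: "nat \<Rightarrow> nat list \<Rightarrow> qf" where
  "P0 l lam = esum (int l) (ext l (length lam) row_fun) (wedge_of (length lam) lam)"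

lemma esum_ext_Cons:
  assumes l: "2 \<le> l" and w: "length w = r"
  shows "esum (int l) (ext l (Suc r) psi) (- int r # w) = esum (int l) (ext l r psi) w"
proof -
  have "esum (int l) (\<lambda>v. ext l (Suc r) psi ((- int r - int l) # v)) w = 0"
    by (rule esum_zero) (use wfun_ext[OF l, of "Suc r" psi] w l in \<open>auto simp: wfun_def\<close>)
  moreover have "esum (int l) (\<lambda>v. ext l (Suc r) psi (- int r # v)) w = esum (int l) (ext l r psi) w"
    by (rule esum_cong) (simp add: ext_Cons[OF l] w)
  ultimately show ?thesis by simp
qed

lemma P0_eq:
  assumes l: "2 \<le> l" and lam: "lam \<in> parts r"
  shows "P0 l lam = esum (int l) (ext l r row_fun) (wedge_of r lam)"
proof -
  have "length lam \<le> r" using lam by (simp add: parts_def)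
  then show ?thesis
  proof (induction rule: dec_induct)
    case (step n)
    then show ?case using esum_ext_Cons[OF l, of "wedge_of n lam" n row_fun] by (simp add: wedge_of_Suc_long del: esum.simps)
  qed (simp add: P0_def)
qed

lemma ext_P0:
  assumes l: "2 \<le> l" and w: "length w = r"
  shows "ext l r (P0 l) w = esum (int l) (ext l r row_fun) w"
  by (rule ext_eqI[OF l wfun_esum[OF wfun_ext[OF l]] _ w]) (simp add: P0_eq[OF l])

text \<open>The factor belonging to the last letter compares the last letters b and b - l. Both are
  nonnegative if the first row is at least l, and the row functional does not distinguish
  them.\<close>

lemma P0_vanish:
  assumes l: "2 \<le> l" and lam: "is_partition lam" "l \<le> pg lam 0"
  shows "P0 l lam = 0"
proof -
  obtain r where r: "length lam = Suc r" using lam l by (cases lam) (auto simp: pg_def)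
  define w where "w = butlast (wedge_of (Suc r) lam)"
  have w: "length w = r" unfolding w_def by simp
  have "wedge_of (Suc r) lam \<noteq> []" using length_wedge_of[of "Suc r" lam] by (metis length_0_conv nat.distinct(1))
  then have e: "wedge_of (Suc r) lam = w @ [int (pg lam 0)]"
    unfolding w_def using wedge_of_last[of "Suc r" lam] last_conv_nth[of "wedge_of (Suc r) lam"] append_butlast_last_id[of "wedge_of (Suc r) lam"] by simp
  have "esum (int l) (\<lambda>v. ext l (Suc r) row_fun (v @ [int (pg lam 0)])) w = esum (int l) (\<lambda>v. ext l (Suc r) row_fun (v @ [int (pg lam 0) - int l])) w"
    by (rule esum_cong, rule ext_row_fun_snoc[OF l]) (use lam(2) w in auto)
  then show ?thesis unfolding P0_def r e esum_snoc by simp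
qed

text \<open>The eigenvalue in size x. Below the end of a nonempty row the only relevant box is the
  addable one starting the next row, of residue -1; it contributes q exactly if x + 1 is divisible
  by l. In size 0 there is no such box, in agreement with 1 not being divisible by l.\<close>

definition chi :: "nat \<Rightarrow> nat \<Rightarrow> int \<Rightarrow> qf" where
  "chi l i x = (if x mod int l = int i then if (x + 1) mod int l = 0 then qv else 1 else 0)"

lemma Ff_row_fun:
  assumes l: "2 \<le> l" and i: "i < l" and lam: "is_partition lam"
  shows "Ff l i row_fun lam = chi l i (int (sum_list lam)) * row_fun lam"
proof -
  consider "lam = []" | m where "lam = [m]" "0 < m" | "2 \<le> length lam"
    using lam by (cases lam; cases "tl lam") (auto simp: is_partition_def)
  then show ?thesis
  proof cases
    case 1
    have ad: "addable [] a \<longleftrightarrow> a = 0" for a by (auto simp: addable_def)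
    have "res l 0 (pg [] 0) = 0" by (simp add: res_def pg_def)
    then have E: "addable [] a \<and> res l a (pg [] a) = int i \<longleftrightarrow> a = 0 \<and> i = 0" for a
      unfolding ad by (cases "a = 0") auto
    have "{a. a = (0 :: nat) \<and> i = 0} = (if i = 0 then {0} else {})" by (cases "i = 0") simp_all
    then have S: "{a. addable [] a \<and> res l a (pg [] a) = int i} = (if i = 0 then {0} else {})" unfolding E .
    have "{b. 0 < b \<and> b = 0 \<and> res l b (pg [] b) = int i} = {}" by auto
    then have "Nb l i [] 0 = 0" unfolding Nb_def ad by (simp add: removable_def)
    moreover have "(0 + 1 :: int) mod int l \<noteq> 0" using l by simp
    ultimately show ?thesis unfolding 1 Ff_def S chi_def using l by (cases "i = 0") (simp_all add: row_fun_def add_box_def)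
  next
    case 2
    have ad: "addable [m] a \<longleftrightarrow> a = 0 \<or> a = 1" for a using 2(2) by (auto simp: addable_def pg_def)
    have rm: "removable [m] a \<longleftrightarrow> a = 0" for a using 2(2) by (auto simp: removable_def pg_def)
    have ab: "row_fun (add_box [m] 0) = 1" "row_fun (add_box [m] 1) = 0" by (simp_all add: row_fun_def add_box_def)
    have "Ff l i row_fun [m] = (\<Sum>a\<in>{a \<in> {0,1}. res l a (pg [m] a) = int i}. qv powi Nb l i [m] a * row_fun (add_box [m] a))"
      unfolding Ff_def ad by (intro sum.cong) auto
    also have "\<dots> = (\<Sum>a\<in>{0,1}. if res l a (pg [m] a) = int i then qv powi Nb l i [m] a * row_fun (add_box [m] a) else 0)"
      by (rule sum.inter_filter) simp
    also have "\<dots> = (if int m mod int l = int i then qv powi Nb l i [m] 0 else 0)"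
      using ab by (simp add: res_def pg_def)
    also have "Nb l i [m] 0 = (if (- 1) mod int l = int i then 1 else 0)"
    proof -
      have A: "{b. 0 < b \<and> addable [m] b \<and> res l b (pg [m] b) = int i} = (if (- 1) mod int l = int i then {1} else {})"
        unfolding ad by (auto simp: res_def pg_def)
      have B: "{b. 0 < b \<and> removable [m] b \<and> res l b ([m] ! b - 1) = int i} = {}" unfolding rm by auto
      show ?thesis unfolding Nb_def A B by simp
    qed
    also have "(if int m mod int l = int i then qv powi (if (- 1) mod int l = int i then 1 else 0) else 0) = chi l i (int m)"
    proof (cases "int m mod int l = int i")
      case True
      have "(- 1) mod int l = int i \<longleftrightarrow> (int m + 1) mod int l = 0"
      proof -
        have "(- 1) mod int l = int m mod int l \<longleftrightarrow> int l dvd - 1 - int m" by (rule mod_eq_dvd_iff)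
        also have "- 1 - int m = - (int m + 1)" by simp
        finally have "(- 1) mod int l = int i \<longleftrightarrow> int l dvd int m + 1" unfolding True dvd_minus_iff .
        then show ?thesis by (simp only: dvd_eq_mod_eq_0)
      qed
      then show ?thesis unfolding chi_def using True by simp
    qed (simp add: chi_def)
    finally show ?thesis unfolding 2(1) by (simp add: row_fun_def[of "[m]"])
  next
    case 3
    have "row_fun (add_box lam a) = 0" for a using 3 by (auto simp: row_fun_def add_box_def)
    then show ?thesis unfolding Ff_def using 3 by (simp add: row_fun_def)
  qed
qed

lemma esum_chi: "esum (int l) (\<lambda>v. chi l i (sum_list v + c) * f v) w = chi l i (sum_list w + c) * esum (int l) f w"
proof (induction w arbitrary: f c)
  case (Cons a w)
  have "chi l i (x - int l) = chi l i x" for x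
  proof -
    have "(x - int l) mod int l = x mod int l" "(x - int l + 1) mod int l = (x + 1) mod int l" by (simp_all add: mod_eq_dvd_iff)
    then show ?thesis unfolding chi_def by simp
  qed
  from this[of "a + sum_list w + c"] have c: "chi l i (sum_list w + (a - int l + c)) = chi l i (sum_list (a # w) + c)" by (simp add: algebra_simps)
  have IH: "esum (int l) (\<lambda>v. chi l i (sum_list (b # v) + c) * f (b # v)) w = chi l i (sum_list w + (b + c)) * esum (int l) (\<lambda>v. f (b # v)) w" for b
  proof -
    have "sum_list (b # v) + c = sum_list v + (b + c)" for v by simp
    then show ?thesis by (simp only: Cons.IH)
  qed
  have c': "sum_list w + (a + c) = sum_list (a # w) + c" by simp
  show ?case by (simp only: esum.simps IH c c' right_diff_distrib)
qed simp

lemma ext_chi: "ext l r (\<lambda>lam. chi l i (int (sum_list lam)) * psi lam) w = chi l i (sum_list w - vac_sum r) * ext l r psi w"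
  unfolding ext_def sum_distrib_left
proof (intro sum.cong refl)
  fix lam assume "lam \<in> {lam \<in> parts r. int (sum_list lam) + vac_sum r = sum_list w}"
  then have "sum_list w - vac_sum r = int (sum_list lam)" by simp
  then show "qstraight l w (wedge_of r lam) * (chi l i (int (sum_list lam)) * psi lam) =
    chi l i (sum_list w - vac_sum r) * (qstraight l w (wedge_of r lam) * psi lam)" by (simp only: mult.left_commute)
qed

lemma fword_ext_row_fun:
  assumes l: "2 \<le> l" and i: "i < l" and r: "2 \<le> r" "(- int r) mod int l \<noteq> int i" and w: "length w = r"
  shows "fword l (int i) (ext l r row_fun) w = chi l i (sum_list w - vac_sum r) * ext l r row_fun w"
  unfolding ext_chi[symmetric]
proof (rule ext_eqI[OF l wfun_fword[OF l i r(2) wfun_ext[OF l]] _ w, symmetric])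
  fix lam assume lam: "lam \<in> parts r"
  then have p: "is_partition lam" "length lam \<le> r" by (auto simp: parts_def)
  show "fword l (int i) (ext l r row_fun) (wedge_of r lam) = chi l i (int (sum_list lam)) * row_fun lam"
  proof (cases "length lam = r")
    \<comment> \<open>\<open>Ff_fword\<close> covers lengths below r. At length r all letters are at
      least 2 - r, also after one of them has been raised, so both sides vanish.\<close>
    case True
    have ge: "2 - int r \<le> wedge_of r lam ! p" if "p < r" for p
    proof -
      have "0 < pg lam (r - 1 - p)" using pg_pos_iff[OF p(1)] True that by simp
      then show ?thesis using that by (simp add: nth_wedge_of)
    qed
    have "ext l r row_fun ((wedge_of r lam)[p := wedge_of r lam ! p + 1]) = 0" if "p < r" for p
    proof (rule ext_row_fun_high[OF l r(1)])
      fix p' assume "p' < r"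
      then show "2 - int r \<le> (wedge_of r lam)[p := wedge_of r lam ! p + 1] ! p'"
        using ge[of p'] by (cases "p' = p") simp_all
    qed simp
    then have "fword l (int i) (ext l r row_fun) (wedge_of r lam) = 0" unfolding fword_eq by (intro sum.neutral) auto
    then show ?thesis using True r by (simp add: row_fun_def)
  next
    case False
    then show ?thesis using Ff_fword[OF l i p(1) _ r(2), of row_fun] p(2) Ff_row_fun[OF l i p(1)] by simp
  qed
qed

lemma Ff_P0:
  assumes l: "2 \<le> l" and i: "i < l" and lam: "is_partition lam"
  shows "Ff l i (P0 l) lam = chi l i (int (sum_list lam)) * P0 l lam"
proof -
  obtain r where r: "max 1 (length lam) < r" "(- int r) mod int l \<noteq> int i" using exists_rank[OF l] by blast
  then have r': "2 \<le> r" "length lam < r" "lam \<in> parts r" using lam by (auto simp: parts_def)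
  define w where "w = wedge_of r lam"
  have w: "length w = r" "sum_list w - vac_sum r = int (sum_list lam)" using r' sum_wedge_of[of lam r] unfolding w_def by auto
  have "Ff l i (P0 l) lam = fword l (int i) (esum (int l) (ext l r row_fun)) w"
    unfolding Ff_fword[OF l i lam r'(2) r(2)] w_def[symmetric] by (rule fword_cong) (simp add: ext_P0[OF l] w)
  also have "\<dots> = esum (int l) (\<lambda>v. chi l i (sum_list v + (- vac_sum r)) * ext l r row_fun v) w"
    unfolding fword_esum by (rule esum_cong) (simp add: fword_ext_row_fun[OF l i r'(1) r(2)] w(1))
  also have "\<dots> = chi l i (int (sum_list lam)) * P0 l lam"
    unfolding esum_chi P0_eq[OF l r'(3)] w_def[symmetric] using w by simp
  finally show ?thesis .
qed

text \<open>h_j of the letter shifts applied to T, written through the transposed B_k by Newton's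
  recursion; \<open>ext_tow\<close> identifies the two descriptions.\<close>

fun tow :: "nat \<Rightarrow> (nat list \<Rightarrow> qf) \<Rightarrow> nat \<Rightarrow> nat list \<Rightarrow> qf" where
  "tow l T j = (if j = 0 then T else (\<lambda>lam. (\<Sum>k\<in>{1..j}. Bf l k (tow l T (j - k)) lam) / of_nat j))"

declare tow.simps [simp del]

lemma tow_0: "tow l T 0 = T" by (simp add: tow.simps)

lemma tow_rec: "of_nat j * tow l T j lam = (\<Sum>k\<in>{1..j}. Bf l k (tow l T (j - k)) lam)"
  by (subst tow.simps) simp

lemma Bf_cong:
  "(\<And>mu. is_partition mu \<Longrightarrow> int (sum_list mu) + int l * int k = int (sum_list lam) \<Longrightarrow> f mu = g mu) \<Longrightarrow> Bf l k f lam = Bf l k g lam"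
  unfolding Bf_def by (intro sum.cong) (auto simp: parts_def)

lemma Bf_scale: "Bf l k (\<lambda>mu. c * f mu) lam = c * Bf l k f lam"
  unfolding Bf_def sum_distrib_left by (simp add: mult.left_commute)

text \<open>The transpose of B_k relates sizes that differ by l * k, so size div l changes by
  exactly k, and along the recursion the twists add up to q^j.\<close>

lemma tow_scaled:
  assumes l: "0 < l"
  shows "qv ^ (sum_list lam div l) * tow l (\<lambda>lam. inverse (qv ^ (sum_list lam div l)) * T lam) j lam = qv ^ j * tow l T j lam"
proof (induction j arbitrary: lam rule: less_induct)
  case (less j)
  define U where "U = (\<lambda>lam. inverse (qv ^ (sum_list lam div l)) * T lam)"
  show ?case
  proof (cases "j = 0")
    case True
    then show ?thesis by (simp add: tow_0)
  next
    case False
    have "qv ^ (sum_list lam div l) * Bf l k (tow l U (j - k)) lam = qv ^ j * Bf l k (tow l T (j - k)) lam" if k: "k \<in> {1..j}" for k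
      unfolding Bf_scale[symmetric]
    proof (rule Bf_cong)
      fix mu assume "int (sum_list mu) + int l * int k = int (sum_list lam)"
      then have "sum_list lam = sum_list mu + k * l" by (metis mult.commute of_nat_add of_nat_eq_iff of_nat_mult)
      then have e: "sum_list lam div l = k + sum_list mu div l" using l by simp
      have "qv ^ (sum_list lam div l) * tow l U (j - k) mu = qv ^ k * (qv ^ (sum_list mu div l) * tow l U (j - k) mu)"
        unfolding e power_add by (simp only: mult.assoc)
      also have "\<dots> = qv ^ k * (qv ^ (j - k) * tow l T (j - k) mu)" using less[of "j - k" mu] k False unfolding U_def by simp
      also have "\<dots> = qv ^ j * tow l T (j - k) mu" using k by (simp flip: mult.assoc power_add)
      finally show "qv ^ (sum_list lam div l) * tow l U (j - k) mu = qv ^ j * tow l T (j - k) mu" .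
    qed
    then have "of_nat j * (qv ^ (sum_list lam div l) * tow l U j lam) = of_nat j * (qv ^ j * tow l T j lam)"
      unfolding mult.left_commute[of "of_nat j"] tow_rec sum_distrib_left by (intro sum.cong refl)
    then show ?thesis using False unfolding U_def by simp
  qed
qed

lemma ext_scale: "ext l r (\<lambda>lam. c * f lam) w = c * ext l r f w"
  unfolding ext_def sum_distrib_left by (simp add: mult.left_commute)

lemma ext_sum: "ext l r (\<lambda>lam. \<Sum>i\<in>I. f i lam) w = (\<Sum>i\<in>I. ext l r (f i) w)"
  unfolding ext_def sum_distrib_left by (rule sum.swap)

lemma ext_tow:
  assumes l: "2 \<le> l" and w: "length w = r"
  shows "ext l r (tow l T j) w = hsum (int l) j (ext l r T) w"
  using w
proof (induction j arbitrary: w rule: less_induct)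
  case (less j)
  show ?case
  proof (cases "j = 0")
    case True
    then show ?thesis by (simp add: tow_0 hsum_0)
  next
    case False
    have "of_nat j * ext l r (tow l T j) w = (\<Sum>k\<in>{1..j}. ext l r (Bf l k (tow l T (j - k))) w)"
      unfolding ext_scale[symmetric] tow_rec ext_sum ..
    also have "\<dots> = (\<Sum>k\<in>{1..j}. shift_sum (int l * int k) (ext l r (tow l T (j - k))) w)"
      by (intro sum.cong refl ext_Bf[OF l]) (auto simp: less.prems)
    also have "\<dots> = (\<Sum>k\<in>{1..j}. shift_sum (int l * int k) (hsum (int l) (j - k) (ext l r T)) w)"
    proof (intro sum.cong refl shift_sum_cong)
      fix k v assume "k \<in> {1..j}" "length (v :: int list) = length w"
      then show "ext l r (tow l T (j - k)) v = hsum (int l) (j - k) (ext l r T) v"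
        using less.prems False by (intro less.IH) auto
    qed
    also have "\<dots> = of_nat j * hsum (int l) j (ext l r T) w" by (rule hsum_newton[symmetric])
    finally show ?thesis using False by simp
  qed
qed

text \<open>The twist absorbs the eigenvalue q of \<open>chi\<close>, which occurs just when size
  div l increases. The remaining eigenvalues are 0 and 1 and hence invariant under inversion of
  q.\<close>

definition T0 :: "nat \<Rightarrow> nat list \<Rightarrow> qf" where
  "T0 l lam = inverse (qv ^ (sum_list lam div l)) * P0 l lam"

lemma row_fun_tow:
  assumes l: "2 \<le> l" and lam: "is_partition lam"
  shows "row_fun lam = (\<Sum>j\<le>sum_list lam div l. qv ^ (sum_list lam div l - j) * tow l (T0 l) j lam)"
proof -
  define r where "r = length lam"
  define N where "N = sum_list lam div l"
  define w where "w = wedge_of r lam"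
  have r: "lam \<in> parts r" using lam by (simp add: parts_def r_def)
  have w: "length w = r" "sum_list w = int (sum_list lam) + vac_sum r" unfolding w_def using sum_wedge_of[of lam r] by (auto simp: r_def)
  have "row_fun lam = ext l r row_fun w" unfolding w_def by (rule ext_wedge_of[OF l r, symmetric])
  also have "\<dots> = (\<Sum>j\<le>N. hsum (int l) j (esum (int l) (ext l r row_fun)) w)"
  proof (rule hsum_esum[symmetric, where s = "vac_sum r"])
    fix v :: "int list" assume "sum_list v < vac_sum r"
    then have "{lam \<in> parts r. int (sum_list lam) + vac_sum r = sum_list v} = {}" by auto
    then show "ext l r row_fun v = 0" unfolding ext_def by (simp only: sum.empty)
  next
    have "sum_list lam < l * (N + 1)" unfolding N_def using l dividend_less_times_div[of l "sum_list lam"] by simp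
    then have "int (sum_list lam) < int l * (int N + 1)" by (metis of_nat_1 of_nat_add of_nat_less_iff of_nat_mult)
    then show "sum_list w - int l * (int N + 1) < vac_sum r" unfolding w(2) by linarith
  qed simp
  also have "\<dots> = (\<Sum>j\<le>N. tow l (P0 l) j lam)"
  proof (intro sum.cong refl)
    fix j
    have "hsum (int l) j (esum (int l) (ext l r row_fun)) w = hsum (int l) j (ext l r (P0 l)) w"
      by (rule hsum_cong) (simp add: ext_P0[OF l] w(1))
    also have "\<dots> = ext l r (tow l (P0 l) j) w" by (rule ext_tow[OF l w(1), symmetric])
    also have "\<dots> = tow l (P0 l) j lam" unfolding w_def by (rule ext_wedge_of[OF l r])
    finally show "hsum (int l) j (esum (int l) (ext l r row_fun)) w = tow l (P0 l) j lam" .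
  qed
  also have "\<dots> = (\<Sum>j\<le>N. qv ^ (N - j) * tow l (T0 l) j lam)"
  proof (intro sum.cong refl)
    fix j assume "j \<in> {..N}"
    then have "qv ^ j * (qv ^ (N - j) * tow l (T0 l) j lam) = qv ^ N * tow l (T0 l) j lam"
      by (simp flip: mult.assoc power_add)
    also have "\<dots> = qv ^ j * tow l (P0 l) j lam" unfolding N_def T0_def[abs_def] by (rule tow_scaled) (use l in simp)
    finally show "tow l (P0 l) j lam = qv ^ (N - j) * tow l (T0 l) j lam" by simp
  qed
  finally show ?thesis unfolding N_def .
qed

lemma T0_vanish: "2 \<le> l \<Longrightarrow> is_partition lam \<Longrightarrow> l \<le> pg lam 0 \<Longrightarrow> T0 l lam = 0"
  unfolding T0_def by (simp add: P0_vanish)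

lemma T0_Nil: "2 \<le> l \<Longrightarrow> T0 l [] = 1"
  using ext_wedge_of[of l "[]" 0 row_fun] by (simp add: T0_def P0_def parts_def is_partition_def row_fun_def)

lemma div_Suc_chi: "2 \<le> l \<Longrightarrow> n mod l = i \<Longrightarrow> inverse (qv ^ (Suc n div l)) * chi l i (int n) = inverse (qv ^ (n div l))"
proof -
  assume l: "2 \<le> l" and i: "n mod l = i"
  have m: "int n mod int l = int i" "(int n + 1) mod int l = int (Suc n mod l)" using i by (auto simp: zmod_int add.commute)
  show ?thesis
  proof (cases "Suc n mod l = 0")
    case True
    then have "Suc n div l = Suc (n div l)" by (simp add: div_Suc)
    then show ?thesis unfolding chi_def m using True by simp
  next
    case False
    then have "Suc n div l = n div l" by (simp add: div_Suc)
    then show ?thesis unfolding chi_def m using False by simp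
  qed
qed

lemma Ff_T0:
  assumes l: "2 \<le> l" and i: "i < l" and lam: "is_partition lam"
  shows "Ff l i (T0 l) lam = (if sum_list lam mod l = i then T0 l lam else 0)"
proof -
  have "Ff l i (T0 l) lam = inverse (qv ^ (Suc (sum_list lam) div l)) * Ff l i (P0 l) lam"
    unfolding Ff_def T0_def sum_distrib_left by (intro sum.cong refl) (auto simp: sum_add_box)
  also have "\<dots> = inverse (qv ^ (Suc (sum_list lam) div l)) * chi l i (int (sum_list lam)) * P0 l lam"
    unfolding Ff_P0[OF assms] by simp
  also have "\<dots> = (if sum_list lam mod l = i then T0 l lam else 0)"
  proof (cases "sum_list lam mod l = i")
    case True
    then show ?thesis unfolding div_Suc_chi[OF l True] T0_def by simp
  next
    case False
    then have "int (sum_list lam) mod int l \<noteq> int i" by (metis of_nat_eq_iff zmod_int)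
    then show ?thesis using False by (simp add: chi_def)
  qed
  finally show ?thesis .
qed

section \<open>The eigenfunctional in terms of holes of the beta set\<close>

definition hole_dist :: "nat \<Rightarrow> int \<Rightarrow> int \<Rightarrow> nat" where
  "hole_dist l x y = nat (\<bar>x - y\<bar> div int l)"

definition hole_exp :: "nat \<Rightarrow> int set \<Rightarrow> nat" where
  "hole_exp l H = (\<Sum>(x,y)\<in>{(x,y)\<in>H \<times> H. x < y}. hole_dist l x y)"

text \<open>H stands for the l - 1 holes of a beta set. If their residues are distinct, exactly one
  residue is missing, and it turns out to be the one residue whose F_i acts by 1 rather than
  0.\<close>

definition hole_fun :: "nat \<Rightarrow> int set \<Rightarrow> qf" where
  "hole_fun l H = (if inj_on (\<lambda>x. x mod int l) H then (- qv) ^ hole_exp l H else 0)"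

lemma hole_exp_insert:
  assumes "finite S" "u \<notin> S"
  shows "hole_exp l (insert u S) = hole_exp l S + (\<Sum>x\<in>S. hole_dist l u x)"
proof -
  define d where "d = (\<lambda>(x,y). hole_dist l x y)"
  define A where "A = {(x,y)\<in>S \<times> S. x < y}"
  define B where "B = (\<lambda>x. (x, u)) ` {x\<in>S. x < u}"
  define C where "C = (\<lambda>x. (u, x)) ` {x\<in>S. u < x}"
  have "finite (S \<times> S)" using assms by blast
  then have fin: "finite A" "finite B" "finite C" unfolding A_def B_def C_def using assms by (auto intro: finite_subset[of _ "S \<times> S"])
  have "{(x,y)\<in>insert u S \<times> insert u S. x < y} = A \<union> (B \<union> C)" unfolding A_def B_def C_def by auto
  then have "hole_exp l (insert u S) = sum d (A \<union> (B \<union> C))" unfolding hole_exp_def d_def by simp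
  also have "\<dots> = sum d A + sum d (B \<union> C)" by (rule sum.union_disjoint) (use fin assms in \<open>auto simp: A_def B_def C_def\<close>)
  also have "sum d (B \<union> C) = sum d B + sum d C" by (rule sum.union_disjoint) (use fin assms in \<open>auto simp: B_def C_def\<close>)
  also have "sum d B = (\<Sum>x\<in>{x\<in>S. x < u}. hole_dist l u x)"
    unfolding B_def by (subst sum.reindex) (auto simp: inj_on_def d_def hole_dist_def abs_minus_commute)
  also have "sum d C = (\<Sum>x\<in>{x\<in>S. u < x}. hole_dist l u x)"
    unfolding C_def by (subst sum.reindex) (auto simp: inj_on_def d_def)
  also have "(\<Sum>x\<in>{x\<in>S. x < u}. hole_dist l u x) + (\<Sum>x\<in>{x\<in>S. u < x}. hole_dist l u x) = (\<Sum>x\<in>S. hole_dist l u x)"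
  proof -
    have "S = {x\<in>S. x < u} \<union> {x\<in>S. u < x}" using assms(2) by (auto simp: less_le)
    then have "(\<Sum>x\<in>S. hole_dist l u x) = (\<Sum>x\<in>{x\<in>S. x < u} \<union> {x\<in>S. u < x}. hole_dist l u x)" by simp
    also have "\<dots> = (\<Sum>x\<in>{x\<in>S. x < u}. hole_dist l u x) + (\<Sum>x\<in>{x\<in>S. u < x}. hole_dist l u x)"
      by (rule sum.union_disjoint) (use assms in auto)
    finally show ?thesis by simp
  qed
  finally show ?thesis unfolding A_def hole_exp_def d_def .
qed

lemma div_pred: "0 < l \<Longrightarrow> z mod int l \<noteq> 0 \<Longrightarrow> (z - 1) div int l = z div int l"
proof -
  assume l: "0 < l" and z: "z mod int l \<noteq> 0"
  have "0 \<le> z mod int l" "z mod int l < int l" using l by simp_all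
  then have b: "0 \<le> z mod int l - 1" "z mod int l - 1 < int l" using z by linarith+
  have "z - 1 = (z mod int l - 1) + z div int l * int l" using div_mult_mod_eq[of z "int l"] by linarith
  then have "(z - 1) div int l = ((z mod int l - 1) + z div int l * int l) div int l" by (rule arg_cong)
  also have "\<dots> = z div int l + (z mod int l - 1) div int l" by (rule div_mult_self1) (use l in simp)
  also have "(z mod int l - 1) div int l = 0" using b by simp
  finally show ?thesis by simp
qed

lemma diff_mod_0_iff: "(x - y) mod int l = 0 \<longleftrightarrow> x mod int l = y mod int l"
  by (simp only: mod_eq_dvd_iff dvd_eq_mod_eq_0)

lemma hole_dist_pred:
  assumes l: "0 < l" and u: "u mod int l \<noteq> b mod int l" "(u - 1) mod int l \<noteq> b mod int l"
  shows "hole_dist l (u - 1) b = hole_dist l u b"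
proof (cases "b < u")
  case True
  have "(u - b) mod int l \<noteq> 0" using u(1) by (simp only: diff_mod_0_iff not_False_eq_True)
  then have "(u - b - 1) div int l = (u - b) div int l" by (rule div_pred[OF l])
  moreover have "\<bar>u - 1 - b\<bar> = u - b - 1" "\<bar>u - b\<bar> = u - b" using True by auto
  ultimately show ?thesis unfolding hole_dist_def by simp
next
  case False
  have "(b - (u - 1)) mod int l \<noteq> 0" using u(2)[symmetric] by (simp only: diff_mod_0_iff not_False_eq_True)
  then have "(b - (u - 1) - 1) div int l = (b - (u - 1)) div int l" by (rule div_pred[OF l])
  moreover have "\<bar>u - 1 - b\<bar> = b - (u - 1)" "\<bar>u - b\<bar> = b - (u - 1) - 1" using False by auto
  ultimately show ?thesis unfolding hole_dist_def by simp
qed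

lemma hole_fun_insert2:
  assumes B: "finite B" "x \<notin> B" "y \<notin> B" "x \<noteq> y"
  shows "hole_fun l (insert x (insert y B)) = (if inj_on (\<lambda>x. x mod int l) (insert x (insert y B))
     then (- qv) ^ (hole_exp l B + (\<Sum>b\<in>B. hole_dist l y b) + (\<Sum>b\<in>B. hole_dist l x b) + hole_dist l x y) else 0)"
proof -
  have "hole_exp l (insert x (insert y B)) = hole_exp l B + (\<Sum>b\<in>B. hole_dist l y b) + (\<Sum>b\<in>B. hole_dist l x b) + hole_dist l x y"
    using hole_exp_insert[of "insert y B" x l] hole_exp_insert[of B y l] B by simp
  then show ?thesis unfolding hole_fun_def by simp
qed

lemma hole_fun_dup: "x \<in> H \<Longrightarrow> y \<in> H \<Longrightarrow> x \<noteq> y \<Longrightarrow> x mod int l = y mod int l \<Longrightarrow> hole_fun l H = 0"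
  unfolding hole_fun_def inj_on_def by auto

text \<open>If two holes share the residue \<open>i + 1\<close>, the two terms moving one of them differ by the factor \<open>- q\<close> and cancel.\<close>

lemma hole_sum:
  assumes l: "2 \<le> l" and i: "i < l" and H: "finite H" "card H = l - 1"
  shows "(\<Sum>h\<in>{h\<in>H. (h - 1) mod int l = int i \<and> h - 1 \<notin> H}.
      qv powi (- (\<Sum>x\<in>{x\<in>H. x < h - 1}. wt l (int i) x)) * hole_fun l (insert (h - 1) (H - {h})))
    = (if \<forall>x\<in>H. x mod int l \<noteq> int i then hole_fun l H else 0)" (is "?L = _")
proof -
  define i' where "i' = (int i + 1) mod int l"
  define A where "A = {h\<in>H. h mod int l = i'}"
  define B where "B = H - A"
  have ii: "i' \<noteq> int i" 
  proof
    assume "i' = int i"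
    then have "(int i + 1) mod int l = int i mod int l" using i unfolding i'_def by simp
    then have "int l dvd int i + 1 - int i" using mod_eq_dvd_iff by blast
    then show False using l by simp
  qed
  have pred: "(h - 1) mod int l = int i \<longleftrightarrow> h mod int l = i'" for h
    unfolding i'_def by (rule mod_shift_iff) (use i in auto)
  show ?thesis
  proof (cases "\<forall>x\<in>H. x mod int l \<noteq> int i")
    case False
    then obtain z where z: "z \<in> H" "z mod int l = int i" by blast
    have "hole_fun l (insert (h - 1) (H - {h})) = 0" if h: "h \<in> H" "(h - 1) mod int l = int i" "h - 1 \<notin> H" for h
    proof (rule hole_fun_dup[of z _ "h - 1"])
      have "h \<noteq> z" using z(2) h(2) pred ii by metis
      then show "z \<in> insert (h - 1) (H - {h})" using z by simp
    qed (use h z in auto)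
    then have "?L = 0" by (intro sum.neutral) auto
    then show ?thesis by (simp only: if_not_P[OF False])
  next
    case True
    have S: "{h\<in>H. (h - 1) mod int l = int i \<and> h - 1 \<notin> H} = A"
      unfolding A_def pred using True pred by auto
    have fA: "finite A" "finite B" "H = A \<union> B" "A \<inter> B = {}" unfolding A_def B_def using H by auto
    have Bm: "b mod int l \<noteq> i'" "b mod int l \<noteq> int i" if "b \<in> B" for b using that True unfolding B_def A_def by auto
    have Am: "a mod int l = i'" "(a - 1) mod int l = int i" "a \<notin> B" "a - 1 \<notin> B" "a - 1 \<notin> A" if "a \<in> A" for a
    proof -
      have a: "a \<in> H" "a mod int l = i'" using that unfolding A_def by blast+
      show m: "a mod int l = i'" by (rule a(2))
      show p: "(a - 1) mod int l = int i" unfolding pred by (rule a(2))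
      show "a \<notin> B" using Bm(1) m by blast
      show "a - 1 \<notin> B" using Bm(2) p by blast
      show "a - 1 \<notin> A" using p ii unfolding A_def by (metis (mono_tags, lifting) mem_Collect_eq)
    qed
    have dB: "(\<Sum>b\<in>B. hole_dist l (a - 1) b) = (\<Sum>b\<in>B. hole_dist l a b)" if "a \<in> A" for a
    proof (intro sum.cong refl hole_dist_pred)
      fix b assume "b \<in> B"
      then show "a mod int l \<noteq> b mod int l" "(a - 1) mod int l \<noteq> b mod int l" using Bm[of b] Am(1,2)[OF that] by metis+
    qed (use l in simp)
    have w: "(\<Sum>x\<in>{x\<in>H. x < h - 1}. wt l (int i) x) = - int (card {x\<in>A. x < h - 1})" if "h \<in> A" for h
    proof -
      have "(\<Sum>x\<in>{x\<in>H. x < h - 1}. wt l (int i) x) = (\<Sum>x\<in>{x\<in>A. x < h - 1}. - 1)"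
        by (rule sum.mono_neutral_cong_right) (use H True in \<open>auto simp: A_def wt_def i'_def\<close>)
      then show ?thesis by simp
    qed
    have L: "?L = (\<Sum>h\<in>A. qv ^ card {x\<in>A. x < h - 1} * hole_fun l (insert (h - 1) (H - {h})))"
      unfolding S by (intro sum.cong refl) (simp add: w)
    have injB: "inj_on (\<lambda>x. x mod int l) (insert a B) \<longleftrightarrow> inj_on (\<lambda>x. x mod int l) B" if "\<And>b. b \<in> B \<Longrightarrow> a mod int l \<noteq> b mod int l" for a
    proof -
      have "a \<notin> B" using that by blast
      then have "B - {a} = B" by simp
      moreover have "a mod int l \<notin> (\<lambda>x. x mod int l) ` B" using that by blast
      ultimately show ?thesis unfolding inj_on_insert by simp
    qed
    consider "card A = 0" | "card A = 1" | "card A = 2" | "3 \<le> card A" by linarith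
    then show ?thesis
    proof cases
      \<comment> \<open>Without holes of residue i or i + 1, the l - 1 holes share l - 2 residues,
        so \<open>hole_fun\<close> vanishes at H as well.\<close>
      case 1
      then have A0: "A = {}" using fA by simp
      have "\<not> inj_on (\<lambda>x. x mod int l) H"
      proof
        assume "inj_on (\<lambda>x. x mod int l) H"
        then have "card ((\<lambda>x. x mod int l) ` H) = l - 1" using H card_image by metis
        moreover have "(\<lambda>x. x mod int l) ` H \<subseteq> {0..<int l} - {int i, i'}"
          using Bm A0 fA l by auto
        then have "card ((\<lambda>x. x mod int l) ` H) \<le> card ({0..<int l} - {int i, i'})" by (intro card_mono) auto
        moreover have "card ({0..<int l} - {int i, i'}) = l - 2"
          using i ii l by (subst card_Diff_subset) (auto simp: i'_def)
        ultimately show False using l by linarith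
      qed
      then show ?thesis unfolding L A0 using True by (simp add: hole_fun_def)
    next
      \<comment> \<open>The only hole of residue i + 1 moves to the free residue i, and no distance
        to another hole changes its integer part modulo l.\<close>
      case 2
      then obtain h where A1: "A = {h}" by (rule card_1_singletonE)
      have h: "h \<in> A" using A1 by simp
      have HB: "H = insert h B" "H - {h} = B" using fA A1 Am[OF h] by auto
      have e: "hole_exp l (insert (h - 1) B) = hole_exp l (insert h B)"
        using hole_exp_insert[OF fA(2), of h] hole_exp_insert[OF fA(2), of "h - 1"] Am[OF h] dB[OF h] by simp
      have "inj_on (\<lambda>x. x mod int l) (insert (h - 1) B) \<longleftrightarrow> inj_on (\<lambda>x. x mod int l) B"
        by (rule injB) (use Am[OF h] Bm in metis)
      moreover have "inj_on (\<lambda>x. x mod int l) (insert h B) \<longleftrightarrow> inj_on (\<lambda>x. x mod int l) B"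
        by (rule injB) (use Am[OF h] Bm in metis)
      ultimately have f: "hole_fun l (insert (h - 1) B) = hole_fun l H" unfolding HB(1) hole_fun_def e by simp
      have c0: "{x\<in>A. x < h - 1} = {}" unfolding A1 by auto
      have "?L = (\<Sum>x\<in>{h}. qv ^ card {y\<in>A. y < x - 1} * hole_fun l (insert (x - 1) (H - {x})))"
        unfolding L by (rule sum.cong[OF A1 refl])
      then have "?L = hole_fun l H" by (simp add: c0 HB(2) f)
      then show ?thesis using True by simp
    next
      case 3
      then obtain a b where "A = {a, b}" "a \<noteq> b" by (auto simp: card_2_iff)
      then have "A = {min a b, max a b}" "min a b < max a b" by (auto simp: min_def max_def)
      then obtain h h' where A2: "A = {h, h'}" "h < h'" by blast
      have h: "h \<in> A" "h' \<in> A" using A2 by auto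
      have "int l dvd h' - h" using Am(1)[OF h(1)] Am(1)[OF h(2)] mod_eq_dvd_iff by metis
      then obtain k where k: "h' - h = int l * k" by blast
      then have "0 < int l * k" using A2(2) by linarith
      then have k0: "0 < k" using l by (simp add: zero_less_mult_iff)
      then have "int l * 1 \<le> int l * k" by (intro mult_left_mono) auto
      then have gap: "h + int l \<le> h'" using k by simp
      have H1: "insert (h - 1) (H - {h}) = insert (h - 1) (insert h' B)" using fA A2 Am[OF h(1)] by auto
      have H2: "insert (h' - 1) (H - {h'}) = insert (h' - 1) (insert h B)" using fA A2 Am[OF h(2)] by auto
      have c1: "{x\<in>A. x < h - 1} = {}" unfolding A2(1) using A2(2) by auto
      have c2: "{x\<in>A. x < h' - 1} = {h}" unfolding A2(1) using gap l by auto
      have d1: "hole_dist l (h - 1) h' = nat k"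
      proof -
        have "\<bar>h - 1 - h'\<bar> = 1 + k * int l" using k A2(2) by (simp add: mult.commute)
        moreover have "(1 + k * int l) div int l = k + 1 div int l" by (rule div_mult_self1) (use l in simp)
        moreover have "1 div int l = 0" using l by simp
        ultimately show ?thesis unfolding hole_dist_def by simp
      qed
      have d2: "hole_dist l (h' - 1) h = nat k - 1"
      proof -
        have "\<bar>h' - 1 - h\<bar> = h' - h - 1" using gap l by linarith
        also have "\<dots> = (int l - 1) + (k - 1) * int l" unfolding k by (simp add: algebra_simps)
        finally have "\<bar>h' - 1 - h\<bar> = (int l - 1) + (k - 1) * int l" .
        moreover have "((int l - 1) + (k - 1) * int l) div int l = (k - 1) + (int l - 1) div int l" by (rule div_mult_self1) (use l in simp)
        moreover have "(int l - 1) div int l = 0" using l by simp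
        ultimately show ?thesis unfolding hole_dist_def using k0 by simp
      qed
      have injBB: "inj_on (\<lambda>x. x mod int l) (insert a (insert b B)) \<longleftrightarrow> inj_on (\<lambda>x. x mod int l) B"
        if "a mod int l = int i" "b mod int l = i'" for a b
      proof -
        have "b mod int l \<noteq> x mod int l" if "x \<in> B" for x using Bm[OF that] \<open>b mod int l = i'\<close> by simp
        note iB = injB[OF this]
        have "a mod int l \<noteq> x mod int l" if "x \<in> insert b B" for x
          using that Bm(2)[of x] ii \<open>a mod int l = int i\<close> \<open>b mod int l = i'\<close> by (cases "x = b") auto
        then have "a mod int l \<notin> (\<lambda>x. x mod int l) ` insert b B" by blast
        moreover have "a \<notin> insert b B" using calculation by blast
        then have "insert b B - {a} = insert b B" by simp
        ultimately show ?thesis unfolding inj_on_insert[of _ a] using iB by simp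
      qed
      define X where "X = hole_exp l B + (\<Sum>b\<in>B. hole_dist l h b) + (\<Sum>b\<in>B. hole_dist l h' b) + (nat k - 1)"
      have f1: "hole_fun l (insert (h - 1) (insert h' B)) = (if inj_on (\<lambda>x. x mod int l) B then (- qv) ^ Suc X else 0)"
      proof -
        have "hole_exp l B + (\<Sum>b\<in>B. hole_dist l h' b) + (\<Sum>b\<in>B. hole_dist l (h - 1) b) + hole_dist l (h - 1) h' = Suc X"
          unfolding d1 dB[OF h(1)] X_def using k0 by simp
        then show ?thesis using hole_fun_insert2[OF fA(2), of "h - 1" h' l] Am[OF h(1)] Am[OF h(2)] A2(2) injBB[of "h - 1" h'] by simp
      qed
      have f2: "hole_fun l (insert (h' - 1) (insert h B)) = (if inj_on (\<lambda>x. x mod int l) B then (- qv) ^ X else 0)"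
      proof -
        have "hole_exp l B + (\<Sum>b\<in>B. hole_dist l h b) + (\<Sum>b\<in>B. hole_dist l (h' - 1) b) + hole_dist l (h' - 1) h = X"
          unfolding d2 dB[OF h(2)] X_def by simp
        moreover have "h' - 1 \<noteq> h" using gap l by simp
        ultimately show ?thesis using hole_fun_insert2[OF fA(2), of "h' - 1" h l] Am[OF h(1)] Am[OF h(2)] injBB[of "h' - 1" h] by simp
      qed
      have "?L = qv ^ 0 * hole_fun l (insert (h - 1) (insert h' B)) + qv ^ 1 * hole_fun l (insert (h' - 1) (insert h B))"
      proof -
        have "?L = (\<Sum>x\<in>{h, h'}. qv ^ card {y\<in>A. y < x - 1} * hole_fun l (insert (x - 1) (H - {x})))" unfolding L by (rule sum.cong[OF A2(1) refl])
        also have "\<dots> = qv ^ card {y\<in>A. y < h - 1} * hole_fun l (insert (h - 1) (H - {h})) + qv ^ card {y\<in>A. y < h' - 1} * hole_fun l (insert (h' - 1) (H - {h'}))"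
          using A2(2) by simp
        finally show ?thesis unfolding c1 c2 H1 H2 by simp
      qed
      also have "\<dots> = 0" unfolding f1 f2 by simp
      finally have "?L = 0" .
      moreover have "hole_fun l H = 0" by (rule hole_fun_dup[of h _ h']) (use h A2(2) Am in \<open>auto simp: fA(3)\<close>)
      ultimately show ?thesis by simp
    next
      \<comment> \<open>Whichever hole is moved, two others of residue i + 1 remain.\<close>
      case 4
      have dup: "\<exists>x y. x \<in> A - {h} \<and> y \<in> A - {h} \<and> x \<noteq> y" for h
      proof -
        have "2 \<le> card (A - {h})" using 4 fA(1) by (cases "h \<in> A") auto
        then show ?thesis using card_le_Suc0_iff_eq[of "A - {h}"] fA(1) by fastforce
      qed
      have "hole_fun l (insert (h - 1) (H - {h})) = 0" for h
      proof -
        obtain x y where "x \<in> A - {h}" "y \<in> A - {h}" "x \<noteq> y" using dup by blast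
        then show ?thesis by (intro hole_fun_dup[of x _ y]) (auto simp: A_def)
      qed
      then have "?L = 0" unfolding L by simp
      moreover obtain x y where "x \<in> A - {0}" "y \<in> A - {0}" "x \<noteq> y" using dup by blast
      then have "hole_fun l H = 0" by (intro hole_fun_dup[of x _ y]) (auto simp: A_def)
      ultimately show ?thesis by simp
    qed
  qed
qed

text \<open>Below the window every position is occupied, and above it none is if the first row is
  shorter than l. So the window contains all holes below l, whatever the rank.\<close>

definition holes :: "nat \<Rightarrow> nat \<Rightarrow> nat list \<Rightarrow> int set" where
  "holes l r lam = {1 - int r..int l - 1} - set (wedge_of r lam)"

definition Tex :: "nat \<Rightarrow> nat list \<Rightarrow> qf" where
  "Tex l lam = (if pg lam 0 < l then hole_fun l (holes l (length lam) lam) else 0)"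

lemma holes_stable:
  assumes "2 \<le> l" "length lam \<le> r"
  shows "holes l r lam = holes l (length lam) lam"
  using assms(2)
proof (induction rule: dec_induct)
  case (step n)
  have "{1 - int (Suc n)..int l - 1} = insert (- int n) {1 - int n..int l - 1}" using assms(1) by auto
  then have "holes l (Suc n) lam = holes l n lam"
    unfolding holes_def wedge_of_Suc_long[OF step.hyps(1)] by auto
  then show ?case using step.IH by simp
qed simp

lemma Tex_wedge:
  assumes l: "2 \<le> l" and r: "0 < r" and lam: "lam \<in> parts r"
  shows "Tex l lam = (if \<forall>x\<in>set (wedge_of r lam). x < int l then hole_fun l ({1 - int r..int l - 1} - set (wedge_of r lam)) else 0)"
proof -
  have p: "is_partition lam" "length lam \<le> r" using lam by (auto simp: parts_def)
  have "pg lam 0 < l \<longleftrightarrow> (\<forall>x\<in>set (wedge_of r lam). x < int l)"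
  proof
    assume a: "pg lam 0 < l"
    show "\<forall>x\<in>set (wedge_of r lam). x < int l"
    proof
      fix x assume "x \<in> set (wedge_of r lam)"
      then obtain j where "j < r" "x = int (pg lam j) - int j" by (auto simp: wedge_of_def)
      then show "x < int l" using a pg_antimono[OF p(1), of 0 j] by simp
    qed
  next
    assume "\<forall>x\<in>set (wedge_of r lam). x < int l"
    moreover have "wedge_of r lam ! (r - 1) \<in> set (wedge_of r lam)" using r by (intro nth_mem) simp
    ultimately show "pg lam 0 < l" using wedge_of_last[OF r, of lam] by auto
  qed
  then show ?thesis unfolding Tex_def holes_stable[OF l p(2), symmetric] unfolding holes_def by simp
qed

lemma wt_telescope:
  assumes i: "i < l"
  shows "(\<Sum>x\<in>{a..<a + int n}. wt l (int i) x) = (if (a + int n - 1) mod int l = int i then 1 else 0) - (if (a - 1) mod int l = int i then 1 else 0)"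
proof (induction n)
  case (Suc n)
  have "{a..<a + int (Suc n)} = insert (a + int n) {a..<a + int n}" by auto
  then have "(\<Sum>x\<in>{a..<a + int (Suc n)}. wt l (int i) x) = wt l (int i) (a + int n) + (\<Sum>x\<in>{a..<a + int n}. wt l (int i) x)" by simp
  moreover have "wt l (int i) (a + int n) = (if (a + int n) mod int l = int i then 1 else 0) - (if (a + int n - 1) mod int l = int i then 1 else 0)"
    unfolding wt_def using mod_shift_iff[of "int i" l "a + int n"] i by simp
  moreover have "a + int (Suc n) - 1 = a + int n" by simp
  ultimately show ?case unfolding Suc.IH by (simp only: add_diff_cancel_left' diff_add_cancel add_diff_eq)
qed simp

lemma holes_card:
  assumes l: "2 \<le> l" and lam: "is_partition lam" "length lam \<le> r" "pg lam 0 < l" "0 < r"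
  shows "set (wedge_of r lam) \<subseteq> {1 - int r..int l - 1}" "card (holes l r lam) = l - 1"
    "\<Sum>(holes l r lam) = \<Sum>{1..int l - 1} - int (sum_list lam)"
proof -
  have d: "distinct (wedge_of r lam)" using wedge_of_sorted[OF lam(1), of r] strict_sorted_iff by blast
  show sub: "set (wedge_of r lam) \<subseteq> {1 - int r..int l - 1}"
  proof
    fix x assume "x \<in> set (wedge_of r lam)"
    then obtain j where "j < r" "x = int (pg lam j) - int j" by (auto simp: wedge_of_def)
    then show "x \<in> {1 - int r..int l - 1}" using lam(3) pg_antimono[OF lam(1), of 0 j] by auto
  qed
  show "card (holes l r lam) = l - 1"
    unfolding holes_def using distinct_card[OF d] l by (subst card_Diff_subset[OF _ sub]) auto
  have "\<Sum>{1 - int r..int l - 1} = \<Sum>{1 - int r..0} + \<Sum>{1..int l - 1}"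
  proof -
    have "{1 - int r..int l - 1} = {1 - int r..0} \<union> {1..int l - 1}" using l lam(4) by auto
    then show ?thesis by (simp only:) (rule sum.union_disjoint, auto)
  qed
  moreover have "\<Sum>{1 - int r..0} = vac_sum r" unfolding vac_sum_def
    by (rule sum.reindex_bij_witness[of _ "\<lambda>j. - int j" "\<lambda>x. nat (- x)"]) auto
  moreover have "\<Sum>(set (wedge_of r lam)) = int (sum_list lam) + vac_sum r"
    unfolding sum_wedge_of[OF lam(2), symmetric] by (rule distinct_sum_list_conv_Sum[OF d, symmetric])
  moreover have "\<Sum>(holes l r lam) = \<Sum>{1 - int r..int l - 1} - \<Sum>(set (wedge_of r lam))"
    unfolding holes_def by (rule sum_diff) (use sub in auto)
  ultimately show "\<Sum>(holes l r lam) = \<Sum>{1..int l - 1} - int (sum_list lam)" by simp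
qed

text \<open>The residues of H add up to the sum of all residues minus the missing one, while the sum
  of H is that of the vacuum holes minus n; comparison modulo l identifies the missing residue with
  n mod l.\<close>

lemma missing_residue:
  assumes l: "2 \<le> l" and i: "i < l" and H: "finite H" "card H = l - 1" "inj_on (\<lambda>x. x mod int l) H"
    and s: "\<Sum>H = \<Sum>{1..int l - 1} - int n"
  shows "(\<forall>x\<in>H. x mod int l \<noteq> int i) \<longleftrightarrow> n mod l = i"
proof -
  define R where "R = (\<lambda>x. x mod int l) ` H"
  have R: "R \<subseteq> {0..<int l}" "card R = l - 1" "finite R" unfolding R_def using l H card_image[OF H(3)] by auto
  have "card ({0..<int l} - R) = 1" using R l by (subst card_Diff_subset) auto
  then obtain c where c: "{0..<int l} - R = {c}" by (rule card_1_singletonE)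
  have c0: "0 \<le> c" "c < int l" "c \<notin> R" using c by auto
  have "\<Sum>{0..<int l} - \<Sum>R = c" using sum_diff[of "{0..<int l}" R "\<lambda>x. x"] R c by simp
  moreover have "\<Sum>{0..<int l} = \<Sum>{1..int l - 1}"
    by (rule sum.mono_neutral_right) auto
  ultimately have SR: "\<Sum>R = \<Sum>{1..int l - 1} - c" by simp
  have "\<Sum>R = (\<Sum>x\<in>H. x mod int l)" unfolding R_def by (rule sum.reindex_cong[OF H(3)]) auto
  then have "\<Sum>R mod int l = \<Sum>H mod int l" by (simp only: mod_sum_eq)
  then have "int l dvd (\<Sum>{1..int l - 1} - c) - (\<Sum>{1..int l - 1} - int n)" unfolding SR s by (simp only: mod_eq_dvd_iff)
  then have "int l dvd int n - c" by simp
  then have "int n mod int l = c mod int l" by (simp only: mod_eq_dvd_iff)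
  then have nc: "int (n mod l) = c" using c0 by (simp add: zmod_int)
  have "(\<forall>x\<in>H. x mod int l \<noteq> int i) \<longleftrightarrow> int i \<notin> R" unfolding R_def image_iff by metis
  also have "\<dots> \<longleftrightarrow> int i \<in> {0..<int l} - R" using i by simp
  also have "\<dots> \<longleftrightarrow> int i = c" unfolding c by simp
  finally show ?thesis using nc by auto
qed

text \<open>Adding a box moves a letter up by one, hence a hole down by one. Over a full interval of
  positions the weights telescope to zero, so the exponent of q collected from the letters to the
  left is minus the one collected from the holes, which is the form required by
  \<open>hole_sum\<close>.\<close>

lemma Ff_Tex:
  assumes l: "2 \<le> l" and i: "i < l" and lam: "is_partition lam" "pg lam 0 < l"
  shows "Ff l i (Tex l) lam = (if sum_list lam mod l = i then Tex l lam else 0)"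
proof -
  obtain r where r: "length lam < r" "(- int r) mod int l \<noteq> int i" using exists_rank[OF l] by blast
  have r0: "0 < r" "length lam \<le> r" using r by auto
  define w where "w = wedge_of r lam"
  define W where "W = set w"
  define I where "I = {1 - int r..int l - 1}"
  define H where "H = holes l r lam"
  define F where "F = (\<lambda>h. qv powi (- (\<Sum>x\<in>{x\<in>H. x < h - 1}. wt l (int i) x)) * hole_fun l (insert (h - 1) (H - {h})))"
  note hc = holes_card[OF l lam(1) r0(2) lam(2) r0(1)]
  have lw: "length w = r" unfolding w_def by simp
  have sw: "sorted_wrt (<) w" unfolding w_def by (rule wedge_of_sorted[OF lam(1)])
  have nth_less: "w ! a < w ! b" if "a < b" "b < r" for a b using sw that lw by (simp add: sorted_wrt_iff_nth_less)
  have WI: "W \<subseteq> I" unfolding W_def w_def I_def by (rule hc(1))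
  have H: "H = I - W" unfolding H_def holes_def I_def W_def w_def ..
  have fH: "finite H" unfolding H I_def by simp
  have trm: "(if w ! p mod int l = int i then qv powi (\<Sum>j<p. wt l (int i) (w ! j)) * ext l r (Tex l) (w[p := w ! p + 1]) else 0)
     = (if w ! p mod int l = int i \<and> w ! p + 1 \<in> H then F (w ! p + 1) else 0)" if p: "p < r" for p
  proof (cases "w ! p mod int l = int i")
    case True
    define e where "e = w ! p"
    have eW: "e \<in> W" unfolding e_def W_def using p lw by simp
    have ei: "e mod int l = int i" using True unfolding e_def .
    show ?thesis
    proof (cases "e + 1 \<in> W")
      case t: True
      then obtain j where j: "j < r" "w ! j = e + 1" unfolding W_def using lw by (auto simp: in_set_conv_nth)
      have "p < j"
      proof (rule ccontr)
        assume "\<not> p < j"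
        then have "j = p \<or> w ! j < w ! p" using nth_less[of j p] p linorder_cases[of j p] by blast
        then show False using j(2) unfolding e_def by auto
      qed
      moreover have "\<not> Suc p < j"
      proof
        assume "Suc p < j"
        then have "w ! p < w ! Suc p" "w ! Suc p < w ! j" using nth_less[of p "Suc p"] nth_less[of "Suc p" j] j by auto
        then show False using j(2) unfolding e_def by simp
      qed
      ultimately have j': "j = Suc p" by simp
      have "wedge_alt l r (ext l r (Tex l))" using wfun_ext[OF l] unfolding wfun_def by blast
      then have "ext l r (Tex l) (w[p := w ! p + 1]) = 0"
        by (intro wedge_alt_equal[OF l, where p = p]) (use j j' p lw in \<open>auto simp: e_def\<close>)
      moreover have "e + 1 \<notin> H" unfolding H using t by simp
      ultimately show ?thesis unfolding e_def by simp
    next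
      case nt: False
      define w' where "w' = w[p := w ! p + 1]"
      have dw: "distinct w" using sw strict_sorted_iff by blast
      have sw': "set w' = insert (e + 1) (W - {e})"
        unfolding w'_def W_def e_def by (rule set_update_distinct[OF dw]) (use p lw in simp)
      have "sorted_wrt (<) w'" unfolding sorted_wrt_iff_nth_less
      proof (intro allI impI)
        fix a b assume ab: "a < b" "b < length w'"
        then have b: "b < r" unfolding w'_def using lw by simp
        have lt: "w ! a < w ! b" by (rule nth_less[OF ab(1) b])
        have "w ! b \<noteq> e + 1" using nt nth_mem[of b w] b lw unfolding W_def by metis
        then show "w' ! a < w' ! b" unfolding w'_def using lt ab(1) b lw unfolding e_def by (cases "a = p"; cases "b = p") simp_all
      qed
      moreover have "1 - int r \<le> w' ! 0"
      proof -
        have "1 - int r \<le> w ! 0" unfolding w_def by (rule wedge_of_hd_ge[OF r0(1)])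
        then show ?thesis unfolding w'_def using lw r0 by (cases "p = 0") auto
      qed
      ultimately obtain mu where mu: "mu \<in> parts r" "wedge_of r mu = w'"
        using normal_wedge[of w' r] lw unfolding w'_def by auto
      have "ext l r (Tex l) w' = Tex l mu" unfolding mu(2)[symmetric] by (rule ext_wedge_of[OF l mu(1)])
      also have "\<dots> = (if e + 1 \<in> H then hole_fun l (insert e (H - {e + 1})) else 0)"
      proof (cases "e + 1 < int l")
        case True
        have "1 - int r \<le> e" "e \<le> int l - 1" using eW WI unfolding I_def by auto
        then have eH: "e + 1 \<in> H" "e \<in> I" using True nt unfolding H I_def by auto
        have "I - set w' = insert e (H - {e + 1})" unfolding sw' H using eH(2) eW by auto
        moreover have "\<forall>x\<in>set w'. x < int l" unfolding sw' using True WI unfolding I_def by auto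
        ultimately show ?thesis unfolding Tex_wedge[OF l r0(1) mu(1)] mu(2) using eH(1) unfolding I_def by simp
      next
        case False
        then have "\<not> (\<forall>x\<in>set w'. x < int l)" unfolding sw' by simp
        moreover have "e + 1 \<notin> H" using False unfolding H I_def by simp
        ultimately show ?thesis unfolding Tex_wedge[OF l r0(1) mu(1)] mu(2) by (simp only: if_False)
      qed
      finally have g: "ext l r (Tex l) w' = (if e + 1 \<in> H then hole_fun l (insert e (H - {e + 1})) else 0)" .
      have "(\<Sum>j<p. wt l (int i) (w ! j)) = (\<Sum>x\<in>{x\<in>W. x < e}. wt l (int i) x)"
      proof -
        have "{x\<in>W. x < e} = (\<lambda>j. w ! j) ` {..<p}"
        proof (intro equalityI subsetI)
          fix x assume "x \<in> {x\<in>W. x < e}"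
          then obtain j where j: "j < r" "x = w ! j" "w ! j < w ! p" unfolding W_def e_def using lw by (auto simp: in_set_conv_nth)
          then have "j < p" using nth_less[of p j] by (cases "j = p"; cases "p < j") auto
          then show "x \<in> (\<lambda>j. w ! j) ` {..<p}" using j by blast
        next
          fix x assume "x \<in> (\<lambda>j. w ! j) ` {..<p}"
          then show "x \<in> {x\<in>W. x < e}" unfolding W_def e_def using nth_less p lw by auto
        qed
        moreover have "inj_on (\<lambda>j. w ! j) {..<p}" using dw p lw by (auto simp: inj_on_def nth_eq_iff_index_eq)
        ultimately show ?thesis by (simp add: sum.reindex)
      qed
      moreover have "(\<Sum>x\<in>{x\<in>W. x < e}. wt l (int i) x) + (\<Sum>x\<in>{x\<in>H. x < e}. wt l (int i) x) = 0"
      proof -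
        have e1: "1 - int r \<le> e" "e \<le> int l - 1" using eW WI unfolding I_def by auto
        define n where "n = nat (e - (1 - int r))"
        have n: "1 - int r + int n = e" unfolding n_def using e1 by simp
        have "{1 - int r..<e} = {x\<in>W. x < e} \<union> {x\<in>H. x < e}" unfolding H using WI e1 unfolding I_def by auto
        then have "(\<Sum>x\<in>{1 - int r..<e}. wt l (int i) x) = (\<Sum>x\<in>{x\<in>W. x < e}. wt l (int i) x) + (\<Sum>x\<in>{x\<in>H. x < e}. wt l (int i) x)"
          by (simp only:) (rule sum.union_disjoint, use fH in \<open>auto simp: W_def H\<close>)
        moreover have "(\<Sum>x\<in>{1 - int r..<e}. wt l (int i) x) = 0"
        proof -
          have "(e - 1) mod int l \<noteq> int i"
          proof
            assume "(e - 1) mod int l = int i"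
            then have "int l dvd e - (e - 1)" using ei mod_eq_dvd_iff by metis
            then show False using l by simp
          qed
          moreover have "1 - int r - 1 = - int r" by simp
          ultimately show ?thesis using wt_telescope[OF i, of "1 - int r" n] r(2) unfolding n by simp
        qed
        ultimately show ?thesis by simp
      qed
      ultimately have x: "(\<Sum>j<p. wt l (int i) (w ! j)) = - (\<Sum>x\<in>{x\<in>H. x < e}. wt l (int i) x)" by simp
      have "e + 1 - 1 = e" by simp
      then show ?thesis unfolding e_def[symmetric] using ei g x unfolding F_def w'_def e_def[symmetric] by simp
    qed
  qed simp
  have "Ff l i (Tex l) lam = (\<Sum>p<r. if w ! p mod int l = int i \<and> w ! p + 1 \<in> H then F (w ! p + 1) else 0)"
    unfolding Ff_fword[OF l i lam(1) r] fword_eq w_def[symmetric] lw by (intro sum.cong refl trm) simp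
  also have "\<dots> = (\<Sum>x\<in>W. if x mod int l = int i \<and> x + 1 \<in> H then F (x + 1) else 0)"
  proof (rule sum.reindex_bij_betw)
    show "bij_betw (\<lambda>p. w ! p) {..<r} W" unfolding W_def using sw strict_sorted_iff bij_betw_nth[of w "{..<r}" "set w"] lw by auto
  qed
  also have "\<dots> = (\<Sum>x\<in>{x\<in>W. x mod int l = int i \<and> x + 1 \<in> H}. F (x + 1))"
    by (rule sum.inter_filter[symmetric]) (simp add: W_def)
  also have "\<dots> = (\<Sum>h\<in>{h\<in>H. (h - 1) mod int l = int i \<and> h - 1 \<notin> H}. F h)"
  proof (rule sum.reindex_bij_witness[of _ "\<lambda>h. h - 1" "\<lambda>x. x + 1"])
    fix h assume h: "h \<in> {h\<in>H. (h - 1) mod int l = int i \<and> h - 1 \<notin> H}"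
    have "h \<noteq> 1 - int r" using h r(2) by auto
    then have "h - 1 \<in> I" using h unfolding H I_def by auto
    then show "h - 1 \<in> {x\<in>W. x mod int l = int i \<and> x + 1 \<in> H}" using h H by auto
  qed (auto simp: H)
  also have "\<dots> = (if \<forall>x\<in>H. x mod int l \<noteq> int i then hole_fun l H else 0)"
    unfolding F_def by (rule hole_sum[OF l i fH]) (use hc(2) H_def in simp)
  also have "\<dots> = (if sum_list lam mod l = i then hole_fun l H else 0)"
  proof (cases "inj_on (\<lambda>x. x mod int l) H")
    case True
    have "(\<forall>x\<in>H. x mod int l \<noteq> int i) \<longleftrightarrow> sum_list lam mod l = i"
      by (rule missing_residue[OF l i fH _ True]) (use hc H_def in auto)
    then show ?thesis by simp
  qed (simp add: hole_fun_def)
  also have "hole_fun l H = Tex l lam" unfolding Tex_def H_def holes_stable[OF l r0(2)] using lam(2) by simp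
  finally show ?thesis .
qed

section \<open>Uniqueness of the eigenfunctional\<close>

definition row_weight :: "nat list \<Rightarrow> nat" where
  "row_weight lam = (\<Sum>j<length lam. j * pg lam j)"

lemma row_weight_add_box:
  assumes a: "addable lam b"
  shows "row_weight (add_box lam b) = row_weight lam + b"
proof -
  define R where "R = Suc (length lam)"
  have eq: "row_weight mu = (\<Sum>j<R. j * pg mu j)" if "length mu \<le> R" for mu
    unfolding row_weight_def by (rule sum.mono_neutral_left) (use that in \<open>auto simp: pg_def\<close>)
  have "b < R" using a by (simp add: addable_def R_def)
  have "row_weight (add_box lam b) = (\<Sum>j<R. j * pg lam j + (if j = b then b else 0))"
    unfolding eq[OF length_add_box[OF a, folded R_def]] pg_add_box[OF a] by (intro sum.cong) auto
  also have "\<dots> = row_weight lam + b" unfolding sum.distrib using \<open>b < R\<close> eq[of lam] by (simp add: R_def del: sum.lessThan_Suc)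
  finally show ?thesis .
qed

definition eigen :: "nat \<Rightarrow> (nat list \<Rightarrow> qf) \<Rightarrow> bool" where
  "eigen l D \<longleftrightarrow> (\<forall>i lam. i < l \<longrightarrow> is_partition lam \<longrightarrow> Ff l i D lam = (if sum_list lam mod l = i then D lam else 0)) \<and>
     (\<forall>lam. is_partition lam \<longrightarrow> l \<le> pg lam 0 \<longrightarrow> D lam = 0)"

lemma remove_box:
  assumes lam: "is_partition lam" "lam \<noteq> []"
  obtains nu where "is_partition nu" "addable nu (length lam - 1)" "add_box nu (length lam - 1) = lam"
    "Suc (pg nu (length lam - 1)) = pg lam (length lam - 1)" "length nu \<le> length lam"
proof -
  define a where "a = length lam - 1"
  have a: "a < length lam" "length lam = Suc a" using lam(2) unfolding a_def by auto
  have pos: "0 < lam ! a" using pg_pos_iff[OF lam(1), of a] a by (simp add: pg_def)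
  define nu where "nu = (if lam ! a = 1 then butlast lam else lam[a := lam ! a - 1])"
  have pgn: "pg nu j = pg lam j - (if j = a then 1 else 0)" for j
    unfolding nu_def pg_def using a pos by (auto simp: nth_butlast nth_list_update less_Suc_eq)
  have len: "a \<le> length nu" "length nu \<le> length lam" unfolding nu_def using a by auto
  have part: "is_partition nu"
  proof (rule partitionI)
    fix i assume i: "Suc i < length nu"
    then have "i \<noteq> a" using len a by simp
    then have "pg nu (Suc i) \<le> pg nu i" unfolding pgn using pg_antimono[OF lam(1), of i "Suc i"] by simp
    then show "nu ! Suc i \<le> nu ! i" using i by (simp add: pg_def)
  next
    have "0 \<notin> set (butlast lam)" using lam(1) in_set_butlastD unfolding is_partition_def by metis
    moreover have "0 \<notin> set (lam[a := lam ! a - 1])" if "lam ! a \<noteq> 1"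
      using lam(1) that pos set_update_subset_insert[of lam a "lam ! a - 1"] unfolding is_partition_def by auto
    ultimately show "0 \<notin> set nu" unfolding nu_def by simp
  qed
  have S: "Suc (pg nu a) = pg lam a" unfolding pgn using a pos by (simp add: pg_def)
  have ad: "addable nu a"
    unfolding addable_def using len(1) S pg_antimono[OF lam(1), of "a - 1" a] pgn[of "a - 1"] by (cases "a = 0") auto
  have "add_box nu a = lam"
  proof (rule partition_eqI[OF add_box_partition[OF part ad] lam(1)])
    show "pg (add_box nu a) j = pg lam j" for j unfolding pg_add_box[OF ad] using S pgn[of j] by (cases "j = a") auto
  qed
  then show thesis using that part ad S len unfolding a_def by blast
qed

text \<open>The eigenvalue equation at the partition nu without the last box of the last row
  determines the value at lam: nu is smaller, and adding a box in a higher row gives a partition of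
  the same size but smaller \<open>row_weight\<close>. Only a box in the row below could spoil the
  induction, and the bound on the first row excludes it.\<close>

lemma eigen_zero:
  assumes l: "2 \<le> l" and D: "eigen l D" "D [] = 0"
  shows "is_partition lam \<Longrightarrow> D lam = 0"
proof (induction lam rule: wf_induct_rule[OF wf_measures[of "[sum_list, row_weight]"]])
  case (1 lam)
  have IH: "D mu = 0" if "is_partition mu" "sum_list mu < sum_list lam \<or> sum_list mu = sum_list lam \<and> row_weight mu < row_weight lam" for mu
    using 1(1)[of mu] that by auto
  consider "lam = []" | "l \<le> pg lam 0" | "lam \<noteq> []" "pg lam 0 < l" by linarith
  then show ?case
  proof cases
    case 1 then show ?thesis using D by simp
  next
    case 2 then show ?thesis using D(1) \<open>is_partition lam\<close> unfolding eigen_def by blast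
  next
    case 3
    define a where "a = length lam - 1"
    obtain nu where nu: "is_partition nu" "addable nu a" "add_box nu a = lam" "Suc (pg nu a) = pg lam a" "length nu \<le> length lam"
      using remove_box[OF 1(2) 3(1)] unfolding a_def by blast
    have sl: "sum_list lam = Suc (sum_list nu)" using sum_add_box[OF nu(2)] nu(3) by simp
    have wl: "row_weight lam = row_weight nu + a" using row_weight_add_box[OF nu(2)] nu(3) by simp
    define i where "i = nat (res l a (pg nu a))"
    have i: "i < l" "int i = res l a (pg nu a)" unfolding i_def res_def using l by (simp_all add: nat_less_iff)
    define S where "S = {b. addable nu b \<and> res l b (pg nu b) = int i}"
    have fS: "finite S" unfolding S_def by (rule finite_addable)
    have aS: "a \<in> S" unfolding S_def using nu(2) i by simp
    have oth: "D (add_box nu b) = 0" if b: "b \<in> S" "b \<noteq> a" for b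
    proof -
      have ad: "addable nu b" and rs: "res l b (pg nu b) = res l a (pg nu a)" using b i unfolding S_def by auto
      show ?thesis
      proof (cases "b < a")
        case True
        have "row_weight (add_box nu b) < row_weight lam" unfolding row_weight_add_box[OF ad] wl using True by simp
        then show ?thesis using IH[OF add_box_partition[OF nu(1) ad]] sum_add_box[OF ad] sl by simp
      next
        case False
        \<comment> \<open>The box would start a new row. Equal residues then force l to divide the
          positive length of the last row, which is below l.\<close>
        then have "b = Suc a" "b \<ge> length nu" using b(2) ad nu(5) 3(1) unfolding addable_def a_def by auto
        then have "(- int (Suc a)) mod int l = (int (pg nu a) - int a) mod int l" using rs unfolding res_def by (simp add: pg_beyond)
        then have "int l dvd - int (Suc a) - (int (pg nu a) - int a)" by (simp only: mod_eq_dvd_iff)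
        also have "- int (Suc a) - (int (pg nu a) - int a) = - int (pg lam a)" using nu(4) by simp
        finally have "l dvd pg lam a" by simp
        moreover have "pg lam a \<le> pg lam 0" by (rule pg_antimono[OF 1(2)]) simp
        ultimately show ?thesis using nu(4) 3(2) dvd_imp_le[of l "pg lam a"] by simp
      qed
    qed
    have "D nu = 0" by (rule IH[OF nu(1)]) (simp add: sl)
    then have "Ff l i D nu = 0" using D(1) i(1) nu(1) unfolding eigen_def by simp
    moreover have "Ff l i D nu = qv powi Nb l i nu a * D (add_box nu a) + (\<Sum>b\<in>S - {a}. qv powi Nb l i nu b * D (add_box nu b))"
      unfolding Ff_def S_def[symmetric] by (rule sum.remove[OF fS aS])
    moreover have "(\<Sum>b\<in>S - {a}. qv powi Nb l i nu b * D (add_box nu b)) = 0" by (intro sum.neutral) (auto simp: oth)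
    ultimately have "qv powi Nb l i nu a * D lam = 0" using nu(3) by simp
    then show ?thesis by simp
  qed
qed

lemma Ff_diff: "Ff l i (\<lambda>lam. f lam - g lam) lam = Ff l i f lam - Ff l i g lam"
  unfolding Ff_def by (simp add: right_diff_distrib sum_subtractf)

lemma Ff_scale: "Ff l i (\<lambda>lam. c * f lam) lam = c * Ff l i f lam"
  unfolding Ff_def by (simp add: sum_distrib_left mult.left_commute)

lemma eigen_T0: "2 \<le> l \<Longrightarrow> eigen l (T0 l)"
  unfolding eigen_def by (simp add: Ff_T0 T0_vanish)

lemma eigen_unique:
  assumes l: "2 \<le> l" and D: "eigen l D" and lam: "is_partition lam"
  shows "D lam = D [] * T0 l lam"
proof -
  have "eigen l (\<lambda>lam. D lam - D [] * T0 l lam)"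
    using D eigen_T0[OF l] unfolding eigen_def Ff_diff Ff_scale by simp
  from eigen_zero[OF l this _ lam] show ?thesis using T0_Nil[OF l] by simp
qed

lemma eigen_Tex: 
  assumes l: "2 \<le> l"
  shows "eigen l (Tex l)"
  unfolding eigen_def
proof (intro conjI allI impI)
  fix i lam assume i: "i < l" and lam: "is_partition lam"
  show "Ff l i (Tex l) lam = (if sum_list lam mod l = i then Tex l lam else 0)"
  proof (cases "pg lam 0 < l")
    case True then show ?thesis using Ff_Tex[OF l i lam] by simp
  next
    case False
    have "Tex l (add_box lam a) = 0" if "addable lam a" for a
      unfolding Tex_def pg_add_box[OF that] using False by simp
    then show ?thesis using False unfolding Ff_def by (simp add: Tex_def)
  qed
qed (simp add: Tex_def)

section \<open>Congruences modulo q, with \<open>pol\<close> the polynomials and \<open>zer\<close>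
  those divisible by q, and the eigenfunctional at q = 0\<close>

definition pol :: "qf \<Rightarrow> bool" where "pol x \<longleftrightarrow> (\<exists>p. x = Fract p 1)"
definition zer :: "qf \<Rightarrow> bool" where "zer x \<longleftrightarrow> (\<exists>y. pol y \<and> x = qv * y)"

lemma pol_Fract [simp]: "pol (Fract p 1)" by (auto simp: pol_def)
lemma pol_0 [simp]: "pol 0" unfolding Zero_fract_def by simp
lemma pol_1 [simp]: "pol 1" unfolding One_fract_def by simp
lemma pol_qv [simp]: "pol qv" by (simp add: qv_def)
lemma pol_add: "pol x \<Longrightarrow> pol y \<Longrightarrow> pol (x + y)" by (auto simp: pol_def)
lemma pol_diff: "pol x \<Longrightarrow> pol y \<Longrightarrow> pol (x - y)" by (auto simp: pol_def)
lemma pol_mult: "pol x \<Longrightarrow> pol y \<Longrightarrow> pol (x * y)" by (auto simp: pol_def)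
lemma pol_minus: "pol x \<Longrightarrow> pol (- x)" by (auto simp: pol_def)
lemma pol_power: "pol x \<Longrightarrow> pol (x ^ n)" by (induction n) (auto intro: pol_mult)
lemma pol_sum: "(\<And>i. i \<in> I \<Longrightarrow> pol (f i)) \<Longrightarrow> pol (sum f I)"
  by (induction I rule: infinite_finite_induct) (auto intro: pol_add)
lemma zer_pol: "zer x \<Longrightarrow> pol x" unfolding zer_def by (auto intro: pol_mult)
lemma zer_0 [simp]: "zer 0" unfolding zer_def by (intro exI[of _ 0]) simp
lemma zer_qv: "pol x \<Longrightarrow> zer (qv * x)" unfolding zer_def by blast
lemma zer_add: "zer x \<Longrightarrow> zer y \<Longrightarrow> zer (x + y)" unfolding zer_def by (metis distrib_left pol_add)
lemma zer_diff: "zer x \<Longrightarrow> zer y \<Longrightarrow> zer (x - y)" unfolding zer_def by (metis right_diff_distrib pol_diff)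
lemma zer_minus: "zer x \<Longrightarrow> zer (- x)" using zer_diff[of 0 x] by simp
lemma zer_mult: "pol x \<Longrightarrow> zer y \<Longrightarrow> zer (x * y)" unfolding zer_def by (metis mult.left_commute pol_mult)
lemma zer_sum: "(\<And>i. i \<in> I \<Longrightarrow> zer (f i)) \<Longrightarrow> zer (sum f I)"
  by (induction I rule: infinite_finite_induct) (auto intro: zer_add)

lemma hole_exp_0:
  assumes "finite H" "0 < l" shows "hole_exp l H = 0 \<longleftrightarrow> (\<forall>x\<in>H. \<forall>y\<in>H. y - x < int l)"
proof -
  have d: "hole_dist l x y = 0 \<longleftrightarrow> y - x < int l" if "x < y" for x y
  proof -
    have e: "\<bar>x - y\<bar> = y - x" using that by simp
    show ?thesis
    proof (cases "y - x < int l")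
      case True
      then show ?thesis unfolding hole_dist_def e using that by (simp add: div_pos_pos_trivial)
    next
      case False
      then have "int l div int l \<le> (y - x) div int l" using assms(2) by (intro zdiv_mono1) auto
      then show ?thesis unfolding hole_dist_def e using False assms(2) by simp
    qed
  qed
  have "finite (H \<times> H)" using assms(1) by blast
  then have "finite {(x,y)\<in>H \<times> H. x < y}" by (rule rev_finite_subset) auto
  then have "hole_exp l H = 0 \<longleftrightarrow> (\<forall>(x,y)\<in>{(x,y)\<in>H \<times> H. x < y}. hole_dist l x y = 0)"
    unfolding hole_exp_def by (subst sum_eq_0_iff) auto
  also have "\<dots> \<longleftrightarrow> (\<forall>x\<in>H. \<forall>y\<in>H. x < y \<longrightarrow> y - x < int l)" using d by auto
  also have "\<dots> \<longleftrightarrow> (\<forall>x\<in>H. \<forall>y\<in>H. y - x < int l)" using assms(2) by (metis diff_gt_0_iff_gt not_less of_nat_0_less_iff order_le_less_trans linorder_neqE_linordered_idom)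
  finally show ?thesis .
qed

lemma hole_fun_mod:
  assumes "finite H" "0 < l"
  shows "zer (hole_fun l H - (if \<forall>x\<in>H. \<forall>y\<in>H. y - x < int l then 1 else 0))"
proof (cases "\<forall>x\<in>H. \<forall>y\<in>H. y - x < int l")
  case True
  have "inj_on (\<lambda>x. x mod int l) H"
  proof (rule inj_onI)
    fix x y assume xy: "x \<in> H" "y \<in> H" "x mod int l = y mod int l"
    then have "int l dvd x - y" by (simp only: mod_eq_dvd_iff)
    moreover have "\<bar>x - y\<bar> < int l" using True xy by (auto simp: abs_less_iff)
    ultimately show "x = y" using dvd_imp_le_int[of "x - y" "int l"] by (cases "x = y") auto
  qed
  then show ?thesis using True hole_exp_0[OF assms] by (simp add: hole_fun_def)
next
  case False
  then obtain n where n: "hole_exp l H = Suc n" using hole_exp_0[OF assms] by (metis not0_implies_Suc)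
  have "zer (qv * - ((- qv) ^ n))" by (intro zer_qv pol_minus pol_power pol_qv)
  then have "zer ((- qv) ^ hole_exp l H)" unfolding n by simp
  then show ?thesis unfolding hole_fun_def using False by auto
qed

definition nu0 :: "nat \<Rightarrow> nat \<Rightarrow> nat list" where
  "nu0 l m = replicate (m div (l - 1)) (l - 1) @ (if m mod (l - 1) = 0 then [] else [m mod (l - 1)])"

lemma nu0_quasi: "Suc j < length (nu0 l m) \<Longrightarrow> nu0 l m ! j = l - 1"
  unfolding nu0_def by (auto simp: nth_append split: if_splits)

lemma quasi_nu0:
  assumes l: "2 \<le> l" and lam: "is_partition lam" "pg lam 0 < l" and q: "\<And>j. Suc j < length lam \<Longrightarrow> lam ! j = l - 1"
  shows "lam = nu0 l (sum_list lam)"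
proof (cases lam rule: rev_cases)
  case Nil then show ?thesis by (simp add: nu0_def)
next
  case (snoc xs c)
  have "xs ! j = l - 1" if "j < length xs" for j using q[of j] that snoc by (simp add: nth_append)
  then have xs: "xs = replicate (length xs) (l - 1)" by (intro nth_equalityI) auto
  define n where "n = length xs"
  have lm: "lam = replicate n (l - 1) @ [c]" using snoc xs n_def by simp
  have c: "0 < c" "c \<le> l - 1"
  proof -
    show "0 < c" using lam(1) snoc unfolding is_partition_def by auto
    have "pg lam n = c" unfolding lm pg_def by (simp add: nth_append)
    then show "c \<le> l - 1" using pg_antimono[OF lam(1), of 0 n] lam(2) by simp
  qed
  have s: "sum_list lam = n * (l - 1) + c" unfolding lm by (simp add: sum_list_replicate)
  show ?thesis
  proof (cases "c = l - 1")
    case True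
    then have "sum_list lam = Suc n * (l - 1)" using s by simp
    then have "sum_list lam div (l - 1) = Suc n" "sum_list lam mod (l - 1) = 0" using l by (simp_all del: mult_Suc)
    then show ?thesis unfolding nu0_def lm True by (simp add: replicate_append_same)
  next
    case False
    then have "sum_list lam div (l - 1) = n" "sum_list lam mod (l - 1) = c" using s c l by (simp_all add: div_mult_self3)
    then show ?thesis unfolding nu0_def lm using c by simp
  qed
qed

text \<open>At q = 0 only configurations with all holes inside an interval of length l survive. For
  a nonempty partition 1 - length is always a hole, and the first row shorter than l - 1, at index
  j, leaves a hole at l - 1 - j; the two are close enough only if that row is the last one.\<close>

lemma holes_window:
  assumes l: "2 \<le> l" and lam: "is_partition lam" "pg lam 0 < l"
  shows "(\<forall>x\<in>holes l (length lam) lam. \<forall>y\<in>holes l (length lam) lam. y - x < int l) \<longleftrightarrow> lam = nu0 l (sum_list lam)" (is "?W \<longleftrightarrow> ?N")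
proof
  define n where "n = length lam"
  have mem: "x \<in> set (wedge_of n lam) \<longleftrightarrow> (\<exists>j<n. x = int (pg lam j) - int j)" for x
    unfolding wedge_of_def by auto
  {
    assume W: ?W
    show ?N
    proof (rule quasi_nu0[OF l lam], rule ccontr)
      fix j0 assume j0: "Suc j0 < length lam" "lam ! j0 \<noteq> l - 1"
      define j where "j = (LEAST j. pg lam j \<noteq> l - 1)"
      have "pg lam j0 \<noteq> l - 1" using j0 by (simp add: pg_def)
      then have j: "pg lam j \<noteq> l - 1" "j \<le> j0" 
        using LeastI[of "\<lambda>j. pg lam j \<noteq> l - 1" j0] Least_le[of "\<lambda>j. pg lam j \<noteq> l - 1" j0] unfolding j_def by blast+
      have less: "pg lam i = l - 1" if "i < j" for i using not_less_Least[of i "\<lambda>j. pg lam j \<noteq> l - 1"] that unfolding j_def by blast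
      have jn: "Suc j < n" using j j0 n_def by simp
      have "pg lam j < l - 1" using j(1) lam(2) pg_antimono[OF lam(1), of 0 j] by simp
      have "int l - 1 - int j \<notin> set (wedge_of n lam)" unfolding mem
      proof
        assume "\<exists>i<n. int l - 1 - int j = int (pg lam i) - int i"
        then obtain i where i: "i < n" "int l - 1 - int j = int (pg lam i) - int i" by blast
        show False
        proof (cases "i < j")
          case True then show False using i less[OF True] l by (simp add: of_nat_diff)
        next
          case False
          then show False using i \<open>pg lam j < l - 1\<close> pg_antimono[OF lam(1), of j i] by simp
        qed
      qed
      moreover have "1 - int n \<notin> set (wedge_of n lam)" unfolding mem
      proof
        assume "\<exists>i<n. 1 - int n = int (pg lam i) - int i"
        then obtain i where i: "i < n" "1 - int n = int (pg lam i) - int i" by blast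
        then show False using pg_pos_iff[OF lam(1), of i] n_def by simp
      qed
      ultimately have "int l - 1 - int j \<in> holes l n lam" "1 - int n \<in> holes l n lam"
        unfolding holes_def using jn l by auto
      then have "(int l - 1 - int j) - (1 - int n) < int l" using W unfolding n_def by blast
      then show False using jn by simp
    qed
  }
  {
    assume N: ?N
    have q: "pg lam j = l - 1" if "Suc j < n" for j
      using nu0_quasi[of j l "sum_list lam"] N that unfolding n_def by (simp add: pg_def)
    have up: "y \<le> int l - int n \<or> n = 0" if y: "y \<in> holes l n lam" for y
    proof (rule ccontr)
      assume "\<not> ?thesis"
      then have g: "int l - int n < y" "0 < n" by auto
      have y1: "y \<le> int l - 1" "y \<notin> set (wedge_of n lam)" using y unfolding holes_def by auto
      define j where "j = nat (int l - 1 - y)"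
      have j: "int j = int l - 1 - y" unfolding j_def using y1 by simp
      then have "Suc j < n" using g by simp
      then have "y = int (pg lam j) - int j" using q[of j] j l by (simp add: of_nat_diff)
      moreover have "j < n" using \<open>Suc j < n\<close> by simp
      ultimately show False using y1(2) unfolding mem by blast
    qed
    show ?W
    proof (intro ballI)
      fix x y assume x: "x \<in> holes l (length lam) lam" and y: "y \<in> holes l (length lam) lam"
      have "1 - int n \<le> x" "y \<le> int l - 1" using x y unfolding holes_def n_def by auto
      moreover have "y \<le> int l - int n \<or> n = 0" using up y n_def by blast
      ultimately show "y - x < int l" by auto
    qed
  }
qed

lemma T0_mod:
  assumes l: "2 \<le> l" and lam: "is_partition lam"
  shows "zer (T0 l lam - (if lam = nu0 l (sum_list lam) then 1 else 0))"
proof -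
  have N: "Tex l [] = 1"
  proof -
    have 0: "hole_exp l {1..int l - 1} = 0" using l by (subst hole_exp_0) auto
    have "inj_on (\<lambda>x. x mod int l) {1..int l - 1}" by (rule inj_onI) simp
    then show ?thesis using l 0 by (simp add: Tex_def holes_def hole_fun_def pg_def)
  qed
  then have e: "T0 l lam = Tex l lam" using eigen_unique[OF l eigen_Tex[OF l] lam] by simp
  show ?thesis
  proof (cases "pg lam 0 < l")
    case True
    have "finite (holes l (length lam) lam)" unfolding holes_def by simp
    from hole_fun_mod[OF this, of l] show ?thesis unfolding holes_window[OF l lam True] e Tex_def using True l by simp
  next
    case False
    have "pg (nu0 l m) 0 \<le> l - 1" for m
      unfolding nu0_def pg_def using l by (auto simp: nth_append intro: less_imp_le mod_less_divisor)
    then have "lam \<noteq> nu0 l (sum_list lam)" using False l by (metis One_nat_def Suc_le_lessD Suc_pred' le_trans less_Suc_eq_le not_less numeral_2_eq_2 zero_less_Suc)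
    then show ?thesis using T0_vanish[OF l lam] False by simp
  qed
qed

section \<open>Values at $q=0$\<close>

text \<open>At q = 0 the rule reads u_m u_k = - u_(k+i) u_(m-i) or, for i = 0, u_m u_k = - u_k u_m:
  the term -q u_k u_m and all summands with j \<ge> 2 carry a factor q. Since k + i has the residue
  of m, each position keeps its residue.\<close>

lemma straight_zer:
  assumes l: "2 \<le> l" and f: "wedge_alt l r f"
    and pl: "\<And>v. length v = r \<Longrightarrow> sorted_wrt (<) v \<Longrightarrow> pol (f v)"
  shows "length w = r \<Longrightarrow> pol (f w) \<and>
    ((\<forall>v. length v = r \<longrightarrow> sorted_wrt (<) v \<longrightarrow> (\<forall>p<r. v ! p mod int l = w ! p mod int l) \<longrightarrow> zer (f v)) \<longrightarrow> zer (f w))"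
proof (induction w rule: straight_induct)
  case (step w)
  define Z where "Z = (\<lambda>w. \<forall>v. length v = r \<longrightarrow> sorted_wrt (<) v \<longrightarrow> (\<forall>p<r. v ! p mod int l = w ! p mod int l) \<longrightarrow> zer (f v))"
  show ?case
  proof (cases "sorted_wrt (<) w")
    case True
    then show ?thesis using pl step.prems by auto
  next
    case False
    then obtain p where p: "Suc p < length w" "w ! Suc p \<le> w ! p" unfolding sorted_iff_no_descent by blast
    define m k i where "m = w ! p" and "k = w ! Suc p" and "i = (m - k) mod int l"
    have IH: "pol (f (upd2 w p x y))" "Z (upd2 w p x y) \<Longrightarrow> zer (f (upd2 w p x y))" if "k \<le> x" "x < m" "x + y = m + k" for x y
    proof -
      have y: "y = w ! p + w ! Suc p - x" using that(3) unfolding m_def k_def by simp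
      have "length (upd2 w p x y) = r" using step.prems by simp
      from step.IH[OF p(1), of x, folded y, OF _ _ this] that show "pol (f (upd2 w p x y))" "Z (upd2 w p x y) \<Longrightarrow> zer (f (upd2 w p x y))"
        unfolding m_def k_def Z_def by auto
    qed
    have Zupd: "Z (upd2 w p x y)" if "Z w" "x mod int l = m mod int l" "y mod int l = k mod int l" for x y
    proof -
      have "upd2 w p x y ! p' mod int l = w ! p' mod int l" if "p' < r" for p'
        using that p step.prems \<open>x mod int l = m mod int l\<close> \<open>y mod int l = k mod int l\<close> unfolding m_def k_def by (auto simp: nth_upd2)
      then show ?thesis using \<open>Z w\<close> unfolding Z_def by simp
    qed
    have "pol (f w) \<and> (Z w \<longrightarrow> zer (f w))"
    proof (cases "k = m")
      case True
      then have "f w = 0" using wedge_alt_equal[OF l, of w f p] f step.prems p unfolding m_def k_def by simp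
      then show ?thesis by simp
    next
      case False
      then have km: "k < m" using p unfolding m_def k_def by simp
      have fw: "f w = (if i = 0 then - f (upd2 w p k m) else - qv * f (upd2 w p k m) + (qv ^ 2 - 1) *
        (\<Sum>j \<in> {j \<in> {1..nat (m - k)}. k + dshift l i j < m - dshift l i j}.
         (- qv) ^ (j - 1) * f (upd2 w p (k + dshift l i j) (m - dshift l i j))))"
        unfolding m_def k_def i_def by (rule wedge_alt_straight[OF l f step.prems]) (use p step.prems in auto)
      show ?thesis
      proof (cases "i = 0")
        case True
        have "m mod int l = k mod int l" using True unfolding i_def by (simp only: diff_mod_0_iff)
        then show ?thesis unfolding fw using True IH[of k m] Zupd[of k m] km by (auto intro: pol_minus zer_minus)
      next
        case i: False
        then have i0: "0 < i" unfolding i_def using l by (simp add: order_less_le)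
        define J where "J = {j \<in> {1..nat (m - k)}. k + dshift l i j < m - dshift l i j}"
        define t where "t = (\<lambda>j. (- qv) ^ (j - 1) * f (upd2 w p (k + dshift l i j) (m - dshift l i j)))"
        have J: "1 \<le> j" "k \<le> k + dshift l i j" "k + dshift l i j < m" "k + dshift l i j + (m - dshift l i j) = m + k" if "j \<in> J" for j
        proof -
          have "1 \<le> j" "k + dshift l i j < m - dshift l i j" using that unfolding J_def by auto
          moreover from this have "0 < dshift l i j" using dshift_pos[OF l i0] by blast
          ultimately show "1 \<le> j" "k \<le> k + dshift l i j" "k + dshift l i j < m" "k + dshift l i j + (m - dshift l i j) = m + k" by auto
        qed
        have pt: "pol (t j)" if "j \<in> J" for j
          unfolding t_def by (intro pol_mult pol_power pol_minus pol_qv IH(1) J(2-4)[OF that])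
        have zt: "zer (t j)" if "j \<in> J" "Z w" for j
        proof (cases "j = 1")
          case True
          have d: "dshift l i 1 = i" by (simp add: dshift_def)
          have "(k + i) mod int l = m mod int l" "(m - i) mod int l = k mod int l"
            unfolding i_def by (simp_all add: mod_simps)
          then have "zer (f (upd2 w p (k + dshift l i j) (m - dshift l i j)))"
            using IH(2)[OF J(2-4)[OF that(1)]] Zupd[OF that(2)] unfolding True d by blast
          then show ?thesis unfolding t_def True by simp
        next
          case False
          moreover have "1 \<le> j" by (rule J(1)[OF that(1)])
          ultimately obtain j' where j': "j - 1 = Suc j'" by (cases "j - 1") auto
          have "t j = qv * (- ((- qv) ^ j' * f (upd2 w p (k + dshift l i j) (m - dshift l i j))))" unfolding t_def j' by simp
          moreover have "pol (- ((- qv) ^ j' * f (upd2 w p (k + dshift l i j) (m - dshift l i j))))"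
            by (intro pol_minus pol_mult pol_power pol_qv IH(1) J(2-4)[OF that(1)])
          ultimately show ?thesis by (simp only: zer_qv)
        qed
        have pk: "pol (f (upd2 w p k m))" using IH(1)[of k m] km by simp
        have fw': "f w = qv * (- f (upd2 w p k m)) + (qv ^ 2 - 1) * sum t J" unfolding fw t_def J_def using i by simp
        have pq: "pol (qv ^ 2 - 1)" by (intro pol_diff pol_power) simp_all
        have z1: "zer (qv * (- f (upd2 w p k m)))" by (intro zer_qv pol_minus pk)
        have "pol (f w)" unfolding fw' by (intro pol_add zer_pol[OF z1] pol_mult pq pol_sum pt)
        moreover have "zer (f w)" if "Z w" unfolding fw' by (intro zer_add z1 zer_mult pq zer_sum zt that)
        ultimately show ?thesis by blast
      qed
    qed
    then show ?thesis unfolding Z_def .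
  qed
qed

lemma qstraight_zer:
  assumes l: "2 \<le> l" and n: "\<not> (length t = length w \<and> sorted_wrt (<) t \<and> (\<forall>p<length w. t ! p mod int l = w ! p mod int l))"
  shows "zer (qstraight l w t)"
proof -
  have "zer (qstraight l v t)" if "length v = length w" "sorted_wrt (<) v" "\<forall>p<length w. v ! p mod int l = w ! p mod int l" for v
    using qstraight_normal[OF l that(2), of t] n that by auto
  then show ?thesis using straight_zer[OF l qstraight_alt[OF l], of "length w" t w] qstraight_normal[OF l] by simp
qed

lemma straight_zer_all:
  assumes "2 \<le> l" "wedge_alt l r f" "\<And>v. length v = r \<Longrightarrow> sorted_wrt (<) v \<Longrightarrow> zer (f v)" "length w = r"
  shows "zer (f w)"
  using straight_zer[OF assms(1,2) zer_pol[OF assms(3)] assms(4)] assms(3) by blast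

lemma esum_zer: "(\<And>v. length v = length w \<Longrightarrow> zer (f v)) \<Longrightarrow> zer (esum K f w)"
proof (induction w arbitrary: f)
  case (Cons a w)
  then show ?case by (auto intro!: zer_diff)
qed simp

lemma hsum_zer: "(\<And>v. length v = length w \<Longrightarrow> zer (f v)) \<Longrightarrow> zer (hsum K j f w)"
proof (induction w arbitrary: f j)
  case (Cons a w)
  then show ?case by (auto intro!: zer_sum)
qed simp

lemma hsum_diff: "hsum K j (\<lambda>v. f v - g v) w = hsum K j f w - hsum K j g w"
  by (induction w arbitrary: f g j) (simp_all add: sum_subtractf)

lemma esum_lower_zer:
  "(\<And>v. list_all2 (\<lambda>x y. x \<le> y \<and> x mod int l = y mod int l) v w \<Longrightarrow> zer (f v)) \<Longrightarrow> zer (esum (int l) f w)"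
proof (induction w arbitrary: f)
  case (Cons a w)
  have "zer (esum (int l) (\<lambda>v. f (b # v)) w)" if "b \<le> a" "b mod int l = a mod int l" for b
    by (rule Cons.IH, rule Cons.prems) (use that in simp)
  then show ?case by (auto intro!: zer_diff)
qed simp

lemma esum_lower:
  "0 < l \<Longrightarrow> (\<And>v. list_all2 (\<lambda>x y. x \<le> y \<and> x mod int l = y mod int l) v w \<Longrightarrow> sum_list v < sum_list w \<Longrightarrow> zer (f v)) \<Longrightarrow> zer (esum (int l) f w - f w)"
proof (induction w arbitrary: f)
  case (Cons a w)
  have le: "sum_list v \<le> sum_list w" if "list_all2 (\<lambda>x y. x \<le> y \<and> x mod int l = y mod int l) v w" for v
    using that by (induction rule: list_all2_induct) auto
  have "zer (esum (int l) (\<lambda>v. f (a # v)) w - f (a # w))"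
    by (rule Cons.IH[OF Cons.prems(1)], rule Cons.prems(2)) auto
  moreover have "zer (esum (int l) (\<lambda>v. f ((a - int l) # v)) w)"
  proof (rule esum_lower_zer, rule Cons.prems(2))
    fix v assume v: "list_all2 (\<lambda>x y. x \<le> y \<and> x mod int l = y mod int l) v w"
    then show "list_all2 (\<lambda>x y. x \<le> y \<and> x mod int l = y mod int l) ((a - int l) # v) (a # w)" by simp
    show "sum_list ((a - int l) # v) < sum_list (a # w)" using le[OF v] Cons.prems(1) by simp
  qed
  ultimately have "zer ((esum (int l) (\<lambda>v. f (a # v)) w - f (a # w)) - esum (int l) (\<lambda>v. f ((a - int l) # v)) w)" by (rule zer_diff)
  then show ?case by (simp add: algebra_simps)
qed simp

section \<open>First rows lengthened by multiples of l, and the towers at q = 0\<close>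

definition lift :: "nat \<Rightarrow> nat list \<Rightarrow> nat list" where
  "lift k lam = (if k = 0 then lam else (pg lam 0 + k) # tl lam)"

lemma pg_lift: "pg (lift k lam) i = pg lam i + (if i = 0 then k else 0)"
  by (cases lam; cases i) (auto simp: lift_def pg_def)

lemma length_lift: "length (lift k lam) \<le> Suc (length lam)" "length (lift k lam) \<le> max 1 (length lam)"
  by (auto simp: lift_def)

lemma lift_partition: "is_partition lam \<Longrightarrow> is_partition (lift k lam)"
proof (rule partitionI)
  fix i assume lam: "is_partition lam" and i: "Suc i < length (lift k lam)"
  have "pg (lift k lam) (Suc i) \<le> pg (lift k lam) i" unfolding pg_lift using pg_antimono[OF lam, of i "Suc i"] by simp
  then show "lift k lam ! Suc i \<le> lift k lam ! i" using i by (simp add: pg_def)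
next
  assume "is_partition lam"
  then show "0 \<notin> set (lift k lam)" unfolding lift_def is_partition_def by (cases lam) auto
qed

lemma sum_lift: "sum_list (lift k lam) = sum_list lam + k"
  by (cases lam) (auto simp: lift_def pg_def)

lemma sum_nu0: "sum_list (nu0 l m) = m"
  using div_mult_mod_eq[of m "l - 1"]
  by (cases "m mod (l - 1) = 0") (simp_all add: nu0_def sum_list_replicate)

lemma pg_nu0_le: "2 \<le> l \<Longrightarrow> pg (nu0 l m) 0 \<le> l - 1"
  unfolding nu0_def pg_def by (auto simp: nth_append intro: less_imp_le mod_less_divisor)

lemma nu0_partition: "2 \<le> l \<Longrightarrow> is_partition (nu0 l m)"
proof (rule partitionI)
  fix i assume l: "2 \<le> l" and i: "Suc i < length (nu0 l m)"
  have "x \<le> l - 1" if "x \<in> set (nu0 l m)" for x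
    using that l unfolding nu0_def by (auto split: if_splits intro: less_imp_le mod_less_divisor)
  then show "nu0 l m ! Suc i \<le> nu0 l m ! i" using nth_mem[OF i] nu0_quasi[OF i] by simp
qed (auto simp: nu0_def)

text \<open>The differences w - t are multiples of l. Between neighbouring positions they change by
  more than -l, because w increases strictly and t by at most l; hence they never decrease.\<close>

lemma residue_mono:
  assumes w: "sorted_wrt (<) w" "length w = n" and t: "\<And>p. Suc p < n \<Longrightarrow> t ! Suc p - t ! p \<le> int l"
    and m: "\<And>p. p < n \<Longrightarrow> t ! p mod int l = w ! p mod int l" and p: "p \<le> p'" "p' < n"
  shows "w ! p - t ! p \<le> w ! p' - t ! p'"
  using p
proof (induction rule: dec_induct)
  case (step k)
  have "w ! k < w ! Suc k" using w step.prems by (simp add: sorted_wrt_iff_nth_less)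
  define D where "D = (w ! Suc k - t ! Suc k) - (w ! k - t ! k)"
  have "int l dvd w ! Suc k - t ! Suc k" "int l dvd w ! k - t ! k" using m[of "Suc k"] m[of k] step.prems by (auto simp: mod_eq_dvd_iff[symmetric])
  then have "int l dvd D" unfolding D_def by (rule dvd_diff)
  moreover have "- int l < D" unfolding D_def using t[of k] step.prems \<open>w ! k < w ! Suc k\<close> by simp
  ultimately have "0 \<le> D" using zdvd_imp_le[of "int l" "- D"] by (cases "0 \<le> D") auto
  then show ?case using step unfolding D_def by simp
qed simp

text \<open>The value at q = 0 expected for the sum of all h_j applied to the indicator of
  \<open>nu0 l m\<close>. \<open>esum_Rho\<close> confirms it by applying the inverse
  product.\<close>

definition Rho :: "nat \<Rightarrow> nat \<Rightarrow> nat list \<Rightarrow> qf" where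
  "Rho l m lam = (if \<exists>j. lam = lift (l * j) (nu0 l m) then 1 else 0)"

lemma wedge_lift: "wedge_of (Suc r) (lift k lam) ! p = wedge_of (Suc r) lam ! p + (if p = r then int k else 0)" if "p < Suc r"
  using that by (simp add: nth_wedge_of pg_lift)

lemma nu0_gap:
  assumes l: "2 \<le> l" and p: "Suc p < n"
  shows "wedge_of n (nu0 l m) ! Suc p - wedge_of n (nu0 l m) ! p \<le> int l"
proof -
  define j where "j = n - 1 - Suc p"
  have j: "n - 1 - p = Suc j" "n - 1 - Suc p = j" using p unfolding j_def by auto
  have "pg (nu0 l m) j \<le> l - 1" using pg_nu0_le[OF l] pg_antimono[OF nu0_partition[OF l], of 0 j] order_trans by blast
  then show ?thesis using p l j by (simp add: nth_wedge_of)
qed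

text \<open>A nonzero value at \<open>q = 0\<close> forces the residues of the word to agree with those of a lift of \<open>nu0 l m\<close>.\<close>

lemma ext_Rho_zer:
  assumes l: "2 \<le> l" and v: "length v = r"
    and n: "\<And>j. qstraight l v (wedge_of r (lift (l * j) (nu0 l m))) \<noteq> 0 \<Longrightarrow>
       (\<And>p. p < r \<Longrightarrow> wedge_of r (lift (l * j) (nu0 l m)) ! p mod int l = v ! p mod int l) \<Longrightarrow> False"
  shows "zer (ext l r (Rho l m) v)"
  unfolding ext_def
proof (rule zer_sum)
  fix lam
  show "zer (qstraight l v (wedge_of r lam) * Rho l m lam)"
  proof (cases "\<exists>j. lam = lift (l * j) (nu0 l m)")
    case True
    then obtain j where j: "lam = lift (l * j) (nu0 l m)" by blast
    have "zer (qstraight l v (wedge_of r lam))"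
    proof (cases "qstraight l v (wedge_of r lam) = 0")
      case False
      then have "\<not> (\<forall>p<r. wedge_of r lam ! p mod int l = v ! p mod int l)" using n[of j] unfolding j by blast
      then show ?thesis using qstraight_zer[OF l, of "wedge_of r lam" v] v by blast
    qed simp
    then show ?thesis unfolding Rho_def by simp
  qed (simp add: Rho_def)
qed

text \<open>Modulo q the value depends on the last letter only through its residue. If the word is
  normal, this is read off. Otherwise let s be a contributing normal word, with letters t before its
  last: equal residues give u \<ge> t letterwise, and s_r cannot exceed the largest letter u_(r-1).
  Comparing sums, s_r - b \<ge> u_(r-1) - t_(r-1), hence b \<le> t_(r-1), contradicting t_(r-1) < c
  \<le> b.\<close>

lemma ext_Rho_snoc:
  assumes l: "2 \<le> l" and len: "length (nu0 l m) \<le> r" "0 < r" and u: "length u = r" "sorted_wrt (<) u" and b: "0 \<le> b"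
  shows "zer (ext l (Suc r) (Rho l m) (u @ [b]) -
    (if u = butlast (wedge_of (Suc r) (nu0 l m)) \<and> b mod int l = int (pg (nu0 l m) 0) then 1 else 0))"
proof -
  define t where "t = wedge_of (Suc r) (nu0 l m)"
  define c where "c = int (pg (nu0 l m) 0)"
  have c: "0 \<le> c" "c < int l" unfolding c_def using pg_nu0_le[OF l, of m] l by auto
  have tl: "length t = Suc r" "t ! r = c" unfolding t_def c_def by (simp_all add: nth_wedge_of)
  have bl: "butlast t ! p = t ! p" if "p < r" for p using that tl by (simp add: nth_butlast)
  have ueq: "u = butlast t \<longleftrightarrow> (\<forall>p<r. u ! p = t ! p)"
    using u tl bl by (auto simp: list_eq_iff_nth_eq)
  have gap: "t ! Suc p - t ! p \<le> int l" if "Suc p < Suc r" for p unfolding t_def by (rule nu0_gap[OF l that])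
  have lt: "wedge_of (Suc r) (lift (l * j) (nu0 l m)) ! p = t ! p + (if p = r then int l * int j else 0)" if "p < Suc r" for p j
    unfolding t_def wedge_lift[OF that] by simp
  have bc: "c \<le> b" if "b mod int l = c" using that b c by (metis mod_less_eq_dividend le_cases order_trans zmod_le_nonneg_dividend)
  have ub: "(u @ [b]) ! p = u ! p" if "p < r" for p using that u by (simp add: nth_append)
  have ubr: "(u @ [b]) ! r = b" using u by (simp add: nth_append)
  have t1: "t ! (r - 1) < c"
    using pg_antimono[OF nu0_partition[OF l, of m], of 0 1] len(2) unfolding t_def c_def by (simp add: nth_wedge_of)
  show ?thesis
  proof (cases "b \<le> u ! (r - 1)")
    case True
    have z: "zer (ext l (Suc r) (Rho l m) (u @ [b]))"
    proof (rule ext_Rho_zer[OF l])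
      fix j
      define s where "s = wedge_of (Suc r) (lift (l * j) (nu0 l m))"
      assume nz: "qstraight l (u @ [b]) (wedge_of (Suc r) (lift (l * j) (nu0 l m))) \<noteq> 0"
      assume res: "\<And>p. p < Suc r \<Longrightarrow> wedge_of (Suc r) (lift (l * j) (nu0 l m)) ! p mod int l = (u @ [b]) ! p mod int l"
      have sp: "s ! p = t ! p" if "p < r" for p using lt[of p j] that unfolding s_def by simp
      have sr: "s ! r = c + int l * int j" using lt[of r j] tl unfolding s_def by simp
      have resu: "t ! p mod int l = u ! p mod int l" if "p < r" for p using res[of p] lt[of p j] ub[of p] that by simp
      have "c mod int l = b mod int l" using res[of r] lt[of r j] tl ubr by simp
      then have cb: "c \<le> b" using bc c by simp
      have "s ! 0 \<le> (u @ [b]) ! 0" using qstraight_hd[OF l nz] unfolding s_def by simp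
      then have h0: "0 \<le> u ! 0 - t ! 0" using sp[of 0] ub[of 0] len(2) by simp
      have D: "0 \<le> u ! p - t ! p" if "p < r" for p
        using residue_mono[OF u(2,1), of t l 0 p] gap resu h0 that by fastforce
      have "(\<forall>p<Suc r. s ! p \<le> u ! (r - 1)) \<and> length s = length (u @ [b]) \<and> sorted_wrt (<) s"
        unfolding s_def
      proof (rule qstraight_support[OF l nz])
        show "\<forall>p<Suc r. (u @ [b]) ! p \<le> u ! (r - 1)"
        proof (intro allI impI)
          fix p assume p: "p < Suc r"
          show "(u @ [b]) ! p \<le> u ! (r - 1)"
          proof (cases "p < r - 1")
            case True
            then have "u ! p < u ! (r - 1)" using u len by (simp add: sorted_wrt_iff_nth_less)
            then show ?thesis using ub[of p] True by simp
          next
            case False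
            then have "p = r - 1 \<or> p = r" using p by auto
            then show ?thesis using \<open>b \<le> u ! (r - 1)\<close> ub[of "r - 1"] ubr len(2) by auto
          qed
        qed
      next
        fix v p x assume v: "\<forall>p<Suc r. v ! p \<le> u ! (r - 1)" "length v = length (u @ [b])" "Suc p < length v" "v ! Suc p \<le> x" "x < v ! p"
        then have "v ! Suc p \<le> u ! (r - 1)" "v ! p \<le> u ! (r - 1)" using u by auto
        then have "v ! p + v ! Suc p - x \<le> u ! (r - 1)" "x \<le> u ! (r - 1)" using v(4,5) by linarith+
        then show "\<forall>p'<Suc r. upd2 v p x (v ! p + v ! Suc p - x) ! p' \<le> u ! (r - 1)" using v u by (auto simp: nth_upd2)
      qed
      then have "s ! r \<le> u ! (r - 1)" using lessI[of r] by blast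
      moreover have "sum_list s = sum_list (u @ [b])" unfolding s_def by (rule qstraight_sum[OF l nz])
      then have "s ! r - b = (\<Sum>p<r. u ! p - t ! p)"
      proof -
        have "length s = Suc r" unfolding s_def by simp
        then have "sum_list s = (\<Sum>p<r. s ! p) + s ! r" by (simp add: sum_list_sum_nth atLeast0LessThan)
        moreover have "(\<Sum>p<r. s ! p) = (\<Sum>p<r. t ! p)" by (intro sum.cong refl) (simp add: sp)
        moreover have "sum_list (u @ [b]) = (\<Sum>p<r. u ! p) + b" using u by (simp add: sum_list_sum_nth[of u] atLeast0LessThan)
        ultimately show ?thesis unfolding sum_subtractf using \<open>sum_list s = sum_list (u @ [b])\<close> by linarith
      qed
      moreover have "u ! (r - 1) - t ! (r - 1) \<le> (\<Sum>p<r. u ! p - t ! p)"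
        by (rule member_le_sum[where f = "\<lambda>p. u ! p - t ! p"]) (use D len in auto)
      ultimately have "b \<le> t ! (r - 1)" by linarith
      then show False using t1 cb by linarith
    qed (use u in simp)
    have n: "\<not> (u = butlast t \<and> b mod int l = c)"
    proof
      assume a: "u = butlast t \<and> b mod int l = c"
      then have "u ! (r - 1) = t ! (r - 1)" using ueq len(2) by simp
      then show False using True t1 bc a by linarith
    qed
    have "(if u = butlast t \<and> b mod int l = c then 1 else 0) = (0 :: qf)" by (rule if_not_P[OF n])
    then have "zer (ext l (Suc r) (Rho l m) (u @ [b]) - (if u = butlast t \<and> b mod int l = c then 1 else 0))" using z by (simp only: diff_zero)
    then show ?thesis unfolding t_def c_def .
  next
    case False
    have so: "sorted_wrt (<) (u @ [b])"
    proof -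
      have "x < b" if "x \<in> set u" for x
      proof -
        have "\<exists>p. p < length u \<and> u ! p = x" using that by (simp only: in_set_conv_nth)
        then obtain p where "p < length u" "u ! p = x" by (elim exE conjE)
        then have p: "p < r" "x = u ! p" using u(1) by simp_all
        have "u ! p \<le> u ! (r - 1)" using u p by (cases "p = r - 1") (auto simp: sorted_wrt_iff_nth_less less_imp_le)
        then show ?thesis using False p by simp
      qed
      then show ?thesis using u by (simp add: sorted_wrt_append)
    qed
    have "ext l (Suc r) (Rho l m) (u @ [b]) = (if u = butlast t \<and> b mod int l = c then 1 else 0)"
    proof (cases "(u @ [b]) ! 0 < - int r")
      case True
      have "u ! 0 < t ! 0" using wedge_of_hd_ge[of "Suc r" "nu0 l m"] True ub[of 0] len unfolding t_def by simp
      then have "u \<noteq> butlast t" using ueq len(2) by auto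
      moreover have "ext l (Suc r) (Rho l m) (u @ [b]) = 0"
        using wfun_ext[OF l, of "Suc r" "Rho l m"] True u unfolding wfun_def by simp
      ultimately show ?thesis by simp
    next
      case f: False
      then obtain lam where lam: "lam \<in> parts (Suc r)" "wedge_of (Suc r) lam = u @ [b]"
        using normal_wedge[of "u @ [b]" "Suc r"] so u by auto
      have e: "ext l (Suc r) (Rho l m) (u @ [b]) = Rho l m lam" unfolding lam(2)[symmetric] by (rule ext_wedge_of[OF l lam(1)])
      have lp: "lift (l * j) (nu0 l m) \<in> parts (Suc r)" for j
        using lift_partition[OF nu0_partition[OF l]] length_lift(1)[of "l * j" "nu0 l m"] len by (simp add: parts_def)
      have "(\<exists>j. lam = lift (l * j) (nu0 l m)) \<longleftrightarrow> u = butlast t \<and> b mod int l = c"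
      proof
        assume "\<exists>j. lam = lift (l * j) (nu0 l m)"
        then obtain j where j: "lam = lift (l * j) (nu0 l m)" by blast
        have "(u @ [b]) ! p = t ! p + (if p = r then int l * int j else 0)" if "p < Suc r" for p
          using lt[OF that, of j] unfolding j[symmetric] lam(2) .
        from this[of r] this have "b = c + int l * int j" "\<forall>p<r. u ! p = t ! p" using ub ubr tl by (auto simp: less_Suc_eq)
        then show "u = butlast t \<and> b mod int l = c" using ueq c by simp
      next
        assume a: "u = butlast t \<and> b mod int l = c"
        then have "int l dvd b - c" using c by (metis mod_eq_dvd_iff mod_pos_pos_trivial)
        then obtain k where k: "b - c = int l * k" by blast
        have "0 \<le> b - c" using bc a by simp
        then have "0 \<le> k" using k l by (metis (no_types) mult_neg_pos mult.commute not_le of_nat_0_less_iff zero_less_numeral order_less_le_trans)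
        then have b: "b = c + int l * int (nat k)" using k by simp
        have "wedge_of (Suc r) lam = wedge_of (Suc r) (lift (l * nat k) (nu0 l m))"
        proof (rule nth_equalityI)
          fix p assume "p < length (wedge_of (Suc r) lam)"
          then have p: "p < Suc r" by simp
          have "(u @ [b]) ! p = t ! p + (if p = r then int l * int (nat k) else 0)"
            using a ueq p ub[of p] ubr tl b by (cases "p = r") auto
          then show "wedge_of (Suc r) lam ! p = wedge_of (Suc r) (lift (l * nat k) (nu0 l m)) ! p" unfolding lt[OF p] lam(2) .
        qed simp
        then show "\<exists>j. lam = lift (l * j) (nu0 l m)" using wedge_of_inj[OF lam(1) lp] by blast
      qed
      then show ?thesis unfolding e Rho_def by simp
    qed
    then show ?thesis unfolding t_def c_def by simp
  qed
qed

text \<open>If the first row is at least l, the factor of the last letter compares b with b - l,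
  which agree modulo q. Otherwise only the word itself contributes: for a lowered word v, letters
  below l force the lift to be trivial, \<open>residue_mono\<close> then forces w = t, and the sum
  of v is too small for t.\<close>

lemma esum_Rho:
  assumes l: "2 \<le> l" and len: "length (nu0 l m) \<le> r" "0 < r" and lam: "lam \<in> parts (Suc r)"
  shows "zer (esum (int l) (ext l (Suc r) (Rho l m)) (wedge_of (Suc r) lam) - (if lam = nu0 l m then 1 else 0))"
proof -
  define f where "f = ext l (Suc r) (Rho l m)"
  define w where "w = wedge_of (Suc r) lam"
  define t where "t = wedge_of (Suc r) (nu0 l m)"
  have lw: "length w = Suc r" unfolding w_def by simp
  have lp: "is_partition lam" using lam by (simp add: parts_def)
  have fw: "wedge_alt l (Suc r) f" unfolding f_def using wfun_ext[OF l] unfolding wfun_def by blast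
  have wr: "w ! r = int (pg lam 0)" unfolding w_def by (simp add: nth_wedge_of)
  show ?thesis
  proof (cases "pg lam 0 < l")
    case False
    define b where "b = int (pg lam 0)"
    have b: "0 \<le> b - int l" "0 \<le> b" "(b - int l) mod int l = b mod int l" unfolding b_def using False by auto
    have e: "w = butlast w @ [b]"
    proof -
      have "w \<noteq> []" using lw by auto
      then show ?thesis using append_butlast_last_id[of w] last_conv_nth[of w] lw wr unfolding b_def by simp
    qed
    have "zer (esum (int l) (\<lambda>v. f (v @ [b]) - f (v @ [b - int l])) (butlast w))"
    proof (rule esum_zer)
      fix v :: "int list" assume v: "length v = length (butlast w)"
      show "zer (f (v @ [b]) - f (v @ [b - int l]))"
      proof (rule straight_zer_all[OF l, where f = "\<lambda>v. f (v @ [b]) - f (v @ [b - int l])" and r = r])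
        show "wedge_alt l r (\<lambda>v. f (v @ [b]) - f (v @ [b - int l]))" by (intro wedge_alt_diff wedge_alt_snoc fw)
        fix u :: "int list" assume u: "length u = r" "sorted_wrt (<) u"
        show "zer (f (u @ [b]) - f (u @ [b - int l]))"
          using zer_diff[OF ext_Rho_snoc[OF l len u b(2)] ext_Rho_snoc[OF l len u b(1)]] unfolding b(3) f_def by simp
      qed (use v lw in simp)
    qed
    then have "zer (esum (int l) f w)" unfolding esum_diff by (subst e) (simp only: esum_snoc)
    moreover have "lam \<noteq> nu0 l m" using False pg_nu0_le[OF l, of m] l by auto
    ultimately show ?thesis unfolding f_def w_def by simp
  next
    case True
    have tr: "t ! r = int (pg (nu0 l m) 0)" "t ! 0 = - int r" unfolding t_def using len by (simp_all add: nth_wedge_of pg_beyond)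
    have w0: "- int r \<le> w ! 0" unfolding w_def using wedge_of_hd_ge[of "Suc r" lam] by simp
    have "zer (esum (int l) f w - f w)"
    proof (rule esum_lower)
      fix v assume v: "list_all2 (\<lambda>x y. x \<le> y \<and> x mod int l = y mod int l) v w" "sum_list v < sum_list w"
      have lv: "length v = Suc r" using list_all2_lengthD[OF v(1)] lw by simp
      have vw: "v ! p \<le> w ! p" "v ! p mod int l = w ! p mod int l" if "p < Suc r" for p
        using list_all2_nthD[OF v(1), of p] that lv by auto
      show "zer (f v)" unfolding f_def
      proof (rule ext_Rho_zer[OF l lv])
        fix j
        define s where "s = wedge_of (Suc r) (lift (l * j) (nu0 l m))"
        assume nz: "qstraight l v (wedge_of (Suc r) (lift (l * j) (nu0 l m))) \<noteq> 0"
        assume res: "\<And>p. p < Suc r \<Longrightarrow> wedge_of (Suc r) (lift (l * j) (nu0 l m)) ! p mod int l = v ! p mod int l"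
        have "(\<forall>p<Suc r. s ! p \<le> int l - 1) \<and> length s = length v \<and> sorted_wrt (<) s"
          unfolding s_def
        proof (rule qstraight_support[OF l nz])
          show "\<forall>p<Suc r. v ! p \<le> int l - 1"
          proof (intro allI impI)
            fix p assume p: "p < Suc r"
            have "w ! p \<le> int l - 1" using True p pg_antimono[OF lp, of 0 "r - p"] unfolding w_def by (simp add: nth_wedge_of)
            then show "v ! p \<le> int l - 1" using vw(1)[OF p] by simp
          qed
        next
          fix v' p x assume v': "\<forall>p<Suc r. v' ! p \<le> int l - 1" "length v' = length v" "Suc p < length v'" "v' ! Suc p \<le> x" "x < v' ! p"
          then have "v' ! Suc p \<le> int l - 1" "v' ! p \<le> int l - 1" using lv by auto
          then have "v' ! p + v' ! Suc p - x \<le> int l - 1" "x \<le> int l - 1" using v'(4,5) by linarith+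
          then show "\<forall>p'<Suc r. upd2 v' p x (v' ! p + v' ! Suc p - x) ! p' \<le> int l - 1" using v' lv by (auto simp: nth_upd2)
        qed
        then have "s ! r \<le> int l - 1" using lessI[of r] by blast
        then have "int l * int j < int l" unfolding s_def wedge_lift[of r r, OF lessI] t_def[symmetric] tr(1) by simp
        then have "j = 0" using l mult_less_cancel_left_pos[of "int l" "int j" 1] by simp
        then have st: "s = t" unfolding s_def t_def lift_def by simp
        have tw: "t ! p mod int l = w ! p mod int l" if "p < Suc r" for p
          using res[OF that] vw(2)[OF that] unfolding s_def[symmetric] st by simp
        have gap: "t ! Suc p - t ! p \<le> int l" if "Suc p < Suc r" for p unfolding t_def by (rule nu0_gap[OF l that])
        have sw: "sorted_wrt (<) w" unfolding w_def by (rule wedge_of_sorted[OF lp])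
        have mono: "w ! p - t ! p \<le> w ! p' - t ! p'" if "p \<le> p'" "p' < Suc r" for p p'
          by (rule residue_mono[OF sw lw gap tw that])
        have D: "0 \<le> w ! p - t ! p" if "p < Suc r" for p using mono[of 0 p] that w0 tr(2) by simp
        have "int l dvd w ! r - t ! r" using tw[of r] by (auto simp: mod_eq_dvd_iff[symmetric])
        moreover have "w ! r - t ! r < int l" using wr tr True by simp
        ultimately have "w ! r - t ! r = 0" using D[of r] zdvd_imp_le[of "int l" "w ! r - t ! r"] by (cases "w ! r - t ! r = 0") auto
        then have "w = t" using mono[of _ r] D lw by (intro nth_equalityI) (auto simp: t_def less_Suc_eq_le intro: antisym)
        moreover have "sum_list s = sum_list v" unfolding s_def by (rule qstraight_sum[OF l nz])
        ultimately show False using v(2) st by simp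
      qed
    qed (use l in simp)
    moreover have "f w = (if lam = nu0 l m then 1 else 0)"
    proof -
      have "(\<exists>j. lam = lift (l * j) (nu0 l m)) \<longleftrightarrow> lam = nu0 l m"
      proof
        assume "\<exists>j. lam = lift (l * j) (nu0 l m)"
        then obtain j where j: "lam = lift (l * j) (nu0 l m)" by blast
        then have "pg lam 0 = pg (nu0 l m) 0 + l * j" by (simp add: pg_lift)
        then have "l * j < l * 1" using True by linarith
        then have "j = 0" by simp
        then show "lam = nu0 l m" using j by (simp add: lift_def)
      next
        assume "lam = nu0 l m"
        then show "\<exists>j. lam = lift (l * j) (nu0 l m)" by (intro exI[of _ 0]) (simp add: lift_def)
      qed
      then show ?thesis unfolding f_def w_def ext_wedge_of[OF l lam] Rho_def by simp
    qed
    ultimately show ?thesis unfolding f_def w_def by simp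
  qed
qed

lemma tow_graded:
  assumes lam: "is_partition lam"
  shows "tow l (\<lambda>mu. if sum_list mu = m then T mu else 0) j lam = (if sum_list lam = m + l * j then tow l T j lam else 0)"
  using lam
proof (induction j arbitrary: lam rule: less_induct)
  case (less j)
  define U where "U = (\<lambda>mu. if sum_list mu = m then T mu else 0)"
  show ?case
  proof (cases "j = 0")
    case True then show ?thesis by (simp add: tow_0)
  next
    case False
    have "Bf l k (tow l U (j - k)) lam = (if sum_list lam = m + l * j then 1 else 0) * Bf l k (tow l T (j - k)) lam" if k: "k \<in> {1..j}" for k
      unfolding Bf_scale[symmetric]
    proof (rule Bf_cong)
      fix mu assume mu: "is_partition mu" "int (sum_list mu) + int l * int k = int (sum_list lam)"
      then have "sum_list lam = sum_list mu + l * k" by (metis of_nat_add of_nat_eq_iff of_nat_mult)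
      moreover have "l * j = l * (j - k) + l * k" using k by (simp flip: distrib_left)
      ultimately have "sum_list lam = m + l * j \<longleftrightarrow> sum_list mu = m + l * (j - k)" by auto
      then show "tow l U (j - k) mu = (if sum_list lam = m + l * j then 1 else 0) * tow l T (j - k) mu"
        using less.IH[OF _ mu(1), of "j - k"] k False unfolding U_def by simp
    qed
    then have "of_nat j * tow l U j lam = (if sum_list lam = m + l * j then 1 else 0) * (of_nat j * tow l T j lam)"
      unfolding tow_rec sum_distrib_left by (intro sum.cong refl)
    then show ?thesis using False unfolding U_def by (auto split: if_splits)
  qed
qed

text \<open>Modulo q the part of \<open>T0\<close> in size m is the indicator of
  \<open>nu0 l m\<close>, that is, the product of the 1 - S_p applied to \<open>Rho\<close>. Summing
  all h_i gives back \<open>Rho\<close>, while the grading leaves only the term i = j.\<close>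

lemma tow_mod:
  assumes l: "2 \<le> l" and lam: "is_partition lam" and j: "l * j \<le> sum_list lam"
  shows "zer (tow l (T0 l) j lam - (if lam = lift (l * j) (nu0 l (sum_list lam - l * j)) then 1 else 0))"
proof -
  define m where "m = sum_list lam - l * j"
  define r where "r = max 1 (max (length lam) (length (nu0 l m)))"
  define N where "N = sum_list lam div l"
  define w where "w = wedge_of (Suc r) lam"
  define U where "U = (\<lambda>mu. if sum_list mu = m then T0 l mu else 0)"
  define f where "f = ext l (Suc r) (Rho l m)"
  have r: "0 < r" "length (nu0 l m) \<le> r" "lam \<in> parts (Suc r)" unfolding r_def using lam by (auto simp: parts_def)
  have lw: "length w = Suc r" and sw: "sum_list w = int (sum_list lam) + vac_sum (Suc r)"
    unfolding w_def using sum_wedge_of[of lam "Suc r"] r by (auto simp: parts_def)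
  have "sum_list lam = m + l * j" unfolding m_def using j by simp
  then have m_iff: "sum_list lam = m + l * i \<longleftrightarrow> i = j" for i using l by auto
  have U: "zer (U mu - (if mu = nu0 l m then 1 else 0))" if "is_partition mu" for mu
  proof (cases "sum_list mu = m")
    case True then show ?thesis using T0_mod[OF l that] unfolding U_def by simp
  next
    case False
    then have "mu \<noteq> nu0 l m" using sum_nu0 by blast
    then show ?thesis using False unfolding U_def by simp
  qed
  have Z: "zer (esum (int l) f v - ext l (Suc r) U v)" if "length v = Suc r" for v
  proof (rule straight_zer_all[OF l, where f = "\<lambda>v. esum (int l) f v - ext l (Suc r) U v", OF _ _ that])
    have wf: "wfun l (Suc r) (esum (int l) f)" "wfun l (Suc r) (ext l (Suc r) U)"
      unfolding f_def by (intro wfun_esum wfun_ext l)+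
    show "wedge_alt l (Suc r) (\<lambda>v. esum (int l) f v - ext l (Suc r) U v)" using wf unfolding wfun_def by (intro wedge_alt_diff) auto
    fix v :: "int list" assume v: "length v = Suc r" "sorted_wrt (<) v"
    show "zer (esum (int l) f v - ext l (Suc r) U v)"
      proof (cases "v ! 0 < 1 - int (Suc r)")
        case True
        then show ?thesis using wf v unfolding wfun_def by simp
      next
        case False
        then obtain mu where mu: "mu \<in> parts (Suc r)" "wedge_of (Suc r) mu = v" using normal_wedge[OF v] by force
        have "ext l (Suc r) U v = U mu" unfolding mu(2)[symmetric] by (rule ext_wedge_of[OF l mu(1)])
        then show ?thesis using zer_diff[OF esum_Rho[OF l r(2,1) mu(1)] U[of mu]] mu unfolding f_def parts_def by simp
      qed
  qed
  have "(\<Sum>i\<le>N. hsum (int l) i (esum (int l) f) w) = f w"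
  proof (rule hsum_esum[where s = "vac_sum (Suc r)"])
    fix v :: "int list" assume "sum_list v < vac_sum (Suc r)"
    then have "{lam \<in> parts (Suc r). int (sum_list lam) + vac_sum (Suc r) = sum_list v} = {}" by auto
    then show "f v = 0" unfolding f_def ext_def by (simp only: sum.empty)
  next
    have "sum_list lam < l * (N + 1)" unfolding N_def using l dividend_less_times_div[of l "sum_list lam"] by simp
    then have "int (sum_list lam) < int l * (int N + 1)" by (metis of_nat_1 of_nat_add of_nat_less_iff of_nat_mult)
    then show "sum_list w - int l * (int N + 1) < vac_sum (Suc r)" unfolding sw by linarith
  qed simp
  moreover have "f w = Rho l m lam" unfolding f_def w_def by (rule ext_wedge_of[OF l r(3)])
  moreover have "(\<Sum>i\<le>N. hsum (int l) i (ext l (Suc r) U) w) = tow l (T0 l) j lam"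
  proof -
    have "hsum (int l) i (ext l (Suc r) U) w = (if i = j then tow l (T0 l) j lam else 0)" for i
    proof -
      have "hsum (int l) i (ext l (Suc r) U) w = tow l U i lam"
        unfolding ext_tow[OF l lw, symmetric] unfolding w_def by (rule ext_wedge_of[OF l r(3)])
      also have "\<dots> = (if sum_list lam = m + l * i then tow l (T0 l) i lam else 0)" unfolding U_def by (rule tow_graded[OF lam])
      finally show ?thesis using m_iff[of i] by simp
    qed
    moreover have "j \<le> N" unfolding N_def using j l by (simp add: less_eq_div_iff_mult_less_eq mult.commute)
    ultimately show ?thesis by simp
  qed
  moreover have "zer ((\<Sum>i\<le>N. hsum (int l) i (ext l (Suc r) U) w) - (\<Sum>i\<le>N. hsum (int l) i (esum (int l) f) w))"
    unfolding sum_subtractf[symmetric]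
  proof (rule zer_sum)
    fix i
    have "zer (hsum (int l) i (\<lambda>v. esum (int l) f v - ext l (Suc r) U v) w)" by (rule hsum_zer) (simp add: Z lw)
    then show "zer (hsum (int l) i (ext l (Suc r) U) w - hsum (int l) i (esum (int l) f) w)"
      unfolding hsum_diff using zer_minus by fastforce
  qed
  moreover have "(\<exists>j'. lam = lift (l * j') (nu0 l m)) \<longleftrightarrow> lam = lift (l * j) (nu0 l m)"
  proof
    assume "\<exists>j'. lam = lift (l * j') (nu0 l m)"
    then obtain j' where j': "lam = lift (l * j') (nu0 l m)" by blast
    then have "sum_list lam = m + l * j'" using sum_lift[of "l * j'" "nu0 l m"] sum_nu0[of l m] by simp
    then have "j' = j" using m_iff by blast
    then show "lam = lift (l * j) (nu0 l m)" using j' by simp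
  qed blast
  ultimately show ?thesis unfolding Rho_def m_def[symmetric] by simp
qed

section \<open>Bar invariance\<close>

lemma Fract_0_1: "Fract 0 1 = (0 :: qf)" and Fract_1_1: "Fract 1 1 = (1 :: qf)"
  unfolding Zero_fract_def One_fract_def by (rule refl)+

lemma cst_0 [simp]: "cst 0 = 0" by (simp add: cst_def Zero_fract_def)
lemma cst_1 [simp]: "cst 1 = 1" by (simp add: cst_def One_fract_def one_pCons)
lemma cst_add: "cst (a + b) = cst a + cst b" by (simp add: cst_def)
lemma cst_mult: "cst (a * b) = cst a * cst b" by (simp add: cst_def mult.commute)

definition inv_eval :: "complex poly \<Rightarrow> qf" where "inv_eval p = poly (map_poly cst p) (inverse qv)"

lemma inv_eval_0 [simp]: "inv_eval 0 = 0" by (simp add: inv_eval_def)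

lemma inv_eval_pCons: "inv_eval (pCons a p) = cst a + inverse qv * inv_eval p"
  by (simp add: inv_eval_def map_poly_pCons)

lemma inv_eval_add: "inv_eval (p + q) = inv_eval p + inv_eval q"
  by (induction p q rule: poly_induct2) (simp_all add: inv_eval_pCons cst_add algebra_simps)

lemma inv_eval_smult: "inv_eval (smult a p) = cst a * inv_eval p"
  by (induction p) (simp_all add: inv_eval_pCons cst_mult algebra_simps)

lemma inv_eval_mult: "inv_eval (p * q) = inv_eval p * inv_eval q"
  by (induction p) (simp_all add: inv_eval_pCons inv_eval_add inv_eval_smult algebra_simps)

text \<open>Clearing denominators turns p(1/q) into a nonzero polynomial of controlled degree. The
  nonvanishing makes \<open>conj\<close> well defined on fractions; the degree bound is what
  isolates constants in \<open>pol_conj_fixed\<close>.\<close>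

lemma inv_eval_clear:
  "p \<noteq> 0 \<Longrightarrow> \<exists>n r. qv ^ n * inv_eval p = Fract r 1 \<and> r \<noteq> 0 \<and> degree r \<le> n"
proof (induction p)
  case (pCons a p)
  show ?case
  proof (cases "p = 0")
    case True
    then have "qv ^ 0 * inv_eval (pCons a p) = Fract [:a:] 1 \<and> [:a:] \<noteq> 0 \<and> degree [:a:] \<le> 0"
      using pCons.hyps by (simp add: inv_eval_pCons cst_def)
    then show ?thesis by blast
  next
    case False
    then obtain n r where r: "qv ^ n * inv_eval p = Fract r 1" "r \<noteq> 0" "degree r \<le> n" using pCons.IH by blast
    have "qv ^ Suc n * inv_eval (pCons a p) = cst a * qv ^ Suc n + (qv * inverse qv) * (qv ^ n * inv_eval p)"
      by (simp only: inv_eval_pCons power_Suc distrib_left mult_ac)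
    also have "\<dots> = Fract (monom a (Suc n) + r) 1"
      unfolding r(1) cst_def unfolding qv_power by (simp add: smult_monom)
    finally have e: "qv ^ Suc n * inv_eval (pCons a p) = Fract (monom a (Suc n) + r) 1" .
    have "coeff r (Suc n) = 0" using r(3) by (intro coeff_eq_0) simp
    then have "monom a (Suc n) + r \<noteq> 0"
    proof (cases "a = 0")
      case True then show ?thesis using r(2) by simp
    next
      case False
      have "coeff (monom a (Suc n) + r) (Suc n) = a" using \<open>coeff r (Suc n) = 0\<close> by simp
      then show ?thesis using False by (metis coeff_0)
    qed
    moreover have "degree (monom a (Suc n) + r) \<le> Suc n"
      using r(3) by (intro degree_add_le degree_monom_le) simp
    ultimately show ?thesis using e by blast
  qed
qed simp

lemma inv_eval_eq_0: "inv_eval p = 0 \<longleftrightarrow> p = 0"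
proof
  assume z: "inv_eval p = 0"
  show "p = 0"
  proof (rule ccontr)
    assume "p \<noteq> 0"
    then obtain n r where r: "qv ^ n * inv_eval p = Fract r 1" "r \<noteq> 0" using inv_eval_clear by blast
    have "Fract r 1 = Fract 0 1" unfolding r(1)[symmetric] z Fract_0_1 by simp
    then show False using r(2) by (simp add: eq_fract)
  qed
qed simp

text \<open>The field automorphism over the complex numbers sending q to its inverse; complex
  coefficients stay as they are. The description is made unique by
  \<open>conj_Fract\<close>.\<close>

definition conj :: "qf \<Rightarrow> qf" where
  "conj x = (THE y. \<exists>a b. b \<noteq> 0 \<and> x = Fract a b \<and> y = inv_eval a / inv_eval b)"

lemma conj_Fract: "b \<noteq> 0 \<Longrightarrow> conj (Fract a b) = inv_eval a / inv_eval b"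
  unfolding conj_def
proof (rule the_equality)
  assume b: "b \<noteq> 0"
  then show "\<exists>a' b'. b' \<noteq> 0 \<and> Fract a b = Fract a' b' \<and> inv_eval a / inv_eval b = inv_eval a' / inv_eval b'" by blast
  fix y assume "\<exists>a' b'. b' \<noteq> 0 \<and> Fract a b = Fract a' b' \<and> y = inv_eval a' / inv_eval b'"
  then obtain a' b' where y: "b' \<noteq> 0" "Fract a b = Fract a' b'" "y = inv_eval a' / inv_eval b'" by blast
  then have "a * b' = a' * b" using b by (simp add: eq_fract)
  then have "inv_eval a * inv_eval b' = inv_eval a' * inv_eval b" unfolding inv_eval_mult[symmetric] by simp
  then show "y = inv_eval a / inv_eval b" using y b by (simp add: frac_eq_eq inv_eval_eq_0)
qed

lemma inv_eval_1 [simp]: "inv_eval 1 = 1"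
  unfolding one_pCons by (simp add: inv_eval_pCons)

lemma conj_poly: "conj (Fract p 1) = inv_eval p"
  by (simp add: conj_Fract)

lemma conj_add: "conj (x + y) = conj x + conj y"
  by (cases x; cases y) (simp add: conj_Fract inv_eval_add inv_eval_mult inv_eval_eq_0 add_frac_eq)

lemma conj_mult: "conj (x * y) = conj x * conj y"
  by (cases x; cases y) (simp add: conj_Fract inv_eval_mult)

lemma conj_0 [simp]: "conj 0 = 0" using conj_poly[of 0] by (simp add: Fract_0_1)
lemma conj_1 [simp]: "conj 1 = 1" using conj_poly[of 1] by (simp add: Fract_1_1)
lemma conj_cst: "conj (cst c) = cst c" by (simp add: cst_def conj_poly) (simp add: inv_eval_pCons cst_def)
lemma conj_qv: "conj qv = inverse qv" unfolding qv_def by (simp add: conj_poly) (simp add: inv_eval_pCons qv_def)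

lemma conj_sum: "conj (sum f I) = (\<Sum>i\<in>I. conj (f i))"
  by (induction I rule: infinite_finite_induct) (simp_all add: conj_add)

lemma conj_eq_0 [simp]: "conj x = 0 \<longleftrightarrow> x = 0"
proof
  assume z: "conj x = 0"
  show "x = 0"
  proof (rule ccontr)
    assume "x \<noteq> 0"
    then have "conj x * conj (inverse x) = 1" unfolding conj_mult[symmetric] by simp
    then show False using z by simp
  qed
qed simp

lemma conj_inverse: "conj (inverse x) = inverse (conj x)"
proof (cases "x = 0")
  case False
  then have "conj x * conj (inverse x) = 1" unfolding conj_mult[symmetric] by simp
  then show ?thesis by (rule inverse_unique[symmetric])
qed simp

lemma conj_inv_eval: "conj (inv_eval p) = Fract p 1"
proof (induction p)
  case 0 then show ?case by (simp add: Fract_0_1)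
next
  case (pCons a p)
  have "pCons a p = [:a:] + [:0,1:] * p" by simp
  then have "Fract (pCons a p) 1 = Fract [:a:] 1 + Fract [:0,1:] 1 * Fract p 1" by (simp only: mult_fract add_fract mult_1_right mult_1 one_neq_zero not_False_eq_True)
  then have "Fract (pCons a p) 1 = cst a + qv * Fract p 1" unfolding cst_def qv_def .
  then show ?case by (simp add: inv_eval_pCons conj_add conj_mult conj_cst conj_inverse conj_qv pCons.IH)
qed

lemma conj_conj: "conj (conj x) = x"
proof (cases x)
  case (Fract a b)
  have "conj (conj x) = conj (inv_eval a * inverse (inv_eval b))" using Fract by (simp add: conj_Fract divide_inverse)
  also have "\<dots> = Fract a 1 * inverse (Fract b 1)" unfolding conj_mult conj_inverse conj_inv_eval ..
  also have "\<dots> = x" using Fract by simp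
  finally show ?thesis .
qed

text \<open>If p(q) = p(1/q), then q^n p has degree n + degree p but is also a polynomial of degree
  at most n.\<close>

lemma pol_conj_fixed:
  assumes "pol x" "conj x = x"
  obtains c where "x = cst c"
proof -
  obtain p where p: "x = Fract p 1" using assms(1) unfolding pol_def by blast
  show thesis
  proof (cases "p = 0")
    case True
    then show thesis using that[of 0] p by (simp add: Fract_0_1)
  next
    case False
    then obtain n r where r: "qv ^ n * inv_eval p = Fract r 1" "r \<noteq> 0" "degree r \<le> n" using inv_eval_clear by blast
    have "inv_eval p = Fract p 1" using assms(2) unfolding p conj_poly .
    then have "Fract (monom 1 n * p) 1 = Fract r 1" using r(1) by (simp add: qv_power)
    then have "monom 1 n * p = r" by (simp add: eq_fract)
    moreover have "degree (monom 1 n * p) = n + degree p"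
      using False by (subst degree_mult_eq) (auto simp: degree_monom_eq)
    ultimately have "degree p = 0" using r(3) by simp
    then obtain c where "p = [:c:]" by (rule degree_eq_zeroE)
    then show thesis using that[of c] p by (simp add: cst_def)
  qed
qed

lemma zer_cst: "zer (cst c) \<Longrightarrow> c = 0"
proof -
  assume "zer (cst c)"
  then obtain p where "cst c = qv * Fract p 1" unfolding zer_def pol_def by blast
  then have "[:c:] = [:0, 1:] * p" unfolding cst_def qv_def by (simp add: eq_fract)
  then show "c = 0" by simp
qed

section \<open>Division by the transposed Heisenberg operators\<close>

lemma wedge_alt_append:
  assumes "wedge_alt l r f" "length z \<le> r" shows "wedge_alt l (r - length z) (\<lambda>v. f (v @ z))"
  unfolding wedge_alt_def
proof (intro allI impI)
  fix w :: "int list" and p m k assume w: "length w = r - length z" "Suc p < r - length z"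
  have "upd2 w p x y @ z = upd2 (w @ z) p x y" for x y
    unfolding upd2_def using w by (simp add: list_update_append)
  then show "pair_rel l (\<lambda>x y. f (upd2 w p x y @ z)) m k = 0"
    using assms w unfolding wedge_alt_def by simp
qed

text \<open>The bound is the least sum of strictly increasing letters starting at 1 - r.
  Straightening inside the prefix preserves its sum, so every normal prefix obtained starts below 1
  - r.\<close>

lemma low_prefix:
  assumes l: "2 \<le> l" and f: "wfun l r f" and u: "length (u @ z) = r" "u \<noteq> []"
    and s: "sum_list u < (\<Sum>p<length u. 1 - int r + int p)"
  shows "f (u @ z) = 0"
proof (rule wedge_alt_zeroI[OF l, where f = "\<lambda>v. f (v @ z)" and w = u and P = "\<lambda>v. sum_list v < (\<Sum>p<length u. 1 - int r + int p)"])
  show "wedge_alt l (length u) (\<lambda>v. f (v @ z))"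
  proof -
    have "r - length z = length u" "length z \<le> r" using u(1) by auto
    then show ?thesis using wedge_alt_append[of l r f z] f unfolding wfun_def by simp
  qed
next
  fix v :: "int list" assume v: "sum_list v < (\<Sum>p<length u. 1 - int r + int p)" "length v = length u" "sorted_wrt (<) v"
  have "v ! 0 < 1 - int r"
  proof (rule ccontr)
    assume g: "\<not> v ! 0 < 1 - int r"
    have "1 - int r + int p \<le> v ! p" if "p < length v" for p
      using that
    proof (induction p)
      case (Suc p)
      then have "v ! p < v ! Suc p" using v(3) by (simp add: sorted_wrt_iff_nth_less)
      then show ?case using Suc by simp
    qed (use g in simp)
    then have "(\<Sum>p<length u. 1 - int r + int p) \<le> (\<Sum>p<length u. v ! p)" by (intro sum_mono) (simp add: v(2))
    then show False using v(1,2) by (simp add: sum_list_sum_nth atLeast0LessThan)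
  qed
  then show "f (v @ z) = 0" using f u v(2) unfolding wfun_def by (cases v) auto
qed (use s in \<open>simp_all add: sum_list_upd2\<close>)

lemma shift_sum_append:
  "shift_sum K f (u @ z) = (\<Sum>p<length u. f (u[p := u ! p - K] @ z)) + shift_sum K (\<lambda>y. f (u @ y)) z" for f :: "int list \<Rightarrow> qf"
proof (induction u arbitrary: f)
  case (Cons a u)
  show ?case using Cons.IH[of "\<lambda>v. f (a # v)"] by (simp add: sum.lessThan_Suc_shift del: sum.lessThan_Suc)
qed simp

definition low_sum :: "nat \<Rightarrow> nat \<Rightarrow> int" where "low_sum r n = (\<Sum>p<n. 1 - int r + int p)"

lemma shift_sum_low:
  assumes l: "2 \<le> l" and f: "wfun l r f" and u: "length (u @ z) = r" and K: "sum_list u - K < low_sum r (length u)"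
  shows "shift_sum K f (u @ z) = shift_sum K (\<lambda>y. f (u @ y)) z"
proof -
  have "f (u[p := u ! p - K] @ z) = 0" if "p < length u" for p
  proof (rule low_prefix[OF l f])
    show "u[p := u ! p - K] \<noteq> []" using that by auto
    show "sum_list (u[p := u ! p - K]) < (\<Sum>p<length (u[p := u ! p - K]). 1 - int r + int p)"
      using K unfolding sum_list_shift[OF that] low_sum_def by simp
  qed (use u in simp)
  then show ?thesis unfolding shift_sum_append by simp
qed

text \<open>After the first row has been lengthened by l * k with l * k exceeding the size, lowering
  any other letter by l * k pushes the prefix below the minimum of \<open>low_prefix\<close>. So B_k
  can only undo the lift. It follows that Om is recovered from its image under the transpose of
  B_k.\<close>

lemma shift_sum_lift:
  assumes l: "2 \<le> l" and k: "sum_list lam < l * k" and len: "length lam \<le> r" and g: "wfun l (Suc r) g"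
  shows "shift_sum (int l * int k) g (wedge_of (Suc r) (lift (l * k) lam)) = g (wedge_of (Suc r) lam)"
proof -
  define w where "w = wedge_of (Suc r) (lift (l * k) lam)"
  define t where "t = wedge_of (Suc r) lam"
  define u where "u = butlast t"
  have lt: "length t = Suc r" "length u = r" unfolding t_def u_def by simp_all
  have t: "t = u @ [int (pg lam 0)]"
  proof -
    have "t \<noteq> []" using lt by auto
    then show ?thesis using append_butlast_last_id[of t] last_conv_nth[of t] lt wedge_of_last[of "Suc r" lam] unfolding u_def t_def by simp
  qed
  have w: "w = u @ [int (pg lam 0) + int (l * k)]"
  proof (rule nth_equalityI)
    fix p assume "p < length w"
    then have p: "p < Suc r" unfolding w_def by simp
    have "w ! p = t ! p + (if p = r then int (l * k) else 0)" using p unfolding w_def t_def by (simp add: nth_wedge_of pg_lift)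
    then show "w ! p = (u @ [int (pg lam 0) + int (l * k)]) ! p" using p lt unfolding t by (auto simp: nth_append less_Suc_eq)
  qed (simp add: w_def lt)
  have su: "sum_list u - int l * int k < low_sum (Suc r) r"
  proof -
    have "sum_list t = int (sum_list lam) + vac_sum (Suc r)" unfolding t_def by (rule sum_wedge_of) (use len in simp)
    then have "sum_list u \<le> int (sum_list lam) + vac_sum (Suc r)" unfolding t by simp
    moreover have "vac_sum (Suc r) = low_sum (Suc r) r"
    proof -
      have "vac_sum (Suc r) = (\<Sum>j<Suc r. int j - int r)"
        unfolding vac_sum_def by (subst sum.nat_diff_reindex[symmetric]) (auto intro!: sum.cong simp: of_nat_diff)
      then show ?thesis unfolding low_sum_def by (simp add: algebra_simps)
    qed
    moreover have "int (sum_list lam) < int l * int k" using k by (metis of_nat_less_iff of_nat_mult)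
    ultimately show ?thesis by linarith
  qed
  have "shift_sum (int l * int k) g w = shift_sum (int l * int k) (\<lambda>y. g (u @ y)) [int (pg lam 0) + int (l * k)]"
    unfolding w by (rule shift_sum_low[OF l g]) (use lt su in simp_all)
  also have "\<dots> = g t" unfolding t by simp
  finally show ?thesis unfolding w_def t_def .
qed

lemma lift_parts: "lam \<in> parts r \<Longrightarrow> lift k lam \<in> parts (Suc r)"
  using lift_partition[of lam k] length_lift(1)[of k lam] by (simp add: parts_def)

lemma Bf_lift:
  assumes l: "2 \<le> l" and k: "0 < k" "sum_list lam < l * k" and lam: "is_partition lam"
  shows "Bf l k Om (lift (l * k) lam) = Om lam"
proof -
  define r where "r = length lam"
  have r: "lam \<in> parts r" using lam by (simp add: parts_def r_def)
  have "Bf l k Om (lift (l * k) lam) = ext l (Suc r) Om (wedge_of (Suc r) lam)"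
    unfolding Bf_shift_sum[OF l k(1) lift_parts[OF r]] by (rule shift_sum_lift[OF l k(2) _ wfun_ext[OF l]]) (simp add: r_def)
  then show ?thesis using ext_wedge_of[OF l parts_Suc[OF r]] by simp
qed

lemma wedge_alt_split_last:
  assumes "\<And>e. wedge_alt l (Suc n) (\<lambda>v. f (v @ [e]))"
    and "\<And>u m k. length u = n \<Longrightarrow> pair_rel l (\<lambda>x y. f (u @ [x, y])) m k = 0"
  shows "wedge_alt l (Suc (Suc n)) f"
  unfolding wedge_alt_def
proof (intro allI impI)
  fix w :: "int list" and p m k assume w: "length w = Suc (Suc n)" "Suc p < Suc (Suc n)"
  show "pair_rel l (\<lambda>x y. f (upd2 w p x y)) m k = 0"
  proof (cases "p = n")
    case True
    have "upd2 w p x y = take n w @ [x, y]" for x y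
      by (rule nth_equalityI) (use w True in \<open>auto simp: nth_upd2 nth_append less_Suc_eq\<close>)
    then show ?thesis using assms(2)[of "take n w" m k] w by simp
  next
    case False
    have "upd2 w p x y = upd2 (butlast w) p x y @ [last w]" for x y
    proof -
      have "w = butlast w @ [last w]" using w by (intro append_butlast_last_id[symmetric]) auto
      then have "upd2 w p x y = upd2 (butlast w @ [last w]) p x y" by simp
      also have "\<dots> = upd2 (butlast w) p x y @ [last w]" unfolding upd2_def using w False by (simp add: list_update_append)
      finally show ?thesis .
    qed
    then show ?thesis using assms(1)[of "last w"] w False unfolding wedge_alt_def by simp
  qed
qed

text \<open>The family \<open>E\<close> is divided by the power sums on words whose last letter has first been raised far enough;
  alternation in the last two letters follows from the antisymmetry of its defect under arbitrarily large shifts.\<close>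

lemma koszul:
  assumes l: "2 \<le> l" and E: "\<And>j k lam. 0 < j \<Longrightarrow> 0 < k \<Longrightarrow> is_partition lam \<Longrightarrow> Bf l j (E k) lam = Bf l k (E j) lam"
  shows "\<exists>Om. \<forall>k lam. 0 < k \<longrightarrow> is_partition lam \<longrightarrow> E k lam = Bf l k Om lam"
proof -
  \<comment> \<open>With such a K, lowering any letter of the prefix v by l * K gives zero, so the
    power sum of degree K acts on the last letter alone.\<close>
  define big where "big = (\<lambda>r v K. 0 < K \<and> sum_list v - int l * int K < low_sum r (length v))"
  have bigI: "\<exists>K. big r v K \<and> k \<le> K" for r v k
  proof -
    define K where "K = max (Suc k) (nat (sum_list v - low_sum r (length v)) + 1)"
    have "int K \<le> int l * int K" using l by (simp add: mult_le_cancel_right1)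
    moreover have "sum_list v - low_sum r (length v) < int K" unfolding K_def by simp
    ultimately have "big r v K" unfolding big_def K_def by linarith
    then show ?thesis unfolding K_def by (intro exI[of _ K]) (simp add: K_def)
  qed
  have bigmono: "big r v K'" if "big r v K" "K \<le> K'" for r v K K'
  proof -
    have "int l * int K \<le> int l * int K'" using that(2) by (intro mult_left_mono) auto
    then show ?thesis using that unfolding big_def by linarith
  qed
  have sw: "shift_sum (int l * int j) (ext l r (E k)) w = shift_sum (int l * int k) (ext l r (E j)) w" if "0 < j" "0 < k" "length w = r" for j k r w
  proof -
    have "ext l r (Bf l j (E k)) w = ext l r (Bf l k (E j)) w"
      unfolding ext_def by (intro sum.cong refl) (use E that in \<open>auto simp: parts_def\<close>)
    then show ?thesis unfolding ext_Bf[OF l that(1,3)] ext_Bf[OF l that(2,3)] .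
  qed
  \<comment> \<open>The candidate quotient: E K read at the last letter raised by l * K. The
    compatibility of the family makes the choice of K immaterial, by \<open>indep\<close>.\<close>
  define X where "X = (\<lambda>r w. let v = butlast w; K = (SOME K. big r v K) in ext l r (E K) (v @ [last w + int l * int K]))"
  have indep: "ext l r (E K) (v @ [e + int l * int K]) = ext l r (E K') (v @ [e + int l * int K'])"
    if "big r v K" "big r v K'" "length v + 1 = r" for r v e K K'
  proof -
    have "shift_sum (int l * int K') (ext l r (E K)) (v @ [e + int l * int K + int l * int K']) = ext l r (E K) (v @ [e + int l * int K])"
      by (subst shift_sum_low[OF l wfun_ext[OF l]]) (use that in \<open>simp_all add: big_def\<close>)
    moreover have "shift_sum (int l * int K) (ext l r (E K')) (v @ [e + int l * int K + int l * int K']) = ext l r (E K') (v @ [e + int l * int K'])"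
      by (subst shift_sum_low[OF l wfun_ext[OF l]]) (use that in \<open>simp_all add: big_def\<close>)
    ultimately show ?thesis using sw[of K' K "v @ [e + int l * int K + int l * int K']" r] that unfolding big_def by simp
  qed
  have Xeq: "X r (v @ [e]) = ext l r (E K) (v @ [e + int l * int K])" if "big r v K" "length v + 1 = r" for r v e K
  proof -
    have "big r v (SOME K. big r v K)" by (rule someI[of "big r v", OF that(1)])
    from indep[OF this that] show ?thesis unfolding X_def Let_def by simp
  qed
  have shiftX: "shift_sum (int l * int j) (X r) (v @ [e]) = ext l r (E j) (v @ [e])" if j: "0 < j" "length v + 1 = r" for j r v e
  proof -
    obtain K where K: "big r v K" using bigI by blast
    have bp: "big r (v[p := v ! p - int l * int j]) K" if "p < length v" for p
    proof -
      have "0 \<le> int l * int j" by simp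
      then show ?thesis using K sum_list_shift[OF that, of "int l * int j"] unfolding big_def length_list_update by linarith
    qed
    have "shift_sum (int l * int j) (X r) (v @ [e]) = (\<Sum>p<length v. X r (v[p := v ! p - int l * int j] @ [e])) + X r (v @ [e - int l * int j])"
      unfolding shift_sum_append by simp
    also have "\<dots> = (\<Sum>p<length v. ext l r (E K) (v[p := v ! p - int l * int j] @ [e + int l * int K])) + ext l r (E K) (v @ [e - int l * int j + int l * int K])"
      using Xeq[OF K j(2)] Xeq[OF bp] j(2) by simp
    also have "\<dots> = shift_sum (int l * int j) (ext l r (E K)) (v @ [e + int l * int K])"
      unfolding shift_sum_append by (simp add: algebra_simps)
    also have "\<dots> = shift_sum (int l * int K) (ext l r (E j)) (v @ [e + int l * int K])"
      by (rule sw) (use j K in \<open>simp_all add: big_def\<close>)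
    also have "\<dots> = ext l r (E j) (v @ [e])"
      by (subst shift_sum_low[OF l wfun_ext[OF l]]) (use j K in \<open>simp_all add: big_def\<close>)
    finally show ?thesis .
  qed
  have altv: "wedge_alt l (Suc n) (\<lambda>v. X (Suc (Suc n)) (v @ [e]))" for n e
    unfolding wedge_alt_def
  proof (intro allI impI)
    fix w :: "int list" and p m k assume w: "length w = Suc n" "Suc p < Suc n"
    define r where "r = Suc (Suc n)"
    obtain K where K: "big r (upd2 w p m k) K" using bigI by blast
    have "pair_rel l (\<lambda>x y. X r (upd2 w p x y @ [e])) m k = pair_rel l (\<lambda>x y. ext l r (E K) (upd2 w p x y @ [e + int l * int K])) m k"
    proof (rule pair_rel_cong, rule Xeq)
      fix x y assume "x + y = m + k"
      then have "sum_list (upd2 w p x y) = sum_list (upd2 w p m k)" using w by (simp add: sum_list_upd2)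
      then show "big r (upd2 w p x y) K" using K unfolding big_def by simp
    qed (use w r_def in simp)
    also have "\<dots> = 0"
    proof -
      have "wedge_alt l r (ext l r (E K))" using wfun_ext[OF l] unfolding wfun_def by blast
      from wedge_alt_append[OF this, of "[e + int l * int K]"] show ?thesis using w unfolding r_def wedge_alt_def by simp
    qed
    finally show "pair_rel l (\<lambda>x y. X (Suc (Suc n)) (upd2 w p x y @ [e])) m k = 0" unfolding r_def .
  qed
  have Xlow: "X (Suc (Suc n)) (u @ [x, y]) = 0" if "length u = n" "u \<noteq> []" "sum_list u < low_sum (Suc (Suc n)) n" for n u x y
  proof -
    obtain K where K: "big (Suc (Suc n)) (u @ [x]) K" using bigI by blast
    have "X (Suc (Suc n)) ((u @ [x]) @ [y]) = ext l (Suc (Suc n)) (E K) ((u @ [x]) @ [y + int l * int K])"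
      by (rule Xeq[OF K]) (use that in simp)
    also have "\<dots> = ext l (Suc (Suc n)) (E K) (u @ [x, y + int l * int K])" by simp
    also have "\<dots> = 0" by (rule low_prefix[OF l wfun_ext[OF l]]) (use that in \<open>simp_all add: low_sum_def\<close>)
    finally show ?thesis by simp
  qed
  have altlast: "pair_rel l (\<lambda>x y. X (Suc (Suc n)) (u @ [x, y])) m k = 0" if u: "length u = n" for n u m k
  proof -
    define r where "r = Suc (Suc n)"
    define g where "g = (\<lambda>x y. X r (u @ [x, y]))"
    define Q where "Q = pair_rel l g"
    obtain J where J: "big r u J" using bigI by blast
    have anti: "Q (s - int l * int j) t + Q s (t - int l * int j) = 0" if j: "J \<le> j" for s t j
    proof -
      have bj: "big r u j" by (rule bigmono[OF J j])
      have "0 = pair_rel l (\<lambda>x y. ext l r (E j) (u @ [x, y])) s t"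
      proof -
        have "wedge_alt l r (ext l r (E j))" using wfun_ext[OF l] unfolding wfun_def by blast
        moreover have "upd2 (u @ [0, 0]) n x y = u @ [x, y]" for x y
          by (rule nth_equalityI) (use u in \<open>auto simp: nth_upd2 nth_append less_Suc_eq\<close>)
        moreover have "length (u @ [0, 0 :: int]) = r" "Suc n < r" using u unfolding r_def by auto
        ultimately have "pair_rel l (\<lambda>x y. ext l r (E j) (upd2 (u @ [0, 0]) n x y)) s t = 0"
          and up: "\<And>x y. upd2 (u @ [0, 0]) n x y = u @ [x, y]" unfolding wedge_alt_def by blast+
        then show ?thesis unfolding up by simp
      qed
      also have "\<dots> = pair_rel l (\<lambda>x y. g (x - int l * int j) (y - int l * 0) + g (x - int l * 0) (y - int l * int j)) s t"
      proof (rule pair_rel_cong)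
        fix x y
        have "ext l r (E j) ((u @ [x]) @ [y]) = shift_sum (int l * int j) (X r) ((u @ [x]) @ [y])"
          by (rule shiftX[symmetric]) (use bj u r_def in \<open>simp_all add: big_def\<close>)
        also have "(u @ [x]) @ [y] = u @ [x, y]" by simp
        also have "shift_sum (int l * int j) (X r) (u @ [x, y]) = (\<Sum>p<length u. X r (u[p := u ! p - int l * int j] @ [x, y])) + (g (x - int l * int j) y + g x (y - int l * int j))"
          unfolding shift_sum_append g_def by simp
        also have "(\<Sum>p<length u. X r (u[p := u ! p - int l * int j] @ [x, y])) = 0"
        proof (rule sum.neutral, rule ballI)
          fix p assume "p \<in> {..<length u}"
          then have p: "p < length u" by simp
          show "X r (u[p := u ! p - int l * int j] @ [x, y]) = 0" unfolding r_def
            by (rule Xlow) (use p u bj sum_list_shift[OF p, of "int l * int j"] in \<open>auto simp: big_def r_def\<close>)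
        qed
        finally show "ext l r (E j) (u @ [x, y]) = g (x - int l * int j) (y - int l * 0) + g (x - int l * 0) (y - int l * int j)" by simp
      qed
      also have "\<dots> = Q (s - int l * int j) t + Q s (t - int l * int j)" unfolding pair_rel_shift Q_def by simp
      finally show ?thesis by simp
    qed
    have step: "Q a b = - Q (a + int l * int j) (b - int l * int j)" if "J \<le> j" for a b j
      using anti[OF that, of "a + int l * int j" b] by (simp add: eq_neg_iff_add_eq_0)
    have "Q m k = - Q (m + int l * int (J + J)) (k - int l * int (J + J))" by (rule step) simp
    moreover have "Q m k = - Q (m + int l * int J) (k - int l * int J)" by (rule step) simp
    moreover have "Q (m + int l * int J) (k - int l * int J) = - Q (m + int l * int J + int l * int J) (k - int l * int J - int l * int J)" by (rule step) simp
    moreover have "m + int l * int J + int l * int J = m + int l * int (J + J)" "k - int l * int J - int l * int J = k - int l * int (J + J)" by (simp_all add: algebra_simps)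
    ultimately have "Q m k = - Q m k" by simp
    then have "2 * Q m k = 0" by (metis add.right_inverse mult_2)
    then show ?thesis unfolding Q_def g_def r_def by simp
  qed
  have Xw: "wfun l (Suc (Suc n)) (X (Suc (Suc n)))" for n
    unfolding wfun_def
  proof (intro conjI allI impI)
    show "wedge_alt l (Suc (Suc n)) (X (Suc (Suc n)))" by (rule wedge_alt_split_last[OF altv altlast])
    fix w :: "int list" assume w: "length w = Suc (Suc n)" "w ! 0 < 1 - int (Suc (Suc n))"
    define v where "v = butlast w"
    have wv: "w = v @ [last w]" "length v = Suc n" unfolding v_def using w by (auto intro!: append_butlast_last_id[symmetric])
    obtain K where K: "big (Suc (Suc n)) v K" using bigI by blast
    have "X (Suc (Suc n)) (v @ [last w]) = ext l (Suc (Suc n)) (E K) (v @ [last w + int l * int K])" by (rule Xeq[OF K]) (simp add: wv(2))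
    also have "\<dots> = 0"
    proof -
      have "v ! 0 = w ! 0" using wv by (metis nth_append zero_less_Suc)
      then have "(v @ [last w + int l * int K]) ! 0 < 1 - int (Suc (Suc n))" using w(2) wv(2) by (simp add: nth_append)
      then show ?thesis using wfun_ext[OF l, of "Suc (Suc n)" "E K"] wv(2) unfolding wfun_def by (simp del: of_nat_Suc)
    qed
    finally show "X (Suc (Suc n)) w = 0" using wv(1) by simp
  qed
  define Om where "Om = (\<lambda>lam. X (Suc (Suc (length lam))) (wedge_of (Suc (Suc (length lam))) lam))"
  have XS: "X (Suc (Suc (Suc n))) (- int (Suc (Suc n)) # w) = X (Suc (Suc n)) w" if w: "length w = Suc (Suc n)" for n w
  proof -
    define v where "v = butlast w"
    have wv: "w = v @ [last w]" "length v = Suc n" unfolding v_def using w by (auto intro!: append_butlast_last_id[symmetric])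
    obtain K1 where K1: "big (Suc (Suc n)) v K1" using bigI by blast
    obtain K where K: "big (Suc (Suc (Suc n))) (- int (Suc (Suc n)) # v) K" "K1 \<le> K" using bigI by blast
    have K': "big (Suc (Suc n)) v K" by (rule bigmono[OF K1 K(2)])
    have "X (Suc (Suc (Suc n))) ((- int (Suc (Suc n)) # v) @ [last w]) = ext l (Suc (Suc (Suc n))) (E K) ((- int (Suc (Suc n)) # v) @ [last w + int l * int K])"
      by (rule Xeq[OF K(1)]) (simp add: wv(2))
    also have "\<dots> = ext l (Suc (Suc n)) (E K) (v @ [last w + int l * int K])"
      unfolding append_Cons by (rule ext_Cons[OF l]) (simp add: wv(2))
    also have "\<dots> = X (Suc (Suc n)) (v @ [last w])" by (rule Xeq[OF K', symmetric]) (simp add: wv(2))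
    finally show ?thesis using wv(1) by simp
  qed
  have Om: "Om lam = X (Suc (Suc n)) (wedge_of (Suc (Suc n)) lam)" if "length lam \<le> n" for n lam
    using that
  proof (induction rule: dec_induct)
    case (step n)
    have "wedge_of (Suc (Suc (Suc n))) lam = - int (Suc (Suc n)) # wedge_of (Suc (Suc n)) lam" by (rule wedge_of_Suc_long) (use step in simp)
    then show ?case using step.IH XS[of "wedge_of (Suc (Suc n)) lam" n] by simp
  qed (simp add: Om_def)
  have extOm: "ext l (Suc (Suc n)) Om w = X (Suc (Suc n)) w" if w: "length w = Suc (Suc n)" for n w
  proof (rule wfun_eqI[OF l wfun_ext[OF l] Xw _ w])
    fix lam assume lam: "lam \<in> parts (Suc (Suc n))"
    define N where "N = Suc (Suc n)"
    have "length lam \<le> N" using lam unfolding N_def parts_def by simp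
    then have "Om lam = X (Suc (Suc N)) (wedge_of (Suc (Suc N)) lam)" by (rule Om)
    also have "wedge_of (Suc (Suc N)) lam = - int (Suc N) # - int N # wedge_of N lam"
      using \<open>length lam \<le> N\<close> by (simp add: wedge_of_Suc_long)
    also have "X (Suc (Suc N)) (- int (Suc N) # - int N # wedge_of N lam) = X (Suc N) (- int N # wedge_of N lam)"
      unfolding N_def by (rule XS) simp
    also have "\<dots> = X N (wedge_of N lam)" unfolding N_def by (rule XS) simp
    finally show "ext l (Suc (Suc n)) Om (wedge_of (Suc (Suc n)) lam) = X (Suc (Suc n)) (wedge_of (Suc (Suc n)) lam)"
      unfolding ext_wedge_of[OF l lam] N_def .
  qed
  have "E k lam = Bf l k Om lam" if k: "0 < k" and lam: "is_partition lam" for k lam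
  proof -
    define n where "n = length lam"
    define w where "w = wedge_of (Suc (Suc n)) lam"
    have p: "lam \<in> parts (Suc (Suc n))" using lam by (simp add: parts_def n_def)
    have lw: "length w = Suc (Suc n)" unfolding w_def by simp
    have wv: "w = butlast w @ [last w]" using lw by (intro append_butlast_last_id[symmetric]) auto
    have "Bf l k Om lam = shift_sum (int l * int k) (X (Suc (Suc n))) w"
      unfolding Bf_shift_sum[OF l k p] w_def[symmetric] by (rule shift_sum_cong) (simp add: extOm lw)
    also have "\<dots> = ext l (Suc (Suc n)) (E k) w"
      using shiftX[OF k, of "butlast w" "Suc (Suc n)" "last w"] wv lw by simp
    also have "\<dots> = E k lam" unfolding w_def by (rule ext_wedge_of[OF l p])
    finally show ?thesis by simp
  qed
  then show ?thesis by blast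
qed

section \<open>Pairing functionals with Fock vectors, and the operators on kets\<close>

lemma lin_op_superset:
  assumes "finite S" "supp v \<subseteq> S"
  shows "lin_op A v mu = (\<Sum>lam\<in>S. v lam * A lam mu)"
  unfolding lin_op_def by (rule sum.mono_neutral_left) (use assms in \<open>auto simp: supp_def\<close>)

lemma supp_ket [simp]: "supp (ket lam) = {lam}"
  by (auto simp: supp_def ket_def)

lemma fock_ket: "is_partition lam \<Longrightarrow> fock (ket lam)"
  by (simp add: fock_def)

lemma lin_op_ket: "lin_op A (ket lam) mu = A lam mu"
  by (simp add: lin_op_def) (simp add: ket_def)

lemma fock_smult: "fock v \<Longrightarrow> fock (smult_v c v)"
proof -
  assume "fock v"
  moreover have "supp (smult_v c v) \<subseteq> supp v" by (auto simp: supp_def smult_v_def)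
  ultimately show ?thesis unfolding fock_def by (meson finite_subset subsetD)
qed

definition comb :: "'i set \<Rightarrow> ('i \<Rightarrow> qf) \<Rightarrow> ('i \<Rightarrow> nat list) \<Rightarrow> fvec" where
  "comb I c h = (\<lambda>kap. \<Sum>i\<in>I. c i * ket (h i) kap)"

lemma supp_comb: "supp (comb I c h) \<subseteq> h ` I"
proof
  fix kap assume "kap \<in> supp (comb I c h)"
  then have "(\<Sum>i\<in>I. c i * ket (h i) kap) \<noteq> 0" by (simp add: supp_def comb_def)
  then obtain i where "i \<in> I" "c i * ket (h i) kap \<noteq> 0" by (rule sum.not_neutral_contains_not_neutral)
  then show "kap \<in> h ` I" by (auto simp: ket_def split: if_splits)
qed

lemma fock_comb: "finite I \<Longrightarrow> (\<And>i. i \<in> I \<Longrightarrow> is_partition (h i)) \<Longrightarrow> fock (comb I c h)"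
  unfolding fock_def using supp_comb[of I c h] by (blast intro: finite_subset)

lemma lin_op_comb: "finite I \<Longrightarrow> lin_op A (comb I c h) mu = (\<Sum>i\<in>I. c i * A (h i) mu)"
proof -
  assume I: "finite I"
  have "lin_op A (comb I c h) mu = (\<Sum>kap\<in>h ` I. (\<Sum>i\<in>I. c i * ket (h i) kap) * A kap mu)"
    using lin_op_superset[OF finite_imageI[OF I] supp_comb[of I c h], of A mu] unfolding comb_def by simp
  also have "\<dots> = (\<Sum>i\<in>I. \<Sum>kap\<in>h ` I. c i * ket (h i) kap * A kap mu)"
    unfolding sum_distrib_right by (rule sum.swap)
  also have "\<dots> = (\<Sum>i\<in>I. c i * A (h i) mu)"
  proof (intro sum.cong refl)
    fix i assume i: "i \<in> I"
    have "(\<Sum>kap\<in>h ` I. c i * ket (h i) kap * A kap mu) = (\<Sum>kap\<in>h ` I. if kap = h i then c i * A kap mu else 0)"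
      by (intro sum.cong refl) (simp add: ket_def)
    then show "(\<Sum>kap\<in>h ` I. c i * ket (h i) kap * A kap mu) = c i * A (h i) mu" using i I by simp
  qed
  finally show ?thesis .
qed

lemma fock_as_comb: "fock v \<Longrightarrow> v = comb (supp v) v (\<lambda>x. x)"
proof
  fix kap assume v: "fock v"
  have "comb (supp v) v (\<lambda>x. x) kap = (\<Sum>i\<in>supp v. if i = kap then v i else 0)"
    unfolding comb_def by (intro sum.cong refl) (auto simp: ket_def)
  also have "\<dots> = v kap" using v by (auto simp: fock_def supp_def)
  finally show "v kap = comb (supp v) v (\<lambda>x. x) kap" by simp
qed

text \<open>The last argument of \<^const>\<open>lin_op\<close> is a dummy.\<close>

definition pair :: "(nat list \<Rightarrow> qf) \<Rightarrow> fvec \<Rightarrow> qf" where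
  "pair Om v = lin_op (\<lambda>lam _. Om lam) v []"

lemma pair_cong: "fock v \<Longrightarrow> (\<And>lam. is_partition lam \<Longrightarrow> f lam = g lam) \<Longrightarrow> pair f v = pair g v"
  unfolding pair_def lin_op_def by (intro sum.cong) (auto simp: fock_def)

lemma finite_box: "finite {mu \<in> parts R. sum_list mu \<le> M}"
proof (rule finite_subset)
  show "{mu \<in> parts R. sum_list mu \<le> M} \<subseteq> {xs. set xs \<subseteq> {..M} \<and> length xs \<le> R}"
    using member_le_sum_list by (fastforce simp: parts_def)
qed (simp add: finite_lists_length_le)

lemma bcoef_eqI:
  assumes l: "2 \<le> l" "0 < k" and "\<And>j. pg mu j = pg nu j"
  shows "bcoef l k lam mu = bcoef l k lam nu"
proof -
  define r where "r = max (length lam) (max (length mu) (length nu))"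
  have "wedge_of r mu = wedge_of r nu" by (rule wedge_of_cong) (rule assms(3))
  then show ?thesis using bcoef_eq[OF l, of lam r mu] bcoef_eq[OF l, of lam r nu] by (simp add: bcoef_trunc_def r_def)
qed

text \<open>A coefficient sees its target nu only through \<open>pg\<close>, so nu may be a
  partition followed by zeros; mu is that partition. The last inequality holds because straightening
  never lowers the last letter.\<close>

lemma bcoef_nonzero:
  assumes l: "2 \<le> l" "0 < k" and nz: "bcoef l k lam nu \<noteq> 0"
  obtains mu where "mu \<in> parts (length lam)" "\<And>j. pg mu j = pg nu j" "sum_list mu + l * k = sum_list lam" "pg lam 0 \<le> pg mu 0 + l * k"
proof -
  define r where "r = Suc (max (length lam) (length nu))"
  have r: "length lam \<le> r" "length nu \<le> r" "0 < r" unfolding r_def by auto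
  define w where "w = wedge_of r lam"
  have "(\<Sum>p<r. qstraight l (w[p := w ! p - int l * int k]) (wedge_of r nu)) \<noteq> 0"
    using nz unfolding bcoef_eq[OF l r(1,2)] bcoef_trunc_def w_def .
  then obtain p where p: "p \<in> {..<r}" "qstraight l (w[p := w ! p - int l * int k]) (wedge_of r nu) \<noteq> 0"
    by (rule sum.not_neutral_contains_not_neutral)
  have lw: "length w = r" unfolding w_def by simp
  have "sorted_wrt (<) (wedge_of r nu)"
    using qstraight_support[OF l(1) p(2), of "\<lambda>_. True"] by blast
  then obtain mu where mu: "mu \<in> parts r" "wedge_of r mu = wedge_of r nu"
    using normal_wedge[of "wedge_of r nu" r] wedge_of_hd_ge[OF r(3)] by auto
  have pgm: "pg mu j = pg nu j" for j
  proof (cases "j < r")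
    case True then show ?thesis using wedge_of_eqD[OF mu(2)] by blast
  next
    case False then show ?thesis using mu(1) r by (simp add: parts_def pg_beyond)
  qed
  have mp: "is_partition mu" "length mu \<le> r" using mu(1) by (auto simp: parts_def)
  have nzm: "bcoef l k lam mu \<noteq> 0" using nz bcoef_eqI[OF l, of mu nu lam] pgm by simp
  have "length mu \<le> length lam" using bcoef_longer[OF l mp(1), of lam] nzm by (auto simp: not_less[symmetric])
  then have m1: "mu \<in> parts (length lam)" using mp by (simp add: parts_def)
  have "int (sum_list mu) + vac_sum r = int (sum_list lam) + vac_sum r - int l * int k"
    using qstraight_sum[OF l(1) p(2)] p(1) lw sum_wedge_of[OF mp(2)] sum_wedge_of[OF r(1)] mu(2) sum_list_shift[of p w "int l * int k"]
    unfolding w_def by simp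
  then have "int (sum_list mu + l * k) = int (sum_list lam)" by simp
  then have m2: "sum_list mu + l * k = sum_list lam" by (simp only: of_nat_eq_iff)
  have "(w[p := w ! p - int l * int k]) ! (r - 1) \<le> wedge_of r nu ! (r - 1)"
    using qstraight_last[OF l(1) p(2)] lw r by simp
  moreover have "w ! (r - 1) - int l * int k \<le> (w[p := w ! p - int l * int k]) ! (r - 1)"
    using lw r by (cases "p = r - 1") simp_all
  ultimately have "int (pg lam 0) - int l * int k \<le> int (pg mu 0)"
    using wedge_of_last[OF r(3), of lam] wedge_of_last[OF r(3), of nu] pgm[of 0] unfolding w_def by simp
  then have "int (pg lam 0) \<le> int (pg mu 0 + l * k)" by simp
  then have "pg lam 0 \<le> pg mu 0 + l * k" by (simp only: of_nat_le_iff)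
  then show thesis using that[OF m1 pgm m2] by blast
qed

lemma bcoef_lift:
  assumes l: "2 \<le> l" and k: "0 < k" "sum_list lam < l * k" and lam: "is_partition lam"
  shows "bcoef l k (lift (l * k) lam) nu = (if \<forall>j. pg lam j = pg nu j then 1 else 0)"
proof -
  define r where "r = max (length lam) (length nu)"
  have r: "length lam \<le> r" "length (lift (l * k) lam) \<le> Suc r" "length nu \<le> Suc r"
    unfolding r_def using length_lift(1)[of "l * k" lam] by auto
  have "bcoef l k (lift (l * k) lam) nu = qstraight l (wedge_of (Suc r) lam) (wedge_of (Suc r) nu)"
    unfolding bcoef_eq[OF l k(1) r(2,3)] bcoef_trunc_eq
    by (rule shift_sum_lift[OF l k(2) r(1) wfun_qstraight[OF l]]) (use wedge_of_hd_ge[of "Suc r" nu] in simp)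
  also have "\<dots> = (if wedge_of (Suc r) lam = wedge_of (Suc r) nu then 1 else 0)"
    by (rule qstraight_normal[OF l wedge_of_sorted[OF lam]])
  also have "wedge_of (Suc r) lam = wedge_of (Suc r) nu \<longleftrightarrow> (\<forall>j. pg lam j = pg nu j)"
  proof
    assume e: "wedge_of (Suc r) lam = wedge_of (Suc r) nu"
    show "\<forall>j. pg lam j = pg nu j"
    proof
      fix j show "pg lam j = pg nu j"
      proof (cases "j < Suc r")
        case True then show ?thesis using wedge_of_eqD[OF e] by blast
      next
        case False then show ?thesis using r by (simp add: pg_beyond r_def)
      qed
    qed
  qed (auto intro: wedge_of_cong)
  finally show ?thesis .
qed

lemma Bf_large:
  assumes l: "2 \<le> l" "0 < k" and lam: "is_partition lam" "sum_list lam \<le> R"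
  shows "Bf l k Om lam = (\<Sum>mu\<in>{mu \<in> parts R. sum_list mu \<le> R}. bcoef l k lam mu * Om mu)"
proof -
  have p: "lam \<in> parts R" using length_le_sum[OF lam(1)] lam by (simp add: parts_def)
  show ?thesis unfolding Bf_eq_sum[OF l p]
  proof (rule sum.mono_neutral_left[OF finite_box])
    show "{mu \<in> parts R. int (sum_list mu) + int l * int k = int (sum_list lam)} \<subseteq> {mu \<in> parts R. sum_list mu \<le> R}"
    proof
      fix mu assume "mu \<in> {mu \<in> parts R. int (sum_list mu) + int l * int k = int (sum_list lam)}"
      then have "mu \<in> parts R" "int (sum_list mu + l * k) = int (sum_list lam)" by auto
      then have "sum_list mu + l * k = sum_list lam" by (simp only: of_nat_eq_iff)
      then have "sum_list mu \<le> R" using lam(2) by linarith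
      then show "mu \<in> {mu \<in> parts R. sum_list mu \<le> R}" using \<open>mu \<in> parts R\<close> by simp
    qed
    show "\<forall>mu\<in>{mu \<in> parts R. sum_list mu \<le> R} - {mu \<in> parts R. int (sum_list mu) + int l * int k = int (sum_list lam)}. bcoef l k lam mu * Om mu = 0"
    proof
      fix mu assume mu: "mu \<in> {mu \<in> parts R. sum_list mu \<le> R} - {mu \<in> parts R. int (sum_list mu) + int l * int k = int (sum_list lam)}"
      have "bcoef l k lam mu = 0"
      proof (rule ccontr)
        assume "bcoef l k lam mu \<noteq> 0"
        then obtain nu where nu: "nu \<in> parts (length lam)" "\<And>j. pg nu j = pg mu j" "sum_list nu + l * k = sum_list lam"
          using bcoef_nonzero[OF l] by metis
        have "nu = mu" using nu mu by (intro partition_eqI) (auto simp: parts_def)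
        then have "int (sum_list mu + l * k) = int (sum_list lam)" using nu(3) by simp
        then have "int (sum_list mu) + int l * int k = int (sum_list lam)" by simp
        then show False using mu by blast
      qed
      then show "bcoef l k lam mu * Om mu = 0" by simp
    qed
  qed
qed

text \<open>Because of trailing zeros \<open>Bop l k v\<close> can have infinite support, where
  \<open>pair\<close> would not see it. Its pairing is therefore expressed by sums over all
  sufficiently large finite boxes of partitions, which depend on \<open>Bop l k v\<close>
  alone.\<close>

lemma pair_Bf:
  assumes l: "2 \<le> l" "0 < k" and v: "fock v"
  shows "\<exists>R0. \<forall>R\<ge>R0. pair (Bf l k Om) v = (\<Sum>mu\<in>{mu \<in> parts R. sum_list mu \<le> R}. Bop l k v mu * Om mu)"
proof (intro exI allI impI)
  fix R assume R: "(\<Sum>lam\<in>supp v. sum_list lam) \<le> R"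
  have fin: "finite (supp v)" using v by (simp add: fock_def)
  have "pair (Bf l k Om) v = (\<Sum>lam\<in>supp v. v lam * (\<Sum>mu\<in>{mu \<in> parts R. sum_list mu \<le> R}. bcoef l k lam mu * Om mu))"
    unfolding pair_def lin_op_def
  proof (intro sum.cong refl)
    fix lam assume lam: "lam \<in> supp v"
    have "sum_list lam \<le> (\<Sum>lam\<in>supp v. sum_list lam)" by (rule member_le_sum[OF lam _ fin]) simp
    moreover have "is_partition lam" using v lam by (simp add: fock_def)
    ultimately show "v lam * Bf l k Om lam = v lam * (\<Sum>mu\<in>{mu \<in> parts R. sum_list mu \<le> R}. bcoef l k lam mu * Om mu)"
      using Bf_large[OF l, of lam R] R by simp
  qed
  also have "\<dots> = (\<Sum>mu\<in>{mu \<in> parts R. sum_list mu \<le> R}. Bop l k v mu * Om mu)"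
    unfolding sum_distrib_left Bop_def lin_op_def sum_distrib_right by (subst sum.swap) (simp add: mult.assoc)
  finally show "pair (Bf l k Om) v = (\<Sum>mu\<in>{mu \<in> parts R. sum_list mu \<le> R}. Bop l k v mu * Om mu)" .
qed

lemma pair_Bf_eq:
  assumes l: "2 \<le> l" "0 < k" "0 < k'" and v: "fock v" "fock v'" and e: "Bop l k v = Bop l k' v'"
  shows "pair (Bf l k Om) v = pair (Bf l k' Om) v'"
proof -
  obtain R1 R2 where R1: "\<And>R. R1 \<le> R \<Longrightarrow> pair (Bf l k Om) v = (\<Sum>mu\<in>{mu \<in> parts R. sum_list mu \<le> R}. Bop l k v mu * Om mu)"
    and R2: "\<And>R. R2 \<le> R \<Longrightarrow> pair (Bf l k' Om) v' = (\<Sum>mu\<in>{mu \<in> parts R. sum_list mu \<le> R}. Bop l k' v' mu * Om mu)"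
    using pair_Bf[OF l(1,2) v(1), of Om] pair_Bf[OF l(1,3) v(2), of Om] by blast
  show ?thesis using R1[of "max R1 R2"] R2[of "max R1 R2"] e by simp
qed

lemma Bop_lift:
  assumes "2 \<le> l" "0 < k" "sum_list lam < l * k" "0 < k'" "sum_list lam < l * k'" "is_partition lam"
  shows "Bop l k (ket (lift (l * k) lam)) = Bop l k' (ket (lift (l * k') lam))"
  unfolding Bop_def using assms by (intro HOL.ext) (simp add: lin_op_ket bcoef_lift)

text \<open>Every B_k |lam> is also the image under B_K, for one large K, of a genuine Fock vector
  built from lifts. Comparing the two presentations transports information about \<open>bar\<close>
  without ever applying it to B_k |lam>.\<close>

lemma Bop_ket_lift:
  assumes l: "2 \<le> l" "0 < k" and K: "0 < K" "sum_list lam < l * K" and lam: "is_partition lam"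
  defines "I \<equiv> {mu \<in> parts (length lam). int (sum_list mu) + int l * int k = int (sum_list lam)}"
  shows "Bop l k (ket lam) = Bop l K (comb I (bcoef l k lam) (lift (l * K)))"
proof
  fix nu
  have fI: "finite I" unfolding I_def by (rule finite_parts)
  have "Bop l K (comb I (bcoef l k lam) (lift (l * K))) nu = (\<Sum>mu\<in>I. bcoef l k lam mu * bcoef l K (lift (l * K) mu) nu)"
    unfolding Bop_def by (rule lin_op_comb[OF fI])
  also have "\<dots> = (\<Sum>mu\<in>I. if \<forall>j. pg mu j = pg nu j then bcoef l k lam nu else 0)"
  proof (intro sum.cong refl)
    fix mu assume mu: "mu \<in> I"
    then have "int (sum_list mu + l * k) = int (sum_list lam)" unfolding I_def by simp
    then have "sum_list mu + l * k = sum_list lam" by (simp only: of_nat_eq_iff)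
    then have "sum_list mu < l * K" using K(2) by linarith
    moreover have "is_partition mu" using mu unfolding I_def parts_def by simp
    ultimately show "bcoef l k lam mu * bcoef l K (lift (l * K) mu) nu = (if \<forall>j. pg mu j = pg nu j then bcoef l k lam nu else 0)"
      using bcoef_lift[OF l(1) K(1)] bcoef_eqI[OF l, of mu nu lam] by simp
  qed
  also have "\<dots> = bcoef l k lam nu"
  proof (cases "bcoef l k lam nu = 0")
    case False
    then obtain mu where mu: "mu \<in> parts (length lam)" "\<And>j. pg mu j = pg nu j" "sum_list mu + l * k = sum_list lam"
      using bcoef_nonzero[OF l] by metis
    have "int (sum_list mu) + int l * int k = int (sum_list lam)" unfolding mu(3)[symmetric] by simp
    then have mI: "mu \<in> I" unfolding I_def using mu(1) by simp
    have "(\<forall>j. pg mu' j = pg nu j) \<longleftrightarrow> mu' = mu" if "mu' \<in> I" for mu'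
      using that mu partition_eqI[of mu' mu] unfolding I_def parts_def by auto
    then have "(\<Sum>mu'\<in>I. if \<forall>j. pg mu' j = pg nu j then bcoef l k lam nu else 0) = (\<Sum>mu'\<in>I. if mu' = mu then bcoef l k lam nu else 0)"
      by (intro sum.cong refl) simp
    then show ?thesis using mI fI by simp
  next
    case True
    then show ?thesis by (simp only: if_cancel sum.neutral_const)
  qed
  finally show "Bop l k (ket lam) nu = Bop l K (comb I (bcoef l k lam) (lift (l * K))) nu"
    unfolding Bop_def lin_op_ket by simp
qed

lemma fop_boxes:
  fixes l i :: nat
  assumes v: "fock v"
  defines "A \<equiv> \<lambda>lam. {a. addable lam a \<and> res l a (pg lam a) = int i}"
  shows "fock (Fop l i v)" and "pair Om (Fop l i v) = pair (Ff l i Om) v"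
proof -
  define S where "S = (\<Union>lam\<in>supp v. add_box lam ` A lam)"
  have fA: "finite (A lam)" for lam unfolding A_def by (rule finite_addable)
  have fv: "finite (supp v)" "\<And>lam. lam \<in> supp v \<Longrightarrow> is_partition lam" using v by (auto simp: fock_def)
  have fS: "finite S" unfolding S_def using fv fA by blast
  have fc: "fcoef l i lam mu = (\<Sum>a\<in>{a\<in>A lam. add_box lam a = mu}. qv powi Nb l i lam a)" for lam mu
    unfolding fcoef_def A_def by (intro sum.cong) auto
  have sub: "supp (Fop l i v) \<subseteq> S"
  proof
    fix mu assume "mu \<in> supp (Fop l i v)"
    then have "(\<Sum>lam\<in>supp v. v lam * fcoef l i lam mu) \<noteq> 0" by (simp add: supp_def Fop_def lin_op_def)
    then obtain lam where lam: "lam \<in> supp v" "v lam * fcoef l i lam mu \<noteq> 0" by (rule sum.not_neutral_contains_not_neutral)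
    then have "(\<Sum>a\<in>{a\<in>A lam. add_box lam a = mu}. qv powi Nb l i lam a) \<noteq> 0" unfolding fc by simp
    then obtain a where "a \<in> {a\<in>A lam. add_box lam a = mu}" by (rule sum.not_neutral_contains_not_neutral)
    then show "mu \<in> S" unfolding S_def using lam by blast
  qed
  have "is_partition mu" if "mu \<in> S" for mu
    using that fv(2) add_box_partition unfolding S_def A_def by auto
  then show "fock (Fop l i v)" unfolding fock_def using sub fS by (blast intro: finite_subset)
  have "pair Om (Fop l i v) = (\<Sum>mu\<in>S. (\<Sum>lam\<in>supp v. v lam * fcoef l i lam mu) * Om mu)"
    unfolding pair_def lin_op_superset[OF fS sub] unfolding Fop_def lin_op_def ..
  also have "\<dots> = (\<Sum>lam\<in>supp v. v lam * (\<Sum>mu\<in>S. fcoef l i lam mu * Om mu))"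
    unfolding sum_distrib_left sum_distrib_right by (subst sum.swap) (simp add: mult.assoc)
  also have "\<dots> = (\<Sum>lam\<in>supp v. v lam * Ff l i Om lam)"
  proof (intro sum.cong refl)
    fix lam assume lam: "lam \<in> supp v"
    have "(\<Sum>mu\<in>S. fcoef l i lam mu * Om mu) = (\<Sum>mu\<in>S. \<Sum>a\<in>{a\<in>A lam. add_box lam a = mu}. qv powi Nb l i lam a * Om (add_box lam a))"
      unfolding fc sum_distrib_right by (intro sum.cong refl) simp
    also have "\<dots> = (\<Sum>a\<in>A lam. qv powi Nb l i lam a * Om (add_box lam a))"
      by (rule sum.group[OF fA fS]) (use lam in \<open>auto simp: S_def\<close>)
    finally show "v lam * (\<Sum>mu\<in>S. fcoef l i lam mu * Om mu) = v lam * Ff l i Om lam" unfolding Ff_def A_def by simp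
  qed
  finally show "pair Om (Fop l i v) = pair (Ff l i Om) v" unfolding pair_def lin_op_def .
qed

section \<open>Operators on functionals that share the relevant properties of the dual bar
  involution\<close>

type_synonym fop = "(nat list \<Rightarrow> qf) \<Rightarrow> nat list \<Rightarrow> qf"

text \<open>The properties are chosen to suffice for fixing \<open>T0\<close> and to pass to linked
  operators. Semilinearity is demanded only at one-row partitions, the empty one included: it
  supplies the normalisation, and lifts of rows are rows again.\<close>

definition good :: "nat \<Rightarrow> fop \<Rightarrow> bool" where
  "good l \<beta> \<longleftrightarrow>
     (\<forall>f g. (\<forall>lam. is_partition lam \<longrightarrow> f lam = g lam) \<longrightarrow> (\<forall>lam. is_partition lam \<longrightarrow> \<beta> f lam = \<beta> g lam)) \<and>
     (\<forall>f g lam. is_partition lam \<longrightarrow> \<beta> (\<lambda>mu. f mu + g mu) lam = \<beta> f lam + \<beta> g lam) \<and>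
     (\<forall>i f lam. i < l \<longrightarrow> is_partition lam \<longrightarrow> \<beta> (Ff l i f) lam = Ff l i (\<beta> f) lam) \<and>
     (\<forall>D f lam. is_partition lam \<longrightarrow> \<beta> (\<lambda>mu. if D (sum_list mu) then f mu else 0) lam = (if D (sum_list lam) then \<beta> f lam else 0)) \<and>
     (\<forall>a f. (\<forall>mu. is_partition mu \<longrightarrow> a \<le> pg mu 0 \<longrightarrow> f mu = 0) \<longrightarrow> (\<forall>lam. is_partition lam \<longrightarrow> a \<le> pg lam 0 \<longrightarrow> \<beta> f lam = 0)) \<and>
     (\<forall>n f. \<beta> f (lift n []) = conj (f (lift n [])))"

lemma good_cong: "good l \<beta> \<Longrightarrow> (\<And>lam. is_partition lam \<Longrightarrow> f lam = g lam) \<Longrightarrow> is_partition lam \<Longrightarrow> \<beta> f lam = \<beta> g lam"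
  and good_add: "good l \<beta> \<Longrightarrow> is_partition lam \<Longrightarrow> \<beta> (\<lambda>mu. f mu + g mu) lam = \<beta> f lam + \<beta> g lam"
  and good_Ff: "good l \<beta> \<Longrightarrow> i < l \<Longrightarrow> is_partition lam \<Longrightarrow> \<beta> (Ff l i f) lam = Ff l i (\<beta> f) lam"
  and good_deg: "good l \<beta> \<Longrightarrow> is_partition lam \<Longrightarrow> \<beta> (\<lambda>mu. if D (sum_list mu) then f mu else 0) lam = (if D (sum_list lam) then \<beta> f lam else 0)"
  and good_row: "good l \<beta> \<Longrightarrow> \<beta> f (lift n []) = conj (f (lift n []))"
  unfolding good_def by blast+

lemma good_vanish: "good l \<beta> \<Longrightarrow> (\<And>mu. is_partition mu \<Longrightarrow> a \<le> pg mu 0 \<Longrightarrow> f mu = 0) \<Longrightarrow> is_partition lam \<Longrightarrow> a \<le> pg lam 0 \<Longrightarrow> \<beta> f lam = 0"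
  unfolding good_def by blast

text \<open>Linked operators need not be equal here, see the introductory remark on \<open>B\<^sub>k\<close>.\<close>

definition link :: "nat \<Rightarrow> fop \<Rightarrow> fop \<Rightarrow> bool" where
  "link l \<beta> \<beta>' \<longleftrightarrow> (\<forall>k f lam. 0 < k \<longrightarrow> is_partition lam \<longrightarrow> \<beta> (Bf l k f) lam = Bf l k (\<beta>' f) lam)"

lemma linkD: "link l \<beta> \<beta>' \<Longrightarrow> 0 < k \<Longrightarrow> is_partition lam \<Longrightarrow> \<beta> (Bf l k f) lam = Bf l k (\<beta>' f) lam"
  unfolding link_def by blast

lemma Ff_cong: "is_partition lam \<Longrightarrow> (\<And>mu. is_partition mu \<Longrightarrow> f mu = g mu) \<Longrightarrow> Ff l i f lam = Ff l i g lam"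
  unfolding Ff_def by (intro sum.cong refl) (auto simp: add_box_partition)

lemma Bf_add: "Bf l k (\<lambda>mu. f mu + g mu) lam = Bf l k f lam + Bf l k g lam"
  unfolding Bf_def by (simp add: distrib_left sum.distrib)

lemma lift_lift_Nil: "lift k (lift n []) = lift (n + k) []"
  by (cases n; cases k) (auto simp: lift_def pg_def)

lemma Bf_sum_shift: "int (sum_list mu) + int l * int k = int (sum_list lam) \<longleftrightarrow> sum_list mu + l * k = sum_list lam"
  by (simp only: of_nat_mult[symmetric] of_nat_add[symmetric] of_nat_eq_iff)

lemma less_mult_Suc: "2 \<le> (l :: nat) \<Longrightarrow> n < l * Suc n"
  using mult_le_mono1[of 1 l "Suc n"] by simp

text \<open>By \<open>Bf_lift\<close>, the linked operator is \<beta>' f lam = \<beta>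
  (\<open>Bf\<close> l K f) (\<open>lift\<close> (l K) lam) with K large, and each property is
  carried through this formula. For the first row, the transpose of B_K raises the vanishing bound
  by at most l K, which is exactly what the lift adds.\<close>

lemma good_link:
  assumes l: "2 \<le> l" and g: "good l \<beta>" and lk: "link l \<beta> \<beta>'"
  shows "good l \<beta>'"
proof -
  have K: "0 < Suc n" "n < l * Suc n" for n by (simp, rule less_mult_Suc[OF l])
  have lp: "is_partition (lift k lam)" if "is_partition lam" for k lam by (rule lift_partition[OF that])
  have rep: "\<beta>' f lam = \<beta> (Bf l (Suc (sum_list lam)) f) (lift (l * Suc (sum_list lam)) lam)" if "is_partition lam" for f lam
    using linkD[OF lk K(1) lp[OF that]] Bf_lift[OF l K that] by simp
  show ?thesis unfolding good_def
  proof (intro conjI allI impI)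
    fix f g :: "nat list \<Rightarrow> qf" and lam assume e: "\<forall>lam. is_partition lam \<longrightarrow> f lam = g lam" and lam: "is_partition lam"
    have "Bf l k f = Bf l k g" for k by (rule HOL.ext, rule Bf_cong) (use e in blast)
    then show "\<beta>' f lam = \<beta>' g lam" unfolding rep[OF lam] by simp
  next
    fix f g :: "nat list \<Rightarrow> qf" and lam assume lam: "is_partition lam"
    show "\<beta>' (\<lambda>mu. f mu + g mu) lam = \<beta>' f lam + \<beta>' g lam"
      unfolding rep[OF lam] Bf_add[abs_def] by (rule good_add[OF g lp[OF lam]])
  next
    fix i and f :: "nat list \<Rightarrow> qf" and lam assume i: "i < l" and lam: "is_partition lam"
    define k where "k = Suc (sum_list lam)"
    have k: "0 < k" "sum_list lam < l * k" unfolding k_def by (rule K)+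
    have "\<beta>' (Ff l i f) lam = \<beta> (Bf l k (Ff l i f)) (lift (l * k) lam)" unfolding k_def by (rule rep[OF lam])
    also have "\<dots> = \<beta> (Ff l i (Bf l k f)) (lift (l * k) lam)"
      by (rule good_cong[OF g _ lp[OF lam]]) (rule Bf_Ff_commute[OF l k(1) i])
    also have "\<dots> = Ff l i (\<beta> (Bf l k f)) (lift (l * k) lam)" by (rule good_Ff[OF g i lp[OF lam]])
    also have "\<dots> = Ff l i (Bf l k (\<beta>' f)) (lift (l * k) lam)" by (rule Ff_cong[OF lp[OF lam]]) (rule linkD[OF lk k(1)])
    also have "\<dots> = Bf l k (Ff l i (\<beta>' f)) (lift (l * k) lam)" by (rule Bf_Ff_commute[OF l k(1) i lp[OF lam], symmetric])
    also have "\<dots> = Ff l i (\<beta>' f) lam" by (rule Bf_lift[OF l k lam])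
    finally show "\<beta>' (Ff l i f) lam = Ff l i (\<beta>' f) lam" .
  next
    fix D :: "nat \<Rightarrow> bool" and f :: "nat list \<Rightarrow> qf" and lam assume lam: "is_partition lam"
    define k where "k = Suc (sum_list lam)"
    have "Bf l k (\<lambda>mu. if D (sum_list mu) then f mu else 0) kap = (if D (sum_list kap - l * k) then Bf l k f kap else 0)" for kap
    proof -
      have "Bf l k (\<lambda>mu. if D (sum_list mu) then f mu else 0) kap = Bf l k (\<lambda>mu. (if D (sum_list kap - l * k) then 1 else 0) * f mu) kap"
      proof (rule Bf_cong)
        fix mu assume "int (sum_list mu) + int l * int k = int (sum_list kap)"
        then have "sum_list kap - l * k = sum_list mu" unfolding Bf_sum_shift by simp
        then show "(if D (sum_list mu) then f mu else 0) = (if D (sum_list kap - l * k) then 1 else 0) * f mu" by simp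
      qed
      then show ?thesis unfolding Bf_scale by simp
    qed
    then have e: "Bf l k (\<lambda>mu. if D (sum_list mu) then f mu else 0) = (\<lambda>kap. if D (sum_list kap - l * k) then Bf l k f kap else 0)" by (rule HOL.ext)
    have "\<beta>' (\<lambda>mu. if D (sum_list mu) then f mu else 0) lam = \<beta> (Bf l k (\<lambda>mu. if D (sum_list mu) then f mu else 0)) (lift (l * k) lam)"
      unfolding k_def by (rule rep[OF lam])
    also have "\<dots> = \<beta> (\<lambda>kap. if D (sum_list kap - l * k) then Bf l k f kap else 0) (lift (l * k) lam)" unfolding e ..
    also have "\<dots> = (if D (sum_list (lift (l * k) lam) - l * k) then \<beta> (Bf l k f) (lift (l * k) lam) else 0)"
      by (rule good_deg[OF g lp[OF lam], of "\<lambda>d. D (d - l * k)"])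
    also have "\<dots> = (if D (sum_list lam) then \<beta>' f lam else 0)"
      unfolding sum_lift k_def rep[OF lam] by simp
    finally show "\<beta>' (\<lambda>mu. if D (sum_list mu) then f mu else 0) lam = (if D (sum_list lam) then \<beta>' f lam else 0)" .
  next
    fix a and f :: "nat list \<Rightarrow> qf" and lam assume f: "\<forall>mu. is_partition mu \<longrightarrow> a \<le> pg mu 0 \<longrightarrow> f mu = 0" and lam: "is_partition lam" "a \<le> pg lam 0"
    define k where "k = Suc (sum_list lam)"
    have k: "0 < k" unfolding k_def by simp
    have "Bf l k f mu = 0" if "is_partition mu" "a + l * k \<le> pg mu 0" for mu
      unfolding Bf_def
    proof (rule sum.neutral, rule ballI)
      fix nu assume nu: "nu \<in> {nu \<in> parts (length mu). int (sum_list nu) + int l * int k = int (sum_list mu)}"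
      show "bcoef l k mu nu * f nu = 0"
      proof (cases "bcoef l k mu nu = 0")
        case False
        then obtain kap where kap: "\<And>j. pg kap j = pg nu j" "pg mu 0 \<le> pg kap 0 + l * k" using bcoef_nonzero[OF l k] by metis
        have "a \<le> pg nu 0" using that(2) kap(2) unfolding kap(1) by simp
        then show ?thesis using f nu by (simp add: parts_def)
      qed simp
    qed
    moreover have "pg (lift (l * k) lam) 0 = pg lam 0 + l * k" by (simp add: pg_lift)
    then have "a + l * k \<le> pg (lift (l * k) lam) 0" using lam(2) by linarith
    ultimately have "\<beta> (Bf l k f) (lift (l * k) lam) = 0" by (rule good_vanish[OF g _ lp[OF lam(1)]])
    then show "\<beta>' f lam = 0" unfolding rep[OF lam(1)] k_def .
  next
    fix n and f :: "nat list \<Rightarrow> qf"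
    have p: "is_partition (lift n [])" by (rule lp) (simp add: is_partition_def)
    define k where "k = Suc (sum_list (lift n []))"
    have "\<beta>' f (lift n []) = \<beta> (Bf l k f) (lift (l * k) (lift n []))" unfolding k_def by (rule rep[OF p])
    also have "\<dots> = conj (Bf l k f (lift (l * k) (lift n [])))" unfolding lift_lift_Nil by (rule good_row[OF g])
    also have "Bf l k f (lift (l * k) (lift n [])) = f (lift n [])" unfolding k_def by (rule Bf_lift[OF l K p])
    finally show "\<beta>' f (lift n []) = conj (f (lift n []))" .
  qed
qed

text \<open>As the transposed B_j and B_k commute, the functionals \<beta>' (\<open>Bf\<close> l k
  f) form a compatible family in k, and \<open>koszul\<close> provides their common
  quotient.\<close>

lemma link_next:
  assumes l: "2 \<le> l" and g: "good l \<beta>" and lk: "link l \<beta> \<beta>'"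
  shows "\<exists>\<beta>''. link l \<beta>' \<beta>''"
proof -
  have "\<exists>Om. \<forall>k lam. 0 < k \<longrightarrow> is_partition lam \<longrightarrow> \<beta>' (Bf l k f) lam = Bf l k Om lam" for f
  proof (rule koszul[OF l])
    fix j k :: nat and lam :: "nat list" assume jk: "0 < j" "0 < k" and lam: "is_partition lam"
    have "Bf l j (\<beta>' (Bf l k f)) lam = \<beta> (Bf l j (Bf l k f)) lam" by (rule linkD[OF lk jk(1) lam, symmetric])
    also have "\<dots> = \<beta> (Bf l k (Bf l j f)) lam" by (rule good_cong[OF g _ lam]) (rule Bf_commute[OF l jk(2,1)])
    also have "\<dots> = Bf l k (\<beta>' (Bf l j f)) lam" by (rule linkD[OF lk jk(2) lam])
    finally show "Bf l j (\<beta>' (Bf l k f)) lam = Bf l k (\<beta>' (Bf l j f)) lam" .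
  qed
  then have "\<exists>\<beta>''. \<forall>f k lam. 0 < k \<longrightarrow> is_partition lam \<longrightarrow> \<beta>' (Bf l k f) lam = Bf l k (\<beta>'' f) lam" by (rule choice[OF allI])
  then show ?thesis unfolding link_def by blast
qed

lemma good_sum:
  assumes g: "good l \<beta>" and lam: "is_partition lam" and I: "finite I"
  shows "\<beta> (\<lambda>mu. \<Sum>i\<in>I. f i mu) lam = (\<Sum>i\<in>I. \<beta> (f i) lam)"
  using I
proof (induction I rule: finite_induct)
  case empty
  show ?case using good_add[OF g lam, of "\<lambda>mu. 0" "\<lambda>mu. 0"] by simp
next
  case (insert x I)
  then show ?case using good_add[OF g lam, of "f x" "\<lambda>mu. \<Sum>i\<in>I. f i mu"] by simp
qed

lemma good_of_nat:
  assumes g: "good l \<beta>" and lam: "is_partition lam"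
  shows "\<beta> (\<lambda>mu. of_nat j * f mu) lam = of_nat j * \<beta> f lam"
  using good_sum[OF g lam, of "{..<j}" "\<lambda>_. f"] by simp

text \<open>\<beta> preserves the eigenvalues 0 and 1, the grading and the vanishing for first row
  at least l, so the image is again an eigenfunctional; its value at the empty partition is 1, and
  uniqueness applies.\<close>

lemma good_T0:
  assumes l: "2 \<le> l" and g: "good l \<beta>" and lam: "is_partition lam"
  shows "\<beta> (T0 l) lam = T0 l lam"
proof -
  have ev: "eigen l (\<beta> (T0 l))" unfolding eigen_def
  proof (intro conjI allI impI)
    fix i lam assume i: "i < l" and lam: "is_partition lam"
    have "Ff l i (\<beta> (T0 l)) lam = \<beta> (Ff l i (T0 l)) lam" by (rule good_Ff[OF g i lam, symmetric])
    also have "\<dots> = \<beta> (\<lambda>mu. if sum_list mu mod l = i then T0 l mu else 0) lam"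
      by (rule good_cong[OF g _ lam]) (rule Ff_T0[OF l i])
    also have "\<dots> = (if sum_list lam mod l = i then \<beta> (T0 l) lam else 0)"
      by (rule good_deg[OF g lam, of "\<lambda>d. d mod l = i"])
    finally show "Ff l i (\<beta> (T0 l)) lam = (if sum_list lam mod l = i then \<beta> (T0 l) lam else 0)" .
  next
    fix lam assume a: "is_partition lam" "l \<le> pg lam 0"
    show "\<beta> (T0 l) lam = 0" by (rule good_vanish[OF g T0_vanish[OF l] a])
  qed
  have "\<beta> (T0 l) [] = 1" using good_row[OF g, of "T0 l" 0] T0_Nil[OF l] by (simp add: lift_def)
  then show ?thesis using eigen_unique[OF l ev lam] by simp
qed

text \<open>Each use of Newton's recursion passes from \<beta> to the linked \<beta>', so the
  induction on j has to range over all good operators possessing a link.\<close>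

lemma good_tow:
  assumes l: "2 \<le> l"
  shows "good l \<beta> \<Longrightarrow> link l \<beta> \<beta>' \<Longrightarrow> is_partition lam \<Longrightarrow> \<beta> (tow l (T0 l) j) lam = tow l (T0 l) j lam"
proof (induction j arbitrary: \<beta> \<beta>' lam rule: less_induct)
  case (less j)
  show ?case
  proof (cases "j = 0")
    case True then show ?thesis using good_T0[OF l less.prems(1,3)] by (simp add: tow_0)
  next
    case False
    have g': "good l \<beta>'" by (rule good_link[OF l less.prems(1,2)])
    obtain \<beta>'' where lk': "link l \<beta>' \<beta>''" using link_next[OF l less.prems(1,2)] by blast
    have "of_nat j * \<beta> (tow l (T0 l) j) lam = \<beta> (\<lambda>mu. of_nat j * tow l (T0 l) j mu) lam"
      by (rule good_of_nat[OF less.prems(1,3), symmetric])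
    also have "\<dots> = (\<Sum>k\<in>{1..j}. \<beta> (Bf l k (tow l (T0 l) (j - k))) lam)"
      unfolding tow_rec by (rule good_sum[OF less.prems(1,3)]) simp
    also have "\<dots> = (\<Sum>k\<in>{1..j}. Bf l k (tow l (T0 l) (j - k)) lam)"
    proof (intro sum.cong refl)
      fix k assume k: "k \<in> {1..j}"
      have "\<beta> (Bf l k (tow l (T0 l) (j - k))) lam = Bf l k (\<beta>' (tow l (T0 l) (j - k))) lam"
        using k by (intro linkD[OF less.prems(2) _ less.prems(3)]) simp
      also have "\<dots> = Bf l k (tow l (T0 l) (j - k)) lam"
      proof (rule Bf_cong)
        fix mu :: "nat list" assume "is_partition mu"
        then show "\<beta>' (tow l (T0 l) (j - k)) mu = tow l (T0 l) (j - k) mu"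
          using k False by (intro less.IH[OF _ g' lk']) simp_all
      qed
      finally show "\<beta> (Bf l k (tow l (T0 l) (j - k))) lam = Bf l k (tow l (T0 l) (j - k)) lam" .
    qed
    also have "\<dots> = of_nat j * tow l (T0 l) j lam" by (rule tow_rec[symmetric])
    finally show ?thesis using False by simp
  qed
qed

lemma Fract_pCons: "Fract (pCons a p) 1 = cst a + qv * Fract p 1"
proof -
  have "pCons a p = [:a:] + [:0,1:] * p" by simp
  then have "Fract (pCons a p) 1 = Fract [:a:] 1 + Fract [:0,1:] 1 * Fract p 1" by (simp only: mult_fract add_fract mult_1_right mult_1 one_neq_zero not_False_eq_True)
  then show ?thesis unfolding cst_def qv_def .
qed

section \<open>The dual bar involution\<close>

context
  fixes l :: nat and bar :: "fvec \<Rightarrow> fvec"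
  assumes l: "2 \<le> l" and ib: "is_bar l bar"
begin

lemmas bar_fock = ib[unfolded is_bar_def, THEN conjunct1, rule_format]
lemmas bar_add = ib[unfolded is_bar_def, THEN conjunct2, THEN conjunct1, rule_format]
lemmas bar_cst = ib[unfolded is_bar_def, THEN conjunct2, THEN conjunct2, THEN conjunct1, rule_format]
lemmas bar_qv = ib[unfolded is_bar_def, THEN conjunct2, THEN conjunct2, THEN conjunct2, THEN conjunct1, rule_format]
lemmas bar_F = ib[unfolded is_bar_def, THEN conjunct2, THEN conjunct2, THEN conjunct2, THEN conjunct2, THEN conjunct2, THEN conjunct1, rule_format]
lemmas bar_B = ib[unfolded is_bar_def, THEN conjunct2, THEN conjunct2, THEN conjunct2, THEN conjunct2, THEN conjunct2, THEN conjunct2, THEN conjunct1, rule_format]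
lemmas bar_vac = ib[unfolded is_bar_def, THEN conjunct2, THEN conjunct2, THEN conjunct2, THEN conjunct2, THEN conjunct2, THEN conjunct2, THEN conjunct2]

lemma smult_add: "smult_v (c + d) v = add_v (smult_v c v) (smult_v d v)"
  and smult_smult: "smult_v c (smult_v d v) = smult_v (c * d) v"
  by (simp_all add: smult_v_def add_v_def distrib_right mult.assoc)

lemma bar_smult_poly: "fock v \<Longrightarrow> bar (smult_v (Fract p 1) v) = smult_v (inv_eval p) (bar v)"
proof (induction p)
  case 0
  then show ?case using bar_cst[of v 0] by (simp add: Fract_0_1)
next
  case (pCons a p)
  have f: "fock (smult_v (Fract p 1) v)" using pCons.prems by (rule fock_smult)
  have "bar (smult_v (Fract (pCons a p) 1) v) = bar (add_v (smult_v (cst a) v) (smult_v qv (smult_v (Fract p 1) v)))"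
    unfolding Fract_pCons smult_add smult_smult ..
  also have "\<dots> = add_v (smult_v (cst a) (bar v)) (smult_v (inverse qv) (smult_v (inv_eval p) (bar v)))"
    using bar_add[OF fock_smult[OF pCons.prems] fock_smult[OF f]] bar_cst[OF pCons.prems] bar_qv[OF f] pCons by simp
  also have "\<dots> = smult_v (inv_eval (pCons a p)) (bar v)" unfolding inv_eval_pCons smult_add smult_smult ..
  finally show ?case .
qed

lemma bar_smult:
  assumes v: "fock v" shows "bar (smult_v c v) = smult_v (conj c) (bar v)"
proof (cases c)
  case (Fract a b)
  have f: "fock (smult_v c v)" using v by (rule fock_smult)
  have "Fract b 1 * c = Fract a 1" using Fract by (simp add: eq_fract)
  then have "smult_v (Fract b 1) (smult_v c v) = smult_v (Fract a 1) v" unfolding smult_smult by simp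
  then have "smult_v (inv_eval b) (bar (smult_v c v)) = smult_v (inv_eval a) (bar v)"
    unfolding bar_smult_poly[OF f, symmetric] bar_smult_poly[OF v, symmetric] by simp
  then have "smult_v (inverse (inv_eval b)) (smult_v (inv_eval b) (bar (smult_v c v))) = smult_v (inverse (inv_eval b)) (smult_v (inv_eval a) (bar v))" by simp
  moreover have "inv_eval b \<noteq> 0" using Fract inv_eval_eq_0 by blast
  moreover have "smult_v 1 u = u" for u by (simp add: smult_v_def)
  ultimately have "bar (smult_v c v) = smult_v (inverse (inv_eval b) * inv_eval a) (bar v)" unfolding smult_smult by simp
  moreover have "conj c = inverse (inv_eval b) * inv_eval a" using Fract by (simp add: conj_Fract divide_inverse mult.commute)
  ultimately show ?thesis by simp
qed

lemma bar_comb: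
  assumes "finite I" "\<And>i. i \<in> I \<Longrightarrow> is_partition (h i)"
  shows "bar (comb I c h) = (\<lambda>nu. \<Sum>i\<in>I. conj (c i) * bar (ket (h i)) nu)"
  using assms
proof (induction I rule: finite_induct)
  case empty
  have "comb {} c h = smult_v 0 (ket [])" by (simp add: comb_def smult_v_def)
  moreover have "fock (ket [])" by (rule fock_ket) (simp add: is_partition_def)
  ultimately show ?case using bar_smult[of "ket []" 0] by (simp add: smult_v_def)
next
  case (insert x I)
  have "comb (insert x I) c h = add_v (smult_v (c x) (ket (h x))) (comb I c h)"
    using insert.hyps by (simp add: comb_def add_v_def smult_v_def)
  moreover have "fock (ket (h x))" using insert.prems by (intro fock_ket) simp
  moreover have "fock (comb I c h)" using insert by (intro fock_comb) simp_all
  ultimately show ?case using bar_add[OF fock_smult] bar_smult insert by (simp add: add_v_def smult_v_def)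
qed

lemma bar_expand: "fock v \<Longrightarrow> bar v nu = (\<Sum>mu\<in>supp v. conj (v mu) * bar (ket mu) nu)"
proof -
  assume v: "fock v"
  have "bar (comb (supp v) v (\<lambda>x. x)) = (\<lambda>nu. \<Sum>mu\<in>supp v. conj (v mu) * bar (ket mu) nu)"
    by (rule bar_comb) (use v in \<open>auto simp: fock_def\<close>)
  then show ?thesis unfolding fock_as_comb[OF v, symmetric] by simp
qed

text \<open>The outer \<open>conj\<close> cancels the semilinearity of \<open>bar\<close> in its
  argument, so the functional so defined on kets extends linearly; this is
  \<open>bar_dual_pair\<close>.\<close>

definition bar_dual :: fop where "bar_dual Om lam = conj (pair Om (bar (ket lam)))"

lemma bar_dual_pair:
  assumes v: "fock v" shows "conj (pair Om (bar v)) = pair (bar_dual Om) v"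
proof -
  define S where "S = (\<Union>mu\<in>supp v. supp (bar (ket mu)))"
  have fv: "finite (supp v)" "\<And>mu. mu \<in> supp v \<Longrightarrow> fock (ket mu)" using v by (auto simp: fock_def fock_ket)
  have fS: "finite S" unfolding S_def using fv bar_fock by (auto simp: fock_def)
  have sub: "supp (bar v) \<subseteq> S"
  proof
    fix nu assume "nu \<in> supp (bar v)"
    then have "(\<Sum>mu\<in>supp v. conj (v mu) * bar (ket mu) nu) \<noteq> 0" using bar_expand[OF v] by (simp add: supp_def)
    then obtain mu where "mu \<in> supp v" "conj (v mu) * bar (ket mu) nu \<noteq> 0" by (rule sum.not_neutral_contains_not_neutral)
    then show "nu \<in> S" unfolding S_def by (auto simp: supp_def)
  qed
  have "pair Om (bar v) = (\<Sum>nu\<in>S. (\<Sum>mu\<in>supp v. conj (v mu) * bar (ket mu) nu) * Om nu)"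
    unfolding pair_def lin_op_superset[OF fS sub] bar_expand[OF v] ..
  also have "\<dots> = (\<Sum>mu\<in>supp v. conj (v mu) * (\<Sum>nu\<in>S. bar (ket mu) nu * Om nu))"
    unfolding sum_distrib_left sum_distrib_right by (subst sum.swap) (simp add: mult.assoc)
  also have "\<dots> = (\<Sum>mu\<in>supp v. conj (v mu) * pair Om (bar (ket mu)))"
  proof (intro sum.cong refl)
    fix mu assume "mu \<in> supp v"
    then have "supp (bar (ket mu)) \<subseteq> S" unfolding S_def by blast
    note e = lin_op_superset[OF fS this]
    show "conj (v mu) * (\<Sum>nu\<in>S. bar (ket mu) nu * Om nu) = conj (v mu) * pair Om (bar (ket mu))"
      unfolding pair_def e ..
  qed
  finally have e: "pair Om (bar v) = (\<Sum>mu\<in>supp v. conj (v mu) * pair Om (bar (ket mu)))" .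
  have "conj (pair Om (bar v)) = (\<Sum>mu\<in>supp v. v mu * bar_dual Om mu)"
    unfolding e conj_sum by (intro sum.cong refl) (simp only: conj_mult conj_conj bar_dual_def)
  then show ?thesis unfolding pair_def lin_op_def .
qed

lemma pair_ket: "pair Om (ket lam) = Om lam"
  by (simp add: pair_def lin_op_ket)

lemma bar_dual_Ff:
  assumes i: "i < l" and lam: "is_partition lam"
  shows "bar_dual (Ff l i Om) lam = Ff l i (bar_dual Om) lam"
proof -
  have fk: "fock (ket lam)" by (rule fock_ket[OF lam])
  have "pair (Ff l i Om) (bar (ket lam)) = pair Om (Fop l i (bar (ket lam)))" by (rule fop_boxes(2)[OF bar_fock[OF fk], symmetric])
  also have "Fop l i (bar (ket lam)) = bar (Fop l i (ket lam))" by (rule bar_F[OF i fk, symmetric])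
  finally have "bar_dual (Ff l i Om) lam = conj (pair Om (bar (Fop l i (ket lam))))" unfolding bar_dual_def by simp
  also have "\<dots> = pair (bar_dual Om) (Fop l i (ket lam))" by (rule bar_dual_pair[OF fop_boxes(1)[OF fk]])
  also have "\<dots> = Ff l i (bar_dual Om) lam" unfolding fop_boxes(2)[OF fk] pair_ket ..
  finally show ?thesis .
qed

lemma bar_Bop_eq:
  assumes "0 < k" "0 < k'" "fock v" "fock v'" "Bop l k v = Bop l k' v'"
  shows "pair (Bf l k Om) (bar v) = pair (Bf l k' Om) (bar v')"
  using pair_Bf_eq[OF l assms(1,2) bar_fock[OF assms(3)] bar_fock[OF assms(4)]] bar_B assms by metis

text \<open>The linked operator is read off at lifts, where the transpose of B_K is invertible. For
  general lam, B_k |lam> is rewritten as B_K of a combination of lifts; since \<open>bar\<close>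
  respects equality of such images, the values do not depend on the choice of K.\<close>

lemma bar_dual_link: "\<exists>\<beta>'. link l bar_dual \<beta>'"
proof -
  define b1 where "b1 = (\<lambda>Om mu. bar_dual (Bf l (Suc (sum_list mu)) Om) (lift (l * Suc (sum_list mu)) mu))"
  have large: "n < l * Suc n" for n by (rule less_mult_Suc[OF l])
  have "bar_dual (Bf l k Om) lam = Bf l k (b1 Om) lam" if k: "0 < k" and lam: "is_partition lam" for k Om lam
  proof -
    define K where "K = Suc (sum_list lam)"
    define I where "I = {mu \<in> parts (length lam). int (sum_list mu) + int l * int k = int (sum_list lam)}"
    have K: "0 < K" "sum_list lam < l * K" unfolding K_def by (simp, rule large)
    have fI: "finite I" unfolding I_def by (rule finite_parts)
    have pI: "is_partition mu" "sum_list mu < l * K" if "mu \<in> I" for mu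
    proof -
      have "sum_list mu + l * k = sum_list lam" "is_partition mu" using that unfolding I_def Bf_sum_shift parts_def by auto
      then show "is_partition mu" "sum_list mu < l * K" using K(2) by linarith+
    qed
    define v where "v = comb I (bcoef l k lam) (lift (l * K))"
    have fv: "fock v" unfolding v_def by (rule fock_comb[OF fI lift_partition[OF pI(1)]])
    have "pair (Bf l k Om) (bar (ket lam)) = pair (Bf l K Om) (bar v)"
      by (rule bar_Bop_eq[OF k K(1) fock_ket[OF lam] fv]) (unfold v_def I_def, rule Bop_ket_lift[OF l k K lam])
    then have "bar_dual (Bf l k Om) lam = pair (bar_dual (Bf l K Om)) v"
      unfolding bar_dual_pair[OF fv, symmetric] unfolding bar_dual_def by simp
    also have "\<dots> = (\<Sum>mu\<in>I. bcoef l k lam mu * bar_dual (Bf l K Om) (lift (l * K) mu))"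
      unfolding pair_def v_def by (rule lin_op_comb[OF fI])
    also have "\<dots> = (\<Sum>mu\<in>I. bcoef l k lam mu * b1 Om mu)"
    proof (intro sum.cong refl)
      fix mu assume mu: "mu \<in> I"
      have "pair (Bf l K Om) (bar (ket (lift (l * K) mu))) =
        pair (Bf l (Suc (sum_list mu)) Om) (bar (ket (lift (l * Suc (sum_list mu)) mu)))"
        by (rule bar_Bop_eq[OF K(1) _ fock_ket[OF lift_partition[OF pI(1)[OF mu]]] fock_ket[OF lift_partition[OF pI(1)[OF mu]]]
          Bop_lift[OF l K(1) pI(2)[OF mu] _ large pI(1)[OF mu]]]) simp_all
      then show "bcoef l k lam mu * bar_dual (Bf l K Om) (lift (l * K) mu) = bcoef l k lam mu * b1 Om mu"
        unfolding b1_def bar_dual_def by simp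
    qed
    also have "\<dots> = Bf l k (b1 Om) lam" unfolding Bf_def I_def ..
    finally show ?thesis .
  qed
  then show ?thesis unfolding link_def by blast
qed

section \<open>Triangularity from the lower global basis, and evaluation on it\<close>

context
  fixes G :: "nat list \<Rightarrow> fvec"
  assumes G: "is_lower_global_basis l bar G"
begin

lemmas G_fock = G[unfolded is_lower_global_basis_def, THEN spec, THEN mp, THEN conjunct1]
lemmas G_bar = G[unfolded is_lower_global_basis_def, THEN spec, THEN mp, THEN conjunct2, THEN conjunct1]
lemmas G_one = G[unfolded is_lower_global_basis_def, THEN spec, THEN mp, THEN conjunct2, THEN conjunct2, THEN conjunct1]
lemmas G_other = G[unfolded is_lower_global_basis_def, THEN spec, THEN mp, THEN conjunct2, THEN conjunct2, THEN conjunct2, THEN spec, THEN mp, OF _ conjI]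
lemmas G_dom = G_other[THEN conjunct1]
lemmas G_sum = G_other[THEN conjunct2, THEN conjunct1]
lemmas G_int = G_other[THEN conjunct2, THEN conjunct2]

lemma G_partition: "is_partition mu \<Longrightarrow> G mu lam \<noteq> 0 \<Longrightarrow> is_partition lam"
  using G_fock unfolding fock_def supp_def by blast

text \<open>A bounded integer that grows strictly with dominance among partitions of one size, used
  as induction measure.\<close>

definition psums :: "nat list \<Rightarrow> nat" where "psums lam = (\<Sum>k\<le>sum_list lam. \<Sum>j<k. pg lam j)"

lemma psums_less:
  assumes "is_partition lam" "is_partition mu" "sum_list lam = sum_list mu" "dominates lam mu" "lam \<noteq> mu"
  shows "psums mu < psums lam"
proof -
  have "\<exists>k\<le>sum_list mu. (\<Sum>j<k. pg mu j) < (\<Sum>j<k. pg lam j)"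
  proof (rule ccontr)
    assume n: "\<not> (\<exists>k\<le>sum_list mu. (\<Sum>j<k. pg mu j) < (\<Sum>j<k. pg lam j))"
    have e: "(\<Sum>j<k. pg mu j) = (\<Sum>j<k. pg lam j)" if "k \<le> sum_list mu" for k
      using n that assms(4) unfolding dominates_def by (metis le_neq_implies_less)
    have "pg lam j = pg mu j" for j
    proof (cases "Suc j \<le> sum_list mu")
      case True then show ?thesis using e[of j] e[of "Suc j"] by simp
    next
      case False
      then show ?thesis using length_le_sum[OF assms(1)] length_le_sum[OF assms(2)] assms(3) by (simp add: pg_beyond)
    qed
    then show False using partition_eqI[OF assms(1,2)] assms(5) by blast
  qed
  then show ?thesis unfolding psums_def assms(3) using assms(4)
    by (intro sum_strict_mono_ex1) (auto simp: dominates_def)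
qed

lemma psums_le: "psums lam \<le> Suc (sum_list lam) * sum_list lam" if "is_partition lam" for lam
proof -
  have "(\<Sum>j<k. pg lam j) \<le> sum_list lam" for k
  proof -
    have "(\<Sum>j<k. pg lam j) \<le> (\<Sum>j<max k (length lam). pg lam j)" by (rule sum_mono2) auto
    then show ?thesis using sum_pg[of lam "max k (length lam)"] by simp
  qed
  then have "psums lam \<le> of_nat (card {..sum_list lam}) * sum_list lam" unfolding psums_def by (intro sum_bounded_above)
  then show ?thesis by simp
qed

text \<open>The ket of lam is the bar invariant G lam minus kets of strictly dominating partitions.
  Induction upwards in dominance transfers the triangularity of G to \<open>bar\<close>; what is
  kept of it is the size and the lower bound on the first row.\<close>

lemma bar_ket_support:
  "is_partition lam \<Longrightarrow> bar (ket lam) nu \<noteq> 0 \<Longrightarrow> is_partition nu \<and> sum_list nu = sum_list lam \<and> pg lam 0 \<le> pg nu 0"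
proof (induction "Suc (sum_list lam) * sum_list lam - psums lam" arbitrary: lam nu rule: less_induct)
  case less
  define S where "S = supp (G lam) - {lam}"
  define w where "w = comb S (G lam) (\<lambda>x. x)"
  have fG: "fock (G lam)" by (rule G_fock[OF less.prems(1)])
  have S: "finite S" "\<And>mu. mu \<in> S \<Longrightarrow> is_partition mu" using fG unfolding S_def fock_def by auto
  have Sd: "dominates mu lam" "sum_list mu = sum_list lam" "mu \<noteq> lam" if "mu \<in> S" for mu
    using G_dom[OF less.prems(1), of mu] G_sum[OF less.prems(1), of mu] that unfolding S_def supp_def by auto
  have fw: "fock w" unfolding w_def by (rule fock_comb[OF S])
  have "ket lam = add_v (G lam) (smult_v (- 1) w)"
  proof
    fix kap
    have "w kap = (\<Sum>i\<in>S. if i = kap then G lam i else 0)"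
      unfolding w_def comb_def by (intro sum.cong refl) (auto simp: ket_def)
    also have "\<dots> = (if kap \<in> S then G lam kap else 0)" using S(1) by simp
    finally show "ket lam kap = add_v (G lam) (smult_v (- 1) w) kap"
      using G_one[OF less.prems(1)] by (auto simp: ket_def add_v_def smult_v_def S_def supp_def)
  qed
  then have "bar (ket lam) = add_v (G lam) (smult_v (conj (- 1)) (bar w))"
    using bar_add[OF fG fock_smult[OF fw]] bar_smult[OF fw] G_bar[OF less.prems(1)] by simp
  then have "G lam nu \<noteq> 0 \<or> bar w nu \<noteq> 0" using less.prems(2) by (auto simp: add_v_def smult_v_def)
  then show ?case
  proof
    assume nz: "G lam nu \<noteq> 0"
    have "pg lam 0 \<le> pg nu 0" if "nu \<noteq> lam" using G_dom[OF less.prems(1) that nz] unfolding dominates_def by (auto dest: spec[of _ 1])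
    then show ?thesis using G_partition[OF less.prems(1) nz] G_sum[OF less.prems(1) _ nz] by (cases "nu = lam") auto
  next
    assume "bar w nu \<noteq> 0"
    moreover have "bar w nu = (\<Sum>mu\<in>S. conj (G lam mu) * bar (ket mu) nu)"
      unfolding w_def by (rule fun_cong[OF bar_comb[OF S]])
    ultimately have "(\<Sum>mu\<in>S. conj (G lam mu) * bar (ket mu) nu) \<noteq> 0" by simp
    then obtain mu where "mu \<in> S" "conj (G lam mu) * bar (ket mu) nu \<noteq> 0" by (rule sum.not_neutral_contains_not_neutral)
    then have mu: "mu \<in> S" "bar (ket mu) nu \<noteq> 0" by auto
    have "psums lam < psums mu" by (rule psums_less[OF S(2)[OF mu(1)] less.prems(1) Sd(2,1,3)[OF mu(1)]])
    then have "Suc (sum_list mu) * sum_list mu - psums mu < Suc (sum_list lam) * sum_list lam - psums lam"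
      using psums_le[OF S(2)[OF mu(1)]] unfolding Sd(2)[OF mu(1)] by linarith
    from less.hyps[OF this S(2)[OF mu(1)] mu(2)]
    show ?thesis using Sd[OF mu(1)] unfolding dominates_def by (auto dest: spec[of _ 1])
  qed
qed

text \<open>A single row dominates all partitions of its size, so its lower global basis vector is
  the ket itself.\<close>

lemma bar_ket_row: "bar (ket (lift n [])) = ket (lift n [])"
proof (cases "n = 0")
  case True then show ?thesis using bar_vac by (simp add: lift_def)
next
  case False
  have r: "lift n [] = [n]" using False by (simp add: lift_def pg_def)
  have p: "is_partition [n]" using False by (simp add: is_partition_def)
  have "G [n] = ket [n]"
  proof
    fix lam
    show "G [n] lam = ket [n] lam"
    proof (cases "lam = [n]")
      case True then show ?thesis using G_one[OF p] by (simp add: ket_def)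
    next
      case ne: False
      have "G [n] lam = 0"
      proof (rule ccontr)
        assume nz: "G [n] lam \<noteq> 0"
        have pl: "is_partition lam" by (rule G_partition[OF p nz])
        have s: "sum_list lam = n" using G_sum[OF p ne nz] by simp
        have "n \<le> pg lam 0" using G_dom[OF p ne nz] unfolding dominates_def by (auto dest: spec[of _ 1] simp: pg_def)
        then obtain x xs where lam: "lam = x # xs" "n \<le> x" using False by (cases lam) (auto simp: pg_def)
        have "x + sum_list xs = n" using s lam(1) by simp
        then have "sum_list xs = 0" using lam(2) by linarith
        then have "xs = []" using pl lam(1) by (cases xs) (auto simp: is_partition_def)
        then show False using lam s ne by simp
      qed
      then show ?thesis using ne by (simp add: ket_def)
    qed
  qed
  then show ?thesis using G_bar[OF p] r by simp
qed

lemma good_bar_dual: "good l bar_dual"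
  unfolding good_def
proof (intro conjI allI impI)
  fix f g :: "nat list \<Rightarrow> qf" and lam assume e: "\<forall>lam. is_partition lam \<longrightarrow> f lam = g lam" and lam: "is_partition lam"
  have "pair f (bar (ket lam)) = pair g (bar (ket lam))" by (rule pair_cong[OF bar_fock[OF fock_ket[OF lam]]]) (use e in blast)
  then show "bar_dual f lam = bar_dual g lam" unfolding bar_dual_def by simp
next
  fix f g :: "nat list \<Rightarrow> qf" and lam
  show "bar_dual (\<lambda>mu. f mu + g mu) lam = bar_dual f lam + bar_dual g lam"
    unfolding bar_dual_def pair_def lin_op_def by (simp add: distrib_left sum.distrib conj_add)
next
  fix i and f :: "nat list \<Rightarrow> qf" and lam assume "i < l" "is_partition lam"
  then show "bar_dual (Ff l i f) lam = Ff l i (bar_dual f) lam" by (rule bar_dual_Ff)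
next
  fix D :: "nat \<Rightarrow> bool" and f :: "nat list \<Rightarrow> qf" and lam assume lam: "is_partition lam"
  have "pair (\<lambda>mu. if D (sum_list mu) then f mu else 0) (bar (ket lam)) = (if D (sum_list lam) then 1 else 0) * pair f (bar (ket lam))"
    unfolding pair_def lin_op_def sum_distrib_left
    by (intro sum.cong refl) (use bar_ket_support[OF lam] in \<open>auto simp: supp_def\<close>)
  then show "bar_dual (\<lambda>mu. if D (sum_list mu) then f mu else 0) lam = (if D (sum_list lam) then bar_dual f lam else 0)"
    unfolding bar_dual_def by simp
next
  fix a and f :: "nat list \<Rightarrow> qf" and lam assume f: "\<forall>mu. is_partition mu \<longrightarrow> a \<le> pg mu 0 \<longrightarrow> f mu = 0" and lam: "is_partition lam" "a \<le> pg lam 0"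
  have "pair f (bar (ket lam)) = 0" unfolding pair_def lin_op_def
  proof (rule sum.neutral, rule ballI)
    fix nu assume "nu \<in> supp (bar (ket lam))"
    then have "is_partition nu \<and> a \<le> pg nu 0" using bar_ket_support[OF lam(1), of nu] lam(2) by (auto simp: supp_def)
    then show "bar (ket lam) nu * f nu = 0" using f by simp
  qed
  then show "bar_dual f lam = 0" unfolding bar_dual_def by simp
next
  fix n and f :: "nat list \<Rightarrow> qf" show "bar_dual f (lift n []) = conj (f (lift n []))"
    unfolding bar_dual_def bar_ket_row pair_ket ..
qed

text \<open>The pairing is fixed by \<open>conj\<close>, since both the functional and G mu are bar
  invariant, and it is a polynomial, hence a constant. Modulo q the off-diagonal coefficients of G
  mu vanish, so this constant is the value of the functional at mu for q = 0.\<close>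

lemma tow_G:
  assumes mu: "is_partition mu" and j: "l * j \<le> sum_list mu"
  shows "pair (tow l (T0 l) j) (G mu) = (if mu = lift (l * j) (nu0 l (sum_list mu - l * j)) then 1 else 0)"
proof -
  define x where "x = pair (tow l (T0 l) j) (G mu)"
  define n where "n = sum_list mu"
  obtain \<beta>' where lk: "link l bar_dual \<beta>'" using bar_dual_link by blast
  have fG: "fock (G mu)" by (rule G_fock[OF mu])
  have "conj x = pair (bar_dual (tow l (T0 l) j)) (G mu)"
    unfolding bar_dual_pair[OF fG, symmetric] x_def G_bar[OF mu] ..
  also have "\<dots> = x" unfolding x_def by (rule pair_cong[OF fG]) (rule good_tow[OF l good_bar_dual lk])
  finally have cx: "conj x = x" .
  define e where "e = (\<lambda>lam. if lam = lift (l * j) (nu0 l (n - l * j)) then 1 else 0 :: qf)"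
  have zt: "zer (tow l (T0 l) j lam - e lam)" if "is_partition lam" "sum_list lam = n" for lam
    unfolding e_def that(2)[symmetric] by (rule tow_mod[OF l that(1)]) (use j that n_def in simp)
  have pt: "pol (tow l (T0 l) j lam)" if "is_partition lam" "sum_list lam = n" for lam
  proof -
    have "pol ((tow l (T0 l) j lam - e lam) + e lam)" by (rule pol_add[OF zer_pol[OF zt[OF that]]]) (simp add: e_def)
    then show ?thesis by simp
  qed
  have fin: "finite (supp (G mu))" and ms: "mu \<in> supp (G mu)" using fG G_one[OF mu] by (auto simp: fock_def supp_def)
  have "x = G mu mu * tow l (T0 l) j mu + (\<Sum>lam\<in>supp (G mu) - {mu}. G mu lam * tow l (T0 l) j lam)"
    unfolding x_def pair_def lin_op_def by (rule sum.remove[OF fin ms])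
  then have x: "x - e mu = (tow l (T0 l) j mu - e mu) + (\<Sum>lam\<in>supp (G mu) - {mu}. G mu lam * tow l (T0 l) j lam)"
    unfolding G_one[OF mu] by simp
  have "zer (x - e mu)" unfolding x
  proof (intro zer_add zt zer_sum mu)
    fix lam assume "lam \<in> supp (G mu) - {mu}"
    then have lam: "lam \<noteq> mu" "G mu lam \<noteq> 0" by (auto simp: supp_def)
    obtain p where p: "G mu lam = Fract p 1" "coeff p 0 = 0" using G_int[OF mu lam] unfolding in_qZq_def by blast
    then obtain p' where "p = pCons 0 p'" by (cases p) auto
    then have "G mu lam = qv * Fract p' 1" using p(1) by (simp add: Fract_pCons)
    then have "zer (G mu lam)" by (simp add: zer_qv)
    then show "zer (G mu lam * tow l (T0 l) j lam)"
      using zer_mult[OF pt[OF G_partition[OF mu lam(2)]]] G_sum[OF mu lam] by (simp add: n_def mult.commute)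
  qed (simp add: n_def)
  moreover have pe: "pol (e mu)" by (simp add: e_def)
  ultimately have "pol ((x - e mu) + e mu)" using pol_add zer_pol by blast
  then have "pol x" by simp
  then obtain c where c: "x = cst c" using pol_conj_fixed cx by blast
  define d where "d = (if mu = lift (l * j) (nu0 l (n - l * j)) then 1 else 0 :: complex)"
  have ed: "e mu = cst d" unfolding e_def d_def by simp
  have "cst c = cst (c - d) + cst d" unfolding cst_add[symmetric] by simp
  then have "x - e mu = cst (c - d)" unfolding c ed by simp
  then have "c - d = 0" using \<open>zer (x - e mu)\<close> zer_cst by metis
  then show ?thesis using c ed unfolding x_def e_def n_def by simp
qed

lemma G_row:
  assumes mu: "is_partition mu" "sum_list mu = n" and n: "1 \<le> n"
  shows "G mu [n] = (\<Sum>j\<le>n div l. qv ^ (n div l - j) * (if mu = lift (l * j) (nu0 l (n - l * j)) then 1 else 0))"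
proof -
  have fG: "fock (G mu)" by (rule G_fock[OF mu(1)])
  have supp: "is_partition lam" "sum_list lam = n" if "lam \<in> supp (G mu)" for lam
    using that G_partition[OF mu(1), of lam] G_sum[OF mu(1), of lam] mu(2) by (cases "lam = mu"; simp add: supp_def)+
  have "pair row_fun (G mu) = G mu [n]"
  proof -
    have "pair row_fun (G mu) = (\<Sum>lam\<in>supp (G mu). if lam = [n] then G mu lam else 0)"
      unfolding pair_def lin_op_def
    proof (intro sum.cong refl)
      fix lam assume "lam \<in> supp (G mu)"
      note s = supp[OF this]
      have "length lam \<le> 1 \<longleftrightarrow> lam = [n]" using s n by (cases lam; cases "tl lam") auto
      then show "G mu lam * row_fun lam = (if lam = [n] then G mu lam else 0)" by (simp add: row_fun_def)
    qed
    also have "\<dots> = G mu [n]" using fG by (auto simp: fock_def supp_def)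
    finally show ?thesis .
  qed
  moreover have "pair row_fun (G mu) = (\<Sum>j\<le>n div l. qv ^ (n div l - j) * pair (tow l (T0 l) j) (G mu))"
  proof -
    have "pair row_fun (G mu) = (\<Sum>lam\<in>supp (G mu). \<Sum>j\<le>n div l. qv ^ (n div l - j) * (G mu lam * tow l (T0 l) j lam))"
      unfolding pair_def lin_op_def
    proof (intro sum.cong refl)
      fix lam assume "lam \<in> supp (G mu)"
      note s = supp[OF this]
      show "G mu lam * row_fun lam = (\<Sum>j\<le>n div l. qv ^ (n div l - j) * (G mu lam * tow l (T0 l) j lam))"
        unfolding row_fun_tow[OF l s(1)] s(2) sum_distrib_left by (simp add: mult.left_commute)
    qed
    then show ?thesis unfolding pair_def lin_op_def sum_distrib_left by (subst sum.swap) simp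
  qed
  moreover have "pair (tow l (T0 l) j) (G mu) = (if mu = lift (l * j) (nu0 l (n - l * j)) then 1 else 0)" if "j \<le> n div l" for j
  proof -
    have "l * j \<le> n" using that l by (simp add: less_eq_div_iff_mult_less_eq mult.commute)
    then show ?thesis using tow_G[OF mu(1), of j] mu(2) by simp
  qed
  ultimately show ?thesis by simp
qed

end

end

text \<open>With j = n div l - i, the part a is l - 1 + l * j. For i \<ge> 1 the remainder n - l * j
  is at least l, so \<open>nu0\<close> begins with a row l - 1, which the lift turns into a.\<close>

lemma mu_part_lift:
  assumes l: "2 \<le> l" and n: "1 \<le> n" and i: "i \<le> n div l"
  shows "mu_part l n i = lift (l * (n div l - i)) (nu0 l (n - l * (n div l - i)))"
proof -
  define j where "j = n div l - i"
  define m where "m = n - l * j"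
  have lj: "l * (n div l) \<le> n" by simp
  have "l * j \<le> l * (n div l)" unfolding j_def by (intro mult_le_mono2) simp
  then have jn: "l * j \<le> n" using lj by linarith
  show ?thesis
  proof (cases "i = 0")
    \<comment> \<open>For i = 0 the remainder is n mod l, at most l - 1, so \<open>nu0\<close> has
      at most one row and the lift is the row n.\<close>
    case True
    have m: "m = n mod l" unfolding m_def j_def True by (simp add: minus_mult_div_eq_mod)
    then have ml: "m < l" using l by simp
    have nm: "n = m + l * j" unfolding m_def using jn by simp
    have "nu0 l m = (if m = 0 then [] else [m])"
    proof (cases "m = l - 1")
      case True then show ?thesis using l by (simp add: nu0_def)
    next
      case False
      then have "m div (l - 1) = 0" "m mod (l - 1) = m" using ml by auto
      then show ?thesis by (simp add: nu0_def)
    qed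
    moreover have "j = 0 \<longrightarrow> m \<noteq> 0" using nm n by auto
    ultimately have "lift (l * j) (nu0 l m) = [n]" using nm l by (auto simp: lift_def pg_def)
    then show ?thesis unfolding mu_part_def j_def[symmetric] m_def[symmetric] using True by simp
  next
    case False
    have "l * Suc j \<le> l * (n div l)" unfolding j_def by (intro mult_le_mono2) (use False i in simp)
    then have "l + l * j \<le> n" using lj by (simp only: mult_Suc_right)
    then have ml: "l \<le> m" unfolding m_def by linarith
    define a where "a = (l - 1) + j * l"
    have na: "n - a = m - (l - 1)" unfolding a_def m_def by (simp add: mult.commute)
    have l1: "0 < l - 1" using l by simp
    have d: "m div (l - 1) = Suc ((m - (l - 1)) div (l - 1))" "m mod (l - 1) = (m - (l - 1)) mod (l - 1)"
      using ml l1 le_div_geq[of "l - 1" m] le_mod_geq[of "l - 1" m] by simp_all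
    have "nu0 l m = (l - 1) # replicate ((n - a) div (l - 1)) (l - 1) @ (if (n - a) mod (l - 1) = 0 then [] else [(n - a) mod (l - 1)])"
      unfolding nu0_def d na by simp
    then have "lift (l * j) (nu0 l m) = a # replicate ((n - a) div (l - 1)) (l - 1) @ (if (n - a) mod (l - 1) = 0 then [] else [(n - a) mod (l - 1)])"
      unfolding lift_def a_def by (auto simp: pg_def mult.commute)
    also have "\<dots> = mu_part l n i" unfolding mu_part_def Let_def a_def j_def using False by simp
    finally show ?thesis unfolding j_def[symmetric] m_def[symmetric] by simp
  qed
qed

theorem theorem6p3:
  fixes l n :: nat
    and bar :: "fvec \<Rightarrow> fvec"
    and G :: "nat list \<Rightarrow> fvec"
  assumes "2 \<le> l" and "1 \<le> n"
    and "is_bar l bar"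
    and "is_lower_global_basis l bar G"
  shows "(\<forall>i \<le> n div l. G (mu_part l n i) [n] = qv ^ i) \<and>
         (\<forall>mu. is_partition mu \<and> (\<forall>i \<le> n div l. mu \<noteq> mu_part l n i) \<longrightarrow> G mu [n] = 0)"
proof -
  define N where "N = n div l"
  note row = G_row[OF assms(1,3,4) _ _ assms(2)]
  have jn: "l * j \<le> n" if "j \<le> N" for j
    using that assms(1) unfolding N_def by (simp add: less_eq_div_iff_mult_less_eq mult.commute)
  have mp: "mu_part l n i = lift (l * (N - i)) (nu0 l (n - l * (N - i)))" if "i \<le> N" for i
    using mu_part_lift[OF assms(1,2)] that unfolding N_def by blast
  \<comment> \<open>The first row divided by l recovers j, so distinct j give distinct lifts and at
    most one summand of \<open>G_row\<close> survives.\<close>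
  have pg0: "pg (lift (l * j) (nu0 l m)) 0 div l = j" for j m
  proof -
    have "pg (nu0 l m) 0 < l" using pg_nu0_le[OF assms(1), of m] assms(1) by linarith
    then show ?thesis unfolding pg_lift using assms(1) by simp
  qed
  show ?thesis
  proof (intro conjI allI impI)
    fix i assume "i \<le> n div l"
    then have i: "i \<le> N" unfolding N_def .
    have p: "is_partition (mu_part l n i)" unfolding mp[OF i] by (intro lift_partition nu0_partition assms)
    have s: "sum_list (mu_part l n i) = n" unfolding mp[OF i] sum_lift sum_nu0 using jn[of "N - i"] by simp
    have "mu_part l n i = lift (l * j) (nu0 l (n - l * j)) \<longleftrightarrow> j = N - i" for j
      using pg0[of "N - i"] pg0[of j] unfolding mp[OF i] by metis
    then have "G (mu_part l n i) [n] = (\<Sum>j\<le>N. qv ^ (N - j) * (if j = N - i then 1 else 0))"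
      using row[OF p s] unfolding N_def by simp
    also have "\<dots> = (\<Sum>j\<le>N. if j = N - i then qv ^ (N - j) else 0)" by (intro sum.cong refl) simp
    also have "\<dots> = qv ^ i" using i by simp
    finally show "G (mu_part l n i) [n] = qv ^ i" .
  next
    fix mu assume mu: "is_partition mu \<and> (\<forall>i\<le>n div l. mu \<noteq> mu_part l n i)"
    show "G mu [n] = 0"
    proof (cases "sum_list mu = n")
      case True
      have "mu \<noteq> lift (l * j) (nu0 l (n - l * j))" if "j \<le> N" for j
        using mu mp[of "N - j"] that unfolding N_def by (metis diff_diff_cancel diff_le_self)
      then show ?thesis using row[of mu] mu True unfolding N_def by simp
    next
      case False
      have "mu \<noteq> [n]" using False by auto
      then show ?thesis using G_sum[OF assms(1,3,4), of mu "[n]"] mu False by auto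
    qed
  qed
qed

end
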